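(* Let $(X_{it})_{i,t\ge1}$ be independent and identically distributed real random variables, let $f:\mathbb{R}^2\to\mathbb{R}$ be measurable with $f(x,y)=f(y,x)$ and $0<\operatorname{Var}(f(X_{11},X_{21}))<\infty$, and let $T_{ij}$, $Z$ and $\rho$ be as defined in the context. Let $p=p_n$ be an integer sequence with $p_n\to\infty$. Assume that one of the following holds: (C1) there exists $s>2$ such that $\mathbb{E}[|Z|^s(\log_+|Z|)^{s/2}]<\infty$, $\rho\le1/3$, and $p=O(n^{(s-2)/4})$; (C2) there exist $\eta>0$ and $0<r\le2/3$ such that $\mathbb{E}[\exp(\eta|Z|^r)]<\infty$, $\rho<1/3$, and $p=\exp(o(n^{r/(2-r)}))$; (C3) there exist $\eta>0$ and $r\ge1/2$ such that $\mathbb{E}[\exp(\eta|Z|^r)]<\infty$, $\rho=1/3$, and $p=\exp(o(n^{1/(3+2/r)}))$; (C4) there exists a constant $K$ with $\mathbb{P}(|Z|\le K)=1$, $\rho=1/3$, and $p=\exp(o(n^{1/3}))$. Let $d_n=d_n^{(\kappa)}$ with $\kappa=\mathbb{E}[Z^3]$ if (C2) holds with $r>1/2$, and $d_n=d_{n,1}$ otherwise. Then, as $n\to\infty$, $$\max_{1\le i<j\le p}d_n(T_{ij}-d_n)\ \xrightarrow{d}\ G,$$ where $G$ is standard Gumbel distributed.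
   Context: For $1\le i<j\le p$ and $l\ge1$, $$Z_{i,j,l}=\frac{f(X_{il},X_{jl})-\mathbb{E}[f(X_{11},X_{21})]}{\sqrt{\operatorname{Var}(f(X_{11},X_{21}))}},\qquad T_{ij}=\frac1{\sqrt n}\sum_{l=1}^nZ_{i,j,l},$$ $Z$ is a random variable with the distribution of $Z_{1,2,1}$, and $\rho=\mathbb{E}[Z_{1,2,1}Z_{1,3,1}]=\operatorname{Corr}(f(X_{11},X_{21}),f(X_{11},X_{31}))$. Set $\tilde p=p(p-1)/2$ and, for $y\in\mathbb{R}$ and $n$ large, $$d_{n,1}=\sqrt{2\log\tilde p}-\frac{\log\log\tilde p+\log4\pi}{2(2\log\tilde p)^{1/2}},\qquad d_n^{(y)}=d_{n,1}+\frac{y\log\tilde p}{3n^{1/2}}.$$ $\log_+t=\max(\log t,0)$. $p=\exp(o(n^a))$ means $\log p_n=o(n^a)$. The standard Gumbel distribution function is $\exp(-e^{-x})$, $x\in\mathbb{R}$. $\xrightarrow{d}$ denotes convergence in distribution. *)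

theory Defs
  imports "HOL-Probability.Probability"
begin

text \<open>
  Throughout, \<open>X i t\<close> is the random variable $X_{it}$ on the probability space \<open>M\<close>; only
  indices \<open>i, t \<ge> 1\<close> are relevant.
\<close>

definition Zn :: "'a measure \<Rightarrow> (nat \<Rightarrow> nat \<Rightarrow> 'a \<Rightarrow> real) \<Rightarrow> (real \<Rightarrow> real \<Rightarrow> real)
    \<Rightarrow> nat \<Rightarrow> nat \<Rightarrow> nat \<Rightarrow> 'a \<Rightarrow> real"
  where "Zn M X f i j l \<omega> =
    (f (X i l \<omega>) (X j l \<omega>) - prob_space.expectation M (\<lambda>\<omega>. f (X 1 1 \<omega>) (X 2 1 \<omega>)))
      / sqrt (prob_space.variance M (\<lambda>\<omega>. f (X 1 1 \<omega>) (X 2 1 \<omega>)))"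

definition Tn :: "'a measure \<Rightarrow> (nat \<Rightarrow> nat \<Rightarrow> 'a \<Rightarrow> real) \<Rightarrow> (real \<Rightarrow> real \<Rightarrow> real)
    \<Rightarrow> nat \<Rightarrow> nat \<Rightarrow> nat \<Rightarrow> 'a \<Rightarrow> real"
  where "Tn M X f n i j \<omega> = (1 / sqrt (real n)) * (\<Sum>l = 1..n. Zn M X f i j l \<omega>)"

definition ptilde :: "nat \<Rightarrow> real"
  where "ptilde p = real p * (real p - 1) / 2"

text \<open>
  The two centering sequences are only meaningful for large \<open>p\<close> and \<open>n\<close>; the values that the
  total functions \<open>ln\<close>, \<open>sqrt\<close> and \<open>/\<close> produce for small arguments do not affect limits.
\<close>

definition d1 :: "nat \<Rightarrow> real"
  where "d1 p = sqrt (2 * ln (ptilde p))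
    - (ln (ln (ptilde p)) + ln (4 * pi)) / (2 * sqrt (2 * ln (ptilde p)))"

definition dy :: "nat \<Rightarrow> nat \<Rightarrow> real \<Rightarrow> real"
  where "dy p n y = d1 p + y * ln (ptilde p) / (3 * sqrt (real n))"

definition ln_plus :: "real \<Rightarrow> real"
  where "ln_plus t = max (ln t) 0"

text \<open>
  In the four conditions \<open>p = exp(o(g n))\<close> is rendered as \<open>ln (p n) = o(g n)\<close>.
\<close>

definition cond_C1 :: "'a measure \<Rightarrow> ('a \<Rightarrow> real) \<Rightarrow> real \<Rightarrow> (nat \<Rightarrow> nat) \<Rightarrow> real \<Rightarrow> bool"
  where "cond_C1 M Z \<rho> p s \<longleftrightarrow>
    s > 2 \<and>
    integrable M (\<lambda>\<omega>. \<bar>Z \<omega>\<bar> powr s * ln_plus \<bar>Z \<omega>\<bar> powr (s / 2)) \<and>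
    \<rho> \<le> 1/3 \<and>
    (\<lambda>n. real (p n)) \<in> O(\<lambda>n. real n powr ((s - 2) / 4))"

definition cond_C2 :: "'a measure \<Rightarrow> ('a \<Rightarrow> real) \<Rightarrow> real \<Rightarrow> (nat \<Rightarrow> nat) \<Rightarrow> real \<Rightarrow> real \<Rightarrow> bool"
  where "cond_C2 M Z \<rho> p \<eta> r \<longleftrightarrow>
    \<eta> > 0 \<and> 0 < r \<and> r \<le> 2/3 \<and>
    integrable M (\<lambda>\<omega>. exp (\<eta> * \<bar>Z \<omega>\<bar> powr r)) \<and>
    \<rho> < 1/3 \<and>
    (\<lambda>n. ln (real (p n))) \<in> o(\<lambda>n. real n powr (r / (2 - r)))"

definition cond_C3 :: "'a measure \<Rightarrow> ('a \<Rightarrow> real) \<Rightarrow> real \<Rightarrow> (nat \<Rightarrow> nat) \<Rightarrow> real \<Rightarrow> real \<Rightarrow> bool"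
  where "cond_C3 M Z \<rho> p \<eta> r \<longleftrightarrow>
    \<eta> > 0 \<and> r \<ge> 1/2 \<and>
    integrable M (\<lambda>\<omega>. exp (\<eta> * \<bar>Z \<omega>\<bar> powr r)) \<and>
    \<rho> = 1/3 \<and>
    (\<lambda>n. ln (real (p n))) \<in> o(\<lambda>n. real n powr (1 / (3 + 2 / r)))"

definition cond_C4 :: "'a measure \<Rightarrow> ('a \<Rightarrow> real) \<Rightarrow> real \<Rightarrow> (nat \<Rightarrow> nat) \<Rightarrow> real \<Rightarrow> bool"
  where "cond_C4 M Z \<rho> p K \<longleftrightarrow>
    measure M {\<omega> \<in> space M. \<bar>Z \<omega>\<bar> \<le> K} = 1 \<and>
    \<rho> = 1/3 \<and>
    (\<lambda>n. ln (real (p n))) \<in> o(\<lambda>n. real n powr (1/3))"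

definition gumbel :: "real measure"
  where "gumbel = interval_measure (\<lambda>x. exp (- exp (- x)))"

lemma
  shows real_distribution_gumbel: "real_distribution gumbel"
    and cdf_gumbel: "cdf gumbel x = exp (- exp (- x))"
proof -
  have mono: "exp (- exp (- x)) \<le> exp (- exp (- y))" if "x \<le> y" for x y :: real
    using that by simp
  have cont: "continuous (at_right a) (\<lambda>x::real. exp (- exp (- x)))" for a
    by (intro continuous_intros)
  have bot: "((\<lambda>x::real. exp (- exp (- x))) \<longlongrightarrow> 0) at_bot"
    by (intro filterlim_compose[OF exp_at_bot] filterlim_compose[OF filterlim_uminus_at_bot_at_top]
        filterlim_compose[OF exp_at_top] filterlim_uminus_at_top_at_bot)
  have "((\<lambda>x::real. exp (- x)) \<longlongrightarrow> 0) at_top"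
    by (intro filterlim_compose[OF exp_at_bot] filterlim_uminus_at_bot_at_top)
  then have "((\<lambda>x::real. exp (- exp (- x))) \<longlongrightarrow> exp (- 0)) at_top"
    by (intro tendsto_intros)
  then have top: "((\<lambda>x::real. exp (- exp (- x))) \<longlongrightarrow> 1) at_top"
    by simp
  show "real_distribution gumbel"
    unfolding gumbel_def by (rule real_distribution_interval_measure[OF mono cont bot top])
  show "cdf gumbel x = exp (- exp (- x))"
    unfolding gumbel_def cdf_def by (rule measure_interval_measure_Iic[OF mono cont bot])
qed

end

theory Submission
  imports Defs "HOL-Real_Asymp.Real_Asymp" "HOL-Computational_Algebra.Polynomial"
begin

text \<open>
 Write \<open>W\<^sub>i\<^sub>j = d (T\<^sub>i\<^sub>j - d)\<close>. The event that the maximum is at most \<open>t\<close> says that none of the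
 \<open>ptilde p\<close> pairs has \<open>W\<^sub>i\<^sub>j > t\<close>. Pairs without a common index are independent, so the number of exceedances is
 nearly Poisson as soon as (a) its mean tends to \<open>exp (- t)\<close> and (b) two pairs with a common index rarely exceed
 together, namely with a probability that is \<open>o(p\<^sup>-\<^sup>3)\<close>. The Chen-Stein bound \<open>chen_stein_zero_count\<close> then gives the
 limit \<open>exp (- exp (- t))\<close> for the probability of no exceedance.

 Both (a) and (b) are moderate deviation statements about sums of independent variables: the error has to be
 relative, since the probabilities tend to 0. They follow from a multiplicative form of Lindeberg's replacement
 method. The indicator of a half-line is smoothed by the logistic function, all of whose derivatives are bounded by
 a multiple of the function itself (\<open>dlogistic_bound\<close>), so that replacing one summand by another with the same
 first \<open>k - 1\<close> moments multiplies the expectation by \<open>1 + o(1/n)\<close> (\<open>lindeberg_step\<close>). As shifts commute, the \<open>n\<close>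
 replacements multiply up (\<open>shift_avg_telescope\<close>). The summands are first truncated at a level which is exceeded
 anywhere in the array with vanishing probability.

 With \<open>k = 3\<close> the comparison variable is standard normal. If \<open>d\<close> may grow faster than \<open>n\<close> to the power 1/6, the
 third moment matters: then \<open>k = 4\<close>, and a nonzero third moment is matched by a centered gamma variable, whose
 convolution powers are again gamma. Its tail carries the factor \<open>exp (\<kappa> d\<^sup>3 / (6 sqrt n))\<close>, and the term
 \<open>\<kappa> ln (ptilde p) / (3 sqrt n)\<close> of the centering compensates exactly this factor (\<open>centering_asymptotics\<close>).

 For (b), both sums are compared with a normal pair of correlation \<open>\<rho>\<close>, for which the joint exceedance probability is
 \<open>O(exp (- d\<^sup>2 / (1 + \<rho>)) / d\<^sup>2)\<close>. Since \<open>p\<^sup>3\<close> is of the order \<open>d\<^sup>3\<^sup>/\<^sup>2 exp (3 d\<^sup>2 / 4)\<close> up to the cubic factor,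
 (b) holds if \<open>3 / 4 \<le> 1 / (1 + \<rho>)\<close>, which is \<open>\<rho> \<le> 1/3\<close>; strict inequality absorbs the factors
 \<open>exp (O(d\<^sup>3 / sqrt n))\<close> that remain when only \<open>d\<^sup>2 / n \<rightarrow> 0\<close>.

 Of the four conditions, the last two imply a moment \<open>E exp (\<eta> \<bar>Z\<bar>\<^sup>1\<^sup>/\<^sup>2) < \<infinity>\<close> with \<open>ln p = o(n\<^sup>1\<^sup>/\<^sup>3)\<close>, so only
 stretched exponential moments and the polynomial-logarithmic moment have to be treated.
\<close>

section \<open>Logistic smoothing and its Taylor expansion\<close>

definition logistic :: "real \<Rightarrow> real"
 where "logistic u = 1 / (1 + exp (- u))"

abbreviation elogistic :: "real \<Rightarrow> ennreal"
 where "elogistic \<equiv> \<lambda>u. ennreal (logistic u)"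

lemma logistic_pos: "0 < logistic u"
 by (simp add: logistic_def add_pos_pos)

lemma logistic_less_1: "logistic u < 1"
 by (simp add: logistic_def add_pos_pos)

lemma logistic_le_exp: "logistic u \<le> exp u"
proof -
 have "exp u * (1 + exp (- u)) = exp u + 1" by (simp add: distrib_left flip: exp_add)
 then have "1 \<le> exp u * (1 + exp (- u))" by (smt (verit) exp_gt_zero)
 then show ?thesis by (simp add: logistic_def divide_le_eq add_pos_pos)
qed

lemma logistic_measurable [measurable]: "logistic \<in> borel_measurable borel"
 unfolding logistic_def by measurable

lemma logistic_shift: "logistic (u + v) \<le> exp \<bar>v\<bar> * logistic u"
proof -
 have "1 + exp (- u) \<le> exp \<bar>v\<bar> * (1 + exp (- (u + v)))"
 proof -
  have "exp (- u) = exp v * exp (- (u + v))" by (simp flip: exp_add)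
  also have "\<dots> \<le> exp \<bar>v\<bar> * exp (- (u + v))" by (intro mult_right_mono) auto
  finally have "exp (- u) \<le> exp \<bar>v\<bar> * exp (- (u + v))" .
  moreover have "1 \<le> exp \<bar>v\<bar>" by simp
  moreover have "exp \<bar>v\<bar> * (1 + exp (- (u + v))) = exp \<bar>v\<bar> + exp \<bar>v\<bar> * exp (- (u + v))"
   by (rule trans[OF distrib_left]) simp
  ultimately show ?thesis by linarith
 qed
 then show ?thesis unfolding logistic_def
  by (simp add: divide_simps add_pos_pos mult.commute)
qed

lemma logistic_shift_lower: "exp (- \<bar>v\<bar>) * logistic u \<le> logistic (u + v)"
 using logistic_shift[of "u + v" "- v"]
 by (simp add: exp_minus field_simps)

primrec logistic_poly :: "nat \<Rightarrow> real poly"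
 where "logistic_poly 0 = [:0, 1:]"
 | "logistic_poly (Suc j) = pderiv (logistic_poly j) * [:0, 1, -1:]"

definition dlogistic :: "nat \<Rightarrow> real \<Rightarrow> real"
 where "dlogistic j u = poly (logistic_poly j) (logistic u)"

lemma dlogistic_0 [simp]: "dlogistic 0 = logistic"
 by (simp add: dlogistic_def fun_eq_iff)

lemma DERIV_logistic: "(logistic has_real_derivative logistic u - (logistic u)\<^sup>2) (at u)"
proof -
 have nz: "1 + exp (- u) \<noteq> 0" by (smt (verit) exp_gt_zero)
 have "(logistic has_real_derivative exp (- u) / (1 + exp (- u))\<^sup>2) (at u)"
  unfolding logistic_def using nz
  by (auto intro!: derivative_eq_intros simp: power2_eq_square)
 moreover have "exp (- u) / (1 + exp (- u))\<^sup>2 = logistic u - (logistic u)\<^sup>2"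
 proof -
  have "logistic u - (logistic u)\<^sup>2 = ((1 + exp (- u)) - 1) / (1 + exp (- u))\<^sup>2"
   unfolding logistic_def using nz by (simp only: diff_divide_distrib power2_eq_square) simp
  then show ?thesis by simp
 qed
 ultimately show ?thesis by simp
qed

lemma DERIV_dlogistic: "(dlogistic j has_real_derivative dlogistic (Suc j) u) (at u)"
proof -
 have "((\<lambda>u. poly (logistic_poly j) (logistic u)) has_real_derivative
   poly (pderiv (logistic_poly j)) (logistic u) * (logistic u - (logistic u)\<^sup>2)) (at u)"
  by (rule DERIV_chain2[OF poly_DERIV DERIV_logistic])
 then show ?thesis
  by (simp add: dlogistic_def[abs_def] power2_eq_square algebra_simps)
qed

text \<open>The derivatives of the logistic function are polynomials in it without constant term, because \<open>y' = y - y\<^sup>2\<close>.\<close>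
lemma dlogistic_bound1: "\<exists>C>0. \<forall>u. \<bar>dlogistic j u\<bar> \<le> C * logistic u"
proof -
 have "[:0, 1:] dvd logistic_poly j"
 proof (induction j)
  case (Suc j)
  have "[:0, 1, -1:] = [:0, 1:] * [:1, -1 :: real:]" by simp
  then show ?case by (metis dvd_mult dvd_triv_left logistic_poly.simps(2))
 qed simp
 then obtain R where R: "logistic_poly j = [:0, 1:] * R" by blast
 have "compact (poly R ` {0..1})"
  by (intro compact_continuous_image continuous_intros) auto
 then have "bounded (poly R ` {0..1})" by (rule compact_imp_bounded)
 then obtain C where C: "C > 0" "\<And>y. y \<in> poly R ` {0..1} \<Longrightarrow> norm y \<le> C"
  using bounded_pos by metis
 have "\<bar>dlogistic j u\<bar> \<le> C * logistic u" for u
 proof -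
  have l: "logistic u \<in> {0..1}" using logistic_pos[of u] logistic_less_1[of u] by auto
  have "\<bar>dlogistic j u\<bar> = \<bar>poly R (logistic u)\<bar> * logistic u"
   using logistic_pos[of u] by (simp add: dlogistic_def R abs_mult)
  also have "\<dots> \<le> C * logistic u"
   using C(2)[of "poly R (logistic u)"] l logistic_pos[of u] by (intro mult_right_mono) auto
  finally show ?thesis .
 qed
 then show ?thesis using C(1) by blast
qed

lemma dlogistic_bound: "\<exists>C\<ge>1. \<forall>j\<le>k. \<forall>u. \<bar>dlogistic j u\<bar> \<le> C * logistic u"
proof -
 obtain c where c: "\<And>j. c j > 0" "\<And>j u. \<bar>dlogistic j u\<bar> \<le> c j * logistic u"
  using dlogistic_bound1 by metis
 have "\<bar>dlogistic j u\<bar> \<le> (1 + (\<Sum>i\<le>k. c i)) * logistic u" if "j \<le> k" for j u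
 proof -
  have "c j \<le> (\<Sum>i\<le>k. c i)" using that c(1) by (intro member_le_sum) (auto intro: less_imp_le)
  then have "c j * logistic u \<le> (1 + (\<Sum>i\<le>k. c i)) * logistic u"
   using logistic_pos[of u] by (intro mult_right_mono) auto
  then show ?thesis using c(2)[of j u] by linarith
 qed
 moreover have "1 + (\<Sum>i\<le>k. c i) \<ge> 1" using c(1) by (simp add: sum_nonneg less_imp_le)
 ultimately show ?thesis by blast
qed

definition trunc :: "real set \<Rightarrow> real \<Rightarrow> real"
 where "trunc B z = (if z \<in> B then z else 0)"

text \<open>The Taylor error at the truncated variable, relative to the value of the logistic function. Outside \<open>B\<close> the variable is replaced by 0 while the Taylor polynomial is still evaluated at \<open>z\<close>; this costs its degree, \<open>k - 1\<close>.\<close>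
definition taylor_rem :: "nat \<Rightarrow> real set \<Rightarrow> real \<Rightarrow> real \<Rightarrow> real"
 where "taylor_rem k B q z =
  (if z \<in> B then (q * \<bar>z\<bar>) ^ k * exp (2 * q * \<bar>z\<bar>) else 1 + (q * \<bar>z\<bar>) ^ (k - 1))"

lemma taylor_rem_nonneg: "0 \<le> q \<Longrightarrow> 0 \<le> taylor_rem k B q z"
 by (auto simp: taylor_rem_def intro!: add_nonneg_nonneg)

text \<open>The Lagrange remainder is a derivative at an intermediate point, hence a multiple of the logistic function there, and a shift by \<open>v\<close> changes this function by a factor of at most \<open>exp \<bar>v\<bar>\<close>.\<close>
lemma logistic_taylor:
 assumes k: "k > 0"
 shows "\<exists>C\<ge>1. \<forall>u z B q. 0 \<le> q \<longrightarrow>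
  \<bar>logistic (u + q * trunc B z) - (\<Sum>j<k. dlogistic j u * (q * z) ^ j / fact j)\<bar>
   \<le> C * taylor_rem k B q z * logistic u"
proof -
 obtain C where C: "C \<ge> 1" "\<And>j u. j \<le> k \<Longrightarrow> \<bar>dlogistic j u\<bar> \<le> C * logistic u"
  using dlogistic_bound[of k] by blast
 have main: "\<bar>logistic (u + q * trunc B z) - (\<Sum>j<k. dlogistic j u * (q * z) ^ j / fact j)\<bar>
   \<le> (2 * C * (1 + real k)) * taylor_rem k B q z * logistic u" if q: "q \<ge> 0" for u z B q
 proof (cases "z \<in> B")
  case True
  define v where "v = q * z"
  have av: "\<bar>v\<bar> = q * \<bar>z\<bar>" using q by (simp add: v_def abs_mult)
  have "\<exists>t. \<bar>t\<bar> \<le> \<bar>v\<bar> \<and> logistic (u + v) = (\<Sum>m<k. dlogistic m (u + 0) / fact m * v ^ m) + dlogistic k (u + t) / fact k * v ^ k"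
  proof (rule Maclaurin_all_le)
   show "(\<lambda>t. dlogistic 0 (u + t)) = (\<lambda>t. logistic (u + t))" by simp
   show "\<forall>m x. ((\<lambda>t. dlogistic m (u + t)) has_real_derivative dlogistic (Suc m) (u + x)) (at x)"
    using DERIV_dlogistic by (auto intro!: DERIV_chain2[where g="\<lambda>t. u + t", of "dlogistic _" _ _ 1, simplified] derivative_eq_intros)
  qed
  then obtain t where t: "\<bar>t\<bar> \<le> \<bar>v\<bar>"
   "logistic (u + v) = (\<Sum>m<k. dlogistic m u / fact m * v ^ m) + dlogistic k (u + t) / fact k * v ^ k"
   by auto
  have "\<bar>logistic (u + v) - (\<Sum>j<k. dlogistic j u * v ^ j / fact j)\<bar> = \<bar>dlogistic k (u + t)\<bar> / fact k * \<bar>v\<bar> ^ k"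
   using t(2) by (simp add: abs_mult power_abs)
  also have "\<dots> \<le> \<bar>dlogistic k (u + t)\<bar> / 1 * \<bar>v\<bar> ^ k"
   by (intro mult_right_mono divide_left_mono) auto
  also have "\<dots> \<le> (C * (exp (2 * \<bar>v\<bar>) * logistic u)) * \<bar>v\<bar> ^ k"
  proof -
   have "\<bar>dlogistic k (u + t)\<bar> \<le> C * logistic (u + t)" using C by auto
   also have "logistic (u + t) \<le> exp \<bar>t\<bar> * logistic u" by (rule logistic_shift)
   also have "\<dots> \<le> exp (2 * \<bar>v\<bar>) * logistic u" using t(1) logistic_pos[of u] by (intro mult_right_mono) auto
   finally show ?thesis using C(1) by (intro mult_right_mono) auto
  qed
  also have "\<dots> = C * taylor_rem k B q z * logistic u"
   using True by (simp add: taylor_rem_def av algebra_simps)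
  also have "\<dots> \<le> (2 * C * (1 + real k)) * taylor_rem k B q z * logistic u"
  proof -
   have "C * 1 \<le> (2 * C) * (1 + real k)" using C(1) by (intro mult_mono) auto
   then show ?thesis using taylor_rem_nonneg[OF q, of k B z] logistic_pos[of u]
    by (intro mult_right_mono) auto
  qed
  finally show ?thesis using True by (simp add: trunc_def v_def)
 next
  case False
  define a where "a = q * \<bar>z\<bar>"
  have a0: "a \<ge> 0" using q by (simp add: a_def)
  have aj: "a ^ j \<le> 1 + a ^ (k - 1)" if "j < k" for j
  proof (cases "a \<le> 1")
   case True
   then show ?thesis using a0 power_le_one[of a j] by (smt (verit) zero_le_power)
  next
   case False
   then have "a ^ j \<le> a ^ (k - 1)" using that by (intro power_increasing) auto
   then show ?thesis by simp
  qed
  have trm: "\<bar>dlogistic j u * (q * z) ^ j / fact j\<bar> \<le> C * logistic u * (1 + a ^ (k - 1))" if "j < k" for j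
  proof -
   have "\<bar>dlogistic j u * (q * z) ^ j / fact j\<bar> = \<bar>dlogistic j u\<bar> * a ^ j / fact j"
    using q by (simp add: abs_mult power_abs a_def)
   also have "\<dots> \<le> \<bar>dlogistic j u\<bar> * a ^ j / 1"
    using a0 by (intro divide_left_mono) auto
   also have "\<dots> \<le> (C * logistic u) * (1 + a ^ (k - 1))" unfolding div_by_1
    using C that aj[OF that] a0 logistic_pos[of u] by (intro mult_mono) auto
   finally show ?thesis by simp
  qed
  have "\<bar>\<Sum>j<k. dlogistic j u * (q * z) ^ j / fact j\<bar> \<le> (\<Sum>j<k. C * logistic u * (1 + a ^ (k - 1)))"
   using trm by (intro order_trans[OF sum_abs] sum_mono) auto
  also have "\<dots> = real k * (C * logistic u * (1 + a ^ (k - 1)))" by simp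
  finally have 1: "\<bar>\<Sum>j<k. dlogistic j u * (q * z) ^ j / fact j\<bar> \<le> real k * (C * logistic u * (1 + a ^ (k - 1)))" .
  have 2: "1 * logistic u * 1 \<le> C * logistic u * (1 + a ^ (k - 1))"
   using C(1) logistic_pos[of u] a0 by (intro mult_mono) auto
  have "\<bar>logistic u - (\<Sum>j<k. dlogistic j u * (q * z) ^ j / fact j)\<bar>
    \<le> C * logistic u * (1 + a ^ (k - 1)) + real k * (C * logistic u * (1 + a ^ (k - 1)))"
   using 1 2 logistic_pos[of u] by linarith
  also have "\<dots> = (1 + real k) * (C * logistic u * (1 + a ^ (k - 1)))"
   by (simp only: distrib_right mult_1)
  also have "\<dots> \<le> 2 * ((1 + real k) * (C * logistic u * (1 + a ^ (k - 1))))"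
   using C(1) logistic_pos[of u] a0 by simp
  also have "\<dots> = (2 * C * (1 + real k)) * (1 + a ^ (k - 1)) * logistic u"
   by (simp only: mult_ac)
  also have "1 + a ^ (k - 1) = taylor_rem k B q z"
   using False by (simp add: taylor_rem_def a_def)
  finally show ?thesis using False by (simp add: trunc_def)
 qed
 have "1 * 1 \<le> C * (1 + real k)" using C(1) by (intro mult_mono) auto
 then have c1: "1 \<le> 2 * C * (1 + real k)" by linarith
 show ?thesis
  by (rule exI[of _ "2 * C * (1 + real k)"], rule conjI[OF c1], intro allI impI) (erule main)
qed

definition taylor2 :: "real \<Rightarrow> real \<Rightarrow> real \<Rightarrow> real \<Rightarrow> real"
 where "taylor2 u1 u2 v1 v2 =
  dlogistic 0 u1 * dlogistic 0 u2
  + (dlogistic 1 u1 * dlogistic 0 u2 * v1 + dlogistic 0 u1 * dlogistic 1 u2 * v2)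
  + (dlogistic 2 u1 * dlogistic 0 u2 * v1\<^sup>2 + 2 * dlogistic 1 u1 * dlogistic 1 u2 * (v1 * v2)
    + dlogistic 0 u1 * dlogistic 2 u2 * v2\<^sup>2) / 2"

lemma power3_sum_exp_le:
 fixes a b :: real
 assumes "a \<ge> 0" "b \<ge> 0"
 shows "(a + b) ^ 3 * exp (a + b) \<le> 8 * (a ^ 3 * exp (2 * a) + b ^ 3 * exp (2 * b))"
proof -
 have *: "(a + b) ^ 3 * exp (a + b) \<le> 8 * (max a b ^ 3 * exp (2 * max a b))"
 proof -
  have "(a + b) ^ 3 * exp (a + b) \<le> (2 * max a b) ^ 3 * exp (2 * max a b)"
   using assms by (intro mult_mono power_mono) auto
  then show ?thesis by (simp add: power_mult_distrib)
 qed
 also have "\<dots> \<le> 8 * (a ^ 3 * exp (2 * a) + b ^ 3 * exp (2 * b))"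
  using assms by (auto simp: max_def)
 finally show ?thesis .
qed

text \<open>Taylor's formula along a line for a product, so that two-dimensional calculus is avoided.\<close>
lemma taylor_product3:
 fixes f0 f1 f2 f3 g0 g1 g2 g3 :: "real \<Rightarrow> real"
 assumes f: "\<And>t. (f0 has_real_derivative f1 t) (at t)" "\<And>t. (f1 has_real_derivative f2 t) (at t)"
   "\<And>t. (f2 has_real_derivative f3 t) (at t)"
  and g: "\<And>t. (g0 has_real_derivative g1 t) (at t)" "\<And>t. (g1 has_real_derivative g2 t) (at t)"
   "\<And>t. (g2 has_real_derivative g3 t) (at t)"
 obtains t where "0 < t" "t < 1"
  "f0 1 * g0 1 = f0 0 * g0 0 + (f1 0 * g0 0 + f0 0 * g1 0)
    + (f2 0 * g0 0 + 2 * (f1 0 * g1 0) + f0 0 * g2 0) / 2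
    + (f3 t * g0 t + 3 * (f2 t * g1 t) + 3 * (f1 t * g2 t) + f0 t * g3 t) / 6"
proof -
 define D where "D m = (if m = 0 then (\<lambda>t. f0 t * g0 t) else if m = 1 then (\<lambda>t. f1 t * g0 t + f0 t * g1 t)
  else if m = 2 then (\<lambda>t. f2 t * g0 t + 2 * (f1 t * g1 t) + f0 t * g2 t)
  else (\<lambda>t. f3 t * g0 t + 3 * (f2 t * g1 t) + 3 * (f1 t * g2 t) + f0 t * g3 t))" for m :: nat
 have D0: "(D 0 has_real_derivative D 1 t) (at t)" for t
  unfolding D_def by (auto intro!: derivative_eq_intros f g)
 have D1: "(D 1 has_real_derivative D 2 t) (at t)" for t
  unfolding D_def by (auto intro!: derivative_eq_intros f g)
 have D2: "(D 2 has_real_derivative D 3 t) (at t)" for t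
  unfolding D_def by (auto intro!: derivative_eq_intros f g)
 have "\<forall>m t. m < 3 \<and> 0 \<le> t \<and> t \<le> 1 \<longrightarrow> ((D m) has_real_derivative D (Suc m) t) (at t)"
 proof (intro allI impI)
  fix m :: nat and t :: real assume "m < 3 \<and> 0 \<le> t \<and> t \<le> 1"
  then consider "m = 0" | "m = 1" | "m = 2" by linarith
  then show "((D m) has_real_derivative D (Suc m) t) (at t)"
   using D0[of t] D1[of t] D2[of t] by cases (simp_all add: numeral_2_eq_2 numeral_3_eq_3)
 qed
 from Maclaurin[of 1 3 D "D 0", OF _ _ _ this]
 obtain t where t: "0 < t" "t < 1" "D 0 1 = (\<Sum>m<3. D m 0 / fact m * 1 ^ m) + D 3 t / fact 3 * 1 ^ 3"
  by auto
 have "(\<Sum>m<3. D m 0 / fact m * 1 ^ m) = D 0 0 + D 1 0 + D 2 0 / 2"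
  by (simp add: numeral_3_eq_3 numeral_2_eq_2)
 then have "D 0 1 = D 0 0 + D 1 0 + D 2 0 / 2 + D 3 t / 6" using t(3) by (simp add: fact_numeral)
 then show thesis using that t(1,2) by (simp add: D_def)
qed

lemma logistic_taylor2:
 "\<exists>C\<ge>1. \<forall>u1 u2 z1 z2 B c. 0 \<le> c \<longrightarrow>
  \<bar>logistic (u1 + c * trunc B z1) * logistic (u2 + c * trunc B z2) - taylor2 u1 u2 (c * z1) (c * z2)\<bar>
   \<le> C * (taylor_rem 3 B c z1 + taylor_rem 3 B c z2) * (logistic u1 * logistic u2)"
proof -
 obtain C where C: "C \<ge> 1" "\<And>j u. j \<le> 3 \<Longrightarrow> \<bar>dlogistic j u\<bar> \<le> C * logistic u"
  using dlogistic_bound[of 3] by blast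
 have dd: "\<bar>dlogistic i u * dlogistic j v\<bar> \<le> C\<^sup>2 * (logistic u * logistic v)" if "i \<le> 3" "j \<le> 3" for i j u v
 proof -
  have "\<bar>dlogistic i u\<bar> * \<bar>dlogistic j v\<bar> \<le> (C * logistic u) * (C * logistic v)"
   using C that logistic_pos[of u] by (intro mult_mono) auto
  then show ?thesis by (simp add: abs_mult power2_eq_square mult_ac)
 qed
 have main: "\<bar>logistic (u1 + c * trunc B z1) * logistic (u2 + c * trunc B z2) - taylor2 u1 u2 (c * z1) (c * z2)\<bar>
   \<le> 40 * C\<^sup>2 * (taylor_rem 3 B c z1 + taylor_rem 3 B c z2) * (logistic u1 * logistic u2)"
  if c: "c \<ge> 0" for u1 u2 z1 z2 B c
 proof -
  define v1 v2 where "v1 = c * z1" and "v2 = c * z2"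
  define a b where "a = c * \<bar>z1\<bar>" and "b = c * \<bar>z2\<bar>"
  have ab: "a \<ge> 0" "b \<ge> 0" "a = \<bar>v1\<bar>" "b = \<bar>v2\<bar>" using c by (auto simp: a_def b_def v1_def v2_def abs_mult)
  define L where "L = logistic u1 * logistic u2"
  have L0: "L > 0" using logistic_pos by (simp add: L_def)
  have C2: "C\<^sup>2 \<ge> 1" using C(1) by simp
  show ?thesis
  proof (cases "z1 \<in> B \<and> z2 \<in> B")
   case True
   define D3 where "D3 t = dlogistic 3 (u1 + t * v1) * v1 ^ 3 * (dlogistic 0 (u2 + t * v2) * v2 ^ 0)
      + 3 * (dlogistic 2 (u1 + t * v1) * v1\<^sup>2 * (dlogistic 1 (u2 + t * v2) * v2 ^ 1))
      + 3 * (dlogistic 1 (u1 + t * v1) * v1 ^ 1 * (dlogistic 2 (u2 + t * v2) * v2\<^sup>2))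
      + dlogistic 0 (u1 + t * v1) * v1 ^ 0 * (dlogistic 3 (u2 + t * v2) * v2 ^ 3)" for t :: real
   have der: "((\<lambda>t. dlogistic j (u + t * v) * v ^ j) has_real_derivative dlogistic (Suc j) (u + t * v) * v ^ Suc j) (at t)" for j u v t
   proof -
    have "((\<lambda>t. dlogistic j (u + t * v)) has_real_derivative dlogistic (Suc j) (u + t * v) * v) (at t)"
     by (rule DERIV_chain2[OF DERIV_dlogistic]) (auto intro!: derivative_eq_intros)
    from DERIV_cmult_right[OF this, of "v ^ j"] show ?thesis by (simp only: power_Suc mult_ac)
   qed
   have num: "Suc 0 = 1" "Suc 1 = 2" "Suc 2 = 3" by auto
   obtain t where t: "0 < t" "t < 1"
    and eq: "dlogistic 0 (u1 + 1 * v1) * v1 ^ 0 * (dlogistic 0 (u2 + 1 * v2) * v2 ^ 0)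
     = dlogistic 0 (u1 + 0 * v1) * v1 ^ 0 * (dlogistic 0 (u2 + 0 * v2) * v2 ^ 0)
     + (dlogistic 1 (u1 + 0 * v1) * v1 ^ 1 * (dlogistic 0 (u2 + 0 * v2) * v2 ^ 0)
       + dlogistic 0 (u1 + 0 * v1) * v1 ^ 0 * (dlogistic 1 (u2 + 0 * v2) * v2 ^ 1))
     + (dlogistic 2 (u1 + 0 * v1) * v1\<^sup>2 * (dlogistic 0 (u2 + 0 * v2) * v2 ^ 0)
       + 2 * (dlogistic 1 (u1 + 0 * v1) * v1 ^ 1 * (dlogistic 1 (u2 + 0 * v2) * v2 ^ 1))
       + dlogistic 0 (u1 + 0 * v1) * v1 ^ 0 * (dlogistic 2 (u2 + 0 * v2) * v2\<^sup>2)) / 2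
     + D3 t / 6"
    unfolding D3_def
    by (rule taylor_product3[OF der[of 0, unfolded num] der[of 1, unfolded num] der[of 2, unfolded num]
       der[of 0, unfolded num] der[of 1, unfolded num] der[of 2, unfolded num]])
   define D01 where "D01 = logistic (u1 + v1) * logistic (u2 + v2)"
   have "D01 = taylor2 u1 u2 v1 v2 + D3 t / 6"
    using eq unfolding D01_def taylor2_def by (simp add: mult_ac)
   then have "\<bar>D01 - taylor2 u1 u2 v1 v2\<bar> = \<bar>D3 t\<bar> / 6"
    by simp
   also have "\<bar>D3 t\<bar> \<le> C\<^sup>2 * (logistic (u1 + t * v1) * logistic (u2 + t * v2)) * (a + b) ^ 3"
   proof -
    define K where "K = C\<^sup>2 * (logistic (u1 + t * v1) * logistic (u2 + t * v2))"
    have K: "\<bar>dlogistic i (u1 + t * v1)\<bar> * \<bar>dlogistic j (u2 + t * v2)\<bar> \<le> K" if "i \<le> 3" "j \<le> 3" for i j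
     using dd[OF that] by (simp add: K_def abs_mult)
    have tri: "\<bar>p + 3 * q + 3 * r + s\<bar> \<le> \<bar>p\<bar> + 3 * \<bar>q\<bar> + 3 * \<bar>r\<bar> + \<bar>s\<bar>" for p q r s :: real
     by linarith
    have "\<bar>D3 t\<bar> \<le> \<bar>dlogistic 3 (u1 + t * v1)\<bar> * \<bar>dlogistic 0 (u2 + t * v2)\<bar> * a ^ 3
      + 3 * (\<bar>dlogistic 2 (u1 + t * v1)\<bar> * \<bar>dlogistic 1 (u2 + t * v2)\<bar> * (a\<^sup>2 * b))
      + 3 * (\<bar>dlogistic 1 (u1 + t * v1)\<bar> * \<bar>dlogistic 2 (u2 + t * v2)\<bar> * (a * b\<^sup>2))
      + \<bar>dlogistic 0 (u1 + t * v1)\<bar> * \<bar>dlogistic 3 (u2 + t * v2)\<bar> * b ^ 3"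
     unfolding D3_def ab(3,4)
     by (rule order_trans[OF tri]) (simp add: abs_mult power_abs mult_ac del: dlogistic_0)
    also have "\<dots> \<le> K * a ^ 3 + 3 * (K * (a\<^sup>2 * b)) + 3 * (K * (a * b\<^sup>2)) + K * b ^ 3"
     using ab(1,2) by (intro add_mono mult_left_mono mult_right_mono K) auto
    also have "\<dots> = K * (a + b) ^ 3" by (simp add: power2_eq_square power3_eq_cube algebra_simps)
    finally show ?thesis by (simp add: K_def)
   qed
   also have "C\<^sup>2 * (logistic (u1 + t * v1) * logistic (u2 + t * v2)) * (a + b) ^ 3
     \<le> C\<^sup>2 * (exp (a + b) * L) * (a + b) ^ 3"
   proof -
    have e: "exp \<bar>t * v1\<bar> \<le> exp a" "exp \<bar>t * v2\<bar> \<le> exp b"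
     using t(1,2) by (auto simp: abs_mult ab mult_left_le_one_le)
    have "logistic (u1 + t * v1) \<le> exp a * logistic u1"
     using logistic_shift[of u1 "t * v1"] e(1) logistic_pos[of u1] by (smt (verit) mult_right_mono)
    moreover have "logistic (u2 + t * v2) \<le> exp b * logistic u2"
     using logistic_shift[of u2 "t * v2"] e(2) logistic_pos[of u2] by (smt (verit) mult_right_mono)
    ultimately have "logistic (u1 + t * v1) * logistic (u2 + t * v2) \<le> (exp a * logistic u1) * (exp b * logistic u2)"
     using logistic_pos by (intro mult_mono) (auto intro: less_imp_le)
    then show ?thesis using ab by (intro mult_right_mono mult_left_mono) (auto simp: L_def exp_add mult_ac)
   qed
   also have "\<dots> \<le> C\<^sup>2 * L * (8 * (a ^ 3 * exp (2 * a) + b ^ 3 * exp (2 * b)))"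
    using power3_sum_exp_le[OF ab(1,2)] C2 L0
    by (smt (verit, ccfv_SIG) mult.assoc mult.commute mult_left_mono zero_le_power2 mult_nonneg_nonneg)
   also have "\<dots> / 6 \<le> \<dots> * 40 / 8"
    using C2 L0 ab by simp
   also have "\<dots> = 40 * C\<^sup>2 * (taylor_rem 3 B c z1 + taylor_rem 3 B c z2) * L"
    using True by (simp add: taylor_rem_def a_def b_def algebra_simps)
   finally show ?thesis using True by (simp add: D01_def trunc_def v1_def v2_def L_def divide_right_mono)
  next
   case False
   define S where "S = taylor_rem 3 B c z1 + taylor_rem 3 B c z2"
   have sq: "x\<^sup>2 \<le> 1 + x ^ 3 * exp (2 * x)" if "x \<ge> 0" for x :: real
   proof (cases "x \<le> 1")
    case True then show ?thesis using that by (smt (verit) power_le_one mult_nonneg_nonneg zero_le_power exp_ge_zero)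
   next
    case False
    have "x\<^sup>2 * 1 * 1 \<le> x\<^sup>2 * x * exp (2 * x)" using False by (intro mult_mono) auto
    then show ?thesis by (simp add: power3_eq_cube power2_eq_square)
   qed
   have ex: "exp x \<le> 3 + x ^ 3 * exp (2 * x)" if "x \<ge> 0" for x :: real
   proof (cases "x \<le> 1")
    case True then have "exp x \<le> 3" using exp_le by (smt (verit) exp_le_cancel_iff)
    then show ?thesis using that by (smt (verit) mult_nonneg_nonneg zero_le_power exp_ge_zero)
   next
    case False
    then have "1 * exp x \<le> x ^ 3 * exp (2 * x)" by (intro mult_mono) (auto simp: one_le_power)
    then show ?thesis by simp
   qed
   have r: "1 \<le> taylor_rem 3 B c z" "(c * \<bar>z\<bar>)\<^sup>2 \<le> taylor_rem 3 B c z" if "z \<notin> B" for z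
    using that by (auto simp: taylor_rem_def)
   have r0: "taylor_rem 3 B c z \<ge> 0" for z using taylor_rem_nonneg[OF c] .
   have sq': "(c * \<bar>z\<bar>)\<^sup>2 \<le> 1 + taylor_rem 3 B c z" for z
    using sq[of "c * \<bar>z\<bar>"] c by (auto simp: taylor_rem_def mult_ac)
   have S1: "S \<ge> 1" using False r(1) r0 unfolding S_def by (smt (verit))
   have aS: "a\<^sup>2 \<le> 2 * S" "b\<^sup>2 \<le> 2 * S"
    using sq'[of z1] sq'[of z2] S1 r0[of z1] r0[of z2] unfolding S_def a_def b_def
    by (simp_all add: algebra_simps)
   have "exp \<bar>c * trunc B z1\<bar> * exp \<bar>c * trunc B z2\<bar> \<le> 3 * S"
   proof -
    have one: "exp \<bar>c * trunc B z\<bar> \<le> 3 + taylor_rem 3 B c z" for z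
     using ex[of "c * \<bar>z\<bar>"] c r0[of z] by (auto simp: trunc_def taylor_rem_def abs_mult mult_ac)
    consider "z1 \<notin> B" | "z2 \<notin> B" using False by blast
    then show ?thesis
    proof cases
     case 1 then show ?thesis using one[of z2] r(1)[of z1] r0[of z1] r0[of z2] by (simp add: S_def trunc_def)
    next
     case 2 then show ?thesis using one[of z1] r(1)[of z2] r0[of z2] r0[of z1] by (simp add: S_def trunc_def)
    qed
   qed
   then have p1: "logistic (u1 + c * trunc B z1) * logistic (u2 + c * trunc B z2) \<le> 3 * S * L"
   proof -
    have "logistic (u1 + c * trunc B z1) * logistic (u2 + c * trunc B z2)
      \<le> (exp \<bar>c * trunc B z1\<bar> * logistic u1) * (exp \<bar>c * trunc B z2\<bar> * logistic u2)"
     using logistic_shift logistic_pos by (intro mult_mono) (auto intro: less_imp_le mult_nonneg_nonneg)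
    also have "\<dots> = (exp \<bar>c * trunc B z1\<bar> * exp \<bar>c * trunc B z2\<bar>) * L" by (simp add: L_def)
    also have "\<dots> \<le> 3 * S * L" using L0 \<open>exp \<bar>c * trunc B z1\<bar> * exp \<bar>c * trunc B z2\<bar> \<le> 3 * S\<close>
     by (intro mult_right_mono) auto
    finally show ?thesis .
   qed
   define K where "K = C\<^sup>2 * L"
   have K0: "K \<ge> 0" using C2 L0 by (simp add: K_def)
   have K: "\<bar>dlogistic i u1\<bar> * \<bar>dlogistic j u2\<bar> \<le> K" if "i \<le> 3" "j \<le> 3" for i j
    using dd[OF that, of u1 u2] by (simp add: K_def L_def abs_mult)
   have al: "a \<le> 2 * S" "b \<le> 2 * S" "a * b \<le> 2 * S"
   proof -
    have "x \<le> 2 * S" if "x\<^sup>2 \<le> 2 * S" for x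
     using that S1 power2_le_imp_le[of x "2 * S"] mult_mono[of 1 "2*S" "2*S" "2*S"]
     by (smt (verit) power2_eq_square)
    then show "a \<le> 2 * S" "b \<le> 2 * S" using aS by auto
    have "2 * (a * b) \<le> a\<^sup>2 + b\<^sup>2" using sum_squares_bound[of a b] by simp
    then show "a * b \<le> 2 * S" using aS by simp
   qed
   have "\<bar>taylor2 u1 u2 v1 v2\<bar> \<le> \<bar>dlogistic 0 u1\<bar> * \<bar>dlogistic 0 u2\<bar>
     + (\<bar>dlogistic 1 u1\<bar> * \<bar>dlogistic 0 u2\<bar> * a + \<bar>dlogistic 0 u1\<bar> * \<bar>dlogistic 1 u2\<bar> * b)
     + (\<bar>dlogistic 2 u1\<bar> * \<bar>dlogistic 0 u2\<bar> * a\<^sup>2 + 2 * (\<bar>dlogistic 1 u1\<bar> * \<bar>dlogistic 1 u2\<bar> * (a * b))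
     + \<bar>dlogistic 0 u1\<bar> * \<bar>dlogistic 2 u2\<bar> * b\<^sup>2) / 2"
   proof -
    have tri: "\<bar>p + (q + r) + (s + t + w) / 2\<bar> \<le> \<bar>p\<bar> + (\<bar>q\<bar> + \<bar>r\<bar>) + (\<bar>s\<bar> + \<bar>t\<bar> + \<bar>w\<bar>) / 2" for p q r s t w :: real
    proof -
     have "\<bar>s + t + w\<bar> \<le> \<bar>s\<bar> + \<bar>t\<bar> + \<bar>w\<bar>" by (intro order_trans[OF abs_triangle_ineq] add_mono order_refl)
     then have 2: "\<bar>(s + t + w) / 2\<bar> \<le> (\<bar>s\<bar> + \<bar>t\<bar> + \<bar>w\<bar>) / 2" by (simp add: abs_divide)
     have 1: "\<bar>p + (q + r)\<bar> \<le> \<bar>p\<bar> + (\<bar>q\<bar> + \<bar>r\<bar>)" by linarith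
     show ?thesis by (rule order_trans[OF abs_triangle_ineq add_mono[OF 1 2]])
    qed
    show ?thesis unfolding taylor2_def ab(3,4)
     by (rule order_trans[OF tri]) (simp add: abs_mult mult_ac del: dlogistic_0)
   qed
   also have "\<dots> \<le> K + (K * a + K * b) + (K * a\<^sup>2 + 2 * (K * (a * b)) + K * b\<^sup>2) / 2"
    using ab(1,2) by (intro add_mono divide_right_mono mult_left_mono mult_right_mono K) auto
   also have "\<dots> \<le> K * S + (K * (2 * S) + K * (2 * S)) + (K * (2 * S) + 2 * (K * (2 * S)) + K * (2 * S)) / 2"
    using al aS K0 mult_left_mono[OF S1 K0] by (intro add_mono divide_right_mono mult_left_mono) simp_all
   also have "\<dots> = 9 * K * S" by simp
   finally have p2: "\<bar>taylor2 u1 u2 v1 v2\<bar> \<le> 9 * K * S" .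
   have p3: "3 * S * L \<le> 3 * (K * S)"
    using mult_right_mono[OF C2, of "S * L"] S1 L0 by (simp add: K_def mult_ac)
   have "\<bar>logistic (u1 + c * trunc B z1) * logistic (u2 + c * trunc B z2) - taylor2 u1 u2 v1 v2\<bar> \<le> 12 * (K * S)"
   proof -
    have "0 \<le> logistic (u1 + c * trunc B z1) * logistic (u2 + c * trunc B z2)"
     using logistic_pos by (intro mult_nonneg_nonneg) (auto intro: less_imp_le)
    moreover have "9 * K * S = 9 * (K * S)" by simp
    ultimately show ?thesis using p1 p2 p3 by linarith
   qed
   also have "\<dots> \<le> 40 * (K * S)" using K0 S1 by simp
   finally show ?thesis by (simp add: K_def S_def L_def v1_def v2_def mult_ac)
  qed
 qed
 have "1 \<le> C\<^sup>2" using C(1) by simp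
 then have c1: "1 \<le> 40 * C\<^sup>2" by linarith
 show ?thesis
  by (rule exI[of _ "40 * C\<^sup>2"], rule conjI[OF c1], intro allI impI) (erule main)
qed

section \<open>Averaging over random shifts\<close>

text \<open>The convolution operator of \<open>\<nu>\<close>. Its \<open>n\<close>-fold iterate averages over a sum of \<open>n\<close> independent shifts.\<close>
definition shift_avg :: "'v::euclidean_space measure \<Rightarrow> ('v \<Rightarrow> ennreal) \<Rightarrow> 'v \<Rightarrow> ennreal"
 where "shift_avg \<nu> g s = (\<integral>\<^sup>+v. g (s + v) \<partial>\<nu>)"

definition borel_prob :: "'v::euclidean_space measure \<Rightarrow> bool"
 where "borel_prob \<nu> \<longleftrightarrow> prob_space \<nu> \<and> sets \<nu> = sets borel"

lemma borel_probD: "borel_prob \<nu> \<Longrightarrow> prob_space \<nu>" "borel_prob \<nu> \<Longrightarrow> sets \<nu> = sets borel"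
 by (auto simp: borel_prob_def)

lemma borel_prob_distr: "prob_space M \<Longrightarrow> V \<in> borel_measurable M \<Longrightarrow> borel_prob (distr M borel V)"
 by (simp add: borel_prob_def prob_space.prob_space_distr)

lemma shift_avg_measurable:
 assumes "borel_prob \<nu>" and [measurable]: "g \<in> borel_measurable borel"
 shows "shift_avg \<nu> g \<in> borel_measurable borel"
proof -
 interpret prob_space \<nu> using assms(1) by (rule borel_probD)
 have [measurable_cong]: "sets \<nu> = sets borel" using assms(1) by (rule borel_probD)
 show ?thesis unfolding shift_avg_def by measurable
qed

lemma shift_avg_pow_measurable:
 assumes "borel_prob \<nu>" "g \<in> borel_measurable borel"
 shows "(shift_avg \<nu> ^^ n) g \<in> borel_measurable borel"
 using assms by (induction n) (auto intro: shift_avg_measurable)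

lemma shift_avg_commute:
 assumes \<nu>: "borel_prob \<nu>" and \<mu>: "borel_prob \<mu>" and [measurable]: "g \<in> borel_measurable borel"
 shows "shift_avg \<nu> (shift_avg \<mu> g) = shift_avg \<mu> (shift_avg \<nu> g)"
proof
 fix s
 interpret N: prob_space \<nu> using \<nu> by (rule borel_probD)
 interpret P: prob_space \<mu> using \<mu> by (rule borel_probD)
 interpret pair_sigma_finite \<nu> \<mu> ..
 have [measurable_cong]: "sets \<nu> = sets borel" "sets \<mu> = sets borel" using \<nu> \<mu> by (auto dest: borel_probD)
 have "(\<integral>\<^sup>+v. \<integral>\<^sup>+w. g (s + v + w) \<partial>\<mu> \<partial>\<nu>) = (\<integral>\<^sup>+w. \<integral>\<^sup>+v. g (s + v + w) \<partial>\<nu> \<partial>\<mu>)"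
  by (rule Fubini'[symmetric]) measurable
 then show "shift_avg \<nu> (shift_avg \<mu> g) s = shift_avg \<mu> (shift_avg \<nu> g) s"
  by (simp add: shift_avg_def add_ac)
qed

lemma shift_avg_pow_commute:
 assumes \<nu>: "borel_prob \<nu>" and \<mu>: "borel_prob \<mu>" and g: "g \<in> borel_measurable borel"
 shows "(shift_avg \<nu> ^^ n) (shift_avg \<mu> g) = shift_avg \<mu> ((shift_avg \<nu> ^^ n) g)"
proof (induction n)
 case (Suc n)
 then show ?case
  by (simp only: funpow.simps o_apply shift_avg_commute[OF \<nu> \<mu> shift_avg_pow_measurable[OF \<nu> g, of n]])
qed simp

lemma shift_avg_mono: "(\<And>s. g s \<le> h s) \<Longrightarrow> shift_avg \<nu> g s \<le> shift_avg \<nu> h s"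
 unfolding shift_avg_def by (intro nn_integral_mono) auto

lemma shift_avg_cmult:
 assumes "borel_prob \<nu>" and [measurable]: "g \<in> borel_measurable borel"
 shows "shift_avg \<nu> (\<lambda>s. c * g s) s = c * shift_avg \<nu> g s"
proof -
 have [measurable_cong]: "sets \<nu> = sets borel" using assms(1) by (rule borel_probD)
 show ?thesis unfolding shift_avg_def by (rule nn_integral_cmult) measurable
qed

text \<open>The operators commute, so a pointwise one-step comparison can be applied inside all the remaining averages, one factor \<open>c\<close> at a time.\<close>
lemma shift_avg_telescope:
 assumes \<nu>: "borel_prob \<nu>" and \<mu>: "borel_prob \<mu>" and g: "g \<in> borel_measurable borel"
  and step: "\<And>s. shift_avg \<nu> g s \<le> c * shift_avg \<mu> g s"
 shows "(shift_avg \<nu> ^^ n) g s \<le> c ^ n * (shift_avg \<mu> ^^ n) g s"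
proof (induction n arbitrary: s)
 case (Suc n)
 have "(shift_avg \<nu> ^^ Suc n) g s = shift_avg \<nu> ((shift_avg \<nu> ^^ n) g) s" by simp
 also have "\<dots> \<le> shift_avg \<nu> (\<lambda>s. c ^ n * (shift_avg \<mu> ^^ n) g s) s"
  using Suc by (intro shift_avg_mono)
 also have "\<dots> = c ^ n * shift_avg \<nu> ((shift_avg \<mu> ^^ n) g) s"
  using \<nu> \<mu> g by (intro shift_avg_cmult shift_avg_pow_measurable)
 finally have 1: "(shift_avg \<nu> ^^ Suc n) g s \<le> c ^ n * shift_avg \<nu> ((shift_avg \<mu> ^^ n) g) s" .
 have "shift_avg \<nu> ((shift_avg \<mu> ^^ n) g) s = (shift_avg \<mu> ^^ n) (shift_avg \<nu> g) s"
  by (simp only: shift_avg_pow_commute[OF \<mu> \<nu> g])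
 also have "\<dots> \<le> (shift_avg \<mu> ^^ n) (\<lambda>s. c * shift_avg \<mu> g s) s"
 proof -
  have "(shift_avg \<mu> ^^ n) h s \<le> (shift_avg \<mu> ^^ n) k s" if "\<And>s. h s \<le> k s" for h k s
   using that
  proof (induction n arbitrary: s)
   case (Suc n)
   then show ?case by (simp add: shift_avg_mono)
  qed simp
  then show ?thesis using step .
 qed
 also have "(shift_avg \<mu> ^^ n) (\<lambda>s. c * shift_avg \<mu> g s) s = c * (shift_avg \<mu> ^^ n) (shift_avg \<mu> g) s"
 proof -
  have "(shift_avg \<mu> ^^ n) (\<lambda>s. c * h s) = (\<lambda>s. c * (shift_avg \<mu> ^^ n) h s)" if "h \<in> borel_measurable borel" for h
  proof (induction n)
   case (Suc n)
   have "shift_avg \<mu> (\<lambda>s. c * (shift_avg \<mu> ^^ n) h s) = (\<lambda>s. c * shift_avg \<mu> ((shift_avg \<mu> ^^ n) h) s)"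
    by (rule ext) (rule shift_avg_cmult[OF \<mu> shift_avg_pow_measurable[OF \<mu> that]])
   then show ?case by (simp only: funpow.simps o_apply Suc.IH)
  qed simp
  then show ?thesis using shift_avg_measurable[OF \<mu> g] by simp
 qed
 finally have 2: "shift_avg \<nu> ((shift_avg \<mu> ^^ n) g) s \<le> c * (shift_avg \<mu> ^^ n) (shift_avg \<mu> g) s" .
 have "c ^ n * (c * (shift_avg \<mu> ^^ n) (shift_avg \<mu> g) s) = c ^ Suc n * (shift_avg \<mu> ^^ Suc n) g s"
  by (simp only: funpow_Suc_right o_apply power_Suc mult_ac)
 then show ?case using order_trans[OF 1 mult_left_mono[OF 2, of "c ^ n"]] by simp
qed simp

lemma (in prob_space) nn_integral_indep_sum:
 fixes V :: "nat \<Rightarrow> 'a \<Rightarrow> 'v::euclidean_space"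
 assumes ind: "indep_vars (\<lambda>_. borel) V {1..n}"
  and law: "\<And>l. l \<in> {1..n} \<Longrightarrow> distr M borel (V l) = \<nu>"
  and \<nu>: "borel_prob \<nu>" and g: "g \<in> borel_measurable borel"
 shows "(\<integral>\<^sup>+y. g (s + (\<Sum>l\<in>{1..n}. V l y)) \<partial>M) = (shift_avg \<nu> ^^ n) g s"
 using ind law g
proof (induction n arbitrary: g)
 case 0
 then show ?case by (simp add: emeasure_space_1)
next
 case (Suc n)
 have ins: "{1..Suc n} = insert (Suc n) {1..n}" by auto
 have V[measurable]: "\<And>l. l \<in> {1..Suc n} \<Longrightarrow> random_variable borel (V l)"
  using Suc.prems(1) by (auto simp: indep_vars_def)
 have [measurable]: "g \<in> borel_measurable borel" by fact
 have "indep_var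
  borel ((\<lambda>f. \<Sum>i\<in>{1..n}. f i) \<circ> (\<lambda>y. restrict (\<lambda>i. V i y) {1..n}))
  borel ((\<lambda>f. f (Suc n)) \<circ> (\<lambda>y. restrict (\<lambda>i. V i y) {Suc n}))"
  by (intro indep_var_compose[OF indep_var_restrict[OF Suc.prems(1)]]) auto
 also have "((\<lambda>f. f (Suc n)) \<circ> (\<lambda>y. restrict (\<lambda>i. V i y) {Suc n})) = V (Suc n)"
  by auto
 also have "((\<lambda>f. \<Sum>i\<in>{1..n}. f i) \<circ> (\<lambda>y. restrict (\<lambda>i. V i y) {1..n})) = (\<lambda>y. \<Sum>i\<in>{1..n}. V i y)"
  by (auto cong: rev_conj_cong)
 finally have iv: "indep_var borel (\<lambda>y. \<Sum>i\<in>{1..n}. V i y) borel (V (Suc n))" .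
 let ?S = "\<lambda>y. \<Sum>i\<in>{1..n}. V i y"
 interpret N: prob_space \<nu> using \<nu> by (rule borel_probD)
 have [measurable_cong]: "sets \<nu> = sets borel" using \<nu> by (rule borel_probD)
 have S[measurable]: "random_variable borel ?S" using V by (intro borel_measurable_sum) auto
 have VS[measurable]: "random_variable borel (V (Suc n))" by (rule V) simp
 have "(\<integral>\<^sup>+y. g (s + (\<Sum>l\<in>{1..Suc n}. V l y)) \<partial>M) = (\<integral>\<^sup>+y. g (s + (?S y + V (Suc n) y)) \<partial>M)"
  by (simp add: add_ac)
 also have "\<dots> = (\<integral>\<^sup>+p. g (s + (fst p + snd p)) \<partial>distr M (borel \<Otimes>\<^sub>M borel) (\<lambda>y. (?S y, V (Suc n) y)))"
  by (subst nn_integral_distr) auto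
 also have "distr M (borel \<Otimes>\<^sub>M borel) (\<lambda>y. (?S y, V (Suc n) y)) = distr M borel ?S \<Otimes>\<^sub>M \<nu>"
  using iv Suc.prems(2)[of "Suc n"] unfolding indep_var_distribution_eq by simp
 also have "(\<integral>\<^sup>+p. g (s + (fst p + snd p)) \<partial>(distr M borel ?S \<Otimes>\<^sub>M \<nu>))
   = (\<integral>\<^sup>+x. \<integral>\<^sup>+v. g (s + (x + v)) \<partial>\<nu> \<partial>distr M borel ?S)"
  by (subst N.nn_integral_fst[symmetric]) auto
 also have "\<dots> = (\<integral>\<^sup>+y. shift_avg \<nu> g (s + ?S y) \<partial>M)"
  unfolding shift_avg_def by (subst nn_integral_distr) (auto simp: add_ac)
 also have "\<dots> = (shift_avg \<nu> ^^ n) (shift_avg \<nu> g) s"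
 proof (rule Suc.IH)
  show "indep_vars (\<lambda>_. borel) V {1..n}" using Suc.prems(1) by (rule indep_vars_subset) auto
  show "distr M borel (V l) = \<nu>" if "l \<in> {1..n}" for l using that by (intro Suc.prems(2)) auto
  show "shift_avg \<nu> g \<in> borel_measurable borel" by (rule shift_avg_measurable[OF \<nu>]) fact
 qed
 finally show ?case by (simp only: funpow_Suc_right o_apply)
qed

section \<open>One Lindeberg replacement step\<close>

definition taylor_const :: "nat \<Rightarrow> real"
 where "taylor_const k = (SOME C. C \<ge> 1 \<and> (\<forall>u z B q. 0 \<le> q \<longrightarrow>
  \<bar>logistic (u + q * trunc B z) - (\<Sum>j<k. dlogistic j u * (q * z) ^ j / fact j)\<bar>
   \<le> C * taylor_rem k B q z * logistic u))"

lemma taylor_const: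
 assumes "k > 0"
 shows "taylor_const k \<ge> 1"
  and "0 \<le> q \<Longrightarrow> \<bar>logistic (u + q * trunc B z) - (\<Sum>j<k. dlogistic j u * (q * z) ^ j / fact j)\<bar>
   \<le> taylor_const k * taylor_rem k B q z * logistic u"
proof -
 note * = someI_ex[OF logistic_taylor[OF assms], folded taylor_const_def]
 show "taylor_const k \<ge> 1" using * by (rule conjunct1)
 show "0 \<le> q \<Longrightarrow> \<bar>logistic (u + q * trunc B z) - (\<Sum>j<k. dlogistic j u * (q * z) ^ j / fact j)\<bar>
   \<le> taylor_const k * taylor_rem k B q z * logistic u"
  using *[THEN conjunct2] by metis
qed

definition taylor2_const :: real
 where "taylor2_const = (SOME C. C \<ge> 1 \<and> (\<forall>u1 u2 z1 z2 B q. 0 \<le> q \<longrightarrow>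
  \<bar>logistic (u1 + q * trunc B z1) * logistic (u2 + q * trunc B z2) - taylor2 u1 u2 (q * z1) (q * z2)\<bar>
   \<le> C * (taylor_rem 3 B q z1 + taylor_rem 3 B q z2) * (logistic u1 * logistic u2)))"

lemma taylor2_const:
 shows "taylor2_const \<ge> 1"
  and "0 \<le> q \<Longrightarrow> \<bar>logistic (u1 + q * trunc B z1) * logistic (u2 + q * trunc B z2) - taylor2 u1 u2 (q * z1) (q * z2)\<bar>
   \<le> taylor2_const * (taylor_rem 3 B q z1 + taylor_rem 3 B q z2) * (logistic u1 * logistic u2)"
proof -
 note * = someI_ex[OF logistic_taylor2, folded taylor2_const_def]
 show "taylor2_const \<ge> 1" using * by (rule conjunct1)
 show "0 \<le> q \<Longrightarrow> \<bar>logistic (u1 + q * trunc B z1) * logistic (u2 + q * trunc B z2) - taylor2 u1 u2 (q * z1) (q * z2)\<bar>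
   \<le> taylor2_const * (taylor_rem 3 B q z1 + taylor_rem 3 B q z2) * (logistic u1 * logistic u2)"
  using *[THEN conjunct2] by metis
qed

lemma trunc_measurable [measurable]:
 assumes [measurable]: "B \<in> sets borel"
 shows "trunc B \<in> borel_measurable borel"
 unfolding trunc_def by measurable

lemma taylor_rem_measurable [measurable]:
 assumes [measurable]: "B \<in> sets borel"
 shows "taylor_rem k B q \<in> borel_measurable borel"
 unfolding taylor_rem_def by measurable

lemma dlogistic_measurable [measurable]: "dlogistic j \<in> borel_measurable borel"
 by (rule borel_measurable_continuous_onI)
  (use DERIV_dlogistic DERIV_isCont in \<open>blast intro: continuous_at_imp_continuous_on\<close>)

lemma abs_trunc_le: "\<bar>trunc B z\<bar> \<le> \<bar>z\<bar>"
 by (simp add: trunc_def)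

lemma one_minus_le_logistic_shift: "(1 - \<bar>v\<bar>) * logistic u \<le> logistic (u + v)"
proof -
 have "(1 - \<bar>v\<bar>) * logistic u \<le> exp (- \<bar>v\<bar>) * logistic u"
  using exp_ge_add_one_self[of "- \<bar>v\<bar>"] logistic_pos[of u] by (intro mult_right_mono) auto
 also have "\<dots> \<le> logistic (u + v)" by (rule logistic_shift_lower)
 finally show ?thesis .
qed

context prob_space
begin

lemma integrable_logistic:
 assumes [measurable]: "W \<in> borel_measurable M"
 shows "integrable M (\<lambda>x. logistic (W x))"
 by (rule integrable_const_bound[of _ 1])
  (use logistic_pos logistic_less_1 in \<open>auto intro: less_imp_le simp: abs_of_pos\<close>)

lemma integrable_logistic_mult:
 assumes [measurable]: "V \<in> borel_measurable M" "W \<in> borel_measurable M"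
 shows "integrable M (\<lambda>x. logistic (V x) * logistic (W x))"
proof (rule integrable_const_bound[of _ 1])
 have "norm (logistic v * logistic w) \<le> 1" for v w
  using logistic_pos[of v] logistic_pos[of w] logistic_less_1[of v] logistic_less_1[of w]
  by (simp add: abs_mult mult_le_one less_imp_le)
 then show "AE x in M. norm (logistic (V x) * logistic (W x)) \<le> 1" by simp
qed simp

lemma expectation_logistic_taylor:
 assumes k: "k > 0" and q: "q \<ge> 0" and [measurable]: "Z \<in> borel_measurable M" "B \<in> sets borel"
  and int: "\<And>j. j < k \<Longrightarrow> integrable M (\<lambda>x. Z x ^ j)"
  and rem: "integrable M (\<lambda>x. taylor_rem k B q (Z x))"
 shows "\<bar>expectation (\<lambda>x. logistic (u + q * trunc B (Z x)))
   - (\<Sum>j<k. dlogistic j u * q ^ j * expectation (\<lambda>x. Z x ^ j) / fact j)\<bar>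
  \<le> taylor_const k * expectation (\<lambda>x. taylor_rem k B q (Z x)) * logistic u"
proof -
 have i1: "integrable M (\<lambda>x. logistic (u + q * trunc B (Z x)))"
  by (rule integrable_logistic) measurable
 have i2: "integrable M (\<lambda>x. dlogistic j u * (q * Z x) ^ j / fact j)" if "j < k" for j
  using int[OF that] by (simp add: power_mult_distrib)
 have i3: "integrable M (\<lambda>x. \<Sum>j<k. dlogistic j u * (q * Z x) ^ j / fact j)"
  using i2 by (intro Bochner_Integration.integrable_sum) auto
 have "(\<Sum>j<k. dlogistic j u * q ^ j * expectation (\<lambda>x. Z x ^ j) / fact j)
   = (\<Sum>j<k. expectation (\<lambda>x. dlogistic j u * (q * Z x) ^ j / fact j))"
  by (intro sum.cong) (auto simp: power_mult_distrib mult.assoc)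
 also have "\<dots> = expectation (\<lambda>x. \<Sum>j<k. dlogistic j u * (q * Z x) ^ j / fact j)"
  using i2 by (intro Bochner_Integration.integral_sum[symmetric]) auto
 finally have eq: "expectation (\<lambda>x. logistic (u + q * trunc B (Z x)))
   - (\<Sum>j<k. dlogistic j u * q ^ j * expectation (\<lambda>x. Z x ^ j) / fact j)
   = expectation (\<lambda>x. logistic (u + q * trunc B (Z x)) - (\<Sum>j<k. dlogistic j u * (q * Z x) ^ j / fact j))"
  using i1 i3 by simp
 have "\<bar>expectation (\<lambda>x. logistic (u + q * trunc B (Z x)) - (\<Sum>j<k. dlogistic j u * (q * Z x) ^ j / fact j))\<bar>
   \<le> expectation (\<lambda>x. \<bar>logistic (u + q * trunc B (Z x)) - (\<Sum>j<k. dlogistic j u * (q * Z x) ^ j / fact j)\<bar>)"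
  by (rule integral_abs_bound)
 also have "\<dots> \<le> expectation (\<lambda>x. taylor_const k * taylor_rem k B q (Z x) * logistic u)"
  using i1 i3 rem taylor_const(2)[OF k q] by (intro integral_mono) auto
 also have "\<dots> = taylor_const k * expectation (\<lambda>x. taylor_rem k B q (Z x)) * logistic u"
  by simp
 finally show ?thesis unfolding eq .
qed

lemma expectation_logistic_lower:
 assumes q: "q \<ge> 0" and [measurable]: "Z \<in> borel_measurable M" "B \<in> sets borel"
  and int: "integrable M (\<lambda>x. \<bar>Z x\<bar>)" and small: "q * expectation (\<lambda>x. \<bar>Z x\<bar>) \<le> 1 / 2"
 shows "logistic u / 2 \<le> expectation (\<lambda>x. logistic (u + q * trunc B (Z x)))"
proof -
 have "logistic u / 2 \<le> (1 - q * expectation (\<lambda>x. \<bar>Z x\<bar>)) * logistic u"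
  using small logistic_pos[of u] by (simp add: field_simps)
 also have "\<dots> = expectation (\<lambda>x. (1 - q * \<bar>Z x\<bar>) * logistic u)"
  using int by (simp add: prob_space)
 also have "\<dots> \<le> expectation (\<lambda>x. logistic (u + q * trunc B (Z x)))"
 proof (rule integral_mono)
  show "integrable M (\<lambda>x. (1 - q * \<bar>Z x\<bar>) * logistic u)" using int by simp
  show "integrable M (\<lambda>x. logistic (u + q * trunc B (Z x)))" by (rule integrable_logistic) measurable
  fix x
  have "(1 - q * \<bar>Z x\<bar>) * logistic u \<le> (1 - \<bar>q * trunc B (Z x)\<bar>) * logistic u"
   using q abs_trunc_le[of B "Z x"] logistic_pos[of u]
   by (intro mult_right_mono) (auto simp: abs_mult mult_left_mono)
  also have "\<dots> \<le> logistic (u + q * trunc B (Z x))" by (rule one_minus_le_logistic_shift)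
  finally show "(1 - q * \<bar>Z x\<bar>) * logistic u \<le> logistic (u + q * trunc B (Z x))" .
 qed
 finally show ?thesis .
qed

lemma expectation_logistic_taylor2:
 assumes q: "q \<ge> 0" and [measurable]: "Z1 \<in> borel_measurable M" "Z2 \<in> borel_measurable M" "B \<in> sets borel"
  and int: "integrable M Z1" "integrable M Z2" "integrable M (\<lambda>x. (Z1 x)\<^sup>2)" "integrable M (\<lambda>x. (Z2 x)\<^sup>2)"
   "integrable M (\<lambda>x. Z1 x * Z2 x)"
  and mom: "expectation Z1 = 0" "expectation Z2 = 0" "expectation (\<lambda>x. (Z1 x)\<^sup>2) = 1"
   "expectation (\<lambda>x. (Z2 x)\<^sup>2) = 1" "expectation (\<lambda>x. Z1 x * Z2 x) = \<rho>"
  and rem: "integrable M (\<lambda>x. taylor_rem 3 B q (Z1 x))" "integrable M (\<lambda>x. taylor_rem 3 B q (Z2 x))"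
 shows "\<bar>expectation (\<lambda>x. logistic (u1 + q * trunc B (Z1 x)) * logistic (u2 + q * trunc B (Z2 x)))
   - (dlogistic 0 u1 * dlogistic 0 u2 + (dlogistic 2 u1 * dlogistic 0 u2 * q\<^sup>2
     + 2 * dlogistic 1 u1 * dlogistic 1 u2 * (q\<^sup>2 * \<rho>) + dlogistic 0 u1 * dlogistic 2 u2 * q\<^sup>2) / 2)\<bar>
  \<le> taylor2_const * (expectation (\<lambda>x. taylor_rem 3 B q (Z1 x)) + expectation (\<lambda>x. taylor_rem 3 B q (Z2 x)))
    * (logistic u1 * logistic u2)" (is "\<bar>?E - ?P\<bar> \<le> _")
proof -
 let ?L = "\<lambda>x. logistic (u1 + q * trunc B (Z1 x)) * logistic (u2 + q * trunc B (Z2 x))"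
 let ?T = "\<lambda>x. taylor2 u1 u2 (q * Z1 x) (q * Z2 x)"
 have i1: "integrable M ?L" by (rule integrable_logistic_mult) measurable
 have Teq: "?T x = dlogistic 0 u1 * dlogistic 0 u2
   + (dlogistic 1 u1 * dlogistic 0 u2 * q * Z1 x + dlogistic 0 u1 * dlogistic 1 u2 * q * Z2 x)
   + (dlogistic 2 u1 * dlogistic 0 u2 * q\<^sup>2 * (Z1 x)\<^sup>2
     + 2 * dlogistic 1 u1 * dlogistic 1 u2 * q\<^sup>2 * (Z1 x * Z2 x)
     + dlogistic 0 u1 * dlogistic 2 u2 * q\<^sup>2 * (Z2 x)\<^sup>2) / 2" for x
  by (simp add: taylor2_def power_mult_distrib power2_eq_square mult_ac)
 have i3: "integrable M ?T" unfolding Teq using int by (intro Bochner_Integration.integrable_add integrable_divide_zero integrable_mult_right) auto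
 have "expectation ?T = ?P"
 proof -
  have "expectation (\<lambda>x. a + (b * Z1 x + c * Z2 x) + (d * (Z1 x)\<^sup>2 + e * (Z1 x * Z2 x) + f * (Z2 x)\<^sup>2) / 2)
    = a + (d + e * \<rho> + f) / 2" for a b c d e f
   using int mom by (simp add: prob_space)
  from this[of "dlogistic 0 u1 * dlogistic 0 u2" "dlogistic 1 u1 * dlogistic 0 u2 * q"
    "dlogistic 0 u1 * dlogistic 1 u2 * q" "dlogistic 2 u1 * dlogistic 0 u2 * q\<^sup>2"
    "2 * dlogistic 1 u1 * dlogistic 1 u2 * q\<^sup>2" "dlogistic 0 u1 * dlogistic 2 u2 * q\<^sup>2"]
  show ?thesis unfolding Teq by (simp only: mult.assoc)
 qed
 then have eq: "?E - ?P = expectation (\<lambda>x. ?L x - ?T x)" using i1 i3 by simp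
 have "\<bar>expectation (\<lambda>x. ?L x - ?T x)\<bar> \<le> expectation (\<lambda>x. \<bar>?L x - ?T x\<bar>)"
  by (rule integral_abs_bound)
 also have "\<dots> \<le> expectation (\<lambda>x. taylor2_const * (taylor_rem 3 B q (Z1 x) + taylor_rem 3 B q (Z2 x)) * (logistic u1 * logistic u2))"
  using i1 i3 rem taylor2_const(2)[OF q] by (intro integral_mono) auto
 also have "\<dots> = taylor2_const * (expectation (\<lambda>x. taylor_rem 3 B q (Z1 x)) + expectation (\<lambda>x. taylor_rem 3 B q (Z2 x)))
    * (logistic u1 * logistic u2)"
  using rem by simp
 finally show ?thesis unfolding eq .
qed

lemma expectation_logistic_lower2:
 assumes q: "q \<ge> 0" and [measurable]: "Z1 \<in> borel_measurable M" "Z2 \<in> borel_measurable M" "B \<in> sets borel"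
  and int: "integrable M (\<lambda>x. \<bar>Z1 x\<bar>)" "integrable M (\<lambda>x. \<bar>Z2 x\<bar>)"
  and small: "q * (expectation (\<lambda>x. \<bar>Z1 x\<bar>) + expectation (\<lambda>x. \<bar>Z2 x\<bar>)) \<le> 1 / 2"
 shows "logistic u1 * logistic u2 / 2
  \<le> expectation (\<lambda>x. logistic (u1 + q * trunc B (Z1 x)) * logistic (u2 + q * trunc B (Z2 x)))"
proof -
 let ?K = "logistic u1 * logistic u2"
 have K: "?K > 0" using logistic_pos by simp
 have "1 / 2 * ?K \<le> (1 - q * (expectation (\<lambda>x. \<bar>Z1 x\<bar>) + expectation (\<lambda>x. \<bar>Z2 x\<bar>))) * ?K"
  using small K by (intro mult_right_mono) auto
 also have "\<dots> = expectation (\<lambda>x. (1 - q * (\<bar>Z1 x\<bar> + \<bar>Z2 x\<bar>)) * ?K)"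
  using int by (simp add: prob_space)
 also have "\<dots> \<le> expectation (\<lambda>x. logistic (u1 + q * trunc B (Z1 x)) * logistic (u2 + q * trunc B (Z2 x)))"
 proof (rule integral_mono)
  show "integrable M (\<lambda>x. (1 - q * (\<bar>Z1 x\<bar> + \<bar>Z2 x\<bar>)) * ?K)" using int by simp
  show "integrable M (\<lambda>x. logistic (u1 + q * trunc B (Z1 x)) * logistic (u2 + q * trunc B (Z2 x)))"
   by (rule integrable_logistic_mult) measurable
  fix x
  let ?a = "\<bar>q * trunc B (Z1 x)\<bar>" and ?b = "\<bar>q * trunc B (Z2 x)\<bar>"
  have "?a \<le> q * \<bar>Z1 x\<bar>" "?b \<le> q * \<bar>Z2 x\<bar>"
   using q abs_trunc_le by (auto simp: abs_mult mult_left_mono)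
  then have "1 - q * (\<bar>Z1 x\<bar> + \<bar>Z2 x\<bar>) \<le> 1 + (- ?a - ?b)" by (simp add: distrib_left)
  also have "\<dots> \<le> exp (- ?a - ?b)" by (rule exp_ge_add_one_self)
  finally have "(1 - q * (\<bar>Z1 x\<bar> + \<bar>Z2 x\<bar>)) * ?K \<le> exp (- ?a - ?b) * ?K"
   using K by (intro mult_right_mono) auto
  also have "\<dots> = (exp (- ?a) * logistic u1) * (exp (- ?b) * logistic u2)"
   by (simp add: exp_diff exp_minus field_simps)
  also have "\<dots> \<le> logistic (u1 + q * trunc B (Z1 x)) * logistic (u2 + q * trunc B (Z2 x))"
   using logistic_shift_lower logistic_pos by (intro mult_mono) (auto intro: less_imp_le)
  finally show "(1 - q * (\<bar>Z1 x\<bar> + \<bar>Z2 x\<bar>)) * ?K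
   \<le> logistic (u1 + q * trunc B (Z1 x)) * logistic (u2 + q * trunc B (Z2 x))" .
 qed
 finally show ?thesis by simp
qed

lemma shift_avg_logistic:
 assumes [measurable]: "W \<in> borel_measurable M"
 shows "shift_avg (distr M borel W) elogistic s = ennreal (expectation (\<lambda>x. logistic (s + W x)))"
proof -
 have "shift_avg (distr M borel W) elogistic s = (\<integral>\<^sup>+x. ennreal (logistic (s + W x)) \<partial>M)"
  unfolding shift_avg_def by (subst nn_integral_distr) auto
 also have "\<dots> = ennreal (expectation (\<lambda>x. logistic (s + W x)))"
  by (intro nn_integral_eq_integral integrable_logistic) (auto intro: less_imp_le logistic_pos)
 finally show ?thesis .
qed

lemma shift_avg_logistic2:
 assumes [measurable]: "V \<in> borel_measurable M" "W \<in> borel_measurable M"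
 shows "shift_avg (distr M borel (\<lambda>x. (V x, W x))) (\<lambda>u. ennreal (logistic (fst u) * logistic (snd u))) s
  = ennreal (expectation (\<lambda>x. logistic (fst s + V x) * logistic (snd s + W x)))"
proof -
 have [measurable]: "(\<lambda>x. (V x, W x)) \<in> borel_measurable M"
  using assms by (rule borel_measurable_Pair)
 have "shift_avg (distr M borel (\<lambda>x. (V x, W x))) (\<lambda>u. ennreal (logistic (fst u) * logistic (snd u))) s
   = (\<integral>\<^sup>+x. ennreal (logistic (fst s + V x) * logistic (snd s + W x)) \<partial>M)"
  unfolding shift_avg_def
  by (subst nn_integral_distr) (auto intro!: measurable_compose[OF _ logistic_measurable] borel_measurable_times
    simp: borel_prod[symmetric])
 also have "\<dots> = ennreal (expectation (\<lambda>x. logistic (fst s + V x) * logistic (snd s + W x)))"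
  by (intro nn_integral_eq_integral integrable_logistic_mult)
   (auto intro!: mult_nonneg_nonneg intro: less_imp_le logistic_pos)
 finally show ?thesis .
qed

end

text \<open>Two quantities with the same approximation are comparable multiplicatively once the second is bounded below by a multiple of the scale \<open>L\<close> of the errors.\<close>
lemma compare_one_step:
 fixes a b P L C r1 r2 :: real
 assumes a: "\<bar>a - P\<bar> \<le> C * r1 * L" and b: "\<bar>b - P\<bar> \<le> C * r2 * L" and l: "L / 2 \<le> b"
  and "C \<ge> 0" "r1 \<ge> 0" "r2 \<ge> 0" "L \<ge> 0"
 shows "a \<le> (1 + 2 * C * (r1 + r2)) * b"
proof -
 have "a \<le> b + C * (r1 + r2) * L" using a b by (simp add: algebra_simps abs_le_iff)
 also have "C * (r1 + r2) * L \<le> C * (r1 + r2) * (2 * b)"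
  using assms by (intro mult_left_mono) auto
 finally show ?thesis by (simp add: algebra_simps)
qed

text \<open>The common moments make the two Taylor polynomials equal. The smallness of the scale keeps the average over \<open>Y\<close> above half the value of the logistic function, which turns the additive error into a factor.\<close>
lemma lindeberg_step:
 fixes M :: "'a measure" and N :: "'b measure"
 assumes M: "prob_space M" and N: "prob_space N"
  and k: "k > 0" and q: "q \<ge> 0"
  and Z: "Z \<in> borel_measurable M" "B \<in> sets borel" and Y: "Y \<in> borel_measurable N" "B' \<in> sets borel"
  and int: "\<And>j. j < k \<Longrightarrow> integrable M (\<lambda>x. Z x ^ j)" "\<And>j. j < k \<Longrightarrow> integrable N (\<lambda>x. Y x ^ j)"
  and mom: "\<And>j. j < k \<Longrightarrow> (LINT x|M. Z x ^ j) = (LINT x|N. Y x ^ j)"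
  and rem: "integrable M (\<lambda>x. taylor_rem k B q (Z x))" "integrable N (\<lambda>x. taylor_rem k B' q (Y x))"
  and Yint: "integrable N (\<lambda>x. \<bar>Y x\<bar>)" and small: "q * (LINT x|N. \<bar>Y x\<bar>) \<le> 1 / 2"
 shows "shift_avg (distr M borel (\<lambda>x. q * trunc B (Z x))) elogistic s
  \<le> ennreal (1 + 2 * taylor_const k * ((LINT x|M. taylor_rem k B q (Z x)) + (LINT x|N. taylor_rem k B' q (Y x))))
   * shift_avg (distr N borel (\<lambda>x. q * trunc B' (Y x))) elogistic s"
proof -
 interpret M: prob_space M by fact
 interpret N: prob_space N by fact
 note [measurable] = Z Y
 have r: "(LINT x|M. taylor_rem k B q (Z x)) \<ge> 0" "(LINT x|N. taylor_rem k B' q (Y x)) \<ge> 0"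
  using taylor_rem_nonneg[OF q] by (auto intro: integral_nonneg_AE)
 let ?c = "1 + 2 * taylor_const k * ((LINT x|M. taylor_rem k B q (Z x)) + (LINT x|N. taylor_rem k B' q (Y x)))"
 have c: "?c \<ge> 0" using r taylor_const(1)[OF k] by (intro add_nonneg_nonneg mult_nonneg_nonneg) auto
 have "(LINT x|M. logistic (s + q * trunc B (Z x))) \<le> ?c * (LINT x|N. logistic (s + q * trunc B' (Y x)))"
 proof (rule compare_one_step)
  show "\<bar>(LINT x|M. logistic (s + q * trunc B (Z x)))
   - (\<Sum>j<k. dlogistic j s * q ^ j * (LINT x|M. Z x ^ j) / fact j)\<bar>
   \<le> taylor_const k * (LINT x|M. taylor_rem k B q (Z x)) * logistic s"
   by (rule M.expectation_logistic_taylor[OF k q Z int(1) rem(1)])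
  have "\<bar>(LINT x|N. logistic (s + q * trunc B' (Y x)))
   - (\<Sum>j<k. dlogistic j s * q ^ j * (LINT x|N. Y x ^ j) / fact j)\<bar>
   \<le> taylor_const k * (LINT x|N. taylor_rem k B' q (Y x)) * logistic s"
   by (rule N.expectation_logistic_taylor[OF k q Y int(2) rem(2)])
  moreover have "(\<Sum>j<k. dlogistic j s * q ^ j * (LINT x|N. Y x ^ j) / fact j)
    = (\<Sum>j<k. dlogistic j s * q ^ j * (LINT x|M. Z x ^ j) / fact j)"
   using mom by (intro sum.cong) auto
  ultimately show "\<bar>(LINT x|N. logistic (s + q * trunc B' (Y x)))
   - (\<Sum>j<k. dlogistic j s * q ^ j * (LINT x|M. Z x ^ j) / fact j)\<bar>
   \<le> taylor_const k * (LINT x|N. taylor_rem k B' q (Y x)) * logistic s" by simp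
  show "logistic s / 2 \<le> (LINT x|N. logistic (s + q * trunc B' (Y x)))"
   by (rule N.expectation_logistic_lower[OF q Y Yint small])
 qed (use r taylor_const(1)[OF k] logistic_pos[of s] in auto)
 then show ?thesis
  using c by (simp add: M.shift_avg_logistic N.shift_avg_logistic ennreal_mult'[symmetric] ennreal_leI)
qed

lemma lindeberg_step2:
 fixes M :: "'a measure" and N :: "'b measure"
 assumes M: "prob_space M" and N: "prob_space N" and q: "q \<ge> 0"
  and Z: "Z1 \<in> borel_measurable M" "Z2 \<in> borel_measurable M" "B \<in> sets borel"
  and Y: "Y1 \<in> borel_measurable N" "Y2 \<in> borel_measurable N" "B' \<in> sets borel"
  and Zint: "integrable M Z1" "integrable M Z2" "integrable M (\<lambda>x. (Z1 x)\<^sup>2)" "integrable M (\<lambda>x. (Z2 x)\<^sup>2)"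
   "integrable M (\<lambda>x. Z1 x * Z2 x)"
  and Zmom: "(LINT x|M. Z1 x) = 0" "(LINT x|M. Z2 x) = 0" "(LINT x|M. (Z1 x)\<^sup>2) = 1"
   "(LINT x|M. (Z2 x)\<^sup>2) = 1" "(LINT x|M. Z1 x * Z2 x) = \<rho>"
  and Yint: "integrable N Y1" "integrable N Y2" "integrable N (\<lambda>x. (Y1 x)\<^sup>2)" "integrable N (\<lambda>x. (Y2 x)\<^sup>2)"
   "integrable N (\<lambda>x. Y1 x * Y2 x)"
  and Ymom: "(LINT x|N. Y1 x) = 0" "(LINT x|N. Y2 x) = 0" "(LINT x|N. (Y1 x)\<^sup>2) = 1"
   "(LINT x|N. (Y2 x)\<^sup>2) = 1" "(LINT x|N. Y1 x * Y2 x) = \<rho>"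
  and remZ: "integrable M (\<lambda>x. taylor_rem 3 B q (Z1 x))" "integrable M (\<lambda>x. taylor_rem 3 B q (Z2 x))"
  and remY: "integrable N (\<lambda>x. taylor_rem 3 B' q (Y1 x))" "integrable N (\<lambda>x. taylor_rem 3 B' q (Y2 x))"
  and small: "q * ((LINT x|N. \<bar>Y1 x\<bar>) + (LINT x|N. \<bar>Y2 x\<bar>)) \<le> 1 / 2"
 shows "shift_avg (distr M borel (\<lambda>x. (q * trunc B (Z1 x), q * trunc B (Z2 x))))
    (\<lambda>u. ennreal (logistic (fst u) * logistic (snd u))) s
  \<le> ennreal (1 + 2 * taylor2_const *
    (((LINT x|M. taylor_rem 3 B q (Z1 x)) + (LINT x|M. taylor_rem 3 B q (Z2 x)))
    + ((LINT x|N. taylor_rem 3 B' q (Y1 x)) + (LINT x|N. taylor_rem 3 B' q (Y2 x)))))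
   * shift_avg (distr N borel (\<lambda>x. (q * trunc B' (Y1 x), q * trunc B' (Y2 x))))
    (\<lambda>u. ennreal (logistic (fst u) * logistic (snd u))) s"
proof -
 interpret M: prob_space M by fact
 interpret N: prob_space N by fact
 note [measurable] = Z Y
 let ?rM = "(LINT x|M. taylor_rem 3 B q (Z1 x)) + (LINT x|M. taylor_rem 3 B q (Z2 x))"
 let ?rN = "(LINT x|N. taylor_rem 3 B' q (Y1 x)) + (LINT x|N. taylor_rem 3 B' q (Y2 x))"
 have r: "?rM \<ge> 0" "?rN \<ge> 0"
  using taylor_rem_nonneg[OF q] by (auto intro!: integral_nonneg_AE add_nonneg_nonneg)
 let ?c = "1 + 2 * taylor2_const * (?rM + ?rN)"
 have "0 \<le> 2 * taylor2_const * (?rM + ?rN)"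
  using taylor2_const(1) by (intro mult_nonneg_nonneg add_nonneg_nonneg[OF r]) linarith+
 then have c: "?c \<ge> 0" by linarith
 obtain u1 u2 where s: "s = (u1, u2)" by (cases s)
 have "(LINT x|M. logistic (u1 + q * trunc B (Z1 x)) * logistic (u2 + q * trunc B (Z2 x)))
   \<le> ?c * (LINT x|N. logistic (u1 + q * trunc B' (Y1 x)) * logistic (u2 + q * trunc B' (Y2 x)))"
  by (rule compare_one_step[OF M.expectation_logistic_taylor2[OF q Z Zint Zmom remZ]
     N.expectation_logistic_taylor2[OF q Y Yint Ymom remY]
     N.expectation_logistic_lower2[OF q Y integrable_abs[OF Yint(1)] integrable_abs[OF Yint(2)] small]])
   (use r taylor2_const(1) logistic_pos[of u1] logistic_pos[of u2] in simp_all)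
 then show ?thesis
  using c by (simp add: s M.shift_avg_logistic2 N.shift_avg_logistic2 ennreal_mult'[symmetric] ennreal_leI)
qed

section \<open>Convolution powers of the normal and gamma laws\<close>

definition normal_shift :: "'v::euclidean_space \<Rightarrow> 'v measure"
 where "normal_shift e = distr (density lborel std_normal_density) borel (\<lambda>y. y *\<^sub>R e)"

lemma prob_space_normal: "\<sigma> > 0 \<Longrightarrow> prob_space (density lborel (normal_density 0 \<sigma>))"
 by (rule prob_space_normal_density)

lemma borel_prob_normal_shift: "borel_prob (normal_shift e)"
 unfolding normal_shift_def by (intro borel_prob_distr prob_space_normal_density) auto

lemma distr_normal_scale:
 assumes "a > 0"
 shows "distr (density lborel std_normal_density) borel (\<lambda>y. a * y) = density lborel (normal_density 0 a)"
proof -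
 interpret prob_space "density lborel std_normal_density" by (rule prob_space_normal_density) simp
 have "distributed (density lborel std_normal_density) lborel (\<lambda>x. x) std_normal_density"
  by (auto simp: distributed_def intro!: measure_eqI simp: emeasure_distr)
 from normal_density_affine[OF this, of a 0]
 have "distributed (density lborel std_normal_density) lborel (\<lambda>x. a * x) (normal_density 0 a)"
  using assms by simp
 then have "distr (density lborel std_normal_density) lborel (\<lambda>y. a * y) = density lborel (normal_density 0 a)"
  by (rule distributed_distr_eq_density)
 then show ?thesis by (simp cong: distr_cong)
qed

lemma normal_shift_scale:
 assumes "a > 0"
 shows "normal_shift (a *\<^sub>R e) = distr (density lborel (normal_density 0 a)) borel (\<lambda>y. y *\<^sub>R e)"
proof -
 have "distr (density lborel (normal_density 0 a)) borel (\<lambda>y. y *\<^sub>R e)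
   = distr (density lborel std_normal_density) borel ((\<lambda>y. y *\<^sub>R e) \<circ> (\<lambda>y. a * y))"
  unfolding distr_normal_scale[OF assms, symmetric] by (subst distr_distr) auto
 also have "(\<lambda>y. y *\<^sub>R e) \<circ> (\<lambda>y. a * y) = (\<lambda>y. y *\<^sub>R a *\<^sub>R e)"
  by (simp add: fun_eq_iff mult.commute)
 finally show ?thesis by (simp add: normal_shift_def)
qed

lemma normal_convolution:
 assumes "a > 0" "b > 0"
 shows "density lborel (normal_density 0 a) \<star> density lborel (normal_density 0 b)
  = density lborel (normal_density 0 (sqrt (a\<^sup>2 + b\<^sup>2)))"
 using assms
 by (subst convolution_density)
  (auto simp: conv_normal_density_zero_mean[symmetric] ennreal_mult
   intro!: prob_space.finite_measure prob_space_normal_density)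

lemma shift_avg_distr_convolution:
 fixes h :: "real \<Rightarrow> 'v::euclidean_space"
 assumes \<mu>: "prob_space \<mu>" "sets \<mu> = sets borel" and \<nu>: "prob_space \<nu>" "sets \<nu> = sets borel"
  and h: "h1 \<in> borel_measurable borel" "h2 \<in> borel_measurable borel" "h \<in> borel_measurable borel"
  and add: "\<And>x y. h1 x + h2 y = h (x + y)" and g: "g \<in> borel_measurable borel"
 shows "shift_avg (distr \<mu> borel h1) (shift_avg (distr \<nu> borel h2) g) = shift_avg (distr (\<mu> \<star> \<nu>) borel h) g"
proof
 fix s
 note [measurable] = h g
 interpret m: prob_space \<mu> by fact
 interpret n: prob_space \<nu> by fact
 have [measurable_cong]: "sets \<mu> = sets borel" "sets \<nu> = sets borel" by fact+
 have "shift_avg (distr \<mu> borel h1) (shift_avg (distr \<nu> borel h2) g) s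
   = (\<integral>\<^sup>+x. \<integral>\<^sup>+y. g (s + h1 x + h2 y) \<partial>\<nu> \<partial>\<mu>)"
 proof -
  have inner: "(\<integral>\<^sup>+v. g (w + v) \<partial>distr \<nu> borel h2) = (\<integral>\<^sup>+y. g (w + h2 y) \<partial>\<nu>)" for w
   by (rule nn_integral_distr) measurable
  show ?thesis unfolding shift_avg_def inner by (rule nn_integral_distr) measurable
 qed
 also have "\<dots> = (\<integral>\<^sup>+x. \<integral>\<^sup>+y. g (s + h (x + y)) \<partial>\<nu> \<partial>\<mu>)" by (simp add: add add.assoc)
 also have "\<dots> = (\<integral>\<^sup>+z. g (s + h z) \<partial>(\<mu> \<star> \<nu>))"
  using \<mu> \<nu> by (subst nn_integral_convolution) (auto intro: m.finite_measure n.finite_measure)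
 also have "\<dots> = shift_avg (distr (\<mu> \<star> \<nu>) borel h) g s"
  unfolding shift_avg_def by (subst nn_integral_distr) auto
 finally show "shift_avg (distr \<mu> borel h1) (shift_avg (distr \<nu> borel h2) g) s
   = shift_avg (distr (\<mu> \<star> \<nu>) borel h) g s" .
qed

lemma shift_avg_normal_pow:
 assumes a: "a > 0" and n: "n > 0" and g: "g \<in> borel_measurable borel"
 shows "(shift_avg (normal_shift (a *\<^sub>R e)) ^^ n) g = shift_avg (normal_shift ((a * sqrt n) *\<^sub>R e)) g"
 using n
proof (induction n)
 case (Suc n)
 show ?case
 proof (cases "n = 0")
  case False
  then have IH: "(shift_avg (normal_shift (a *\<^sub>R e)) ^^ n) g = shift_avg (normal_shift ((a * sqrt n) *\<^sub>R e)) g"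
   using Suc.IH by simp
  have pos: "a * sqrt n > 0" "a * sqrt (Suc n) > 0" using a False by auto
  have "shift_avg (normal_shift (a *\<^sub>R e)) (shift_avg (normal_shift ((a * sqrt n) *\<^sub>R e)) g)
   = shift_avg (distr (density lborel (normal_density 0 a) \<star> density lborel (normal_density 0 (a * sqrt n))) borel (\<lambda>y. y *\<^sub>R e)) g"
   unfolding normal_shift_scale[OF a] normal_shift_scale[OF pos(1)]
   using a pos g by (intro shift_avg_distr_convolution prob_space_normal) (auto simp: scaleR_add_left)
  also have "sqrt (a\<^sup>2 + (a * sqrt n)\<^sup>2) = a * sqrt (Suc n)"
  proof -
   have "a\<^sup>2 + (a * sqrt n)\<^sup>2 = a\<^sup>2 * Suc n" by (simp add: power_mult_distrib algebra_simps)
   then show ?thesis using a by (simp add: real_sqrt_mult)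
  qed
  then have "density lborel (normal_density 0 a) \<star> density lborel (normal_density 0 (a * sqrt n))
    = density lborel (normal_density 0 (a * sqrt (Suc n)))"
   using normal_convolution[OF a pos(1)] by simp
  finally show ?thesis unfolding normal_shift_scale[OF pos(2)] funpow.simps o_apply IH .
 qed simp
qed simp

definition gamma_density :: "real \<Rightarrow> real \<Rightarrow> real"
 where "gamma_density a y = (if y > 0 then y powr (a - 1) * exp (- y) / Gamma a else 0)"

lemma gamma_density_measurable [measurable]: "gamma_density a \<in> borel_measurable borel"
 unfolding gamma_density_def by measurable

lemma gamma_density_nonneg: "a > 0 \<Longrightarrow> gamma_density a y \<ge> 0"
 by (simp add: gamma_density_def Gamma_real_pos less_imp_le)

lemma nn_integral_gamma_moment:
 assumes "a > 0" "b > 0"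
 shows "(\<integral>\<^sup>+y. ennreal (indicator {0<..} y * y powr (a - 1) * exp (- b * y)) \<partial>lborel) = ennreal (Gamma a / b powr a)"
proof -
 have "ennreal (Gamma a) = (\<integral>\<^sup>+t. ennreal (indicator {0..} t * t powr (a - 1) / exp t) \<partial>lborel)"
  by (rule Gamma_conv_nn_integral_real[OF assms(1)])
 also have "\<dots> = ennreal \<bar>b\<bar> * (\<integral>\<^sup>+t. ennreal (indicator {0..} (0 + b * t) * (0 + b * t) powr (a - 1) / exp (0 + b * t)) \<partial>lborel)"
  using assms by (intro nn_integral_real_affine) auto
 also have "\<dots> = ennreal b * (\<integral>\<^sup>+t. ennreal (b powr (a - 1)) * ennreal (indicator {0<..} t * t powr (a - 1) * exp (- b * t)) \<partial>lborel)"
  using assms by (intro arg_cong2[of _ _ _ _ "(*)"] nn_integral_cong_AE eventually_mono[OF AE_lborel_singleton[of 0]])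
   (auto simp: indicator_def ennreal_mult'[symmetric] powr_mult exp_minus field_simps zero_le_mult_iff)
 also have "\<dots> = ennreal (b powr a) * (\<integral>\<^sup>+t. ennreal (indicator {0<..} t * t powr (a - 1) * exp (- b * t)) \<partial>lborel)"
  using assms by (subst nn_integral_cmult) (auto simp: mult.assoc[symmetric] ennreal_mult'[symmetric] powr_diff)
 finally have e: "ennreal (Gamma a) = ennreal (b powr a) * (\<integral>\<^sup>+t. ennreal (indicator {0<..} t * t powr (a - 1) * exp (- b * t)) \<partial>lborel)" .
 have "ennreal (Gamma a / b powr a) = ennreal (1 / b powr a) * ennreal (Gamma a)"
  using assms by (simp add: ennreal_mult'[symmetric])
 also have "\<dots> = (ennreal (1 / b powr a) * ennreal (b powr a)) * (\<integral>\<^sup>+t. ennreal (indicator {0<..} t * t powr (a - 1) * exp (- b * t)) \<partial>lborel)"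
  unfolding e by (simp add: mult.assoc)
 also have "ennreal (1 / b powr a) * ennreal (b powr a) = 1"
  using assms by (simp add: ennreal_mult'[symmetric])
 finally show ?thesis by simp
qed

lemma prob_space_gamma:
 assumes "a > 0"
 shows "prob_space (density lborel (gamma_density a))"
proof
 have G: "Gamma a > 0" using assms by (rule Gamma_real_pos)
 have "(\<integral>\<^sup>+y. ennreal (gamma_density a y) \<partial>lborel)
   = (\<integral>\<^sup>+y. ennreal (1 / Gamma a) * ennreal (indicator {0<..} y * y powr (a - 1) * exp (- 1 * y)) \<partial>lborel)"
  using G by (intro nn_integral_cong) (auto simp: gamma_density_def indicator_def ennreal_mult'[symmetric])
 also have "\<dots> = ennreal (1 / Gamma a) * ennreal (Gamma a / 1 powr a)"
  by (subst nn_integral_cmult) (auto simp: nn_integral_gamma_moment[OF assms, of 1, simplified])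
 also have "\<dots> = 1" using G by (simp add: ennreal_mult'[symmetric])
 finally show "emeasure (density lborel (gamma_density a)) (space (density lborel (gamma_density a))) = 1"
  by (simp add: emeasure_density)
qed

lemma gamma_density_conv:
 assumes a: "a > 0" and b: "b > 0"
 shows "(\<integral>\<^sup>+y. ennreal (gamma_density a (x - y)) * ennreal (gamma_density b y) \<partial>lborel) = ennreal (gamma_density (a + b) x)"
proof (cases "x > 0")
 case False
 then have "(\<integral>\<^sup>+y. ennreal (gamma_density a (x - y)) * ennreal (gamma_density b y) \<partial>lborel) = (\<integral>\<^sup>+y. 0 \<partial>(lborel :: real measure))"
  by (intro nn_integral_cong) (auto simp: gamma_density_def)
 then show ?thesis using False by (simp add: gamma_density_def)
next
 case True
 have G: "Gamma a > 0" "Gamma b > 0" "Gamma (a + b) > 0" using a b by (auto intro: Gamma_real_pos)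
 define c where "c = x powr (a + b - 2) * exp (- x) / (Gamma a * Gamma b)"
 have c0: "c \<ge> 0" using G by (simp add: c_def)
 have "(\<integral>\<^sup>+y. ennreal (gamma_density a (x - y)) * ennreal (gamma_density b y) \<partial>lborel)
   = ennreal \<bar>x\<bar> * (\<integral>\<^sup>+t. ennreal (gamma_density a (x - (0 + x * t))) * ennreal (gamma_density b (0 + x * t)) \<partial>lborel)"
  using True by (intro nn_integral_real_affine) auto
 also have "(\<integral>\<^sup>+t. ennreal (gamma_density a (x - (0 + x * t))) * ennreal (gamma_density b (0 + x * t)) \<partial>lborel)
   = (\<integral>\<^sup>+t. ennreal c * ennreal (indicator {0..1} t * (t powr (b - 1) * (1 - t) powr (a - 1))) \<partial>lborel)"
 proof (intro nn_integral_cong_AE eventually_mono[OF eventually_conj[OF AE_lborel_singleton[of 0] AE_lborel_singleton[of 1]]])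
  fix t :: real assume t: "t \<noteq> 0 \<and> t \<noteq> 1"
  show "ennreal (gamma_density a (x - (0 + x * t))) * ennreal (gamma_density b (0 + x * t))
   = ennreal c * ennreal (indicator {0..1} t * (t powr (b - 1) * (1 - t) powr (a - 1)))"
  proof (cases "0 < t \<and> t < 1")
   case t': True
   have "x - x * t = x * (1 - t)" by (simp add: algebra_simps)
   then have "gamma_density a (x - x * t) = x powr (a - 1) * (1 - t) powr (a - 1) * exp (- x * (1 - t)) / Gamma a"
    using True t' by (simp add: gamma_density_def powr_mult)
   moreover have "gamma_density b (x * t) = x powr (b - 1) * t powr (b - 1) * exp (- x * t) / Gamma b"
    using True t' by (simp add: gamma_density_def powr_mult)
   ultimately have "gamma_density a (x - x * t) * gamma_density b (x * t)
     = (x powr (a - 1) * x powr (b - 1)) * (exp (- x * (1 - t)) * exp (- x * t)) / (Gamma a * Gamma b)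
      * (t powr (b - 1) * (1 - t) powr (a - 1))"
    by (simp only: times_divide_eq_left times_divide_eq_right divide_divide_eq_left mult_ac)
   also have "x powr (a - 1) * x powr (b - 1) = x powr (a + b - 2)"
    by (simp add: powr_add[symmetric])
   also have "exp (- x * (1 - t)) * exp (- x * t) = exp (- x)"
    by (simp add: exp_add[symmetric] algebra_simps)
   finally have "gamma_density a (x - x * t) * gamma_density b (x * t) = c * (t powr (b - 1) * (1 - t) powr (a - 1))"
    unfolding c_def .
   then show ?thesis using t' G c0 a b
    by (simp add: ennreal_mult'[symmetric] gamma_density_nonneg)
  next
   case False
   then have "t < 0 \<or> t > 1" using t by auto
   then have "gamma_density b (x * t) = 0 \<or> gamma_density a (x - x * t) = 0"
    using True by (auto simp: gamma_density_def zero_less_mult_iff)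
   then show ?thesis using \<open>t < 0 \<or> t > 1\<close> by (auto simp: indicator_def)
  qed
 qed
 also have "\<dots> = ennreal c * (\<integral>\<^sup>+t. ennreal (indicator {0..1} t * (t powr (b - 1) * (1 - t) powr (a - 1))) \<partial>lborel)"
  by (subst nn_integral_cmult) auto
 also have "(\<integral>\<^sup>+t. ennreal (indicator {0..1} t * (t powr (b - 1) * (1 - t) powr (a - 1))) \<partial>lborel) = ennreal (Beta b a)"
  using nn_integral_has_integral_lebesgue[OF _ has_integral_Beta_real[OF b a]] by simp
 also have "ennreal \<bar>x\<bar> * (ennreal c * ennreal (Beta b a)) = ennreal (x * (c * Beta b a))"
  using True c0 by (simp add: ennreal_mult'[symmetric])
 also have "x * (c * Beta b a) = gamma_density (a + b) x"
 proof -
  have "x * x powr (a + b - 2) = x powr (a + b - 1)"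
   using True powr_add[of x 1 "a + b - 2"] by simp
  then show ?thesis using True G unfolding c_def Beta_def gamma_density_def
   by (simp add: field_simps)
 qed
 finally show ?thesis .
qed

lemma gamma_convolution:
 assumes "a > 0" "b > 0"
 shows "density lborel (gamma_density a) \<star> density lborel (gamma_density b) = density lborel (gamma_density (a + b))"
 using assms
 by (subst convolution_density)
  (auto simp: gamma_density_conv intro!: prob_space.finite_measure prob_space_gamma)

text \<open>The mean of the gamma law with shape \<open>a\<close> is \<open>a\<close>, so this law is centered, and its convolution powers stay in the family with the same scale \<open>c\<close>.\<close>
definition gamma_shift :: "real \<Rightarrow> real \<Rightarrow> real measure"
 where "gamma_shift c a = distr (density lborel (gamma_density a)) borel (\<lambda>y. c * (y - a))"

lemma shift_avg_gamma_pow: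
 assumes a: "a > 0" and n: "n > 0" and g: "g \<in> borel_measurable borel"
 shows "(shift_avg (gamma_shift c a) ^^ n) g = shift_avg (gamma_shift c (n * a)) g"
 using n
proof (induction n)
 case (Suc n)
 show ?case
 proof (cases "n = 0")
  case False
  then have IH: "(shift_avg (gamma_shift c a) ^^ n) g = shift_avg (gamma_shift c (n * a)) g"
   using Suc.IH by simp
  have pos: "n * a > 0" using a False by auto
  have add: "a + n * a = Suc n * a" by (simp add: algebra_simps)
  have "shift_avg (gamma_shift c a) (shift_avg (gamma_shift c (n * a)) g)
   = shift_avg (distr (density lborel (gamma_density a) \<star> density lborel (gamma_density (n * a))) borel (\<lambda>y. c * (y - Suc n * a))) g"
   unfolding gamma_shift_def
   using a pos g by (intro shift_avg_distr_convolution prob_space_gamma) (auto simp: algebra_simps)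
  also have "density lborel (gamma_density a) \<star> density lborel (gamma_density (n * a)) = density lborel (gamma_density (Suc n * a))"
   unfolding gamma_convolution[OF a pos] add ..
  finally show ?thesis unfolding funpow.simps o_apply IH by (simp only: gamma_shift_def)
 qed simp
qed simp

section \<open>Smoothed tails of the comparison laws\<close>

lemma integrable_exp_neg_abs:
 assumes "b > 0"
 shows "integrable lborel (\<lambda>w::real. exp (- b * \<bar>w\<bar>))"
proof -
 let ?f = "\<lambda>w::real. indicator {0<..} w * w powr (1 - 1) * exp (- b * w)"
 have i: "integrable lborel ?f"
 proof (rule integrableI_nonneg)
  show "(\<integral>\<^sup>+w. ennreal (?f w) \<partial>lborel) < \<infinity>"
   using nn_integral_gamma_moment[of 1 b] assms by simp
 qed auto
 have i': "integrable lborel (\<lambda>w. ?f (0 + (-1) * w))"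
  using lborel_integrable_real_affine[OF i, of "-1" 0] by simp
 have "integrable lborel (\<lambda>w. ?f w + ?f (0 + (-1) * w))" using i i' by (rule Bochner_Integration.integrable_add)
 moreover have "AE w in lborel. ?f w + ?f (0 + (-1) * w) = exp (- b * \<bar>w\<bar>)"
  using AE_lborel_singleton[of 0] by eventually_elim (auto simp: indicator_def)
 ultimately show ?thesis
  by (subst integrable_cong_AE[where g="\<lambda>w. ?f w + ?f (0 + (-1) * w)"]) (auto elim: eventually_mono)
qed

text \<open>Smoothing multiplies an exponential tail by this constant; it tends to 1 as the smoothing becomes sharp.\<close>
definition smoothing_factor :: "real \<Rightarrow> real"
 where "smoothing_factor A = (LINT w|lborel. logistic (A * w) * exp (- w))"

lemma logistic_exp_bound:
 assumes "A \<ge> 2" "1 / 2 \<le> c" "c \<le> 3 / 2"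
 shows "logistic (A * w) * exp (- c * w) \<le> exp (- (1 / 2) * \<bar>w\<bar>)"
proof (cases "w \<ge> 0")
 case True
 have "logistic (A * w) * exp (- c * w) \<le> 1 * exp (- c * w)"
  using logistic_less_1[of "A * w"] by (intro mult_right_mono) auto
 also have "\<dots> \<le> exp (- (1 / 2) * \<bar>w\<bar>)"
  using True mult_right_mono[OF assms(2), of w] by simp
 finally show ?thesis .
next
 case False
 have "logistic (A * w) * exp (- c * w) \<le> exp (A * w) * exp (- c * w)"
  by (intro mult_right_mono logistic_le_exp) auto
 also have "\<dots> = exp ((A - c) * w)" by (simp add: exp_add[symmetric] algebra_simps)
 also have "\<dots> \<le> exp (1 / 2 * w)"
  using False assms by (auto intro!: mult_right_mono_neg)
 finally show ?thesis using False by simp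
qed

lemma smoothing_factor_tendsto: "(smoothing_factor \<longlongrightarrow> 1) at_top"
proof -
 have "((\<lambda>A. LINT w|lborel. logistic (A * w) * exp (- w)) \<longlongrightarrow> (LINT w|lborel. indicator {0<..} w * exp (- w))) at_top"
 proof (rule integral_dominated_convergence_at_top[where w="\<lambda>w. exp (- (1 / 2) * \<bar>w\<bar>)"])
  show "integrable lborel (\<lambda>w::real. exp (- (1 / 2) * \<bar>w\<bar>))" by (rule integrable_exp_neg_abs) simp
  show "\<forall>\<^sub>F A in at_top. AE w in lborel. norm (logistic (A * w) * exp (- w)) \<le> exp (- (1 / 2) * \<bar>w\<bar>)"
   using eventually_ge_at_top[of 2]
  proof eventually_elim
   case (elim A)
   show ?case
   proof (rule AE_I2)
    fix w
    show "norm (logistic (A * w) * exp (- w)) \<le> exp (- (1 / 2) * \<bar>w\<bar>)"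
     using logistic_exp_bound[OF elim, of 1 w] logistic_pos[of "A * w"] by (simp add: abs_mult)
   qed
  qed
  show "AE w in lborel. ((\<lambda>A. logistic (A * w) * exp (- w)) \<longlongrightarrow> indicator {0<..} w * exp (- w)) at_top"
   using AE_lborel_singleton[of 0]
  proof eventually_elim
   case (elim w)
   have "((\<lambda>A. logistic (A * w)) \<longlongrightarrow> indicator {0<..} w) at_top"
   proof (cases "w > 0")
    case True
    have "filterlim (\<lambda>A. w * A) at_top at_top"
     using True by (intro filterlim_tendsto_pos_mult_at_top[OF tendsto_const _ filterlim_ident])
    then have "filterlim (\<lambda>A. - (w * A)) at_bot at_top"
     by (rule filterlim_compose[OF filterlim_uminus_at_bot_at_top])
    then have "((\<lambda>A. exp (- (w * A))) \<longlongrightarrow> 0) at_top"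
     by (rule filterlim_compose[OF exp_at_bot])
    then have "((\<lambda>A. exp (- (A * w))) \<longlongrightarrow> 0) at_top" by (simp only: mult.commute)
    then have "((\<lambda>A. 1 / (1 + exp (- (A * w)))) \<longlongrightarrow> 1 / (1 + 0)) at_top"
     by (intro tendsto_divide tendsto_add tendsto_const) simp_all
    then show ?thesis using True by (simp add: logistic_def)
   next
    case False
    then have "- w > 0" using elim by auto
    have ex: "((\<lambda>A. exp (A * w)) \<longlongrightarrow> 0) at_top"
    proof (rule filterlim_compose[OF exp_at_bot])
     have "filterlim (\<lambda>A. w * A) at_bot at_top"
      using \<open>- w > 0\<close> by (intro filterlim_tendsto_neg_mult_at_bot[OF tendsto_const _ filterlim_ident]) simp
     then show "filterlim (\<lambda>A. A * w) at_bot at_top" by (simp only: mult.commute)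
    qed
    have "((\<lambda>A. logistic (A * w)) \<longlongrightarrow> 0) at_top"
     by (rule tendsto_sandwich[OF always_eventually always_eventually tendsto_const ex])
      (simp_all add: less_imp_le[OF logistic_pos] logistic_le_exp)
    then show ?thesis using False by simp
   qed
   then show ?case by (intro tendsto_intros)
  qed
 qed auto
 moreover have "(LINT w|lborel. indicator {0<..} w * exp (- w)) = (1::real)"
 proof -
  have "(\<integral>\<^sup>+w. ennreal (indicator {0<..} w * exp (- w)) \<partial>lborel) = (\<integral>\<^sup>+w. ennreal (indicator {0<..} w * w powr (1 - 1) * exp (- 1 * w)) \<partial>lborel)"
   by (intro nn_integral_cong) (auto simp: indicator_def)
  also have "\<dots> = ennreal 1" using nn_integral_gamma_moment[of 1 1] by simp
  finally show ?thesis by (intro integral_eq_nn_integral[THEN trans]) auto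
 qed
 ultimately show ?thesis unfolding smoothing_factor_def[abs_def] by simp
qed

text \<open>After the substitution \<open>s = d + v / d\<close> the density is, relative to its value at \<open>d\<close>, close to \<open>exp (- v)\<close>. The assumption on \<open>c\<close> provides the dominating function.\<close>
lemma smoothed_tail_limit:
 fixes d :: "nat \<Rightarrow> real" and f :: "nat \<Rightarrow> real \<Rightarrow> real"
 assumes d: "filterlim d at_top sequentially" and A: "A \<ge> 2"
  and [measurable]: "\<And>n. f n \<in> borel_measurable borel" and f0: "\<And>n s. f n s \<ge> 0"
  and fpos: "\<forall>\<^sub>F n in sequentially. f n (d n) > 0"
  and ratio: "\<And>v. (\<lambda>n. f n (d n + v / d n) / f n (d n)) \<longlonglongrightarrow> exp (- v)"
  and dom: "\<forall>\<^sub>F n in sequentially. \<forall>v. f n (d n + v / d n) \<le> f n (d n) * exp (- c n * v)"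
  and c: "c \<longlonglongrightarrow> 1"
  and norm: "(\<lambda>n. P n * f n (d n) / d n) \<longlonglongrightarrow> 1"
 shows "(\<lambda>n. P n * (LINT s|lborel. logistic (A * (d n * (s - d n) - t)) * f n s)) \<longlonglongrightarrow> exp (- t) * smoothing_factor A"
proof -
 define r where "r n v = f n (d n + v / d n) / f n (d n)" for n v
 have [measurable]: "r n \<in> borel_measurable borel" for n unfolding r_def by measurable
 have cev: "\<forall>\<^sub>F n in sequentially. 1 / 2 \<le> c n \<and> c n \<le> 3 / 2"
  using order_tendstoD(1)[OF c, of "1/2"] order_tendstoD(2)[OF c, of "3/2"]
  by (auto elim: eventually_elim2 intro: less_imp_le)
 have good: "\<forall>\<^sub>F n in sequentially. (1 / 2 \<le> c n \<and> c n \<le> 3 / 2) \<and> f n (d n) > 0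
   \<and> (\<forall>v. f n (d n + v / d n) \<le> f n (d n) * exp (- c n * v)) \<and> d n > 0"
  by (intro eventually_conj cev fpos dom eventually_compose_filterlim[OF eventually_gt_at_top d])
 then obtain N where N: "\<And>n. n \<ge> N \<Longrightarrow> (1 / 2 \<le> c n \<and> c n \<le> 3 / 2) \<and> f n (d n) > 0
   \<and> (\<forall>v. f n (d n + v / d n) \<le> f n (d n) * exp (- c n * v)) \<and> d n > 0"
  unfolding eventually_sequentially by blast
 have lim: "(\<lambda>n. LINT w|lborel. logistic (A * w) * r (n + N) (t + w)) \<longlonglongrightarrow> (LINT w|lborel. logistic (A * w) * exp (- (t + w)))"
 proof (rule integral_dominated_convergence[where w="\<lambda>w. exp (3 / 2 * \<bar>t\<bar>) * exp (- (1 / 2) * \<bar>w\<bar>)"])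
  show "integrable lborel (\<lambda>w::real. exp (3 / 2 * \<bar>t\<bar>) * exp (- (1 / 2) * \<bar>w\<bar>))"
   by (intro integrable_mult_right integrable_exp_neg_abs) simp
  show "AE w in lborel. (\<lambda>n. logistic (A * w) * r (n + N) (t + w)) \<longlonglongrightarrow> logistic (A * w) * exp (- (t + w))"
   unfolding r_def
   by (intro AE_I2 tendsto_mult tendsto_const) (rule LIMSEQ_ignore_initial_segment[OF ratio])
  fix n
  show "AE w in lborel. norm (logistic (A * w) * r (n + N) (t + w)) \<le> exp (3 / 2 * \<bar>t\<bar>) * exp (- (1 / 2) * \<bar>w\<bar>)"
  proof (rule AE_I2)
   fix w
   let ?n = "n + N"
   have Nn: "1 / 2 \<le> c ?n" "c ?n \<le> 3 / 2" "f ?n (d ?n) > 0" "d ?n > 0"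
    and Nd: "f ?n (d ?n + (t + w) / d ?n) \<le> f ?n (d ?n) * exp (- c ?n * (t + w))"
    using N[of ?n] by auto
   have r0: "0 \<le> r ?n (t + w)" unfolding r_def using f0 by simp
   have "r ?n (t + w) \<le> exp (- c ?n * (t + w))"
    unfolding r_def using Nn(3) Nd by (simp only: divide_le_eq mult.commute if_True)
   also have "\<dots> = exp (- c ?n * t) * exp (- c ?n * w)" by (simp add: exp_add[symmetric] algebra_simps)
   also have "\<dots> \<le> exp (3 / 2 * \<bar>t\<bar>) * exp (- c ?n * w)"
   proof -
    have "- c ?n * t \<le> c ?n * \<bar>t\<bar>" using Nn by (auto simp: abs_if mult_nonneg_nonneg)
    also have "\<dots> \<le> 3 / 2 * \<bar>t\<bar>" using Nn by (intro mult_right_mono) auto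
    finally show ?thesis by (intro mult_right_mono) auto
   qed
   finally have "logistic (A * w) * r ?n (t + w) \<le> logistic (A * w) * (exp (3 / 2 * \<bar>t\<bar>) * exp (- c ?n * w))"
    using logistic_pos[of "A * w"] by (intro mult_left_mono) auto
   also have "\<dots> = exp (3 / 2 * \<bar>t\<bar>) * (logistic (A * w) * exp (- c ?n * w))" by simp
   also have "\<dots> \<le> exp (3 / 2 * \<bar>t\<bar>) * exp (- (1 / 2) * \<bar>w\<bar>)"
    using logistic_exp_bound[OF A, of "c ?n" w] Nn by (intro mult_left_mono) auto
   finally show "norm (logistic (A * w) * r ?n (t + w)) \<le> exp (3 / 2 * \<bar>t\<bar>) * exp (- (1 / 2) * \<bar>w\<bar>)"
    using r0 logistic_pos[of "A * w"] by (simp add: abs_mult)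
  qed
 qed auto
 have "(LINT w|lborel. logistic (A * w) * exp (- (t + w))) = (LINT w|lborel. exp (- t) * (logistic (A * w) * exp (- w)))"
  by (intro Bochner_Integration.integral_cong) (auto simp: exp_diff exp_minus field_simps exp_add)
 then have "(LINT w|lborel. logistic (A * w) * exp (- (t + w))) = exp (- t) * smoothing_factor A"
  by (simp add: smoothing_factor_def)
 with lim have lim': "(\<lambda>n. LINT w|lborel. logistic (A * w) * r n (t + w)) \<longlonglongrightarrow> exp (- t) * smoothing_factor A"
  using LIMSEQ_offset[of _ N] by auto
 have "(\<lambda>n. (P n * f n (d n) / d n) * (LINT w|lborel. logistic (A * w) * r n (t + w))) \<longlonglongrightarrow> 1 * (exp (- t) * smoothing_factor A)"
  by (intro tendsto_mult norm lim')
 moreover have "\<forall>\<^sub>F n in sequentially. (P n * f n (d n) / d n) * (LINT w|lborel. logistic (A * w) * r n (t + w))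
   = P n * (LINT s|lborel. logistic (A * (d n * (s - d n) - t)) * f n s)"
  using good
 proof eventually_elim
  case (elim n)
  have "(LINT s|lborel. logistic (A * (d n * (s - d n) - t)) * f n s)
    = \<bar>1 / d n\<bar> *\<^sub>R (LINT w|lborel. logistic (A * (d n * ((d n + t / d n) + 1 / d n * w - d n) - t)) * f n ((d n + t / d n) + 1 / d n * w))"
   using elim by (intro lborel_integral_real_affine) auto
  also have "(LINT w|lborel. logistic (A * (d n * ((d n + t / d n) + 1 / d n * w - d n) - t)) * f n ((d n + t / d n) + 1 / d n * w))
    = (LINT w|lborel. f n (d n) * (logistic (A * w) * r n (t + w)))"
  proof (intro Bochner_Integration.integral_cong refl)
   fix w
   have "d n * ((d n + t / d n) + 1 / d n * w - d n) - t = w" using elim by (simp add: field_simps)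
   moreover have "(d n + t / d n) + 1 / d n * w = d n + (t + w) / d n" by (simp add: add_divide_distrib)
   moreover have "f n (d n + (t + w) / d n) = f n (d n) * r n (t + w)" using elim by (simp add: r_def)
   ultimately show "logistic (A * (d n * ((d n + t / d n) + 1 / d n * w - d n) - t)) * f n ((d n + t / d n) + 1 / d n * w)
     = f n (d n) * (logistic (A * w) * r n (t + w))"
    by (simp only: mult_ac)
  qed
  finally show ?case using elim by simp
 qed
 ultimately show ?thesis unfolding mult_1 by (rule Lim_transform_eventually)
qed

lemma shift_avg_logistic_density:
 assumes [measurable]: "f \<in> borel_measurable borel" "h \<in> borel_measurable borel" and f0: "\<And>y. f y \<ge> 0"
  and p: "prob_space (density lborel (\<lambda>x. ennreal (f x)))"
 shows "enn2real (shift_avg (distr (density lborel f) borel h) elogistic s)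
   = (LINT y|lborel. logistic (s + h y) * f y)"
proof -
 interpret prob_space "density lborel f" by fact
 have "enn2real (shift_avg (distr (density lborel f) borel h) elogistic s)
   = (LINT y|density lborel f. logistic (s + h y))"
 proof -
  have "(LINT y|density lborel f. logistic (s + h y)) \<ge> 0"
   by (intro integral_nonneg_AE AE_I2 less_imp_le logistic_pos)
  then show ?thesis by (subst shift_avg_logistic) (simp_all)
 qed
 also have "\<dots> = (LINT y|lborel. f y *\<^sub>R logistic (s + h y))"
  using f0 by (intro integral_density) auto
 finally show ?thesis by (simp add: mult.commute)
qed

lemma normal_smoothed_tail:
 assumes d: "filterlim d at_top sequentially" and A: "A \<ge> 2"
  and norm: "(\<lambda>n. P n * std_normal_density (d n) / d n) \<longlonglongrightarrow> 1"
 shows "(\<lambda>n. P n * enn2real (shift_avg (normal_shift (A * d n)) elogistic (A * (- (d n)\<^sup>2 - t))))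
  \<longlonglongrightarrow> exp (- t) * smoothing_factor A"
proof -
 have sq: "(x + v / x)\<^sup>2 = x\<^sup>2 + 2 * v + (v / x)\<^sup>2" if "x > 0" for x v :: real
  using that by (simp add: power2_sum)
 have ev: "\<forall>\<^sub>F n in sequentially. d n > 0" by (rule eventually_compose_filterlim[OF eventually_gt_at_top d])
 have rat: "std_normal_density (x + v / x) / std_normal_density x = exp (- v) * exp (- ((v / x)\<^sup>2 / 2))" if "x > 0" for x v
 proof -
  have "std_normal_density (x + v / x) / std_normal_density x = exp (- (x + v / x)\<^sup>2 / 2) / exp (- x\<^sup>2 / 2)"
   by (simp add: std_normal_density_def)
  also have "\<dots> = exp (- (x + v / x)\<^sup>2 / 2 - (- x\<^sup>2 / 2))" by (rule exp_diff[symmetric])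
  also have "- (x + v / x)\<^sup>2 / 2 - (- x\<^sup>2 / 2) = - v + - ((v / x)\<^sup>2 / 2)"
   unfolding sq[OF that] by (simp add: field_simps)
  finally show ?thesis by (simp only: exp_add)
 qed
 have lim: "(\<lambda>n. P n * (LINT s|lborel. logistic (A * (d n * (s - d n) - t)) * std_normal_density s)) \<longlonglongrightarrow> exp (- t) * smoothing_factor A"
 proof (rule smoothed_tail_limit[OF d A, where c="\<lambda>_. 1"])
  fix v
  have "(\<lambda>n. v / d n) \<longlonglongrightarrow> 0" by (rule real_tendsto_divide_at_top[OF tendsto_const d])
  then have "(\<lambda>n. exp (- v) * exp (- ((v / d n)\<^sup>2 / 2))) \<longlonglongrightarrow> exp (- v) * exp (- (0\<^sup>2 / 2))"
   by (intro tendsto_intros) auto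
  then have "(\<lambda>n. exp (- v) * exp (- ((v / d n)\<^sup>2 / 2))) \<longlonglongrightarrow> exp (- v)" by simp
  moreover have "\<forall>\<^sub>F n in sequentially. exp (- v) * exp (- ((v / d n)\<^sup>2 / 2)) = std_normal_density (d n + v / d n) / std_normal_density (d n)"
   using ev by eventually_elim (rule rat[symmetric])
  ultimately show "(\<lambda>n. std_normal_density (d n + v / d n) / std_normal_density (d n)) \<longlonglongrightarrow> exp (- v)"
   by (rule Lim_transform_eventually)
 next
  show "\<forall>\<^sub>F n in sequentially. \<forall>v. std_normal_density (d n + v / d n) \<le> std_normal_density (d n) * exp (- 1 * v)"
   using ev
  proof eventually_elim
   case (elim n)
   show ?case
   proof
    fix v
    have "std_normal_density (d n + v / d n) / std_normal_density (d n) \<le> exp (- v) * 1"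
     unfolding rat[OF elim] by (intro mult_left_mono) auto
    then show "std_normal_density (d n + v / d n) \<le> std_normal_density (d n) * exp (- 1 * v)"
     by (simp add: divide_le_eq normal_density_pos mult.commute)
   qed
  qed
 qed (use norm in \<open>simp_all add: normal_density_pos normal_density_nonneg\<close>)
 have "enn2real (shift_avg (normal_shift (A * d n)) elogistic (A * (- (d n)\<^sup>2 - t)))
   = (LINT s|lborel. logistic (A * (d n * (s - d n) - t)) * std_normal_density s)" for n
 proof -
  have arg: "A * (- (d n)\<^sup>2 - t) + y *\<^sub>R (A * d n) = A * (d n * (y - d n) - t)" for y
   by (simp add: power2_eq_square algebra_simps)
  have eq: "enn2real (shift_avg (distr (density lborel std_normal_density) borel (\<lambda>y. y *\<^sub>R (A * d n))) elogistic s)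
    = (LINT y|lborel. logistic (s + y *\<^sub>R (A * d n)) * std_normal_density y)" for s
   by (rule shift_avg_logistic_density[OF _ _ normal_density_nonneg prob_space_normal_density[OF zero_less_one]])
    measurable
  show ?thesis unfolding normal_shift_def eq arg ..
 qed
 note eq = this
 show ?thesis unfolding eq by (rule lim)
qed

lemma abs_ln_1p_minus_cubic:
 fixes z :: real
 assumes z: "\<bar>z\<bar> \<le> 1 / 2"
 shows "\<bar>ln (1 + z) - (z - z\<^sup>2 / 2 + z ^ 3 / 3)\<bar> \<le> 2 * z ^ 4"
proof (cases "z = 0")
 case False
 define F where "F x = ln (1 + x) - (x - x\<^sup>2 / 2 + x ^ 3 / 3)" for x :: real
 have der: "(F has_real_derivative - (x ^ 3) / (1 + x)) (at x)" if "\<bar>x\<bar> \<le> 1 / 2" for x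
 proof -
  have "1 + x > 0" using that by auto
  then have "(F has_real_derivative (1 / (1 + x) - (1 - x + x\<^sup>2))) (at x)"
   unfolding F_def by (auto intro!: derivative_eq_intros simp: field_simps power2_eq_square)
  moreover have "1 / (1 + x) - (1 - x + x\<^sup>2) = - (x ^ 3) / (1 + x)"
   using \<open>1 + x > 0\<close> by (simp add: field_simps power2_eq_square power3_eq_cube)
  ultimately show ?thesis by simp
 qed
 have "\<exists>\<xi>. \<bar>\<xi>\<bar> \<le> \<bar>z\<bar> \<and> F z - F 0 = z * (- (\<xi> ^ 3) / (1 + \<xi>))"
 proof (cases "z > 0")
  case True
  have "\<exists>\<xi>>0. \<xi> < z \<and> F z - F 0 = (z - 0) * (- (\<xi> ^ 3) / (1 + \<xi>))"
   using True z by (intro MVT2 der) auto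
  then obtain \<xi> where "0 < \<xi>" "\<xi> < z" "F z - F 0 = (z - 0) * (- (\<xi> ^ 3) / (1 + \<xi>))" by auto
  then show ?thesis by (intro exI[of _ \<xi>]) auto
 next
  case False
  with \<open>z \<noteq> 0\<close> have "z < 0" by simp
  have "\<exists>\<xi>>z. \<xi> < 0 \<and> F 0 - F z = (0 - z) * (- (\<xi> ^ 3) / (1 + \<xi>))"
   using \<open>z < 0\<close> z by (intro MVT2 der) auto
  then obtain \<xi> where "z < \<xi>" "\<xi> < 0" "F 0 - F z = (0 - z) * (- (\<xi> ^ 3) / (1 + \<xi>))" by auto
  then show ?thesis by (intro exI[of _ \<xi>]) (auto simp: algebra_simps)
 qed
 then obtain \<xi> where \<xi>: "\<bar>\<xi>\<bar> \<le> \<bar>z\<bar>" "F z - F 0 = z * (- (\<xi> ^ 3) / (1 + \<xi>))" by blast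
 have "1 + \<xi> \<ge> 1 / 2" using \<xi>(1) z by auto
 have "\<bar>F z - F 0\<bar> = \<bar>z\<bar> * (\<bar>\<xi>\<bar> ^ 3 / (1 + \<xi>))"
  unfolding \<xi>(2) using \<open>1 + \<xi> \<ge> 1 / 2\<close> by (simp add: abs_mult power_abs)
 also have "\<dots> \<le> \<bar>z\<bar> * (\<bar>z\<bar> ^ 3 / (1 / 2))"
  using \<xi>(1) \<open>1 + \<xi> \<ge> 1 / 2\<close> by (intro mult_left_mono frac_le power_mono) auto
 also have "\<dots> = 2 * \<bar>z\<bar> ^ 4" by (simp add: eval_nat_numeral)
 finally show ?thesis by (simp add: F_def power_even_abs)
qed simp

text \<open>The cubic term is the effect of the skewness; the quartic one vanishes by assumption.\<close>
lemma gamma_exponent_limit: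
 fixes s m :: "nat \<Rightarrow> real"
 assumes m: "filterlim m at_top sequentially" and s: "(\<lambda>n. s n ^ 4 / m n) \<longlonglongrightarrow> 0"
 shows "(\<lambda>n. ((m n - 1) * ln (1 + s n / sqrt (m n)) - sqrt (m n) * s n) - (- (s n)\<^sup>2 / 2 + s n ^ 3 / (3 * sqrt (m n)))) \<longlonglongrightarrow> 0"
proof -
 have mpos: "\<forall>\<^sub>F n in sequentially. m n > 0" by (rule eventually_compose_filterlim[OF eventually_gt_at_top m])
 define z where "z n = s n / sqrt (m n)" for n
 have im: "(\<lambda>n. 1 / m n) \<longlonglongrightarrow> 0" by (rule real_tendsto_divide_at_top[OF tendsto_const m])
 have "(\<lambda>n. (s n ^ 4 / m n) * (1 / m n)) \<longlonglongrightarrow> 0 * 0" by (rule tendsto_mult[OF s im])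
 moreover have "\<forall>\<^sub>F n in sequentially. (s n ^ 4 / m n) * (1 / m n) = z n ^ 4"
  using mpos
 proof eventually_elim
  case (elim n)
  have "sqrt (m n) ^ 4 = (sqrt (m n) ^ 2) ^ 2" by (simp only: power_mult[symmetric]) simp
  also have "\<dots> = m n ^ 2" using elim by simp
  finally show ?case by (simp add: z_def power_divide power2_eq_square)
 qed
 ultimately have "(\<lambda>n. z n ^ 4) \<longlonglongrightarrow> 0 * 0" by (rule Lim_transform_eventually)
 then have "(\<lambda>n. root 4 (z n ^ 4)) \<longlonglongrightarrow> root 4 0" by (intro tendsto_intros) simp
 moreover have "root 4 (x ^ 4) = \<bar>x\<bar>" for x :: real
  using real_root_power_cancel[of 4 "\<bar>x\<bar>"] by simp
 ultimately have "(\<lambda>n. \<bar>z n\<bar>) \<longlonglongrightarrow> 0" by simp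
 then have z0: "z \<longlonglongrightarrow> 0" by (simp add: tendsto_rabs_zero_iff)
 have zs: "\<forall>\<^sub>F n in sequentially. \<bar>z n\<bar> < 1 / 2"
  using order_tendstoD(2)[OF tendsto_rabs_zero[OF z0], of "1/2"] by simp
 have "(\<lambda>n. ln (1 + z n)) \<longlonglongrightarrow> ln (1 + 0)" by (intro tendsto_intros z0) simp
 then have l0: "(\<lambda>n. ln (1 + z n)) \<longlonglongrightarrow> 0" by simp
 have bnd: "\<forall>\<^sub>F n in sequentially. norm (((m n - 1) * ln (1 + s n / sqrt (m n)) - sqrt (m n) * s n) - (- (s n)\<^sup>2 / 2 + s n ^ 3 / (3 * sqrt (m n))))
   \<le> 2 * (s n ^ 4 / m n) + \<bar>ln (1 + z n)\<bar>"
  using mpos zs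
 proof eventually_elim
  case (elim n)
  define r where "r = sqrt (m n)"
  have r: "r > 0" and mr: "m n = r * r" using elim by (auto simp: r_def)
  have sz: "s n = r * z n" using r by (simp add: z_def r_def)
  have zr: "s n / r = z n" by (simp add: z_def r_def)
  have e1: "m n * (z n - z n ^ 2 / 2 + z n ^ 3 / 3) = r * s n + (- (s n)\<^sup>2 / 2 + s n ^ 3 / (3 * r))"
   unfolding sz mr using r by (simp add: field_simps power2_eq_square power3_eq_cube)
  have e2: "m n * z n ^ 4 = s n ^ 4 / m n"
   unfolding sz mr using r by (simp add: field_simps eval_nat_numeral)
  have "((m n - 1) * ln (1 + s n / sqrt (m n)) - sqrt (m n) * s n) - (- (s n)\<^sup>2 / 2 + s n ^ 3 / (3 * sqrt (m n)))
    = m n * (ln (1 + z n) - (z n - z n ^ 2 / 2 + z n ^ 3 / 3)) - ln (1 + z n)"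
   using e1 unfolding r_def[symmetric] zr by (simp add: algebra_simps)
  also have "norm \<dots> \<le> m n * \<bar>ln (1 + z n) - (z n - z n ^ 2 / 2 + z n ^ 3 / 3)\<bar> + \<bar>ln (1 + z n)\<bar>"
   using elim(1) abs_triangle_ineq4[of "m n * (ln (1 + z n) - (z n - z n ^ 2 / 2 + z n ^ 3 / 3))" "ln (1 + z n)"]
   by (simp add: abs_mult)
  also have "m n * \<bar>ln (1 + z n) - (z n - z n ^ 2 / 2 + z n ^ 3 / 3)\<bar> \<le> m n * (2 * z n ^ 4)"
   using elim abs_ln_1p_minus_cubic[of "z n"] by (intro mult_left_mono) auto
  also have "m n * (2 * z n ^ 4) = 2 * (s n ^ 4 / m n)" using e2 by simp
  finally show ?case by simp
 qed
 have "(\<lambda>n. 2 * (s n ^ 4 / m n) + \<bar>ln (1 + z n)\<bar>) \<longlonglongrightarrow> 2 * 0 + 0"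
  by (intro tendsto_add tendsto_mult tendsto_const s tendsto_rabs_zero l0)
 then have "(\<lambda>n. 2 * (s n ^ 4 / m n) + \<bar>ln (1 + z n)\<bar>) \<longlonglongrightarrow> 0" by simp
 then show ?thesis by (rule Lim_null_comparison[OF bnd])
qed

text \<open>The density of a gamma variable of shape \<open>m\<close> after standardization, reflected if the sign is negative.\<close>
definition std_gamma_density :: "real \<Rightarrow> real \<Rightarrow> real \<Rightarrow> real"
 where "std_gamma_density m e s = sqrt m * gamma_density m (m + e * sqrt m * s)"

lemma std_gamma_density_measurable [measurable]: "std_gamma_density m e \<in> borel_measurable borel"
 unfolding std_gamma_density_def by measurable

lemma std_gamma_density_nonneg: "m > 0 \<Longrightarrow> std_gamma_density m e s \<ge> 0"
 by (simp add: std_gamma_density_def gamma_density_nonneg)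

lemma std_gamma_argument:
 assumes "m > 0"
 shows "m + e * sqrt m * s = m * (1 + e * s / sqrt m)"
proof -
 define r where "r = sqrt m"
 have "r > 0" "m = r * r" using assms by (auto simp: r_def)
 then have "m + e * r * s = m * (1 + e * s / r)" by (simp add: field_simps)
 then show ?thesis by (simp add: r_def)
qed

lemma std_gamma_density_eq:
 assumes m: "m > 0" and s: "1 + e * s / sqrt m > 0"
 shows "std_gamma_density m e s
  = std_gamma_density m e 0 * exp ((m - 1) * ln (1 + e * s / sqrt m) - sqrt m * (e * s))"
proof -
 note y = std_gamma_argument[OF m, of e s]
 have pos: "m * (1 + e * s / sqrt m) > 0" using m s by simp
 have "gamma_density m (m + e * sqrt m * s)
   = (m * (1 + e * s / sqrt m)) powr (m - 1) * exp (- (m + e * sqrt m * s)) / Gamma m"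
  using pos unfolding gamma_density_def y[symmetric] by simp
 also have "(m * (1 + e * s / sqrt m)) powr (m - 1) = m powr (m - 1) * exp ((m - 1) * ln (1 + e * s / sqrt m))"
  using m s by (simp add: powr_mult) (simp add: powr_def)
 also have "exp (- (m + e * sqrt m * s)) = exp (- m) * exp (- (sqrt m * (e * s)))"
  by (simp add: exp_add[symmetric] mult_ac)
 also have "m powr (m - 1) * exp ((m - 1) * ln (1 + e * s / sqrt m)) * (exp (- m) * exp (- (sqrt m * (e * s)))) / Gamma m
   = (m powr (m - 1) * exp (- m) / Gamma m) * (exp ((m - 1) * ln (1 + e * s / sqrt m)) * exp (- (sqrt m * (e * s))))"
  by (simp only: times_divide_eq_left times_divide_eq_right mult_ac)
 also have "exp ((m - 1) * ln (1 + e * s / sqrt m)) * exp (- (sqrt m * (e * s)))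
   = exp ((m - 1) * ln (1 + e * s / sqrt m) - sqrt m * (e * s))"
  by (simp add: exp_add[symmetric])
 also have "m powr (m - 1) * exp (- m) / Gamma m = gamma_density m m"
  using m by (simp add: gamma_density_def)
 finally show ?thesis by (simp add: std_gamma_density_def)
qed

lemma std_gamma_density_eq_0: "m > 0 \<Longrightarrow> 1 + e * s / sqrt m \<le> 0 \<Longrightarrow> std_gamma_density m e s = 0"
proof -
 assume m: "m > 0" and s: "1 + e * s / sqrt m \<le> 0"
 have "m + e * sqrt m * s = m * (1 + e * s / sqrt m)" by (rule std_gamma_argument[OF m])
 also have "\<dots> \<le> 0" using m s by (simp add: mult_le_0_iff)
 finally show ?thesis by (simp add: std_gamma_density_def gamma_density_def)
qed

lemma integral_gamma_density: "a > 0 \<Longrightarrow> (LINT y|lborel. gamma_density a y) = 1"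
proof -
 assume a: "a > 0"
 interpret prob_space "density lborel (gamma_density a)" by (rule prob_space_gamma[OF a])
 have "(\<integral>\<^sup>+y. ennreal (gamma_density a y) \<partial>lborel) = ennreal 1"
  using emeasure_space_1 by (simp add: emeasure_density)
 then show ?thesis
  by (subst integral_eq_nn_integral) (simp_all add: gamma_density_nonneg[OF a])
qed

lemma integral_std_gamma_density:
 assumes m: "m > 0" and E: "E \<in> {1, -1}" and [measurable]: "h \<in> borel_measurable borel"
 shows "(LINT y|lborel. h y * gamma_density m y) = (LINT s|lborel. h (m + E * sqrt m * s) * std_gamma_density m E s)"
proof -
 have "(LINT y|lborel. h y * gamma_density m y)
   = \<bar>E * sqrt m\<bar> *\<^sub>R (LINT s|lborel. h (m + E * sqrt m * s) * gamma_density m (m + E * sqrt m * s))"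
  using m E by (intro lborel_integral_real_affine) auto
 also have "\<bar>E * sqrt m\<bar> = sqrt m" using m E by (auto simp: abs_mult)
 also have "sqrt m *\<^sub>R (LINT s|lborel. h (m + E * sqrt m * s) * gamma_density m (m + E * sqrt m * s))
   = (LINT s|lborel. sqrt m * (h (m + E * sqrt m * s) * gamma_density m (m + E * sqrt m * s)))"
  by simp
 also have "\<dots> = (LINT s|lborel. h (m + E * sqrt m * s) * std_gamma_density m E s)"
  by (intro Bochner_Integration.integral_cong) (simp_all add: std_gamma_density_def mult_ac)
 finally show ?thesis .
qed


text \<open>Concavity of the logarithm gives an exponential majorant for the density far from its mode.\<close>
lemma ln_tangent:
 fixes a b :: real
 assumes "a > 0" "b > 0"
 shows "ln b \<le> ln a + (b - a) / a"
proof -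
 have "ln (b / a) \<le> b / a - 1" using assms by (intro ln_le_minus_one) auto
 then show ?thesis using assms by (simp add: ln_div diff_divide_distrib)
qed

lemma gamma_exponent_bound:
 assumes m: "m > 1" and s: "1 + s / sqrt m > 0"
 shows "(m - 1) * ln (1 + s / sqrt m) - sqrt m * s \<le> 2 - \<bar>s\<bar>"
proof -
 define r where "r = sqrt m"
 have r: "r > 1" and mr: "m = r * r" using m by (auto simp: r_def)
 have s': "1 + s / r > 0" using s by (simp add: r_def)
 have m1: "m - 1 = (r + 1) * (r - 1)" unfolding mr by (simp add: algebra_simps)
 have m0: "m - 1 \<ge> 0" using m by simp
 have up: "(m - 1) * ln (1 + s / r) - r * s \<le> 1 - s"
 proof -
  have "ln (1 + s / r) \<le> ln (1 + 1 / r) + ((1 + s / r) - (1 + 1 / r)) / (1 + 1 / r)"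
   using s' r by (intro ln_tangent) (auto intro: add_pos_pos)
  also have "ln (1 + 1 / r) \<le> 1 / r" using r by (intro ln_add_one_self_le_self) auto
  also have "((1 + s / r) - (1 + 1 / r)) / (1 + 1 / r) = (s - 1) / (r + 1)"
  proof -
   have "(1 + s / r) - (1 + 1 / r) = (s - 1) / r" by (simp add: diff_divide_distrib)
   moreover have "1 + 1 / r = (r + 1) / r" using r by (simp add: add_divide_distrib)
   ultimately show ?thesis using r by simp
  qed
  finally have "(m - 1) * ln (1 + s / r) \<le> (m - 1) * (1 / r + (s - 1) / (r + 1))"
   using m0 by (intro mult_left_mono) auto
  also have "\<dots> = (m - 1) / r + (r - 1) * (s - 1)"
  proof -
   have "(m - 1) * ((s - 1) / (r + 1)) = (r - 1) * (s - 1)" unfolding m1 using r by simp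
   then show ?thesis by (simp add: distrib_left)
  qed
  also have "(m - 1) / r \<le> r" unfolding mr using r by (simp add: field_simps)
  finally show ?thesis by (simp add: algebra_simps)
 qed
 have lo: "(m - 1) * ln (1 + s / r) - r * s \<le> 2 + s"
 proof -
  have "ln (1 + s / r) \<le> ln (1 - 1 / r) + ((1 + s / r) - (1 - 1 / r)) / (1 - 1 / r)"
   using s' r by (intro ln_tangent) auto
  also have "ln (1 - 1 / r) \<le> - 1 / r" using r ln_le_minus_one[of "1 - 1 / r"] by simp
  also have "((1 + s / r) - (1 - 1 / r)) / (1 - 1 / r) = (s + 1) / (r - 1)"
  proof -
   have "(1 + s / r) - (1 - 1 / r) = (s + 1) / r" by (simp add: add_divide_distrib)
   moreover have "1 - 1 / r = (r - 1) / r" using r by (simp add: diff_divide_distrib)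
   ultimately show ?thesis using r by simp
  qed
  finally have "(m - 1) * ln (1 + s / r) \<le> (m - 1) * (- 1 / r + (s + 1) / (r - 1))"
   using m0 by (intro mult_left_mono) auto
  also have "\<dots> = - ((m - 1) / r) + (r + 1) * (s + 1)"
  proof -
   have "(m - 1) * ((s + 1) / (r - 1)) = (r + 1) * (s + 1)" unfolding m1 using r by simp
   moreover have "(m - 1) * (- 1 / r) = - ((m - 1) / r)" by simp
   ultimately show ?thesis by (simp only: distrib_left)
  qed
  also have "- ((m - 1) / r) \<le> 1 - r" unfolding mr using r by (simp add: field_simps)
  finally show ?thesis by (simp add: algebra_simps)
 qed
 show ?thesis using up lo unfolding r_def by (auto simp: abs_if)
qed

lemma std_gamma_density_at_0: "std_gamma_density m E 0 = sqrt m * gamma_density m m"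
 by (simp add: std_gamma_density_def)

text \<open>This is Stirling's formula.\<close>
lemma std_gamma_density_mode_limit:
 assumes m: "filterlim m at_top sequentially"
 shows "(\<lambda>n. std_gamma_density (m n) E 0) \<longlonglongrightarrow> 1 / sqrt (2 * pi)"
proof -
 define h where "h n s = (if 1 + s / sqrt (m n) > 0 then exp ((m n - 1) * ln (1 + s / sqrt (m n)) - sqrt (m n) * s) else 0)" for n and s :: real
 have [measurable]: "h n \<in> borel_measurable borel" for n unfolding h_def by measurable
 have "\<forall>\<^sub>F n in sequentially. m n > 1" by (rule eventually_compose_filterlim[OF eventually_gt_at_top m])
 then obtain N where N: "\<And>n. n \<ge> N \<Longrightarrow> m n > 1" unfolding eventually_sequentially by blast
 have pt: "(\<lambda>n. h n s) \<longlonglongrightarrow> exp (- s\<^sup>2 / 2)" for s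
 proof -
  have sq: "filterlim (\<lambda>n. sqrt (m n)) at_top sequentially" by (rule filterlim_compose[OF sqrt_at_top m])
  have s4: "(\<lambda>n. s ^ 4 / m n) \<longlonglongrightarrow> 0" by (rule real_tendsto_divide_at_top[OF tendsto_const m])
  have s3: "(\<lambda>n. s ^ 3 / (3 * sqrt (m n))) \<longlonglongrightarrow> 0"
   by (intro real_tendsto_divide_at_top[OF tendsto_const] filterlim_tendsto_pos_mult_at_top[OF tendsto_const _ sq]) simp
  have s1: "(\<lambda>n. s / sqrt (m n)) \<longlonglongrightarrow> 0" by (rule real_tendsto_divide_at_top[OF tendsto_const sq])
  have "(\<lambda>n. (((m n - 1) * ln (1 + s / sqrt (m n)) - sqrt (m n) * s) - (- s\<^sup>2 / 2 + s ^ 3 / (3 * sqrt (m n)))) + (- s\<^sup>2 / 2 + s ^ 3 / (3 * sqrt (m n)))) \<longlonglongrightarrow> 0 + (- s\<^sup>2 / 2 + 0)"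
   by (intro tendsto_add gamma_exponent_limit[OF m s4] s3 tendsto_const)
  then have "(\<lambda>n. (m n - 1) * ln (1 + s / sqrt (m n)) - sqrt (m n) * s) \<longlonglongrightarrow> - s\<^sup>2 / 2" by simp
  then have "(\<lambda>n. exp ((m n - 1) * ln (1 + s / sqrt (m n)) - sqrt (m n) * s)) \<longlonglongrightarrow> exp (- s\<^sup>2 / 2)" by (rule tendsto_exp)
  moreover have "\<forall>\<^sub>F n in sequentially. exp ((m n - 1) * ln (1 + s / sqrt (m n)) - sqrt (m n) * s) = h n s"
   using order_tendstoD(1)[OF s1, of "-1"] by (simp add: h_def) (auto elim: eventually_mono)
  ultimately show ?thesis by (rule Lim_transform_eventually)
 qed
 have "(\<lambda>n. LINT s|lborel. h (n + N) s) \<longlonglongrightarrow> (LINT s|lborel. exp (- s\<^sup>2 / 2))"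
 proof (rule integral_dominated_convergence[where w="\<lambda>s. exp 2 * exp (- 1 * \<bar>s\<bar>)"])
  show "integrable lborel (\<lambda>s::real. exp 2 * exp (- 1 * \<bar>s\<bar>))"
   by (intro integrable_mult_right integrable_exp_neg_abs) simp
  show "AE s in lborel. (\<lambda>n. h (n + N) s) \<longlonglongrightarrow> exp (- s\<^sup>2 / 2)"
   by (intro AE_I2 LIMSEQ_ignore_initial_segment pt)
  fix n
  show "AE s in lborel. norm (h (n + N) s) \<le> exp 2 * exp (- 1 * \<bar>s\<bar>)"
  proof (rule AE_I2)
   fix s
   show "norm (h (n + N) s) \<le> exp 2 * exp (- 1 * \<bar>s\<bar>)"
    using gamma_exponent_bound[OF N[of "n + N"], of s] by (simp add: h_def exp_add[symmetric])
  qed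
 qed auto
 then have L: "(\<lambda>n. LINT s|lborel. h n s) \<longlonglongrightarrow> (LINT s|lborel. exp (- s\<^sup>2 / 2))" by (rule LIMSEQ_offset)
 have "(LINT s|lborel. exp (- s\<^sup>2 / 2)) = (LINT s|lborel. sqrt (2 * pi) * std_normal_density s)"
  by (intro Bochner_Integration.integral_cong) (simp_all add: std_normal_density_def)
 also have "\<dots> = sqrt (2 * pi)" using integral_std_normal_moment_even[of 0] by simp
 finally have L': "(\<lambda>n. LINT s|lborel. h n s) \<longlonglongrightarrow> sqrt (2 * pi)" using L by simp
 have "(\<lambda>n. 1 / (LINT s|lborel. h n s)) \<longlonglongrightarrow> 1 / sqrt (2 * pi)"
  by (intro tendsto_divide tendsto_const L') simp
 moreover have "\<forall>\<^sub>F n in sequentially. 1 / (LINT s|lborel. h n s) = std_gamma_density (m n) E 0"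
  unfolding eventually_sequentially
 proof (intro exI allI impI)
  fix n assume "N \<le> n"
  then have mn: "m n > 0" using N[of n] by simp
  have "1 = (LINT s|lborel. std_gamma_density (m n) 1 s)"
   using integral_std_gamma_density[OF mn, of 1 "\<lambda>_. 1"] integral_gamma_density[OF mn] by simp
  also have "\<dots> = (LINT s|lborel. std_gamma_density (m n) 1 0 * h n s)"
  proof (intro Bochner_Integration.integral_cong refl)
   fix s
   show "std_gamma_density (m n) 1 s = std_gamma_density (m n) 1 0 * h n s"
    using std_gamma_density_eq[OF mn, of 1 s] std_gamma_density_eq_0[OF mn, of 1 s] by (simp add: h_def)
  qed
  finally have e: "1 = std_gamma_density (m n) 1 0 * (LINT s|lborel. h n s)" by simp
  then have "(LINT s|lborel. h n s) \<noteq> 0" by auto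
  with e show "1 / (LINT s|lborel. h n s) = std_gamma_density (m n) E 0"
   unfolding std_gamma_density_at_0 by (simp add: field_simps)
 qed
 ultimately show ?thesis by (rule Lim_transform_eventually)
qed

text \<open>The skewness of the gamma law with shape \<open>k\<close> is twice the sign divided by \<open>sqrt k\<close>; the cubic factor in the normalization is the resulting correction of the normal tail.\<close>
lemma gamma_smoothed_tail:
 fixes d :: "nat \<Rightarrow> real" and A k g t :: real
 assumes d: "filterlim d at_top sequentially" and A: "A \<ge> 2" and k: "k > 0" and g: "g \<in> {1, -1}"
  and d4: "(\<lambda>n. d n ^ 4 / real n) \<longlonglongrightarrow> 0"
  and norm: "(\<lambda>n. P n * std_normal_density (d n) * exp (2 * g / sqrt k * d n ^ 3 / (6 * sqrt n)) / d n) \<longlonglongrightarrow> 1"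
 shows "(\<lambda>n. P n * enn2real (shift_avg (gamma_shift (g * A * d n / sqrt (n * k)) (n * k)) elogistic (A * (- (d n)\<^sup>2 - t))))
  \<longlonglongrightarrow> exp (- t) * smoothing_factor A"
proof -
 define m where "m n = real n * k" for n
 have g2: "g * g = 1" and g0: "g \<noteq> 0" using g by auto
 have m: "filterlim m at_top sequentially" unfolding m_def
  by (subst mult.commute) (intro filterlim_tendsto_pos_mult_at_top[OF tendsto_const k] filterlim_real_sequentially)
 have mpos: "\<forall>\<^sub>F n in sequentially. m n > 0" by (rule eventually_compose_filterlim[OF eventually_gt_at_top m])
 have m1: "\<forall>\<^sub>F n in sequentially. m n > 1" by (rule eventually_compose_filterlim[OF eventually_gt_at_top m])
 have dpos: "\<forall>\<^sub>F n in sequentially. d n > 0" by (rule eventually_compose_filterlim[OF eventually_gt_at_top d])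
 have sq: "filterlim (\<lambda>n. sqrt (m n)) at_top sequentially" by (rule filterlim_compose[OF sqrt_at_top m])
 define L where "L n s = (m n - 1) * ln (1 + s / sqrt (m n)) - sqrt (m n) * s" for n s
 have vd: "(\<lambda>n. v / d n) \<longlonglongrightarrow> 0" for v by (rule real_tendsto_divide_at_top[OF tendsto_const d])
 have s4: "(\<lambda>n. (g * (d n + v / d n)) ^ 4 / m n) \<longlonglongrightarrow> 0" for v
 proof -
  have "(\<lambda>n. (1 / k) * (d n ^ 4 / real n) * (1 + (v / d n) * (1 / d n)) ^ 4) \<longlonglongrightarrow> (1 / k) * 0 * (1 + 0 * 0) ^ 4"
   by (intro tendsto_mult tendsto_const d4 tendsto_power tendsto_add vd)
  then have "(\<lambda>n. (1 / k) * (d n ^ 4 / real n) * (1 + (v / d n) * (1 / d n)) ^ 4) \<longlonglongrightarrow> 0" by simp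
  moreover have "\<forall>\<^sub>F n in sequentially. (1 / k) * (d n ^ 4 / real n) * (1 + (v / d n) * (1 / d n)) ^ 4 = (g * (d n + v / d n)) ^ 4 / m n"
   using dpos
  proof eventually_elim
   case (elim n)
   have "d n + v / d n = d n * (1 + (v / d n) * (1 / d n))" using elim by (simp add: field_simps)
   moreover have "g ^ 4 = 1" using g by auto
   ultimately show ?case by (simp add: power_mult_distrib m_def)
  qed
  ultimately show ?thesis by (rule Lim_transform_eventually)
 qed
 have z0: "(\<lambda>n. g * (d n + v / d n) / sqrt (m n)) \<longlonglongrightarrow> 0" for v
 proof -
  have im: "(\<lambda>n. 1 / m n) \<longlonglongrightarrow> 0" by (rule real_tendsto_divide_at_top[OF tendsto_const m])
  have "(\<lambda>n. ((g * (d n + v / d n)) ^ 4 / m n) * (1 / m n)) \<longlonglongrightarrow> 0 * 0" by (intro tendsto_mult s4 im)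
  moreover have "\<forall>\<^sub>F n in sequentially. ((g * (d n + v / d n)) ^ 4 / m n) * (1 / m n) = (g * (d n + v / d n) / sqrt (m n)) ^ 4"
   using mpos
  proof eventually_elim
   case (elim n)
   have "sqrt (m n) ^ 4 = (sqrt (m n) ^ 2) ^ 2" by (simp only: power_mult[symmetric]) simp
   also have "\<dots> = m n * m n" using elim by (simp add: power2_eq_square)
   finally show ?case by (simp add: power_divide)
  qed
  ultimately have "(\<lambda>n. (g * (d n + v / d n) / sqrt (m n)) ^ 4) \<longlonglongrightarrow> 0 * 0" by (rule Lim_transform_eventually)
  then have "(\<lambda>n. root 4 ((g * (d n + v / d n) / sqrt (m n)) ^ 4)) \<longlonglongrightarrow> root 4 (0 * 0)" by (intro tendsto_intros)
  moreover have "root 4 (x ^ 4) = \<bar>x\<bar>" for x :: real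
   using real_root_power_cancel[of 4 "\<bar>x\<bar>"] by simp
  ultimately show ?thesis by (simp only: tendsto_rabs_zero_iff mult_zero_left real_root_zero)
 qed
 have zpos: "\<forall>\<^sub>F n in sequentially. 1 + g * (d n + v / d n) / sqrt (m n) > 0" for v
  using order_tendstoD(1)[OF z0, of "-1" v] by (auto elim: eventually_mono)
 have zpos0: "\<forall>\<^sub>F n in sequentially. 1 + g * d n / sqrt (m n) > 0" using zpos[of 0] by simp
 have exps: "(\<lambda>n. L n (g * (d n + v / d n)) - (- (g * (d n + v / d n))\<^sup>2 / 2 + (g * (d n + v / d n)) ^ 3 / (3 * sqrt (m n)))) \<longlonglongrightarrow> 0" for v
  unfolding L_def by (rule gamma_exponent_limit[OF m s4])
 define f where "f n = std_gamma_density (m n) g" for n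
 have feq: "f n s = std_gamma_density (m n) g 0 * exp (L n (g * s))" if "m n > 0" "1 + g * s / sqrt (m n) > 0" for n s
  unfolding f_def L_def using std_gamma_density_eq[OF that] .
 have C0: "(\<lambda>n. std_gamma_density (m n) g 0) \<longlonglongrightarrow> 1 / sqrt (2 * pi)" by (rule std_gamma_density_mode_limit[OF m])
 have Cpos: "\<forall>\<^sub>F n in sequentially. std_gamma_density (m n) g 0 > 0"
  using order_tendstoD(1)[OF C0, of 0] by simp
 define c where "c n = (1 + g * (1 / d n) * (1 / sqrt (m n))) / (1 + g * d n / sqrt (m n))" for n
 have main: "(\<lambda>n. P n * (LINT s|lborel. logistic (A * (d n * (s - d n) - t)) * f n s)) \<longlonglongrightarrow> exp (- t) * smoothing_factor A"
 proof (rule smoothed_tail_limit[OF d A, where c=c])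
  show "f n \<in> borel_measurable borel" for n unfolding f_def by measurable
  show "0 \<le> f n s" for n s
  proof (cases "n = 0")
   case True then show ?thesis by (simp add: f_def std_gamma_density_def m_def)
  next
   case False then show ?thesis unfolding f_def m_def using k by (intro std_gamma_density_nonneg) auto
  qed
  show "\<forall>\<^sub>F n in sequentially. 0 < f n (d n)"
   using mpos zpos0 Cpos by eventually_elim (simp add: feq)
  show "c \<longlonglongrightarrow> 1"
  proof -
   have "(\<lambda>n. (1 + g * (1 / d n) * (1 / sqrt (m n))) / (1 + g * (d n + 0 / d n) / sqrt (m n))) \<longlonglongrightarrow> (1 + g * 0 * 0) / (1 + 0)"
    by (intro tendsto_divide tendsto_add tendsto_mult tendsto_const vd z0 real_tendsto_divide_at_top[OF tendsto_const sq]) simp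
   then show ?thesis by (simp add: c_def[abs_def])
  qed
  show "(\<lambda>n. f n (d n + v / d n) / f n (d n)) \<longlonglongrightarrow> exp (- v)" for v
  proof -
   let ?Q = "\<lambda>n s. - s\<^sup>2 / 2 + s ^ 3 / (3 * sqrt (m n))"
   have e0: "(\<lambda>n. L n (g * d n) - ?Q n (g * d n)) \<longlonglongrightarrow> 0" using exps[of 0] by simp
   have dq: "(\<lambda>n. d n / sqrt (m n)) \<longlonglongrightarrow> 0"
   proof -
    have "(\<lambda>n. g * (g * (d n + 0 / d n) / sqrt (m n))) \<longlonglongrightarrow> g * 0" by (intro tendsto_mult tendsto_const z0)
    then show ?thesis using g2 by (simp add: mult.assoc[symmetric])
   qed
   have "(\<lambda>n. - v - (v / d n)\<^sup>2 / 2 + g * (v * (d n / sqrt (m n)) + v * (v / d n) * (1 / sqrt (m n)) + (v / d n) ^ 3 * (1 / sqrt (m n)) / 3))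
     \<longlonglongrightarrow> - v - 0\<^sup>2 / 2 + g * (v * 0 + v * 0 * 0 + 0 ^ 3 * 0 / 3)"
    by (intro tendsto_add tendsto_diff tendsto_divide tendsto_mult tendsto_power tendsto_const vd dq
      real_tendsto_divide_at_top[OF tendsto_const sq]) auto
   then have q: "(\<lambda>n. - v - (v / d n)\<^sup>2 / 2 + g * (v * (d n / sqrt (m n)) + v * (v / d n) * (1 / sqrt (m n)) + (v / d n) ^ 3 * (1 / sqrt (m n)) / 3))
     \<longlonglongrightarrow> - v" by simp
   have "\<forall>\<^sub>F n in sequentially. - v - (v / d n)\<^sup>2 / 2 + g * (v * (d n / sqrt (m n)) + v * (v / d n) * (1 / sqrt (m n)) + (v / d n) ^ 3 * (1 / sqrt (m n)) / 3)
     = ?Q n (g * (d n + v / d n)) - ?Q n (g * d n)"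
    using dpos mpos
   proof eventually_elim
    case (elim n)
    define r where "r = sqrt (m n)"
    have r: "r > 0" using elim by (simp add: r_def)
    have e3: "g ^ 3 = g" "g\<^sup>2 = 1" using g by auto
    show ?case unfolding r_def[symmetric] power_mult_distrib e3 using r elim(1)
     by (simp add: field_simps power2_eq_square power3_eq_cube)
   qed
   with q have "(\<lambda>n. ?Q n (g * (d n + v / d n)) - ?Q n (g * d n)) \<longlonglongrightarrow> - v" by (rule Lim_transform_eventually)
   then have "(\<lambda>n. (L n (g * (d n + v / d n)) - ?Q n (g * (d n + v / d n))) - (L n (g * d n) - ?Q n (g * d n))
     + (?Q n (g * (d n + v / d n)) - ?Q n (g * d n))) \<longlonglongrightarrow> 0 - 0 + (- v)"
    by (intro tendsto_add tendsto_diff exps e0)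
   then have "(\<lambda>n. L n (g * (d n + v / d n)) - L n (g * d n)) \<longlonglongrightarrow> - v" by (simp add: algebra_simps)
   then have "(\<lambda>n. exp (L n (g * (d n + v / d n)) - L n (g * d n))) \<longlonglongrightarrow> exp (- v)" by (rule tendsto_exp)
   moreover have "\<forall>\<^sub>F n in sequentially. exp (L n (g * (d n + v / d n)) - L n (g * d n)) = f n (d n + v / d n) / f n (d n)"
    using mpos zpos0 zpos[of v] Cpos by eventually_elim (simp add: feq exp_diff)
   ultimately show ?thesis by (rule Lim_transform_eventually)
  qed
  show "\<forall>\<^sub>F n in sequentially. \<forall>v. f n (d n + v / d n) \<le> f n (d n) * exp (- c n * v)"
   using m1 zpos0 Cpos dpos
  proof eventually_elim
   case (elim n)
   show ?case
   proof
    fix v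
    define r where "r = sqrt (m n)"
    have r: "r > 0" and mr: "m n = r * r" using elim by (auto simp: r_def)
    let ?b = "1 + g * (d n + v / d n) / r" and ?a = "1 + g * d n / r"
    have a: "?a > 0" using elim by (simp add: r_def)
    show "f n (d n + v / d n) \<le> f n (d n) * exp (- c n * v)"
    proof (cases "?b > 0")
     case True
     have "L n (g * (d n + v / d n)) - L n (g * d n) = (m n - 1) * (ln ?b - ln ?a) - r * (g * (v / d n))"
      unfolding L_def r_def by (simp add: algebra_simps)
     also have "\<dots> \<le> (m n - 1) * ((?b - ?a) / ?a) - r * (g * (v / d n))"
      using ln_tangent[OF a True] elim(1) by (intro diff_right_mono mult_left_mono) auto
     also have "\<dots> = - c n * v"
     proof -
      have ca: "c n * ?a = 1 + g * (1 / d n) * (1 / r)" unfolding c_def r_def[symmetric] using a by simp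
      have "((m n - 1) * ((?b - ?a) / ?a) - r * (g * (v / d n))) * ?a
        = (m n - 1) * (?b - ?a) - r * (g * (v / d n)) * ?a"
      proof -
       have gen: "(Y * (W / x) - Z) * x = Y * W - Z * x" if "x \<noteq> 0" for Y W Z x :: real
        using that by (simp add: left_diff_distrib)
       show ?thesis by (rule gen) (use a in linarith)
      qed
      also have "\<dots> = - (1 + g * (1 / d n) * (1 / r)) * v"
      proof -
       have "r * (g * (v / d n)) * (g * d n / r) = (g * g) * v" using r elim(4) by (simp add: field_simps)
       then have 1: "r * (g * (v / d n)) * ?a = r * (g * (v / d n)) + v" using g2 by (simp add: distrib_left)
       have 2: "(m n - 1) * (?b - ?a) = r * (g * (v / d n)) - g * (1 / d n) * (1 / r) * v"
       proof -
        have ba: "?b - ?a = g * (v / d n) / r" by (simp add: distrib_left add_divide_distrib)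
        show ?thesis unfolding mr ba using r elim(4) by (simp add: field_simps)
       qed
       show ?thesis unfolding 1 2 by (simp add: algebra_simps)
      qed
      also have "\<dots> = (- c n * v) * ?a" unfolding ca[symmetric] by simp
      finally have eqa: "((m n - 1) * ((?b - ?a) / ?a) - r * (g * (v / d n))) * ?a = (- c n * v) * ?a" .
      have "?a \<noteq> 0" using a by linarith
      from mult_right_cancel[OF this, THEN iffD1, OF eqa] show ?thesis .
     qed
     finally have "exp (L n (g * (d n + v / d n))) \<le> exp (L n (g * d n)) * exp (- c n * v)"
      by (simp add: exp_add[symmetric])
     then show ?thesis
      using feq[of n "d n + v / d n"] feq[of n "d n"] True a elim by (simp add: r_def mult.assoc)
    next
     case False
     then have "f n (d n + v / d n) = 0" unfolding f_def using elim(1)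
      by (intro std_gamma_density_eq_0) (auto simp: r_def)
     then show ?thesis using feq[of n "d n"] a elim by (simp add: r_def)
    qed
   qed
  qed
  show "(\<lambda>n. P n * f n (d n) / d n) \<longlonglongrightarrow> 1"
  proof -
   have e0: "(\<lambda>n. L n (g * d n) - (- (g * d n)\<^sup>2 / 2 + (g * d n) ^ 3 / (3 * sqrt (m n)))) \<longlonglongrightarrow> 0" using exps[of 0] by simp
   have "(\<lambda>n. (P n * std_normal_density (d n) * exp (2 * g / sqrt k * d n ^ 3 / (6 * sqrt n)) / d n)
     * ((sqrt (2 * pi) * std_gamma_density (m n) g 0) * exp (L n (g * d n) - (- (g * d n)\<^sup>2 / 2 + (g * d n) ^ 3 / (3 * sqrt (m n))))))
     \<longlonglongrightarrow> 1 * ((sqrt (2 * pi) * (1 / sqrt (2 * pi))) * exp 0)"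
    by (intro tendsto_mult norm tendsto_const C0 tendsto_exp e0)
   then have "(\<lambda>n. (P n * std_normal_density (d n) * exp (2 * g / sqrt k * d n ^ 3 / (6 * sqrt n)) / d n)
     * ((sqrt (2 * pi) * std_gamma_density (m n) g 0) * exp (L n (g * d n) - (- (g * d n)\<^sup>2 / 2 + (g * d n) ^ 3 / (3 * sqrt (m n))))))
     \<longlonglongrightarrow> 1" by simp
   moreover have "\<forall>\<^sub>F n in sequentially. (P n * std_normal_density (d n) * exp (2 * g / sqrt k * d n ^ 3 / (6 * sqrt n)) / d n)
     * ((sqrt (2 * pi) * std_gamma_density (m n) g 0) * exp (L n (g * d n) - (- (g * d n)\<^sup>2 / 2 + (g * d n) ^ 3 / (3 * sqrt (m n)))))
     = P n * f n (d n) / d n"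
    using mpos zpos0
   proof eventually_elim
    case (elim n)
    have e3: "(g * d n) ^ 3 = g * d n ^ 3" "(g * d n)\<^sup>2 = (d n)\<^sup>2" using g by (auto simp: power_mult_distrib)
    have n: "2 * g / sqrt k * d n ^ 3 / (6 * sqrt n) = (g * d n) ^ 3 / (3 * sqrt (m n))"
     unfolding e3 m_def real_sqrt_mult by simp
    let ?E = "exp ((g * d n) ^ 3 / (3 * sqrt (m n)))"
    let ?X = "exp (L n (g * d n) - (- (g * d n)\<^sup>2 / 2 + (g * d n) ^ 3 / (3 * sqrt (m n))))"
    have "P n * std_normal_density (d n) * ?E / d n * ((sqrt (2 * pi) * std_gamma_density (m n) g 0) * ?X)
      = P n * (std_gamma_density (m n) g 0 * ((std_normal_density (d n) * sqrt (2 * pi)) * ?E * ?X)) / d n"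
     by (simp only: times_divide_eq_left times_divide_eq_right mult_ac)
    also have "std_normal_density (d n) * sqrt (2 * pi) = exp (- (d n)\<^sup>2 / 2)" by (simp add: std_normal_density_def)
    also have "exp (- (d n)\<^sup>2 / 2) * ?E * ?X = exp (L n (g * d n))"
     unfolding e3 by (simp add: exp_add[symmetric])
    also have "std_gamma_density (m n) g 0 * exp (L n (g * d n)) = f n (d n)" using feq elim by simp
    finally show ?case unfolding n .
   qed
   ultimately show ?thesis by (rule Lim_transform_eventually)
  qed
 qed
 have "\<forall>\<^sub>F n in sequentially. P n * (LINT s|lborel. logistic (A * (d n * (s - d n) - t)) * f n s)
  = P n * enn2real (shift_avg (gamma_shift (g * A * d n / sqrt (n * k)) (n * k)) elogistic (A * (- (d n)\<^sup>2 - t)))"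
  using mpos
 proof eventually_elim
  case (elim n)
  define c0 where "c0 = g * A * d n / sqrt (m n)"
  have "enn2real (shift_avg (gamma_shift c0 (m n)) elogistic (A * (- (d n)\<^sup>2 - t)))
    = (LINT y|lborel. logistic (A * (- (d n)\<^sup>2 - t) + c0 * (y - m n)) * gamma_density (m n) y)"
   unfolding gamma_shift_def
   by (rule shift_avg_logistic_density[OF _ _ gamma_density_nonneg[OF elim] prob_space_gamma[OF elim]]) measurable
  also have "\<dots> = (LINT s|lborel. logistic (A * (- (d n)\<^sup>2 - t) + c0 * ((m n + g * sqrt (m n) * s) - m n)) * std_gamma_density (m n) g s)"
   by (rule integral_std_gamma_density[OF elim g]) measurable
  also have "\<dots> = (LINT s|lborel. logistic (A * (d n * (s - d n) - t)) * f n s)"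
  proof -
   have "c0 * ((m n + g * sqrt (m n) * s) - m n) = (g * g) * (A * d n * s)" for s
    using elim by (simp add: c0_def)
   then have "A * (- (d n)\<^sup>2 - t) + c0 * ((m n + g * sqrt (m n) * s) - m n) = A * (d n * (s - d n) - t)" for s
    unfolding g2 by (simp add: power2_eq_square algebra_simps)
   then show ?thesis by (simp only: f_def)
  qed
  finally show ?case by (simp add: c0_def m_def)
 qed
 with main show ?thesis by (rule Lim_transform_eventually)
qed

section \<open>A correlated normal pair\<close>

lemma power_le_fact_exp:
 fixes x :: real
 assumes "x \<ge> 0"
 shows "x ^ k \<le> fact k * exp x"
proof -
 have "x ^ k / fact k = (\<Sum>i\<in>{k}. inverse (fact i) * x ^ i)"
  by (simp add: divide_inverse mult.commute)
 also have "\<dots> \<le> (\<Sum>i. inverse (fact i) * x ^ i)"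
  using assms by (intro sum_le_suminf summable_exp) auto
 also have "\<dots> = exp x" by (simp add: exp_def)
 finally show ?thesis by (simp add: divide_le_eq mult.commute)
qed

abbreviation std_normal :: "real measure"
 where "std_normal \<equiv> density lborel std_normal_density"

lemma prob_space_std_normal: "prob_space std_normal"
 by (rule prob_space_normal_density) simp

lemma integrable_std_normal_exp:
 "integrable std_normal (\<lambda>x. \<bar>x\<bar> ^ k * exp (c * \<bar>x\<bar>))"
proof -
 have bound: "\<bar>x\<bar> ^ k * exp (c * \<bar>x\<bar>) * std_normal_density x \<le> fact k * exp ((c + 2)\<^sup>2 / 2) * exp (- 1 * \<bar>x\<bar>)" for x :: real
 proof -
  have "\<bar>x\<bar> ^ k * exp (c * \<bar>x\<bar>) * std_normal_density x \<le> (fact k * exp \<bar>x\<bar>) * exp (c * \<bar>x\<bar>) * exp (- x\<^sup>2 / 2)"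
  proof (intro mult_mono power_le_fact_exp)
   have "1 / sqrt (2 * pi) \<le> 1" using pi_gt3 by (simp add: divide_le_eq_1)
   then show "std_normal_density x \<le> exp (- x\<^sup>2 / 2)"
    unfolding std_normal_density_def by (intro mult_left_le_one_le) auto
  qed auto
  also have "\<dots> = fact k * exp ((c + 1) * \<bar>x\<bar> - x\<^sup>2 / 2)"
   by (simp add: exp_add[symmetric] mult.assoc algebra_simps)
  also have "(c + 1) * \<bar>x\<bar> - x\<^sup>2 / 2 \<le> (c + 2)\<^sup>2 / 2 - \<bar>x\<bar>"
  proof -
   have "0 \<le> (\<bar>x\<bar> - (c + 2))\<^sup>2" by simp
   then have "2 * ((c + 2) * \<bar>x\<bar>) \<le> x\<^sup>2 + (c + 2)\<^sup>2" by (simp add: power2_eq_square algebra_simps)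
   then show ?thesis by (simp add: algebra_simps)
  qed
  finally have "\<bar>x\<bar> ^ k * exp (c * \<bar>x\<bar>) * std_normal_density x \<le> fact k * exp ((c + 2)\<^sup>2 / 2 - \<bar>x\<bar>)"
   by simp
  also have "exp ((c + 2)\<^sup>2 / 2 - \<bar>x\<bar>) = exp ((c + 2)\<^sup>2 / 2) * exp (- 1 * \<bar>x\<bar>)"
   by (simp add: exp_add[symmetric])
  finally show ?thesis by (simp only: mult.assoc)
 qed
 have "integrable lborel (\<lambda>x. std_normal_density x *\<^sub>R (\<bar>x\<bar> ^ k * exp (c * \<bar>x\<bar>)))"
 proof (rule Bochner_Integration.integrable_bound)
  show "integrable lborel (\<lambda>x::real. fact k * exp ((c + 2)\<^sup>2 / 2) * exp (- 1 * \<bar>x\<bar>))"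
   by (intro integrable_mult_right integrable_exp_neg_abs) simp
  show "AE x in lborel. norm (std_normal_density x *\<^sub>R (\<bar>x\<bar> ^ k * exp (c * \<bar>x\<bar>))) \<le> norm (fact k * exp ((c + 2)\<^sup>2 / 2) * exp (- 1 * \<bar>x\<bar>))"
   using bound by (intro AE_I2) (simp add: abs_mult mult_ac normal_density_nonneg)
 qed measurable
 then show ?thesis by (subst integrable_density) (auto simp: normal_density_nonneg)
qed

lemma std_normal_moments:
 shows "integrable std_normal (\<lambda>x. x)" "(LINT x|std_normal. x) = 0"
  "integrable std_normal (\<lambda>x. x\<^sup>2)" "(LINT x|std_normal. x\<^sup>2) = 1"
  "integrable std_normal (\<lambda>x. x ^ 3)" "(LINT x|std_normal. x ^ 3) = 0"
 using integrable_std_normal_moment[of 1] integrable_std_normal_moment[of 2] integrable_std_normal_moment[of 3]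
  integral_std_normal_moment_odd[of 0] integral_std_normal_moment_even[of 1] integral_std_normal_moment_odd[of 1]
 by (simp_all add: integrable_density integral_density normal_density_nonneg numeral_3_eq_3)

lemma prob_space_pair_marginals:
 assumes P: "prob_space P" and Q: "prob_space Q"
 shows "prob_space (P \<Otimes>\<^sub>M Q)" "distr (P \<Otimes>\<^sub>M Q) P fst = P" "distr (P \<Otimes>\<^sub>M Q) Q snd = Q"
proof -
 interpret P: prob_space P by fact
 interpret Q: prob_space Q by fact
 interpret PQ: pair_prob_space P Q ..
 show ps: "prob_space (P \<Otimes>\<^sub>M Q)" by (rule PQ.prob_space_axioms)
 show f: "distr (P \<Otimes>\<^sub>M Q) P fst = P" by (rule Q.distr_pair_fst)
 show s: "distr (P \<Otimes>\<^sub>M Q) Q snd = Q"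
 proof -
  interpret QP: pair_prob_space Q P ..
  have "distr (P \<Otimes>\<^sub>M Q) Q snd = distr (distr (Q \<Otimes>\<^sub>M P) (P \<Otimes>\<^sub>M Q) (\<lambda>(x, y). (y, x))) Q snd"
   using PQ.distr_pair_swap by simp
  also have "\<dots> = distr (Q \<Otimes>\<^sub>M P) Q fst"
   by (subst distr_distr) (auto simp: o_def case_prod_beta intro!: distr_cong)
  also have "\<dots> = Q" by (rule P.distr_pair_fst)
  finally show ?thesis .
 qed
qed

lemma indep_var_fst_snd:
 fixes f :: "'a \<Rightarrow> real" and g :: "'b \<Rightarrow> real"
 assumes P: "prob_space P" and Q: "prob_space Q"
  and [measurable]: "f \<in> borel_measurable P" "g \<in> borel_measurable Q"
 shows "prob_space.indep_var (P \<Otimes>\<^sub>M Q) borel (\<lambda>x. f (fst x)) borel (\<lambda>x. g (snd x))"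
proof -
 note m = prob_space_pair_marginals[OF P Q]
 interpret G: prob_space "distr Q borel g" by (rule prob_space.prob_space_distr[OF Q]) measurable
 have f: "distr (P \<Otimes>\<^sub>M Q) borel (\<lambda>x. f (fst x)) = distr P borel f"
  using distr_distr[of f P borel fst "P \<Otimes>\<^sub>M Q"] m(2) by (simp add: o_def)
 have g: "distr (P \<Otimes>\<^sub>M Q) borel (\<lambda>x. g (snd x)) = distr Q borel g"
  using distr_distr[of g Q borel snd "P \<Otimes>\<^sub>M Q"] m(3) by (simp add: o_def)
 have "distr P borel f \<Otimes>\<^sub>M distr Q borel g = distr (P \<Otimes>\<^sub>M Q) (borel \<Otimes>\<^sub>M borel) (\<lambda>(x, y). (f x, g y))"
  by (rule pair_measure_distr) (measurable, rule G.sigma_finite_measure_axioms)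
 then show ?thesis
  by (subst prob_space.indep_var_distribution_eq[OF m(1)]) (simp add: f g case_prod_unfold)
qed

abbreviation normal3 :: "(real \<times> real \<times> real) measure"
 where "normal3 \<equiv> std_normal \<Otimes>\<^sub>M (std_normal \<Otimes>\<^sub>M std_normal)"

lemma prob_space_normal3: "prob_space normal3"
 by (intro prob_space_pair_marginals(1) prob_space_std_normal)

lemma normal3_coord:
 fixes h :: "real \<Rightarrow> real"
 assumes [measurable]: "h \<in> borel_measurable borel" and h: "integrable std_normal h"
 shows "integrable normal3 (\<lambda>x. h (fst x))" "(LINT x|normal3. h (fst x)) = (LINT x|std_normal. h x)"
  "integrable normal3 (\<lambda>x. h (fst (snd x)))" "(LINT x|normal3. h (fst (snd x))) = (LINT x|std_normal. h x)"
  "integrable normal3 (\<lambda>x. h (snd (snd x)))" "(LINT x|normal3. h (snd (snd x))) = (LINT x|std_normal. h x)"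
proof -
 note S = prob_space_std_normal
 note S2 = prob_space_pair_marginals[OF S S]
 note S3 = prob_space_pair_marginals[OF S S2(1)]
 have d1: "distr normal3 std_normal fst = std_normal" by (rule S3)
 have d2: "distr normal3 std_normal (fst \<circ> snd) = std_normal"
  by (subst distr_distr[symmetric, where N="std_normal \<Otimes>\<^sub>M std_normal"]) (simp_all add: S3(3) S2(2))
 have d3: "distr normal3 std_normal (snd \<circ> snd) = std_normal"
  by (subst distr_distr[symmetric, where N="std_normal \<Otimes>\<^sub>M std_normal"]) (simp_all add: S3(3) S2(3))
 have *: "integrable normal3 (\<lambda>x. h (f x)) \<and> (LINT x|normal3. h (f x)) = (LINT x|std_normal. h x)"
  if d: "distr normal3 std_normal f = std_normal" and [measurable]: "f \<in> measurable normal3 std_normal" for f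
 proof
  have hm: "h \<in> borel_measurable std_normal" by simp
  show "integrable normal3 (\<lambda>x. h (f x))"
   using integrable_distr_eq[OF that(2) hm] h d by simp
  show "(LINT x|normal3. h (f x)) = (LINT x|std_normal. h x)"
   using integral_distr[OF that(2) hm] d by simp
 qed
 show "integrable normal3 (\<lambda>x. h (fst x))" "(LINT x|normal3. h (fst x)) = (LINT x|std_normal. h x)"
  using *[OF d1] by auto
 show "integrable normal3 (\<lambda>x. h (fst (snd x)))" "(LINT x|normal3. h (fst (snd x))) = (LINT x|std_normal. h x)"
  using *[OF d2] by auto
 show "integrable normal3 (\<lambda>x. h (snd (snd x)))" "(LINT x|normal3. h (snd (snd x))) = (LINT x|std_normal. h x)"
  using *[OF d3] by auto
qed

lemma normal3_products:
 shows "integrable normal3 (\<lambda>x. fst x * fst (snd x))" "(LINT x|normal3. fst x * fst (snd x)) = 0"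
  "integrable normal3 (\<lambda>x. fst x * snd (snd x))" "(LINT x|normal3. fst x * snd (snd x)) = 0"
  "integrable normal3 (\<lambda>x. fst (snd x) * snd (snd x))" "(LINT x|normal3. fst (snd x) * snd (snd x)) = 0"
proof -
 note S = prob_space_std_normal
 note S2 = prob_space_pair_marginals[OF S S]
 note S3 = prob_space_pair_marginals[OF S S2(1)]
 interpret N: prob_space normal3 by (rule prob_space_normal3)
 interpret N2: prob_space "std_normal \<Otimes>\<^sub>M std_normal" by (rule S2)
 have im: "(\<lambda>x::real. x) \<in> borel_measurable borel" by measurable
 note id = normal3_coord[OF im std_normal_moments(1), unfolded std_normal_moments(2)]
 have i1: "N.indep_var borel (\<lambda>x. fst x) borel (\<lambda>x. fst (snd x))"
  by (rule indep_var_fst_snd[OF S S2(1), of "\<lambda>x. x" fst]) measurable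
 have i2: "N.indep_var borel (\<lambda>x. fst x) borel (\<lambda>x. snd (snd x))"
  by (rule indep_var_fst_snd[OF S S2(1), of "\<lambda>x. x" snd]) measurable
 have i3: "N2.indep_var borel (\<lambda>x. fst x) borel (\<lambda>x. snd x)"
  by (rule indep_var_fst_snd[OF S S, of "\<lambda>x. x" "\<lambda>x. x"]) measurable
 show "integrable normal3 (\<lambda>x. fst x * fst (snd x))" by (rule N.indep_var_integrable[OF i1 id(1) id(3)])
 show "(LINT x|normal3. fst x * fst (snd x)) = 0" unfolding N.indep_var_lebesgue_integral[OF i1 id(1) id(3)] id(2) by (rule mult_zero_left)
 show "integrable normal3 (\<lambda>x. fst x * snd (snd x))" by (rule N.indep_var_integrable[OF i2 id(1) id(5)])
 show "(LINT x|normal3. fst x * snd (snd x)) = 0" unfolding N.indep_var_lebesgue_integral[OF i2 id(1) id(5)] id(2) by (rule mult_zero_left)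
 have j1: "integrable (std_normal \<Otimes>\<^sub>M std_normal) (\<lambda>x. fst x)"
 proof -
  have "integrable (distr (std_normal \<Otimes>\<^sub>M std_normal) std_normal fst) (\<lambda>x. x)"
   unfolding S2(2) by (rule std_normal_moments(1))
  then show ?thesis by (rule integrable_distr[OF measurable_fst])
 qed
 have j2: "integrable (std_normal \<Otimes>\<^sub>M std_normal) (\<lambda>x. snd x)"
 proof -
  have "integrable (distr (std_normal \<Otimes>\<^sub>M std_normal) std_normal snd) (\<lambda>x. x)"
   unfolding S2(3) by (rule std_normal_moments(1))
  then show ?thesis by (rule integrable_distr[OF measurable_snd])
 qed
 have j3: "(LINT x|(std_normal \<Otimes>\<^sub>M std_normal). fst x) = 0"
 proof -
  have "(LINT x|distr (std_normal \<Otimes>\<^sub>M std_normal) std_normal fst. x) = (LINT x|(std_normal \<Otimes>\<^sub>M std_normal). fst x)"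
   by (rule integral_distr) measurable
  then show ?thesis unfolding S2(2) std_normal_moments(2) by (rule sym)
 qed
 let ?h = "\<lambda>x::real\<times>real. fst x * snd x"
 have h1: "integrable (std_normal \<Otimes>\<^sub>M std_normal) ?h"
  by (rule N2.indep_var_integrable[OF i3 j1 j2])
 have h2: "(LINT x|(std_normal \<Otimes>\<^sub>M std_normal). ?h x) = 0"
  unfolding N2.indep_var_lebesgue_integral[OF i3 j1 j2] j3 by (rule mult_zero_left)
 have "integrable (distr normal3 (std_normal \<Otimes>\<^sub>M std_normal) snd) ?h"
  unfolding S3(3) by (rule h1)
 then show "integrable normal3 (\<lambda>x. fst (snd x) * snd (snd x))"
  by (rule integrable_distr[OF measurable_snd])
 have "(LINT x|distr normal3 (std_normal \<Otimes>\<^sub>M std_normal) snd. ?h x) = (LINT x|normal3. fst (snd x) * snd (snd x))"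
  by (rule integral_distr) measurable
 then show "(LINT x|normal3. fst (snd x) * snd (snd x)) = 0" unfolding S3(3) h2 by (rule sym)
qed

text \<open>Together with \<open>corr2\<close>, a normal pair of correlation \<open>\<rho>\<close>: a common coordinate and two private ones. This needs \<open>\<rho> \<ge> 0\<close>.\<close>
definition corr1 :: "real \<Rightarrow> real \<times> real \<times> real \<Rightarrow> real"
 where "corr1 \<rho> x = sqrt \<rho> * fst x + sqrt (1 - \<rho>) * fst (snd x)"

definition corr2 :: "real \<Rightarrow> real \<times> real \<times> real \<Rightarrow> real"
 where "corr2 \<rho> x = sqrt \<rho> * fst x + sqrt (1 - \<rho>) * snd (snd x)"

lemma corr_measurable [measurable]: "corr1 \<rho> \<in> borel_measurable normal3" "corr2 \<rho> \<in> borel_measurable normal3"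
 unfolding corr1_def[abs_def] corr2_def[abs_def] by measurable

lemma corr_moments:
 assumes "0 \<le> \<rho>" "\<rho> \<le> 1"
 shows "integrable normal3 (corr1 \<rho>)" "integrable normal3 (corr2 \<rho>)"
  "integrable normal3 (\<lambda>x. (corr1 \<rho> x)\<^sup>2)" "integrable normal3 (\<lambda>x. (corr2 \<rho> x)\<^sup>2)"
  "integrable normal3 (\<lambda>x. corr1 \<rho> x * corr2 \<rho> x)"
  "(LINT x|normal3. corr1 \<rho> x) = 0" "(LINT x|normal3. corr2 \<rho> x) = 0"
  "(LINT x|normal3. (corr1 \<rho> x)\<^sup>2) = 1" "(LINT x|normal3. (corr2 \<rho> x)\<^sup>2) = 1"
  "(LINT x|normal3. corr1 \<rho> x * corr2 \<rho> x) = \<rho>"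
proof -
 define q e where "q = sqrt \<rho>" and "e = sqrt (1 - \<rho>)"
 have q: "q * q = \<rho>" "e * e = 1 - \<rho>" using assms by (auto simp: q_def e_def)
 have c: "corr1 \<rho> x = q * fst x + e * fst (snd x)" "corr2 \<rho> x = q * fst x + e * snd (snd x)" for x
  by (simp_all add: corr1_def corr2_def q_def e_def)
 have im: "(\<lambda>x::real. x) \<in> borel_measurable borel" "(\<lambda>x::real. x\<^sup>2) \<in> borel_measurable borel" by measurable
 note id = normal3_coord[OF im(1) std_normal_moments(1), unfolded std_normal_moments(2)]
  and sq = normal3_coord[OF im(2) std_normal_moments(3), unfolded std_normal_moments(4)]
 have e1: "(corr1 \<rho> x)\<^sup>2 = (q * q) * (fst x)\<^sup>2 + (e * e) * (fst (snd x))\<^sup>2 + (2 * q * e) * (fst x * fst (snd x))" for x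
  unfolding c by (simp add: power2_eq_square algebra_simps)
 have e2: "(corr2 \<rho> x)\<^sup>2 = (q * q) * (fst x)\<^sup>2 + (e * e) * (snd (snd x))\<^sup>2 + (2 * q * e) * (fst x * snd (snd x))" for x
  unfolding c by (simp add: power2_eq_square algebra_simps)
 have e3: "corr1 \<rho> x * corr2 \<rho> x = (q * q) * (fst x)\<^sup>2 + (q * e) * (fst x * fst (snd x)) + (q * e) * (fst x * snd (snd x)) + (e * e) * (fst (snd x) * snd (snd x))" for x
  unfolding c by (simp add: power2_eq_square algebra_simps)
 have lin: "(\<lambda>x. corr1 \<rho> x) = (\<lambda>x. q * fst x + e * fst (snd x))" "(\<lambda>x. corr2 \<rho> x) = (\<lambda>x. q * fst x + e * snd (snd x))"
  unfolding c by simp_all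
 have i1: "integrable normal3 (\<lambda>x. q * fst x + e * fst (snd x))" "integrable normal3 (\<lambda>x. q * fst x + e * snd (snd x))"
  by (intro Bochner_Integration.integrable_add integrable_mult_right id)+
 show "integrable normal3 (corr1 \<rho>)" "integrable normal3 (corr2 \<rho>)"
  using i1 unfolding lin[symmetric] by simp_all
 show "(LINT x|normal3. corr1 \<rho> x) = 0"
  unfolding c using id by (subst Bochner_Integration.integral_add) simp_all
 show "(LINT x|normal3. corr2 \<rho> x) = 0"
  unfolding c using id by (subst Bochner_Integration.integral_add) simp_all
 show "integrable normal3 (\<lambda>x. (corr1 \<rho> x)\<^sup>2)" "integrable normal3 (\<lambda>x. (corr2 \<rho> x)\<^sup>2)" "integrable normal3 (\<lambda>x. corr1 \<rho> x * corr2 \<rho> x)"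
  unfolding e1 e2 e3
  by (intro Bochner_Integration.integrable_add integrable_mult_right sq normal3_products)+
 have lin3: "(LINT x|normal3. a * f x + b * g x + c' * h x) = a * (LINT x|normal3. f x) + b * (LINT x|normal3. g x) + c' * (LINT x|normal3. h x)"
  if "integrable normal3 f" "integrable normal3 g" "integrable normal3 h" for a b c' and f g h :: "real \<times> real \<times> real \<Rightarrow> real"
  using that by (simp add: Bochner_Integration.integral_add)
 have lin4: "(LINT x|normal3. a * f x + b * g x + c' * h x + d' * k x)
   = a * (LINT x|normal3. f x) + b * (LINT x|normal3. g x) + c' * (LINT x|normal3. h x) + d' * (LINT x|normal3. k x)"
  if "integrable normal3 f" "integrable normal3 g" "integrable normal3 h" "integrable normal3 k" for a b c' d' and f g h k :: "real \<times> real \<times> real \<Rightarrow> real"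
  using that by (simp add: Bochner_Integration.integral_add)
 show "(LINT x|normal3. (corr1 \<rho> x)\<^sup>2) = 1"
  unfolding e1 lin3[OF sq(1) sq(3) normal3_products(1)] sq normal3_products q by simp
 show "(LINT x|normal3. (corr2 \<rho> x)\<^sup>2) = 1"
  unfolding e2 lin3[OF sq(1) sq(5) normal3_products(3)] sq normal3_products q by simp
 show "(LINT x|normal3. corr1 \<rho> x * corr2 \<rho> x) = \<rho>"
  unfolding e3 lin4[OF sq(1) normal3_products(1) normal3_products(3) normal3_products(5)] sq normal3_products q by simp
qed

lemma nn_integral_normal3:
 assumes [measurable]: "h \<in> borel_measurable normal3"
 shows "(\<integral>\<^sup>+x. h x \<partial>normal3) = (\<integral>\<^sup>+x. \<integral>\<^sup>+y. \<integral>\<^sup>+z. h (x, y, z) \<partial>std_normal \<partial>std_normal \<partial>std_normal)"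
proof -
 interpret S: prob_space std_normal by (rule prob_space_std_normal)
 interpret S2: prob_space "std_normal \<Otimes>\<^sub>M std_normal"
  by (rule prob_space_pair_marginals(1)[OF prob_space_std_normal prob_space_std_normal])
 have "(\<integral>\<^sup>+x. h x \<partial>normal3) = (\<integral>\<^sup>+x. \<integral>\<^sup>+w. h (x, w) \<partial>(std_normal \<Otimes>\<^sub>M std_normal) \<partial>std_normal)"
  by (rule S2.nn_integral_fst[symmetric]) measurable
 also have "\<dots> = (\<integral>\<^sup>+x. \<integral>\<^sup>+y. \<integral>\<^sup>+z. h (x, y, z) \<partial>std_normal \<partial>std_normal \<partial>std_normal)"
 proof (rule nn_integral_cong)
  fix x
  show "(\<integral>\<^sup>+w. h (x, w) \<partial>(std_normal \<Otimes>\<^sub>M std_normal)) = (\<integral>\<^sup>+y. \<integral>\<^sup>+z. h (x, y, z) \<partial>std_normal \<partial>std_normal)"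
   by (rule S.nn_integral_fst[symmetric]) measurable
 qed
 finally show ?thesis .
qed

lemma shift_avg_normal_shift:
 assumes [measurable]: "g \<in> borel_measurable borel"
 shows "shift_avg (normal_shift v) g s = (\<integral>\<^sup>+x. g (s + x *\<^sub>R v) \<partial>std_normal)"
 unfolding shift_avg_def normal_shift_def by (rule nn_integral_distr) measurable

definition corr_shift :: "real \<Rightarrow> real \<Rightarrow> (real \<times> real) measure"
 where "corr_shift \<rho> a = distr normal3 borel (\<lambda>x. (a * corr1 \<rho> x, a * corr2 \<rho> x))"

lemma corr_pair_measurable: "(\<lambda>x. (a * corr1 \<rho> x, a * corr2 \<rho> x)) \<in> borel_measurable normal3"
 by (intro borel_measurable_Pair borel_measurable_times corr_measurable borel_measurable_const)

lemma borel_prob_corr_shift: "borel_prob (corr_shift \<rho> a)"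
 unfolding corr_shift_def by (intro borel_prob_distr prob_space_normal3 corr_pair_measurable)

lemma shift_avg_corr_shift:
 assumes g: "g \<in> borel_measurable borel"
 shows "shift_avg (corr_shift \<rho> a) g = shift_avg (normal_shift (a *\<^sub>R (sqrt \<rho>, sqrt \<rho>)))
  (shift_avg (normal_shift (a *\<^sub>R (sqrt (1 - \<rho>), 0))) (shift_avg (normal_shift (a *\<^sub>R (0, sqrt (1 - \<rho>)))) g))"
proof
 fix s
 note [measurable] = g corr_pair_measurable
 let ?h = "\<lambda>x. (a * corr1 \<rho> x, a * corr2 \<rho> x)"
 have 1: "shift_avg (normal_shift v) g \<in> borel_measurable borel" for v
  by (rule shift_avg_measurable[OF borel_prob_normal_shift g])
 have 2: "shift_avg (normal_shift w) (shift_avg (normal_shift v) g) \<in> borel_measurable borel" for v w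
  by (rule shift_avg_measurable[OF borel_prob_normal_shift 1])
 have "shift_avg (corr_shift \<rho> a) g s = (\<integral>\<^sup>+x. g (s + ?h x) \<partial>normal3)"
  unfolding shift_avg_def corr_shift_def by (rule nn_integral_distr) measurable
 also have "\<dots> = (\<integral>\<^sup>+x. \<integral>\<^sup>+y. \<integral>\<^sup>+z. g (s + ?h (x, y, z)) \<partial>std_normal \<partial>std_normal \<partial>std_normal)"
  by (rule nn_integral_normal3) measurable
 also have "\<dots> = (\<integral>\<^sup>+x. \<integral>\<^sup>+y. \<integral>\<^sup>+z. g (s + x *\<^sub>R a *\<^sub>R (sqrt \<rho>, sqrt \<rho>) + y *\<^sub>R a *\<^sub>R (sqrt (1 - \<rho>), 0) + z *\<^sub>R a *\<^sub>R (0, sqrt (1 - \<rho>)))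
   \<partial>std_normal \<partial>std_normal \<partial>std_normal)"
 proof -
  have eq: "s + ?h (x, y, z) = s + x *\<^sub>R a *\<^sub>R (sqrt \<rho>, sqrt \<rho>) + y *\<^sub>R a *\<^sub>R (sqrt (1 - \<rho>), 0) + z *\<^sub>R a *\<^sub>R (0, sqrt (1 - \<rho>))" for x y z
   by (cases s) (simp add: corr1_def corr2_def algebra_simps)
  show ?thesis by (intro nn_integral_cong arg_cong[where f=g] eq)
 qed
 also have "\<dots> = shift_avg (normal_shift (a *\<^sub>R (sqrt \<rho>, sqrt \<rho>)))
  (shift_avg (normal_shift (a *\<^sub>R (sqrt (1 - \<rho>), 0))) (shift_avg (normal_shift (a *\<^sub>R (0, sqrt (1 - \<rho>)))) g)) s"
  by (simp only: shift_avg_normal_shift[OF 2] shift_avg_normal_shift[OF 1] shift_avg_normal_shift[OF g])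
 finally show "shift_avg (corr_shift \<rho> a) g s = \<dots>" .
qed

lemma shift_avg_pow_product:
 assumes b: "borel_prob m0" "borel_prob m1" "borel_prob m2" and g: "g \<in> borel_measurable borel"
  and eq: "\<And>h. h \<in> borel_measurable borel \<Longrightarrow> shift_avg \<nu> h = shift_avg m0 (shift_avg m1 (shift_avg m2 h))"
 shows "(shift_avg \<nu> ^^ n) g = (shift_avg m0 ^^ n) ((shift_avg m1 ^^ n) ((shift_avg m2 ^^ n) g))"
proof (induction n)
 case (Suc n)
 note m = shift_avg_pow_measurable shift_avg_measurable b g
 have "(shift_avg \<nu> ^^ Suc n) g = shift_avg m0 (shift_avg m1 (shift_avg m2 ((shift_avg m0 ^^ n) ((shift_avg m1 ^^ n) ((shift_avg m2 ^^ n) g)))))"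
  unfolding funpow.simps o_apply Suc.IH by (rule eq) (intro m)
 also have "shift_avg m2 ((shift_avg m0 ^^ n) ((shift_avg m1 ^^ n) ((shift_avg m2 ^^ n) g)))
   = (shift_avg m0 ^^ n) (shift_avg m2 ((shift_avg m1 ^^ n) ((shift_avg m2 ^^ n) g)))"
  by (rule shift_avg_pow_commute[symmetric]) (intro m)+
 also have "shift_avg m2 ((shift_avg m1 ^^ n) ((shift_avg m2 ^^ n) g)) = (shift_avg m1 ^^ n) (shift_avg m2 ((shift_avg m2 ^^ n) g))"
  by (rule shift_avg_pow_commute[symmetric]) (intro m)+
 also have "shift_avg m1 ((shift_avg m0 ^^ n) ((shift_avg m1 ^^ n) (shift_avg m2 ((shift_avg m2 ^^ n) g))))
   = (shift_avg m0 ^^ n) (shift_avg m1 ((shift_avg m1 ^^ n) (shift_avg m2 ((shift_avg m2 ^^ n) g))))"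
  by (rule shift_avg_pow_commute[symmetric]) (intro m)+
 finally show ?case by (simp only: funpow.simps o_apply)
qed simp

lemma shift_avg_corr_pow:
 assumes a: "a > 0" and n: "n > 0" and g: "g \<in> borel_measurable borel"
 shows "(shift_avg (corr_shift \<rho> a) ^^ n) g = shift_avg (corr_shift \<rho> (a * sqrt n)) g"
proof -
 note m = shift_avg_measurable borel_prob_normal_shift g
 have "(shift_avg (corr_shift \<rho> a) ^^ n) g = (shift_avg (normal_shift (a *\<^sub>R (sqrt \<rho>, sqrt \<rho>))) ^^ n)
  ((shift_avg (normal_shift (a *\<^sub>R (sqrt (1 - \<rho>), 0))) ^^ n) ((shift_avg (normal_shift (a *\<^sub>R (0, sqrt (1 - \<rho>)))) ^^ n) g))"
  by (intro shift_avg_pow_product borel_prob_normal_shift g shift_avg_corr_shift)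
 also have "(shift_avg (normal_shift (a *\<^sub>R (0, sqrt (1 - \<rho>)))) ^^ n) g = shift_avg (normal_shift ((a * sqrt n) *\<^sub>R (0, sqrt (1 - \<rho>)))) g"
  by (rule shift_avg_normal_pow[OF a n g])
 also have "(shift_avg (normal_shift (a *\<^sub>R (sqrt (1 - \<rho>), 0))) ^^ n) (shift_avg (normal_shift ((a * sqrt n) *\<^sub>R (0, sqrt (1 - \<rho>)))) g)
   = shift_avg (normal_shift ((a * sqrt n) *\<^sub>R (sqrt (1 - \<rho>), 0))) (shift_avg (normal_shift ((a * sqrt n) *\<^sub>R (0, sqrt (1 - \<rho>)))) g)"
  by (rule shift_avg_normal_pow[OF a n]) (intro m)
 also have "(shift_avg (normal_shift (a *\<^sub>R (sqrt \<rho>, sqrt \<rho>))) ^^ n) \<dots>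
   = shift_avg (normal_shift ((a * sqrt n) *\<^sub>R (sqrt \<rho>, sqrt \<rho>))) \<dots>"
  by (rule shift_avg_normal_pow[OF a n]) (intro m)
 also have "\<dots> = shift_avg (corr_shift \<rho> (a * sqrt n)) g"
  by (rule shift_avg_corr_shift[OF g, symmetric])
 finally show ?thesis .
qed

definition exp_abs_mass :: real
 where "exp_abs_mass = (LINT w|lborel. exp (- (1 / 2) * \<bar>w\<bar>))"

lemma nn_integral_exp_abs: "(\<integral>\<^sup>+w. ennreal (exp (- (1 / 2) * \<bar>w\<bar>)) \<partial>lborel) = ennreal exp_abs_mass"
 unfolding exp_abs_mass_def by (intro nn_integral_eq_integral integrable_exp_neg_abs) auto

lemma exp_abs_mass_nonneg: "exp_abs_mass \<ge> 0"
 unfolding exp_abs_mass_def by (intro integral_nonneg_AE AE_I2) simp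

lemma nn_integral_std_normal_exp:
 "(\<integral>\<^sup>+x. ennreal (exp (s * x)) \<partial>std_normal) = ennreal (exp (s\<^sup>2 / 2))"
proof -
 have "(\<integral>\<^sup>+x. ennreal (exp (s * x)) \<partial>std_normal) = (\<integral>\<^sup>+x. ennreal (std_normal_density x) * ennreal (exp (s * x)) \<partial>lborel)"
  by (rule nn_integral_density) measurable
 also have "\<dots> = (\<integral>\<^sup>+x. ennreal (exp (s\<^sup>2 / 2)) * ennreal (normal_density s 1 x) \<partial>lborel)"
 proof (rule nn_integral_cong)
  fix x
  have "std_normal_density x * exp (s * x) = exp (s\<^sup>2 / 2) * normal_density s 1 x"
  proof -
   have "exp (- x\<^sup>2 / 2) * exp (s * x) = exp (s\<^sup>2 / 2) * exp (- (x - s)\<^sup>2 / 2)"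
    by (simp add: exp_add[symmetric] power2_eq_square field_simps)
   then show ?thesis by (simp add: normal_density_def)
  qed
  then show "ennreal (std_normal_density x) * ennreal (exp (s * x)) = ennreal (exp (s\<^sup>2 / 2)) * ennreal (normal_density s 1 x)"
   by (simp add: ennreal_mult'[symmetric] normal_density_nonneg)
 qed
 also have "\<dots> = ennreal (exp (s\<^sup>2 / 2)) * (\<integral>\<^sup>+x. ennreal (normal_density s 1 x) \<partial>lborel)"
  by (rule nn_integral_cmult) measurable
 also have "(\<integral>\<^sup>+x. ennreal (normal_density s 1 x) \<partial>lborel) = 1"
 proof -
  interpret prob_space "density lborel (normal_density s 1)" by (rule prob_space_normal_density) simp
  show ?thesis using emeasure_space_1 by (simp add: emeasure_density)
 qed
 finally show ?thesis by simp
qed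

text \<open>With \<open>w\<close> for the argument of the logistic function divided by \<open>A\<close>, the normal density contributes \<open>exp (- w / (1 + \<rho>))\<close>, the tilt that is optimal for the joint event; times the logistic function this is at most \<open>exp (- \<bar>w\<bar> / 2)\<close>.\<close>
lemma logistic_gauss_slice_bound:
 fixes d :: real
 assumes d: "d > 0" and \<rho>: "0 \<le> \<rho>" "\<rho> < 1" and A: "A \<ge> 2"
 shows "(\<integral>\<^sup>+y. ennreal (logistic (A * (d * (m + sqrt (1 - \<rho>) * y - d) - t))) \<partial>std_normal)
  \<le> ennreal (exp_abs_mass * exp (- t / (1 + \<rho>)) / (d * sqrt (1 - \<rho>) * sqrt (2 * pi))
    * exp (d\<^sup>2 * (1 - \<rho>) / (2 * (1 + \<rho>)\<^sup>2) - d\<^sup>2 / (1 + \<rho>)) * exp (d / (1 + \<rho>) * m))"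
proof -
 define e where "e = sqrt (1 - \<rho>)"
 have e: "e > 0" "e * e = 1 - \<rho>" using \<rho> by (auto simp: e_def)
 define y0 where "y0 = d * e / (1 + \<rho>)"
 define y1 where "y1 = (d + t / d - m) / e"
 have c: "1 / 2 \<le> 1 / (1 + \<rho>)" "1 / (1 + \<rho>) \<le> 3 / 2" using \<rho> by (auto simp: field_simps)
 define C where "C = 1 / sqrt (2 * pi) * exp (y0\<^sup>2 / 2 - y0 * y1)"
 have C0: "C \<ge> 0" by (simp add: C_def)
 let ?f = "\<lambda>y. logistic (A * (d * (m + e * y - d) - t))"
 have "(\<integral>\<^sup>+y. ennreal (?f y) \<partial>std_normal) = (\<integral>\<^sup>+y. ennreal (std_normal_density y) * ennreal (?f y) \<partial>lborel)"
  by (rule nn_integral_density) measurable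
 also have "\<dots> = ennreal \<bar>1 / (d * e)\<bar> * (\<integral>\<^sup>+w. ennreal (std_normal_density (y1 + 1 / (d * e) * w)) * ennreal (?f (y1 + 1 / (d * e) * w)) \<partial>lborel)"
  using d e by (intro nn_integral_real_affine) auto
 also have "\<dots> \<le> ennreal \<bar>1 / (d * e)\<bar> * (\<integral>\<^sup>+w. ennreal C * ennreal (exp (- (1 / 2) * \<bar>w\<bar>)) \<partial>lborel)"
 proof (intro mult_left_mono nn_integral_mono)
  fix w
  let ?y = "y1 + 1 / (d * e) * w"
  have arg: "d * (m + e * ?y - d) - t = w"
   unfolding y1_def using d e(1) by (simp add: field_simps)
  have yy: "y0 * (1 / (d * e) * w) = 1 / (1 + \<rho>) * w"
   unfolding y0_def using d e(1) by simp
  have "- y\<^sup>2 / 2 \<le> y0\<^sup>2 / 2 - y0 * y" for y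
   using sum_squares_bound[of y y0] by (simp add: mult_ac)
  then have "- ?y\<^sup>2 / 2 \<le> y0\<^sup>2 / 2 - y0 * ?y" .
  also have "\<dots> = (y0\<^sup>2 / 2 - y0 * y1) + - (1 / (1 + \<rho>)) * w" using yy by (simp add: algebra_simps)
  finally have "exp (- ?y\<^sup>2 / 2) \<le> exp (y0\<^sup>2 / 2 - y0 * y1) * exp (- (1 / (1 + \<rho>)) * w)"
   unfolding exp_add[symmetric] by simp
  then have "std_normal_density ?y \<le> C * exp (- (1 / (1 + \<rho>)) * w)"
   unfolding std_normal_density_def C_def mult.assoc by (intro mult_left_mono) auto
  then have "std_normal_density ?y * logistic (A * w) \<le> (C * exp (- (1 / (1 + \<rho>)) * w)) * logistic (A * w)"
   using logistic_pos[of "A * w"] by (intro mult_right_mono) auto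
  also have "\<dots> = C * (logistic (A * w) * exp (- (1 / (1 + \<rho>)) * w))" by simp
  also have "\<dots> \<le> C * exp (- (1 / 2) * \<bar>w\<bar>)"
   by (intro mult_left_mono logistic_exp_bound[OF A c] C0)
  finally have "std_normal_density ?y * ?f ?y \<le> C * exp (- (1 / 2) * \<bar>w\<bar>)" unfolding arg .
  then show "ennreal (std_normal_density ?y) * ennreal (?f ?y) \<le> ennreal C * ennreal (exp (- (1 / 2) * \<bar>w\<bar>))"
   using C0 by (simp add: ennreal_mult'[symmetric] normal_density_nonneg ennreal_leI)
 qed simp
 also have "\<dots> = ennreal \<bar>1 / (d * e)\<bar> * (ennreal C * ennreal exp_abs_mass)"
  by (subst nn_integral_cmult, measurable, simp only: nn_integral_exp_abs)
 also have "\<dots> = ennreal (1 / (d * e) * (C * exp_abs_mass))"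
  using d e(1) C0 by (simp add: ennreal_mult'[symmetric])
 also have "1 / (d * e) * (C * exp_abs_mass) = exp_abs_mass * exp (- t / (1 + \<rho>)) / (d * e * sqrt (2 * pi))
    * exp (d\<^sup>2 * (1 - \<rho>) / (2 * (1 + \<rho>)\<^sup>2) - d\<^sup>2 / (1 + \<rho>)) * exp (d / (1 + \<rho>) * m)"
 proof -
  have 1: "y0\<^sup>2 / 2 = d\<^sup>2 * (1 - \<rho>) / (2 * (1 + \<rho>)\<^sup>2)"
   unfolding y0_def e(2)[symmetric] by (simp add: power_divide power_mult_distrib power2_eq_square mult_ac)
  have 2: "y0 * y1 = d\<^sup>2 / (1 + \<rho>) + t / (1 + \<rho>) - d / (1 + \<rho>) * m"
   unfolding y0_def y1_def using d e(1) by (simp add: diff_divide_distrib add_divide_distrib power2_eq_square right_diff_distrib distrib_left)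
  have "exp (y0\<^sup>2 / 2 - y0 * y1) = exp (- t / (1 + \<rho>)) * exp (d\<^sup>2 * (1 - \<rho>) / (2 * (1 + \<rho>)\<^sup>2) - d\<^sup>2 / (1 + \<rho>)) * exp (d / (1 + \<rho>) * m)"
   unfolding 1 2 exp_add[symmetric] by (simp add: algebra_simps)
  then show ?thesis unfolding C_def by simp
 qed
 finally show ?thesis unfolding e_def .
qed

text \<open>The private coordinates are integrated out by the slice bound; what is left is a normal exponential moment in the common coordinate.\<close>
lemma corr_shift_logistic_bound:
 fixes d :: real
 assumes d: "d > 0" and \<rho>: "0 \<le> \<rho>" "\<rho> < 1" and A: "A \<ge> 2"
 shows "shift_avg (corr_shift \<rho> (A * d)) (\<lambda>u. ennreal (logistic (fst u) * logistic (snd u))) (A * (- d\<^sup>2 - t), A * (- d\<^sup>2 - t))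
  \<le> ennreal (exp_abs_mass\<^sup>2 * exp (- 2 * t / (1 + \<rho>)) / ((1 - \<rho>) * (2 * pi)) * (exp (- d\<^sup>2 / (1 + \<rho>)) / d\<^sup>2))"
proof -
 define q e where "q = sqrt \<rho>" and "e = sqrt (1 - \<rho>)"
 have q: "q * q = \<rho>" and e: "e > 0" "e * e = 1 - \<rho>" using \<rho> by (auto simp: q_def e_def)
 have r1: "1 + \<rho> > 0" using \<rho> by simp
 let ?f = "\<lambda>x y. logistic (A * (d * (q * x + e * y - d) - t))"
 define B where "B = exp_abs_mass * exp (- t / (1 + \<rho>)) / (d * e * sqrt (2 * pi))
    * exp (d\<^sup>2 * (1 - \<rho>) / (2 * (1 + \<rho>)\<^sup>2) - d\<^sup>2 / (1 + \<rho>))"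
 have B0: "B \<ge> 0" using d e exp_abs_mass_nonneg by (simp add: B_def)
 define s where "s = 2 * d * q / (1 + \<rho>)"
 have slice: "(\<integral>\<^sup>+y. ennreal (?f x y) \<partial>std_normal) \<le> ennreal (B * exp (d / (1 + \<rho>) * (q * x)))" for x
  using logistic_gauss_slice_bound[OF d \<rho> A, of "q * x" t] unfolding e_def[symmetric] B_def .
 have gm: "(\<lambda>u::real\<times>real. ennreal (logistic (fst u) * logistic (snd u))) \<in> borel_measurable borel"
  unfolding borel_prod[symmetric] by measurable
 note [measurable] = gm corr_pair_measurable
 let ?u = "(A * (- d\<^sup>2 - t), A * (- d\<^sup>2 - t))"
 let ?h = "\<lambda>x. (A * d * corr1 \<rho> x, A * d * corr2 \<rho> x)"
 let ?g = "\<lambda>u. ennreal (logistic (fst u) * logistic (snd u))"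
 have "shift_avg (corr_shift \<rho> (A * d)) ?g ?u = (\<integral>\<^sup>+x. ?g (?u + ?h x) \<partial>normal3)"
  unfolding shift_avg_def corr_shift_def by (rule nn_integral_distr) measurable
 also have "\<dots> = (\<integral>\<^sup>+x. \<integral>\<^sup>+y. \<integral>\<^sup>+z. ?g (?u + ?h (x, y, z)) \<partial>std_normal \<partial>std_normal \<partial>std_normal)"
  by (rule nn_integral_normal3) measurable
 also have "\<dots> = (\<integral>\<^sup>+x. \<integral>\<^sup>+y. \<integral>\<^sup>+z. ennreal (?f x y) * ennreal (?f x z) \<partial>std_normal \<partial>std_normal \<partial>std_normal)"
 proof (intro nn_integral_cong)
  fix x y z
  have 1: "A * (- d\<^sup>2 - t) + A * d * corr1 \<rho> (x, y, z) = A * (d * (q * x + e * y - d) - t)"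
   by (simp add: corr1_def q_def e_def power2_eq_square algebra_simps)
  have 2: "A * (- d\<^sup>2 - t) + A * d * corr2 \<rho> (x, y, z) = A * (d * (q * x + e * z - d) - t)"
   by (simp add: corr2_def q_def e_def power2_eq_square algebra_simps)
  show "?g (?u + ?h (x, y, z)) = ennreal (?f x y) * ennreal (?f x z)"
   unfolding fst_add snd_add fst_conv snd_conv 1 2
   by (rule ennreal_mult) (simp_all add: less_imp_le logistic_pos)
 qed
 also have "\<dots> = (\<integral>\<^sup>+x. (\<integral>\<^sup>+y. ennreal (?f x y) \<partial>std_normal) * (\<integral>\<^sup>+z. ennreal (?f x z) \<partial>std_normal) \<partial>std_normal)"
 proof (rule nn_integral_cong)
  fix x
  have "(\<integral>\<^sup>+z. ennreal (?f x y) * ennreal (?f x z) \<partial>std_normal) = ennreal (?f x y) * (\<integral>\<^sup>+z. ennreal (?f x z) \<partial>std_normal)" for y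
   by (rule nn_integral_cmult) measurable
  then show "(\<integral>\<^sup>+y. \<integral>\<^sup>+z. ennreal (?f x y) * ennreal (?f x z) \<partial>std_normal \<partial>std_normal)
    = (\<integral>\<^sup>+y. ennreal (?f x y) \<partial>std_normal) * (\<integral>\<^sup>+z. ennreal (?f x z) \<partial>std_normal)"
   by (simp only:) (rule nn_integral_multc, measurable)
 qed
 also have "\<dots> \<le> (\<integral>\<^sup>+x. ennreal (B\<^sup>2) * ennreal (exp (s * x)) \<partial>std_normal)"
 proof (rule nn_integral_mono)
  fix x
  have "(\<integral>\<^sup>+y. ennreal (?f x y) \<partial>std_normal) * (\<integral>\<^sup>+z. ennreal (?f x z) \<partial>std_normal)
    \<le> ennreal (B * exp (d / (1 + \<rho>) * (q * x))) * ennreal (B * exp (d / (1 + \<rho>) * (q * x)))"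
   by (intro mult_mono slice) auto
  also have "\<dots> = ennreal ((B * exp (d / (1 + \<rho>) * (q * x))) * (B * exp (d / (1 + \<rho>) * (q * x))))"
   by (rule ennreal_mult[symmetric]) (use B0 in auto)
  also have "(B * exp (d / (1 + \<rho>) * (q * x))) * (B * exp (d / (1 + \<rho>) * (q * x))) = B\<^sup>2 * exp (s * x)"
  proof -
   have "d / (1 + \<rho>) * (q * x) + d / (1 + \<rho>) * (q * x) = s * x" unfolding s_def by simp
   then have "exp (d / (1 + \<rho>) * (q * x)) * exp (d / (1 + \<rho>) * (q * x)) = exp (s * x)"
    unfolding exp_add[symmetric] by simp
   then show ?thesis by (simp only: power2_eq_square mult_ac)
  qed
  also have "ennreal (B\<^sup>2 * exp (s * x)) = ennreal (B\<^sup>2) * ennreal (exp (s * x))"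
   by (rule ennreal_mult) auto
  finally show "(\<integral>\<^sup>+y. ennreal (?f x y) \<partial>std_normal) * (\<integral>\<^sup>+z. ennreal (?f x z) \<partial>std_normal) \<le> ennreal (B\<^sup>2) * ennreal (exp (s * x))" .
 qed
 also have "\<dots> = ennreal (B\<^sup>2) * ennreal (exp (s\<^sup>2 / 2))"
  by (subst nn_integral_cmult) (simp_all add: nn_integral_std_normal_exp)
 also have "\<dots> = ennreal (B\<^sup>2 * exp (s\<^sup>2 / 2))"
  by (rule ennreal_mult[symmetric]) auto
 also have "B\<^sup>2 * exp (s\<^sup>2 / 2) = exp_abs_mass\<^sup>2 * exp (- 2 * t / (1 + \<rho>)) / ((1 - \<rho>) * (2 * pi)) * (exp (- d\<^sup>2 / (1 + \<rho>)) / d\<^sup>2)"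
 proof -
  have s2: "s\<^sup>2 / 2 = 2 * d\<^sup>2 * \<rho> / (1 + \<rho>)\<^sup>2"
   unfolding s_def q[symmetric] by (simp add: power_divide power_mult_distrib power2_eq_square)
  let ?E = "d\<^sup>2 * (1 - \<rho>) / (2 * (1 + \<rho>)\<^sup>2) - d\<^sup>2 / (1 + \<rho>)"
  have ex: "?E + ?E + s\<^sup>2 / 2 = - d\<^sup>2 / (1 + \<rho>)"
  proof -
   define D where "D = (1 + \<rho>)\<^sup>2"
   have D: "D \<noteq> 0" using r1 by (simp add: D_def)
   have dr: "d\<^sup>2 / (1 + \<rho>) = d\<^sup>2 * (1 + \<rho>) / D" unfolding D_def using r1 by (simp add: power2_eq_square)
   have "?E + ?E + s\<^sup>2 / 2 = (d\<^sup>2 * (1 - \<rho>) - 2 * d\<^sup>2 * (1 + \<rho>) + 2 * d\<^sup>2 * \<rho>) / (1 + \<rho>)\<^sup>2"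
    unfolding s2 dr D_def[symmetric] using D by (simp add: field_simps)
   also have "d\<^sup>2 * (1 - \<rho>) - 2 * d\<^sup>2 * (1 + \<rho>) + 2 * d\<^sup>2 * \<rho> = (- d\<^sup>2) * (1 + \<rho>)" by (simp add: algebra_simps)
   also have "(- d\<^sup>2) * (1 + \<rho>) / (1 + \<rho>)\<^sup>2 = - d\<^sup>2 / (1 + \<rho>)" using r1 by (simp add: power2_eq_square)
   finally show ?thesis .
  qed
  have "B\<^sup>2 * exp (s\<^sup>2 / 2) = exp_abs_mass\<^sup>2 * (exp (- t / (1 + \<rho>)))\<^sup>2 / (d * e * sqrt (2 * pi))\<^sup>2 * ((exp ?E)\<^sup>2 * exp (s\<^sup>2 / 2))"
   unfolding B_def by (simp add: power_mult_distrib power_divide)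
  also have "(exp (- t / (1 + \<rho>)))\<^sup>2 = exp (- 2 * t / (1 + \<rho>))"
   unfolding power2_eq_square exp_add[symmetric] by simp
  also have "(exp ?E)\<^sup>2 * exp (s\<^sup>2 / 2) = exp (- d\<^sup>2 / (1 + \<rho>))"
   unfolding power2_eq_square[of "exp ?E"] exp_add[symmetric] ex ..
  also have "(d * e * sqrt (2 * pi))\<^sup>2 = d\<^sup>2 * ((1 - \<rho>) * (2 * pi))"
   unfolding e(2)[symmetric] by (simp add: power_mult_distrib power2_eq_square)
  finally show ?thesis by simp
 qed
 finally show ?thesis .
qed

section \<open>Poisson approximation of the number of exceedances\<close>

lemma abs_power_diff_le_1:
 fixes t :: real
 assumes "0 \<le> t" "t \<le> 1"
 shows "\<bar>t ^ a - t ^ b\<bar> \<le> 1"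
proof -
 have "0 \<le> t ^ n \<and> t ^ n \<le> 1" for n using assms by (simp add: power_le_one)
 from this[of a] this[of b] show ?thesis by (simp add: abs_le_iff)
qed

text \<open>Let \<open>G t = E t\<^sup>W\<close> for the number \<open>W\<close> of events that occur, with mean \<open>\<lambda>\<close>. Conditioning on one event and removing its neighbours shows that \<open>G' - \<lambda> G\<close> is at most the right-hand side on the unit interval. Integrating the derivative of \<open>G t exp (- \<lambda> t)\<close> from 0 to 1, where \<open>G 1 = 1\<close>, gives the bound for \<open>G 0\<close>, the probability that no event occurs.\<close>
lemma (in prob_space) chen_stein_zero_count:
 fixes E :: "'i \<Rightarrow> 'a set" and S :: "'i set" and B :: "'i \<Rightarrow> 'i set"
 assumes S: "finite S" and E: "\<And>i. i \<in> S \<Longrightarrow> E i \<in> events"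
  and B: "\<And>i. i \<in> S \<Longrightarrow> B i \<subseteq> S - {i}"
  and indep: "\<And>i g. i \<in> S \<Longrightarrow>
   expectation (\<lambda>w. indicator (E i) w * (g (card {j \<in> S - insert i (B i). w \<in> E j}) :: real))
   = prob (E i) * expectation (\<lambda>w. g (card {j \<in> S - insert i (B i). w \<in> E j}))"
 shows "\<bar>prob (space M - (\<Union>i\<in>S. E i)) - exp (- (\<Sum>i\<in>S. prob (E i)))\<bar>
  \<le> (\<Sum>i\<in>S. prob (E i) * (prob (E i) + (\<Sum>j\<in>B i. prob (E j)))) + (\<Sum>i\<in>S. \<Sum>j\<in>B i. prob (E i \<inter> E j))"
proof -
 define cnt where "cnt J w = card {j \<in> J. w \<in> E j}" for J and w :: 'a
 have cnt_sum: "real (cnt J w) = (\<Sum>j\<in>J. indicator (E j) w)" if "finite J" for J w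
  using that by (simp add: cnt_def indicator_def sum.If_cases Int_def)
 have Em[measurable]: "\<And>i. i \<in> S \<Longrightarrow> E i \<in> sets M" by (rule E)
 have cnt_meas: "cnt J \<in> measurable M (count_space UNIV)" if "J \<subseteq> S" for J
 proof -
  have fJ: "finite J" using that S finite_subset by blast
  have "(\<lambda>w. real (cnt J w)) \<in> borel_measurable M"
   unfolding cnt_sum[OF fJ] using that E by (intro borel_measurable_sum borel_measurable_indicator) auto
  then have "(\<lambda>w. nat \<lfloor>real (cnt J w)\<rfloor>) \<in> measurable M (count_space UNIV)" by measurable
  then show ?thesis by simp
 qed
 define lam where "lam = (\<Sum>i\<in>S. prob (E i))"
 define b where "b = (\<Sum>i\<in>S. prob (E i) * (prob (E i) + (\<Sum>j\<in>B i. prob (E j)))) + (\<Sum>i\<in>S. \<Sum>j\<in>B i. prob (E i \<inter> E j))"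
 let ?n = "card S"
 have cnt_le: "cnt S w \<le> ?n" for w unfolding cnt_def using S by (intro card_mono) auto
 define pk where "pk k = prob {w \<in> space M. cnt S w = k}" for k
 have ev: "{w \<in> space M. cnt S w = k} \<in> events" for k
  using cnt_meas[of S] by measurable
 have int_pow: "integrable M (\<lambda>w. t ^ cnt J w)" if "0 \<le> t" "t \<le> 1" "J \<subseteq> S" for t :: real and J
 proof (rule integrable_const_bound[of _ 1])
  show "AE w in M. norm (t ^ cnt J w) \<le> 1" using that by (simp add: power_le_one)
  show "(\<lambda>w. t ^ cnt J w) \<in> borel_measurable M"
   using cnt_meas[OF that(3)] by measurable
 qed
 have finite_exp: "expectation (\<lambda>w. g (cnt S w)) = (\<Sum>k\<le>?n. g k * pk k)" for g :: "nat \<Rightarrow> real"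
 proof -
  have "g (cnt S w) = (\<Sum>k\<le>?n. g k * indicator {w \<in> space M. cnt S w = k} w)" if "w \<in> space M" for w
   using cnt_le[of w] that by (subst sum.remove[of _ "cnt S w"]) (auto simp: indicator_def intro!: sum.neutral)
  then have "expectation (\<lambda>w. g (cnt S w)) = expectation (\<lambda>w. \<Sum>k\<le>?n. g k * indicator {w \<in> space M. cnt S w = k} w)"
   by (intro Bochner_Integration.integral_cong) auto
  also have "\<dots> = (\<Sum>k\<le>?n. expectation (\<lambda>w. g k * indicator {w \<in> space M. cnt S w = k} w))"
   using ev by (intro Bochner_Integration.integral_sum integrable_mult_right integrable_real_indicator) (auto simp: emeasure_eq_measure)
  also have "\<dots> = (\<Sum>k\<le>?n. g k * pk k)"
   using ev by (intro sum.cong) (auto simp: pk_def)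
  finally show ?thesis .
 qed
 define f where "f t = (\<Sum>k\<le>?n. t ^ k * pk k) * exp (- lam * t)" for t :: real
 have der: "(f has_real_derivative
   (\<Sum>k\<le>?n. real k * t ^ (k - 1) * pk k) * exp (- lam * t) + (\<Sum>k\<le>?n. t ^ k * pk k) * (- lam * exp (- lam * t))) (at t)" for t
 proof -
  have a: "((\<lambda>t. \<Sum>k\<le>?n. t ^ k * pk k) has_real_derivative (\<Sum>k\<le>?n. real k * t ^ (k - 1) * pk k)) (at t)"
   by (intro DERIV_sum) (auto intro!: derivative_eq_intros)
  have e: "((\<lambda>t. exp (- lam * t)) has_real_derivative - lam * exp (- lam * t)) (at t)"
   by (auto intro!: derivative_eq_intros)
  show ?thesis unfolding f_def
   by (rule DERIV_cong[OF DERIV_mult[OF a e]]) (simp only: mult.commute)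
 qed
 have stein: "\<bar>(\<Sum>k\<le>?n. real k * t ^ (k - 1) * pk k) - lam * (\<Sum>k\<le>?n. t ^ k * pk k)\<bar> \<le> b" if t: "0 \<le> t" "t \<le> 1" for t
 proof -
  let ?W = "cnt S" and ?V = "\<lambda>i. cnt (S - insert i (B i))" and ?U = "\<lambda>i. cnt (B i)"
  have fB: "finite (B i)" "B i \<subseteq> S" "i \<notin> B i" if "i \<in> S" for i
   using B[OF that] S finite_subset by auto
  have split: "real (?W w) = indicator (E i) w + real (?U i w) + real (?V i w)" if "i \<in> S" for i w
  proof -
   have "S = insert i (B i \<union> (S - insert i (B i)))" using that fB[OF that] by auto
   then have "(\<Sum>j\<in>S. indicator (E j) w) = (\<Sum>j\<in>insert i (B i \<union> (S - insert i (B i))). indicator (E j) w :: real)" by simp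
   also have "\<dots> = indicator (E i) w + (\<Sum>j\<in>B i \<union> (S - insert i (B i)). indicator (E j) w)"
    using fB[OF that] S by (intro sum.insert) auto
   also have "(\<Sum>j\<in>B i \<union> (S - insert i (B i)). indicator (E j) w :: real) = (\<Sum>j\<in>B i. indicator (E j) w) + (\<Sum>j\<in>S - insert i (B i). indicator (E j) w)"
    using fB[OF that] S by (intro sum.union_disjoint) auto
   finally show ?thesis using S fB[OF that] by (simp add: cnt_sum)
  qed
  have iI: "integrable M (\<lambda>w. indicator A w :: real)" if "A \<in> events" for A
   using that by (intro integrable_real_indicator) (auto simp: emeasure_eq_measure)
  have iIp: "integrable M (\<lambda>w. indicator (E i) w * t ^ cnt J w)" if "i \<in> S" "J \<subseteq> S" for i J
  proof (rule integrable_const_bound[of _ 1])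
   show "AE w in M. norm (indicator (E i) w * t ^ cnt J w) \<le> 1"
    using t by (simp add: indicator_def power_le_one abs_mult)
   show "(\<lambda>w. indicator (E i) w * t ^ cnt J w) \<in> borel_measurable M"
    using cnt_meas[OF that(2)] E[OF that(1)] by measurable
  qed
  have iIp1: "integrable M (\<lambda>w. indicator (E i) w * t ^ (cnt S w - 1))" if "i \<in> S" for i
  proof (rule integrable_const_bound[of _ 1])
   show "AE w in M. norm (indicator (E i) w * t ^ (cnt S w - 1)) \<le> 1"
    using t by (simp add: indicator_def power_le_one abs_mult)
   show "(\<lambda>w. indicator (E i) w * t ^ (cnt S w - 1)) \<in> borel_measurable M"
    using cnt_meas[of S] E[OF that(1)] by measurable
  qed
  have iU: "integrable M (\<lambda>w. real (?U i w))" "expectation (\<lambda>w. real (?U i w)) = (\<Sum>j\<in>B i. prob (E j))" if "i \<in> S" for i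
  proof -
   have Eb: "E j \<in> events" if "j \<in> B i" for j using that fB(2)[OF \<open>i \<in> S\<close>] E by auto
   show "integrable M (\<lambda>w. real (?U i w))"
    unfolding cnt_sum[OF fB(1)[OF that]] using iI Eb by (intro Bochner_Integration.integrable_sum) auto
   show "expectation (\<lambda>w. real (?U i w)) = (\<Sum>j\<in>B i. prob (E j))"
    unfolding cnt_sum[OF fB(1)[OF that]] using iI Eb
    by (subst Bochner_Integration.integral_sum) auto
  qed
  have iEU: "integrable M (\<lambda>w. indicator (E i) w * real (?U i w))"
   "expectation (\<lambda>w. indicator (E i) w * real (?U i w)) = (\<Sum>j\<in>B i. prob (E i \<inter> E j))" if "i \<in> S" for i
  proof -
   have Eb: "E i \<inter> E j \<in> events" if "j \<in> B i" for j using that fB(2)[OF \<open>i \<in> S\<close>] E \<open>i \<in> S\<close> by auto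
   have eq: "indicator (E i) w * real (?U i w) = (\<Sum>j\<in>B i. indicator (E i \<inter> E j) w)" for w
    unfolding cnt_sum[OF fB(1)[OF that]] sum_distrib_left by (simp add: indicator_inter_arith)
   show "integrable M (\<lambda>w. indicator (E i) w * real (?U i w))"
    unfolding eq using iI Eb by (intro Bochner_Integration.integrable_sum) auto
   show "expectation (\<lambda>w. indicator (E i) w * real (?U i w)) = (\<Sum>j\<in>B i. prob (E i \<inter> E j))"
    unfolding eq using iI Eb by (subst Bochner_Integration.integral_sum) auto
  qed
  have one: "\<bar>expectation (\<lambda>w. indicator (E i) w * t ^ (?W w - 1)) - prob (E i) * expectation (\<lambda>w. t ^ ?W w)\<bar>
    \<le> prob (E i) * (prob (E i) + (\<Sum>j\<in>B i. prob (E j))) + (\<Sum>j\<in>B i. prob (E i \<inter> E j))" if i: "i \<in> S" for i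
  proof -
   have VS: "S - insert i (B i) \<subseteq> S" by auto
   have p1: "\<bar>indicator (E i) w * t ^ (?W w - 1) - indicator (E i) w * t ^ ?V i w\<bar> \<le> indicator (E i) w * real (?U i w)" for w
   proof (cases "w \<in> E i")
    case True
    show ?thesis
    proof (cases "?U i w = 0")
     case U: True
     then have "?W w - 1 = ?V i w" using split[OF i, of w] True by simp
     then show ?thesis by simp
    next
     case False
     then have "1 \<le> real (?U i w)" by simp
     then show ?thesis using abs_power_diff_le_1[OF t, of "?W w - 1" "?V i w"] True by simp
    qed
   qed simp
   have p2: "\<bar>t ^ ?V i w - t ^ ?W w\<bar> \<le> indicator (E i) w + real (?U i w)" for w
   proof (cases "?V i w = ?W w")
    case False
    then have "real (?V i w) \<noteq> real (?W w)" by simp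
    then have "indicator (E i) w + real (?U i w) \<noteq> 0" using split[OF i, of w] by linarith
    then have "1 \<le> indicator (E i) w + real (?U i w)" by (auto simp: indicator_def split: if_splits)
    then show ?thesis using abs_power_diff_le_1[OF t, of "?V i w" "?W w"] by linarith
   qed (simp add: indicator_def)
   have "\<bar>expectation (\<lambda>w. indicator (E i) w * t ^ (?W w - 1)) - expectation (\<lambda>w. indicator (E i) w * t ^ ?V i w)\<bar>
     = \<bar>expectation (\<lambda>w. indicator (E i) w * t ^ (?W w - 1) - indicator (E i) w * t ^ ?V i w)\<bar>"
    by (subst Bochner_Integration.integral_diff[OF iIp1[OF i] iIp[OF i VS]]) simp
   also have "\<dots> \<le> expectation (\<lambda>w. \<bar>indicator (E i) w * t ^ (?W w - 1) - indicator (E i) w * t ^ ?V i w\<bar>)"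
    by (rule integral_abs_bound)
   also have "\<dots> \<le> expectation (\<lambda>w. indicator (E i) w * real (?U i w))"
    by (intro integral_mono integrable_abs Bochner_Integration.integrable_diff iIp1[OF i] iIp[OF i VS] iEU(1)[OF i] p1)
   finally have q1: "\<bar>expectation (\<lambda>w. indicator (E i) w * t ^ (?W w - 1)) - expectation (\<lambda>w. indicator (E i) w * t ^ ?V i w)\<bar>
     \<le> (\<Sum>j\<in>B i. prob (E i \<inter> E j))" unfolding iEU(2)[OF i] .
   have q2: "expectation (\<lambda>w. indicator (E i) w * t ^ ?V i w) = prob (E i) * expectation (\<lambda>w. t ^ ?V i w)"
    unfolding cnt_def by (rule indep[OF i])
   have "\<bar>expectation (\<lambda>w. t ^ ?V i w) - expectation (\<lambda>w. t ^ ?W w)\<bar> = \<bar>expectation (\<lambda>w. t ^ ?V i w - t ^ ?W w)\<bar>"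
    by (subst Bochner_Integration.integral_diff[OF int_pow[OF t VS] int_pow[OF t order_refl]]) simp
   also have "\<dots> \<le> expectation (\<lambda>w. \<bar>t ^ ?V i w - t ^ ?W w\<bar>)" by (rule integral_abs_bound)
   also have "\<dots> \<le> expectation (\<lambda>w. indicator (E i) w + real (?U i w))"
    by (intro integral_mono integrable_abs Bochner_Integration.integrable_diff Bochner_Integration.integrable_add
      int_pow[OF t VS] int_pow[OF t order_refl] iI[OF E[OF i]] iU(1)[OF i] p2)
   also have "\<dots> = prob (E i) + (\<Sum>j\<in>B i. prob (E j))"
    by (subst Bochner_Integration.integral_add[OF iI[OF E[OF i]] iU(1)[OF i]]) (simp add: iU(2)[OF i] E[OF i])
   finally have q3: "\<bar>expectation (\<lambda>w. t ^ ?V i w) - expectation (\<lambda>w. t ^ ?W w)\<bar> \<le> prob (E i) + (\<Sum>j\<in>B i. prob (E j))" .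
   have "\<bar>prob (E i) * expectation (\<lambda>w. t ^ ?V i w) - prob (E i) * expectation (\<lambda>w. t ^ ?W w)\<bar>
     = prob (E i) * \<bar>expectation (\<lambda>w. t ^ ?V i w) - expectation (\<lambda>w. t ^ ?W w)\<bar>"
    by (simp add: right_diff_distrib[symmetric] abs_mult)
   also have "\<dots> \<le> prob (E i) * (prob (E i) + (\<Sum>j\<in>B i. prob (E j)))"
    by (intro mult_left_mono q3) simp
   finally show ?thesis using q1 unfolding q2 by linarith
  qed
  have eq1: "(\<Sum>k\<le>?n. real k * t ^ (k - 1) * pk k) = (\<Sum>i\<in>S. expectation (\<lambda>w. indicator (E i) w * t ^ (?W w - 1)))"
  proof -
   have "(\<Sum>k\<le>?n. real k * t ^ (k - 1) * pk k) = expectation (\<lambda>w. real (?W w) * t ^ (?W w - 1))"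
    using finite_exp[of "\<lambda>k. real k * t ^ (k - 1)"] by simp
   also have "\<dots> = expectation (\<lambda>w. \<Sum>i\<in>S. indicator (E i) w * t ^ (?W w - 1))"
    unfolding cnt_sum[OF S] sum_distrib_right ..
   also have "\<dots> = (\<Sum>i\<in>S. expectation (\<lambda>w. indicator (E i) w * t ^ (?W w - 1)))"
    by (intro Bochner_Integration.integral_sum iIp1)
   finally show ?thesis .
  qed
  have eq2: "(\<Sum>k\<le>?n. t ^ k * pk k) = expectation (\<lambda>w. t ^ ?W w)"
   using finite_exp[of "\<lambda>k. t ^ k"] by simp
  have "\<bar>(\<Sum>k\<le>?n. real k * t ^ (k - 1) * pk k) - lam * (\<Sum>k\<le>?n. t ^ k * pk k)\<bar>
    = \<bar>\<Sum>i\<in>S. (expectation (\<lambda>w. indicator (E i) w * t ^ (?W w - 1)) - prob (E i) * expectation (\<lambda>w. t ^ ?W w))\<bar>"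
   unfolding eq1 eq2 lam_def sum_distrib_right sum_subtractf ..
  also have "\<dots> \<le> (\<Sum>i\<in>S. prob (E i) * (prob (E i) + (\<Sum>j\<in>B i. prob (E j))) + (\<Sum>j\<in>B i. prob (E i \<inter> E j)))"
   by (intro order_trans[OF sum_abs] sum_mono one)
  also have "\<dots> = b" unfolding b_def by (rule sum.distrib)
  finally show ?thesis .
 qed
 have "\<exists>\<xi>>0. \<xi> < 1 \<and> f 1 - f 0 = (1 - 0) * ((\<Sum>k\<le>?n. real k * \<xi> ^ (k - 1) * pk k) * exp (- lam * \<xi>) + (\<Sum>k\<le>?n. \<xi> ^ k * pk k) * (- lam * exp (- lam * \<xi>)))"
  by (intro MVT2 der) simp
 then obtain \<xi> where \<xi>: "0 < \<xi>" "\<xi> < 1" "f 1 - f 0 = (1 - 0) * ((\<Sum>k\<le>?n. real k * \<xi> ^ (k - 1) * pk k) * exp (- lam * \<xi>) + (\<Sum>k\<le>?n. \<xi> ^ k * pk k) * (- lam * exp (- lam * \<xi>)))"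
  by blast
 have l0: "lam \<ge> 0" unfolding lam_def by (intro sum_nonneg) simp
 have "f 1 - f 0 = ((\<Sum>k\<le>?n. real k * \<xi> ^ (k - 1) * pk k) - lam * (\<Sum>k\<le>?n. \<xi> ^ k * pk k)) * exp (- lam * \<xi>)"
  unfolding \<xi>(3) by (simp add: algebra_simps)
 then have "\<bar>f 1 - f 0\<bar> = \<bar>(\<Sum>k\<le>?n. real k * \<xi> ^ (k - 1) * pk k) - lam * (\<Sum>k\<le>?n. \<xi> ^ k * pk k)\<bar> * exp (- lam * \<xi>)"
  by (simp add: abs_mult)
 also have "\<dots> \<le> b * 1"
 proof (intro mult_mono stein)
  show "exp (- lam * \<xi>) \<le> 1" using l0 \<xi> by simp
  show "0 \<le> b" using stein[of 0] by linarith
 qed (use \<xi> in auto)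
 finally have main: "\<bar>f 1 - f 0\<bar> \<le> b" by simp
 have "f 1 = exp (- lam)"
  using finite_exp[of "\<lambda>_. 1"] by (simp add: f_def prob_space)
 moreover have "f 0 = prob (space M - (\<Union>i\<in>S. E i))"
 proof -
  have "f 0 = pk 0"
   unfolding f_def by (subst sum.remove[of _ 0]) (auto intro!: sum.neutral simp: power_0_left)
  have "{w \<in> space M. cnt S w = 0} = space M - (\<Union>i\<in>S. E i)"
   using S by (auto simp: cnt_def)
  then have "pk 0 = prob (space M - (\<Union>i\<in>S. E i))" by (simp add: pk_def)
  then show ?thesis using \<open>f 0 = pk 0\<close> by simp
 qed
 ultimately show ?thesis using main unfolding b_def lam_def by (simp add: abs_minus_commute)
qed

section \<open>Arrays of independent identically distributed variables\<close>

locale iid_array = prob_space +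
 fixes X :: "nat \<Rightarrow> nat \<Rightarrow> 'a \<Rightarrow> real"
 assumes X_indep: "indep_vars (\<lambda>_. borel) (\<lambda>(i, t). X i t) ({1..} \<times> {1..})"
  and X_ident: "\<And>i t. i \<ge> 1 \<Longrightarrow> t \<ge> 1 \<Longrightarrow> distr M borel (X i t) = distr M borel (X 1 1)"
begin

lemma X_meas: 
 assumes "i \<ge> 1" "t \<ge> 1"
 shows "X i t \<in> borel_measurable M"
proof -
 have "\<forall>p\<in>{1..} \<times> {1..}. (\<lambda>(i, t). X i t) p \<in> borel_measurable M"
  using X_indep unfolding indep_vars_def by (rule conjunct1)
 from bspec[OF this, of "(i, t)"] assms show ?thesis by simp
qed

abbreviation "triple_borel \<equiv> borel \<Otimes>\<^sub>M (borel \<Otimes>\<^sub>M borel) :: (real \<times> real \<times> real) measure"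

lemma distr_triple:
 assumes ijk: "i \<ge> 1" "j \<ge> 1" "k \<ge> 1" "l \<ge> 1" "i \<noteq> j" "i \<noteq> k" "j \<noteq> k"
 shows "distr M triple_borel (\<lambda>w. (X i l w, X j l w, X k l w)) = distr M triple_borel (\<lambda>w. (X 1 1 w, X 2 1 w, X 3 1 w))"
proof -
 let ?\<mu> = "distr M borel (X 1 1)"
 let ?I = "{0, 1, 2 :: nat}"
 let ?\<phi> = "\<lambda>x :: nat \<Rightarrow> real. (x 0, x 1, x 2)"
 have \<phi>[measurable]: "?\<phi> \<in> measurable (PiM ?I (\<lambda>_. borel)) triple_borel"
  by (intro measurable_Pair measurable_component_singleton) simp_all
 have main: "distr M triple_borel (\<lambda>w. (X i l w, X j l w, X k l w)) = distr (PiM ?I (\<lambda>_. ?\<mu>)) triple_borel ?\<phi>"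
  if ijk: "i \<ge> 1" "j \<ge> 1" "k \<ge> 1" "l \<ge> 1" "i \<noteq> j" "i \<noteq> k" "j \<noteq> k" for i j k l
 proof -
  let ?J = "{(i, l), (j, l), (k, l)}"
  let ?f = "\<lambda>n::nat. if n = 0 then (i, l) else if n = 1 then (j, l) else (k, l)"
  let ?X = "\<lambda>p. X (fst p) (snd p)"
  have rv: "random_variable borel (?X p)" if "p \<in> ?J" for p
   using that ijk by (elim insertE emptyE) (simp_all add: X_meas)
  have "indep_vars (\<lambda>_. borel) (\<lambda>(i, t). X i t) ?J"
   by (rule indep_vars_subset[OF X_indep]) (use ijk in simp)
  then have ind: "indep_vars (\<lambda>_. borel) ?X ?J" by (simp add: case_prod_unfold)
  have "distr M (PiM ?J (\<lambda>_. borel)) (\<lambda>w. \<lambda>p\<in>?J. ?X p w) = PiM ?J (\<lambda>p. distr M borel (?X p))"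
   by (rule indep_vars_iff_distr_eq_PiM'[THEN iffD1, OF _ rv ind]) simp_all
  also have "\<dots> = PiM ?J (\<lambda>_. ?\<mu>)"
  proof (rule PiM_cong[OF refl])
   fix p assume "p \<in> ?J"
   then show "distr M borel (?X p) = ?\<mu>"
    by (elim insertE emptyE) (simp_all only: fst_conv snd_conv X_ident[OF ijk(1) ijk(4)] X_ident[OF ijk(2) ijk(4)] X_ident[OF ijk(3) ijk(4)])
  qed
  finally have J: "distr M (PiM ?J (\<lambda>_. borel)) (\<lambda>w. \<lambda>p\<in>?J. ?X p w) = PiM ?J (\<lambda>_. ?\<mu>)" .
  have mu: "prob_space ?\<mu>" by (rule prob_space_distr) (rule X_meas, simp_all)
  have R: "distr (PiM ?J (\<lambda>_. ?\<mu>)) (PiM ?I (\<lambda>_. ?\<mu>)) (\<lambda>x. \<lambda>n\<in>?I. x (?f n)) = PiM ?I (\<lambda>_. ?\<mu>)"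
  proof (rule distr_PiM_reindex[where M="\<lambda>_. ?\<mu>", OF mu])
   show "inj_on ?f ?I" using ijk(5-7) by (simp add: inj_on_def)
   show "?f \<in> ?I \<rightarrow> ?J" by simp
  qed
  have m1: "(\<lambda>x. \<lambda>n\<in>?I. x (?f n)) \<in> measurable (PiM ?J (\<lambda>_. borel)) (PiM ?I (\<lambda>_. borel :: real measure))"
   by (intro measurable_restrict measurable_component_singleton) simp
  have m0: "(\<lambda>w. \<lambda>p\<in>?J. ?X p w) \<in> measurable M (PiM ?J (\<lambda>_. borel))"
   by (intro measurable_restrict rv)
  have cI: "sets (PiM ?I (\<lambda>_. ?\<mu>)) = sets (PiM ?I (\<lambda>_. borel :: real measure))" by (intro sets_PiM_cong) auto
  have cJ: "sets (PiM ?J (\<lambda>_. ?\<mu>)) = sets (PiM ?J (\<lambda>_. borel :: real measure))" by (intro sets_PiM_cong) auto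
  have "distr (PiM ?I (\<lambda>_. ?\<mu>)) triple_borel ?\<phi>
    = distr (distr (PiM ?J (\<lambda>_. ?\<mu>)) (PiM ?I (\<lambda>_. borel)) (\<lambda>x. \<lambda>n\<in>?I. x (?f n))) triple_borel ?\<phi>"
  proof -
   have "distr (PiM ?J (\<lambda>_. ?\<mu>)) (PiM ?I (\<lambda>_. borel)) (\<lambda>x. \<lambda>n\<in>?I. x (?f n)) = distr (PiM ?J (\<lambda>_. ?\<mu>)) (PiM ?I (\<lambda>_. ?\<mu>)) (\<lambda>x. \<lambda>n\<in>?I. x (?f n))"
    by (rule distr_cong[OF refl cI[symmetric] refl])
   then show ?thesis by (simp only: R)
  qed
  also have "\<dots> = distr (distr (distr M (PiM ?J (\<lambda>_. borel)) (\<lambda>w. \<lambda>p\<in>?J. ?X p w)) (PiM ?I (\<lambda>_. borel)) (\<lambda>x. \<lambda>n\<in>?I. x (?f n))) triple_borel ?\<phi>"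
   unfolding J ..
  also have "\<dots> = distr M triple_borel (?\<phi> \<circ> ((\<lambda>x. \<lambda>n\<in>?I. x (?f n)) \<circ> (\<lambda>w. \<lambda>p\<in>?J. ?X p w)))"
   by (subst distr_distr[OF m1 m0], subst distr_distr[OF \<phi> measurable_comp[OF m0 m1]]) simp
  also have "?\<phi> \<circ> ((\<lambda>x. \<lambda>n\<in>?I. x (?f n)) \<circ> (\<lambda>w. \<lambda>p\<in>?J. ?X p w)) = (\<lambda>w. (X i l w, X j l w, X k l w))"
   by (rule ext) simp
  finally show ?thesis by (rule sym)
 qed
 show ?thesis unfolding main[OF ijk] by (rule main[symmetric]) simp_all
qed

text \<open>For fixed rows the columns are independent and identically distributed.\<close>
lemma nn_integral_row_sums:
 fixes F :: "real \<times> real \<times> real \<Rightarrow> 'v::euclidean_space"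
 assumes ijk: "i \<ge> 1" "j \<ge> 1" "k \<ge> 1" "i \<noteq> j" "i \<noteq> k" "j \<noteq> k"
  and F: "F \<in> borel_measurable triple_borel" and g: "g \<in> borel_measurable borel"
 shows "(\<integral>\<^sup>+w. g (s + (\<Sum>l\<in>{1..n}. F (X i l w, X j l w, X k l w))) \<partial>M)
  = (shift_avg (distr M borel (\<lambda>w. F (X 1 1 w, X 2 1 w, X 3 1 w))) ^^ n) g s"
proof (rule nn_integral_indep_sum[OF _ _ _ g])
 note [measurable] = F
 have m: "(\<lambda>w. (X i l w, X j l w, X k l w)) \<in> measurable M triple_borel" if "i \<ge> 1" "j \<ge> 1" "k \<ge> 1" "l \<ge> 1" for i j k l
  using that by (intro measurable_Pair X_meas) auto
 have "(\<lambda>w. F (X 1 1 w, X 2 1 w, X 3 1 w)) \<in> borel_measurable M"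
  by (rule measurable_compose[OF m F]) auto
 then show "borel_prob (distr M borel (\<lambda>w. F (X 1 1 w, X 2 1 w, X 3 1 w)))"
  by (intro borel_prob_distr prob_space_axioms)
 show "distr M borel (\<lambda>w. F (X i l w, X j l w, X k l w)) = distr M borel (\<lambda>w. F (X 1 1 w, X 2 1 w, X 3 1 w))"
  if "l \<in> {1..n}" for l
 proof -
  have l: "l \<ge> 1" using that by simp
  have "distr M borel (\<lambda>w. F (X i l w, X j l w, X k l w)) = distr (distr M triple_borel (\<lambda>w. (X i l w, X j l w, X k l w))) borel F"
   by (subst distr_distr[OF F m[OF ijk(1-3) l]]) (simp add: o_def)
  also have "\<dots> = distr (distr M triple_borel (\<lambda>w. (X 1 1 w, X 2 1 w, X 3 1 w))) borel F"
   unfolding distr_triple[OF ijk(1-3) l ijk(4-6)] ..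
  also have "\<dots> = distr M borel (\<lambda>w. F (X 1 1 w, X 2 1 w, X 3 1 w))"
   by (subst distr_distr[OF F m]) (simp_all add: o_def)
  finally show ?thesis .
 qed
 let ?K = "\<lambda>l. {(i, l), (j, l), (k, l)}"
 have "indep_vars (\<lambda>l. PiM (?K l) (\<lambda>_. borel)) (\<lambda>l w. restrict (\<lambda>p. (\<lambda>(i, t). X i t) p w) (?K l)) {1..n}"
  by (rule indep_vars_restrict[OF X_indep]) (use ijk in \<open>auto simp: disjoint_family_on_def\<close>)
 moreover have "(\<lambda>x. F (x (i, l), x (j, l), x (k, l))) \<in> measurable (PiM (?K l) (\<lambda>_. borel)) borel" for l
  by (rule measurable_compose[OF _ F]) (intro measurable_Pair measurable_component_singleton, auto)
 ultimately have "indep_vars (\<lambda>_. borel) (\<lambda>l w. (\<lambda>x. F (x (i, l), x (j, l), x (k, l))) (restrict (\<lambda>p. (\<lambda>(i, t). X i t) p w) (?K l))) {1..n}"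
  by (rule indep_vars_compose2)
 then show "indep_vars (\<lambda>_. borel) (\<lambda>l w. F (X i l w, X j l w, X k l w)) {1..n}" by simp
qed

lemma expectation_triple:
 fixes F :: "real \<times> real \<times> real \<Rightarrow> real"
 assumes ijk: "i \<ge> 1" "j \<ge> 1" "k \<ge> 1" "l \<ge> 1" "i \<noteq> j" "i \<noteq> k" "j \<noteq> k"
  and F: "F \<in> borel_measurable triple_borel"
 shows "expectation (\<lambda>w. F (X i l w, X j l w, X k l w)) = expectation (\<lambda>w. F (X 1 1 w, X 2 1 w, X 3 1 w))"
  and "integrable M (\<lambda>w. F (X i l w, X j l w, X k l w)) \<longleftrightarrow> integrable M (\<lambda>w. F (X 1 1 w, X 2 1 w, X 3 1 w))"
proof -
 have m: "(\<lambda>w. (X i l w, X j l w, X k l w)) \<in> measurable M triple_borel" if "i \<ge> 1" "j \<ge> 1" "k \<ge> 1" "l \<ge> 1" for i j k l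
  using that by (intro measurable_Pair X_meas) auto
 have m1: "(\<lambda>w. (X 1 1 w, X 2 1 w, X 3 1 w)) \<in> measurable M triple_borel" by (rule m) auto
 show "expectation (\<lambda>w. F (X i l w, X j l w, X k l w)) = expectation (\<lambda>w. F (X 1 1 w, X 2 1 w, X 3 1 w))"
  using integral_distr[OF m[OF ijk(1-4)] F] integral_distr[OF m1 F] distr_triple[OF ijk] by simp
 show "integrable M (\<lambda>w. F (X i l w, X j l w, X k l w)) \<longleftrightarrow> integrable M (\<lambda>w. F (X 1 1 w, X 2 1 w, X 3 1 w))"
  using integrable_distr_eq[OF m[OF ijk(1-4)] F] integrable_distr_eq[OF m1 F] distr_triple[OF ijk] by simp
qed

text \<open>Rows \<open>i, j\<close> and the rows used by \<open>J\<close> are disjoint blocks of an independent family.\<close>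
lemma indep_exceedance:
 fixes h :: "real \<Rightarrow> real \<Rightarrow> real" and g :: "nat \<Rightarrow> real" and c :: real and n :: nat
 assumes h: "(\<lambda>(x, y). h x y) \<in> borel_measurable (borel \<Otimes>\<^sub>M borel)"
  and ij: "i \<ge> 1" "j \<ge> 1"
  and J: "finite J" "\<And>k m. (k, m) \<in> J \<Longrightarrow> k \<ge> 1 \<and> m \<ge> 1 \<and> {k, m} \<inter> {i, j} = {}"
 defines "E \<equiv> \<lambda>p. {w \<in> space M. c < (\<Sum>l\<in>{1..n}. h (X (fst p) l w) (X (snd p) l w))}"
 shows "expectation (\<lambda>w. indicator (E (i, j)) w * g (card {p \<in> J. w \<in> E p}))
  = prob (E (i, j)) * expectation (\<lambda>w. g (card {p \<in> J. w \<in> E p}))"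
proof -
 let ?A = "{i, j} \<times> {1..n}" and ?B = "(fst ` J \<union> snd ` J) \<times> {1..n}"
 let ?XX = "\<lambda>p. (\<lambda>(i, t). X i t) p"
 have AB: "?A \<inter> ?B = {}" "?A \<subseteq> {1..} \<times> {1..}" "?B \<subseteq> {1..} \<times> {1..}"
  using ij J(2) by (auto dest: J(2))
 note iv = indep_var_restrict[OF X_indep AB]
 define S where "S p x = (\<Sum>l\<in>{1..n}. h (x (fst p, l)) (x (snd p, l)))" for p :: "nat \<times> nat" and x :: "nat \<times> nat \<Rightarrow> real"
 have hm: "(\<lambda>x. h (x a) (x b)) \<in> borel_measurable (PiM L (\<lambda>_. borel))" if "a \<in> L" "b \<in> L" for a b and L :: "(nat \<times> nat) set"
 proof -
  have "(\<lambda>x. (x a, x b)) \<in> measurable (PiM L (\<lambda>_. borel)) (borel \<Otimes>\<^sub>M borel :: (real \<times> real) measure)"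
   using that by (intro measurable_Pair measurable_component_singleton)
  from measurable_compose[OF this h] show ?thesis by simp
 qed
 have SA: "S (i, j) \<in> borel_measurable (PiM ?A (\<lambda>_. borel))"
  unfolding S_def[abs_def] by (intro borel_measurable_sum hm) auto
 have SB: "S p \<in> borel_measurable (PiM ?B (\<lambda>_. borel))" if "p \<in> J" for p
  unfolding S_def[abs_def] using that by (intro borel_measurable_sum hm) force+
 define Y1 where "Y1 x = (if c < S (i, j) x then 1 else 0 :: real)" for x
 have Y1: "Y1 \<in> borel_measurable (PiM ?A (\<lambda>_. borel))"
  unfolding Y1_def[abs_def] using SA by measurable
 define cn where "cn x = (\<Sum>p\<in>J. if c < S p x then 1 else 0 :: real)" for x
 have cn: "cn \<in> borel_measurable (PiM ?B (\<lambda>_. borel))"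
  unfolding cn_def[abs_def] using SB by (intro borel_measurable_sum measurable_If) (auto intro!: borel_measurable_pred_less)
 have Y2: "(\<lambda>x. g (nat \<lfloor>cn x\<rfloor>)) \<in> borel_measurable (PiM ?B (\<lambda>_. borel))"
  using cn by measurable
 have iv2: "indep_var borel (Y1 \<circ> (\<lambda>w. restrict (\<lambda>p. ?XX p w) ?A)) borel ((\<lambda>x. g (nat \<lfloor>cn x\<rfloor>)) \<circ> (\<lambda>w. restrict (\<lambda>p. ?XX p w) ?B))"
  by (rule indep_var_compose[OF iv Y1 Y2])
 have SX: "S p (restrict (\<lambda>p. ?XX p w) L) = (\<Sum>l\<in>{1..n}. h (X (fst p) l w) (X (snd p) l w))"
  if "{fst p, snd p} \<times> {1..n} \<subseteq> L" for p w L
  unfolding S_def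
 proof (rule sum.cong[OF refl])
  fix l assume "l \<in> {1..n}"
  then have "(fst p, l) \<in> L" "(snd p, l) \<in> L" using that by auto
  then show "h (restrict (\<lambda>p. ?XX p w) L (fst p, l)) (restrict (\<lambda>p. ?XX p w) L (snd p, l)) = h (X (fst p) l w) (X (snd p) l w)"
   by simp
 qed
 have e1: "(Y1 \<circ> (\<lambda>w. restrict (\<lambda>p. ?XX p w) ?A)) w = indicator (E (i, j)) w" if "w \<in> space M" for w
  using that by (simp add: Y1_def SX E_def indicator_def)
 have e2: "((\<lambda>x. g (nat \<lfloor>cn x\<rfloor>)) \<circ> (\<lambda>w. restrict (\<lambda>p. ?XX p w) ?B)) w = g (card {p \<in> J. w \<in> E p})" if "w \<in> space M" for w
 proof -
  have "cn (restrict (\<lambda>p. ?XX p w) ?B) = (\<Sum>p\<in>J. if w \<in> E p then 1 else 0)"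
   unfolding cn_def
  proof (rule sum.cong[OF refl])
   fix p assume "p \<in> J"
   then have "{fst p, snd p} \<times> {1..n} \<subseteq> ?B" by force
   from SX[OF this] show "(if c < S p (restrict (\<lambda>p. ?XX p w) ?B) then 1 else 0) = (if w \<in> E p then 1 else 0 :: real)"
    using that by (simp add: E_def)
  qed
  also have "\<dots> = real (card {p \<in> J. w \<in> E p})" using J(1) by (simp add: sum.If_cases Int_def)
  finally show ?thesis by simp
 qed
 have bnd: "\<bar>g (card {p \<in> J. w \<in> E p})\<bar> \<le> (\<Sum>k\<le>card J. \<bar>g k\<bar>)" for w
 proof -
  have "card {p \<in> J. w \<in> E p} \<le> card J" using J(1) by (intro card_mono) auto
  then show ?thesis by (intro member_le_sum) auto
 qed
 have rv1: "(Y1 \<circ> (\<lambda>w. restrict (\<lambda>p. ?XX p w) ?A)) \<in> borel_measurable M" by (rule indep_var_rv1[OF iv2])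
 have rv2: "((\<lambda>x. g (nat \<lfloor>cn x\<rfloor>)) \<circ> (\<lambda>w. restrict (\<lambda>p. ?XX p w) ?B)) \<in> borel_measurable M" by (rule indep_var_rv2[OF iv2])
 have i1: "integrable M (Y1 \<circ> (\<lambda>w. restrict (\<lambda>p. ?XX p w) ?A))"
  by (rule integrable_const_bound[of _ 1, OF _ rv1]) (auto simp: Y1_def)
 have i2: "integrable M ((\<lambda>x. g (nat \<lfloor>cn x\<rfloor>)) \<circ> (\<lambda>w. restrict (\<lambda>p. ?XX p w) ?B))"
  by (rule integrable_const_bound[of _ "\<Sum>k\<le>card J. \<bar>g k\<bar>", OF _ rv2]) (intro AE_I2, simp only: e2 real_norm_def, rule bnd)
 have "expectation (\<lambda>w. indicator (E (i, j)) w * g (card {p \<in> J. w \<in> E p}))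
   = expectation (\<lambda>w. (Y1 \<circ> (\<lambda>w. restrict (\<lambda>p. ?XX p w) ?A)) w * ((\<lambda>x. g (nat \<lfloor>cn x\<rfloor>)) \<circ> (\<lambda>w. restrict (\<lambda>p. ?XX p w) ?B)) w)"
  by (intro Bochner_Integration.integral_cong refl) (simp only: e1 e2)
 also have "\<dots> = expectation (Y1 \<circ> (\<lambda>w. restrict (\<lambda>p. ?XX p w) ?A)) * expectation ((\<lambda>x. g (nat \<lfloor>cn x\<rfloor>)) \<circ> (\<lambda>w. restrict (\<lambda>p. ?XX p w) ?B))"
  by (rule indep_var_lebesgue_integral[OF iv2 i1 i2])
 also have "expectation (Y1 \<circ> (\<lambda>w. restrict (\<lambda>p. ?XX p w) ?A)) = expectation (indicator (E (i, j)))"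
  by (intro Bochner_Integration.integral_cong refl) (simp only: e1)
 also have "expectation (indicator (E (i, j))) = prob (E (i, j))"
  using Int_absorb2[of "E (i, j)" "space M"] by (simp add: E_def Int_def)
 also have "expectation ((\<lambda>x. g (nat \<lfloor>cn x\<rfloor>)) \<circ> (\<lambda>w. restrict (\<lambda>p. ?XX p w) ?B)) = expectation (\<lambda>w. g (card {p \<in> J. w \<in> E p}))"
  by (intro Bochner_Integration.integral_cong refl) (simp only: e2)
 finally show ?thesis .
qed

end

section \<open>From one-step comparison to tail limits\<close>

lemma indicator_le_logistic:
 assumes "A > 0" "\<delta> > 0" "w > (0::real)"
 shows "1 \<le> (1 + exp (- (A * \<delta>))) * logistic (A * (w + \<delta>))"
proof -
 have "exp (- (A * (w + \<delta>))) \<le> exp (- (A * \<delta>))" using assms by (simp add: distrib_left)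
 then have "1 + exp (- (A * (w + \<delta>))) \<le> 1 + exp (- (A * \<delta>))" by simp
 moreover have "1 + exp (- (A * (w + \<delta>))) > 0" by (simp add: add_pos_pos)
 ultimately show ?thesis by (simp add: logistic_def le_divide_eq)
qed

lemma logistic_lower_nonpos:
 assumes "u \<le> 0"
 shows "exp u / 2 \<le> logistic u"
proof -
 have "exp u * (1 + exp (- u)) \<le> 2" using assms by (simp add: distrib_left flip: exp_add)
 then show ?thesis by (simp add: logistic_def field_simps add_pos_pos)
qed

lemma logistic_le_indicator:
 assumes "A > 0" "\<delta> > 0"
 shows "logistic (A * (w - \<delta>)) - 2 * exp (- (A * \<delta>)) * logistic (A * w) \<le> (if w > 0 then 1 else 0)"
proof (cases "w > 0")
 case True
 have "0 \<le> 2 * exp (- (A * \<delta>)) * logistic (A * w)" using logistic_pos[of "A * w"] by simp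
 then show ?thesis unfolding if_P[OF True] using logistic_less_1[of "A * (w - \<delta>)"] by linarith
next
 case False
 then have "A * w \<le> 0" using assms by (simp add: mult_le_0_iff)
 have "logistic (A * (w - \<delta>)) \<le> exp (A * (w - \<delta>))" by (rule logistic_le_exp)
 also have "\<dots> = 2 * exp (- (A * \<delta>)) * (exp (A * w) / 2)" by (simp add: exp_add[symmetric] right_diff_distrib)
 also have "\<dots> \<le> 2 * exp (- (A * \<delta>)) * logistic (A * w)"
  by (intro mult_left_mono logistic_lower_nonpos \<open>A * w \<le> 0\<close>) simp
 finally show ?thesis using False by simp
qed

text \<open>The indicator of a half-line lies between logistic functions moved by \<open>\<delta>\<close>, up to factors tending to 1 with \<open>A\<close>. First \<open>A\<close> tends to infinity, then \<open>\<delta>\<close> to 0.\<close>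
lemma (in prob_space) tail_limit_from_smoothed:
 fixes W :: "nat \<Rightarrow> 'a \<Rightarrow> real"
 assumes W: "\<And>n. W n \<in> borel_measurable M" and P: "\<And>n. P n \<ge> 0"
  and lim: "\<And>A t. A \<ge> 2 \<Longrightarrow> (\<lambda>n. P n * expectation (\<lambda>v. logistic (A * (W n v - t)))) \<longlonglongrightarrow> exp (- t) * smoothing_factor A"
 shows "(\<lambda>n. P n * prob {v \<in> space M. t < W n v}) \<longlonglongrightarrow> exp (- t)"
proof (rule order_tendstoI)
 note [measurable] = W
 have iL: "integrable M (\<lambda>v. logistic (A * (W n v - s)))" for A n s
  by (rule integrable_logistic) measurable
 have iI: "integrable M (\<lambda>v. indicator {v \<in> space M. t < W n v} v :: real)" for n
  by (rule integrable_real_indicator) (auto simp: emeasure_eq_measure)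
 have pI: "prob {v \<in> space M. t < W n v} = expectation (\<lambda>v. indicator {v \<in> space M. t < W n v} v)" for n
  by simp
 have dec: "((\<lambda>A::real. exp (- (A * \<delta>))) \<longlongrightarrow> 0) at_top" if "\<delta> > 0" for \<delta>
 proof -
  have "filterlim (\<lambda>A. \<delta> * A) at_top at_top"
   using that by (intro filterlim_tendsto_pos_mult_at_top[OF tendsto_const _ filterlim_ident])
  then have "filterlim (\<lambda>A. - (\<delta> * A)) at_bot at_top"
   by (rule filterlim_compose[OF filterlim_uminus_at_bot_at_top])
  then have "((\<lambda>A. exp (- (\<delta> * A))) \<longlongrightarrow> 0) at_top"
   by (rule filterlim_compose[OF exp_at_bot])
  then show ?thesis by (simp only: mult.commute)
 qed
 {
  fix a assume a: "exp (- t) < a"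
  have "((\<lambda>\<delta>. exp (- (t - \<delta>))) \<longlongrightarrow> exp (- (t - 0))) (at_right 0)" by (intro tendsto_intros)
  from order_tendstoD(2)[OF this, of a] a have "\<forall>\<^sub>F \<delta> in at_right 0. exp (- (t - \<delta>)) < a" by simp
  then have "\<forall>\<^sub>F \<delta> in at_right 0. exp (- (t - \<delta>)) < a \<and> \<delta> > 0"
   by (intro eventually_conj eventually_at_right_less)
  then obtain \<delta> where \<delta>: "exp (- (t - \<delta>)) < a" "\<delta> > 0"
   using eventually_happens' trivial_limit_at_right_real by blast
  have "((\<lambda>A. (1 + exp (- (A * \<delta>))) * (exp (- (t - \<delta>)) * smoothing_factor A)) \<longlongrightarrow> (1 + 0) * (exp (- (t - \<delta>)) * 1)) at_top"
   by (intro tendsto_mult tendsto_add tendsto_const dec[OF \<delta>(2)] smoothing_factor_tendsto)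
  from order_tendstoD(2)[OF this, of a] \<delta>(1)
  have "\<forall>\<^sub>F A in at_top. (1 + exp (- (A * \<delta>))) * (exp (- (t - \<delta>)) * smoothing_factor A) < a" by simp
  then have "\<forall>\<^sub>F A in at_top. (1 + exp (- (A * \<delta>))) * (exp (- (t - \<delta>)) * smoothing_factor A) < a \<and> A \<ge> 2"
   by (intro eventually_conj eventually_ge_at_top)
  then obtain A where A: "(1 + exp (- (A * \<delta>))) * (exp (- (t - \<delta>)) * smoothing_factor A) < a" "A \<ge> 2"
   using eventually_happens' trivial_limit_at_top_linorder by blast
  have "(\<lambda>n. (1 + exp (- (A * \<delta>))) * (P n * expectation (\<lambda>v. logistic (A * (W n v - (t - \<delta>)))))) \<longlonglongrightarrow> (1 + exp (- (A * \<delta>))) * (exp (- (t - \<delta>)) * smoothing_factor A)"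
   by (intro tendsto_mult tendsto_const lim A(2))
  from order_tendstoD(2)[OF this A(1)]
  show "\<forall>\<^sub>F n in sequentially. P n * prob {v \<in> space M. t < W n v} < a"
  proof eventually_elim
   case (elim n)
   have "prob {v \<in> space M. t < W n v} \<le> expectation (\<lambda>v. (1 + exp (- (A * \<delta>))) * logistic (A * (W n v - (t - \<delta>))))"
    unfolding pI
   proof (rule integral_mono[OF iI integrable_mult_right[OF iL]])
    fix v
    show "indicator {v \<in> space M. t < W n v} v \<le> (1 + exp (- (A * \<delta>))) * logistic (A * (W n v - (t - \<delta>)))"
    proof (cases "t < W n v")
     case True
     have eq: "W n v - (t - \<delta>) = (W n v - t) + \<delta>" by simp
     have "indicator {v \<in> space M. t < W n v} v \<le> (1::real)" by (simp add: indicator_def)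
     also have "\<dots> \<le> (1 + exp (- (A * \<delta>))) * logistic (A * ((W n v - t) + \<delta>))"
      using True A(2) \<delta>(2) by (intro indicator_le_logistic) auto
     finally show ?thesis unfolding eq .
    next
     case False
     then show ?thesis using logistic_pos[of "A * (W n v - (t - \<delta>))"] by (simp add: indicator_def add_nonneg_nonneg)
    qed
   qed
   also have "\<dots> = (1 + exp (- (A * \<delta>))) * expectation (\<lambda>v. logistic (A * (W n v - (t - \<delta>))))" by simp
   finally have "P n * prob {v \<in> space M. t < W n v} \<le> P n * ((1 + exp (- (A * \<delta>))) * expectation (\<lambda>v. logistic (A * (W n v - (t - \<delta>)))))"
    using P by (intro mult_left_mono)
   also have "\<dots> = (1 + exp (- (A * \<delta>))) * (P n * expectation (\<lambda>v. logistic (A * (W n v - (t - \<delta>)))))" by (simp only: mult_ac)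
   finally show ?case using elim by linarith
  qed
 }
 {
  fix a assume a: "a < exp (- t)"
  have "((\<lambda>\<delta>. exp (- (t + \<delta>))) \<longlongrightarrow> exp (- (t + 0))) (at_right 0)" by (intro tendsto_intros)
  from order_tendstoD(1)[OF this, of a] a have "\<forall>\<^sub>F \<delta> in at_right 0. a < exp (- (t + \<delta>))" by simp
  then have "\<forall>\<^sub>F \<delta> in at_right 0. a < exp (- (t + \<delta>)) \<and> \<delta> > 0"
   by (intro eventually_conj eventually_at_right_less)
  then obtain \<delta> where \<delta>: "a < exp (- (t + \<delta>))" "\<delta> > 0"
   using eventually_happens' trivial_limit_at_right_real by blast
  let ?F = "\<lambda>A. exp (- (t + \<delta>)) * smoothing_factor A - 2 * exp (- (A * \<delta>)) * (exp (- t) * smoothing_factor A)"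
  have "(?F \<longlongrightarrow> exp (- (t + \<delta>)) * 1 - 2 * 0 * (exp (- t) * 1)) at_top"
   by (intro tendsto_mult tendsto_diff tendsto_const dec[OF \<delta>(2)] smoothing_factor_tendsto)
  from order_tendstoD(1)[OF this, of a] \<delta>(1)
  have "\<forall>\<^sub>F A in at_top. a < ?F A" by simp
  then have "\<forall>\<^sub>F A in at_top. a < ?F A \<and> A \<ge> 2"
   by (intro eventually_conj eventually_ge_at_top)
  then obtain A where A: "a < ?F A" "A \<ge> 2"
   using eventually_happens' trivial_limit_at_top_linorder by blast
  have "(\<lambda>n. P n * expectation (\<lambda>v. logistic (A * (W n v - (t + \<delta>)))) - 2 * exp (- (A * \<delta>)) * (P n * expectation (\<lambda>v. logistic (A * (W n v - t))))) \<longlonglongrightarrow> ?F A"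
   by (intro tendsto_mult tendsto_diff tendsto_const lim A(2))
  from order_tendstoD(1)[OF this A(1)]
  show "\<forall>\<^sub>F n in sequentially. a < P n * prob {v \<in> space M. t < W n v}"
  proof eventually_elim
   case (elim n)
   have "expectation (\<lambda>v. logistic (A * (W n v - (t + \<delta>)))) - 2 * exp (- (A * \<delta>)) * expectation (\<lambda>v. logistic (A * (W n v - t)))
    = expectation (\<lambda>v. logistic (A * (W n v - (t + \<delta>))) - 2 * exp (- (A * \<delta>)) * logistic (A * (W n v - t)))"
    by (subst Bochner_Integration.integral_diff[OF iL integrable_mult_right[OF iL]]) simp
   also have "\<dots> \<le> prob {v \<in> space M. t < W n v}"
    unfolding pI
   proof (rule integral_mono[OF Bochner_Integration.integrable_diff[OF iL integrable_mult_right[OF iL]] iI])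
    fix v assume "v \<in> space M"
    have eq: "W n v - (t + \<delta>) = (W n v - t) - \<delta>" by simp
    show "logistic (A * (W n v - (t + \<delta>))) - 2 * exp (- (A * \<delta>)) * logistic (A * (W n v - t)) \<le> indicator {v \<in> space M. t < W n v} v"
    proof -
     have ind: "indicator {v \<in> space M. t < W n v} v = (if W n v - t > 0 then 1 else 0 :: real)"
      using \<open>v \<in> space M\<close> by (simp add: indicator_def)
     show ?thesis unfolding eq ind using A(2) \<delta>(2) by (intro logistic_le_indicator) auto
    qed
   qed
   finally have "P n * (expectation (\<lambda>v. logistic (A * (W n v - (t + \<delta>)))) - 2 * exp (- (A * \<delta>)) * expectation (\<lambda>v. logistic (A * (W n v - t))))
    \<le> P n * prob {v \<in> space M. t < W n v}"
    using P by (intro mult_left_mono)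
   moreover have "P n * (expectation (\<lambda>v. logistic (A * (W n v - (t + \<delta>)))) - 2 * exp (- (A * \<delta>)) * expectation (\<lambda>v. logistic (A * (W n v - t))))
    = P n * expectation (\<lambda>v. logistic (A * (W n v - (t + \<delta>)))) - 2 * exp (- (A * \<delta>)) * (P n * expectation (\<lambda>v. logistic (A * (W n v - t))))"
    by (simp add: right_diff_distrib)
   ultimately show ?case using elim by linarith
  qed
 }
qed

lemma power_one_plus_le_exp:
 assumes "\<epsilon> \<ge> (0::real)"
 shows "(1 + \<epsilon>) ^ n \<le> exp (real n * \<epsilon>)"
proof -
 have "(1 + \<epsilon>) ^ n \<le> exp \<epsilon> ^ n" using assms by (intro power_mono exp_ge_add_one_self) auto
 then show ?thesis by (simp add: exp_of_nat_mult)
qed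

lemma shift_avg_logistic_le_1:
 assumes "borel_prob \<nu>"
 shows "(shift_avg \<nu> ^^ n) elogistic s \<le> 1"
proof (induction n arbitrary: s)
 case 0
 show ?case using logistic_less_1[of s] by (simp add: less_imp_le)
next
 case (Suc n)
 have "(shift_avg \<nu> ^^ Suc n) elogistic s \<le> shift_avg \<nu> (\<lambda>_. 1) s"
  unfolding funpow.simps o_apply by (rule shift_avg_mono) (rule Suc.IH)
 also have "\<dots> = 1"
  using borel_probD(1)[OF assms] by (simp add: shift_avg_def prob_space.emeasure_space_1)
 finally show ?case .
qed

lemma taylor_rem_comparator:
 assumes N: "prob_space N" and Y: "Y \<in> borel_measurable N"
  and int: "integrable N (\<lambda>v. \<bar>Y v\<bar> ^ k * exp (c * \<bar>Y v\<bar>))" and q: "0 \<le> q" "2 * q \<le> c"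
 shows "integrable N (\<lambda>v. taylor_rem k UNIV q (Y v))"
  and "(LINT v|N. taylor_rem k UNIV q (Y v)) \<le> q ^ k * (LINT v|N. \<bar>Y v\<bar> ^ k * exp (c * \<bar>Y v\<bar>))"
proof -
 note [measurable] = Y
 have b: "taylor_rem k UNIV q y \<le> q ^ k * (\<bar>y\<bar> ^ k * exp (c * \<bar>y\<bar>))" for y
 proof -
  have "taylor_rem k UNIV q y = q ^ k * (\<bar>y\<bar> ^ k * exp (2 * q * \<bar>y\<bar>))" by (simp add: taylor_rem_def power_mult_distrib)
  also have "\<dots> \<le> q ^ k * (\<bar>y\<bar> ^ k * exp (c * \<bar>y\<bar>))" using q by (intro mult_left_mono) (auto intro: mult_right_mono)
  finally show ?thesis .
 qed
 have i2: "integrable N (\<lambda>v. q ^ k * (\<bar>Y v\<bar> ^ k * exp (c * \<bar>Y v\<bar>)))" using int by (rule integrable_mult_right)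
 show i1: "integrable N (\<lambda>v. taylor_rem k UNIV q (Y v))"
 proof (rule Bochner_Integration.integrable_bound[OF i2])
  show "AE v in N. norm (taylor_rem k UNIV q (Y v)) \<le> norm (q ^ k * (\<bar>Y v\<bar> ^ k * exp (c * \<bar>Y v\<bar>)))"
  proof (rule AE_I2)
   fix v
   show "norm (taylor_rem k UNIV q (Y v)) \<le> norm (q ^ k * (\<bar>Y v\<bar> ^ k * exp (c * \<bar>Y v\<bar>)))"
    using b[of "Y v"] taylor_rem_nonneg[OF q(1), of k UNIV "Y v"] unfolding real_norm_def by linarith
  qed
 qed measurable
 have "(LINT v|N. taylor_rem k UNIV q (Y v)) \<le> (LINT v|N. q ^ k * (\<bar>Y v\<bar> ^ k * exp (c * \<bar>Y v\<bar>)))"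
  by (intro integral_mono i1 i2 b)
 also have "\<dots> = q ^ k * (LINT v|N. \<bar>Y v\<bar> ^ k * exp (c * \<bar>Y v\<bar>))" by simp
 finally show "(LINT v|N. taylor_rem k UNIV q (Y v)) \<le> q ^ k * (LINT v|N. \<bar>Y v\<bar> ^ k * exp (c * \<bar>Y v\<bar>))" .
qed

lemma trunc_UNIV [simp]: "trunc UNIV z = z"
 by (simp add: trunc_def)

text \<open>Both directions of the replacement step are used, each with a factor \<open>1 + o(1/n)\<close>; after \<open>n\<close> steps the ratio tends to 1.\<close>
lemma lindeberg_limit:
 fixes M :: "'a measure" and N :: "'b measure" and q u :: "nat \<Rightarrow> real"
 assumes M: "prob_space M" and N: "prob_space N" and k: "k \<ge> 2"
  and Z: "Z \<in> borel_measurable M" and B: "\<And>n. B n \<in> sets borel" and Y: "Y \<in> borel_measurable N"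
  and int: "\<And>j. j < k \<Longrightarrow> integrable M (\<lambda>v. Z v ^ j)" "\<And>j. j < k \<Longrightarrow> integrable N (\<lambda>v. Y v ^ j)"
  and mom: "\<And>j. j < k \<Longrightarrow> (LINT v|M. Z v ^ j) = (LINT v|N. Y v ^ j)"
  and q: "\<forall>\<^sub>F n in sequentially. q n > 0" "q \<longlonglongrightarrow> 0" "(\<lambda>n. real n * q n ^ k) \<longlonglongrightarrow> 0"
  and remZ: "\<forall>\<^sub>F n in sequentially. integrable M (\<lambda>v. taylor_rem k (B n) (q n) (Z v))"
   "(\<lambda>n. real n * (LINT v|M. taylor_rem k (B n) (q n) (Z v))) \<longlonglongrightarrow> 0"
  and Yexp: "c > 0" "integrable N (\<lambda>v. \<bar>Y v\<bar> ^ k * exp (c * \<bar>Y v\<bar>))"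
  and P: "\<And>n. P n \<ge> 0"
  and lim: "(\<lambda>n. P n * enn2real ((shift_avg (distr N borel (\<lambda>v. q n * Y v)) ^^ n) elogistic (u n))) \<longlonglongrightarrow> l"
 shows "(\<lambda>n. P n * enn2real ((shift_avg (distr M borel (\<lambda>v. q n * trunc (B n) (Z v))) ^^ n) elogistic (u n))) \<longlonglongrightarrow> l"
proof -
 let ?g = "\<lambda>u. ennreal (logistic u)"
 have gm: "?g \<in> borel_measurable borel" by measurable
 have k0: "k > 0" "1 < k" using k by auto
 define rZ where "rZ n = (LINT v|M. taylor_rem k (B n) (q n) (Z v))" for n
 define rY where "rY n = (LINT v|N. taylor_rem k UNIV (q n) (Y v))" for n
 define \<epsilon> where "\<epsilon> n = 2 * taylor_const k * (rZ n + rY n)" for n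
 define mY where "mY = (LINT v|N. \<bar>Y v\<bar> ^ k * exp (c * \<bar>Y v\<bar>))"
 let ?L = "\<lambda>n. (shift_avg (distr M borel (\<lambda>v. q n * trunc (B n) (Z v))) ^^ n) ?g (u n)"
 let ?R = "\<lambda>n. (shift_avg (distr N borel (\<lambda>v. q n * Y v)) ^^ n) ?g (u n)"
 have intZ1: "integrable M (\<lambda>v. \<bar>Z v\<bar>)" and intY1: "integrable N (\<lambda>v. \<bar>Y v\<bar>)"
  using int(1)[OF k0(2)] int(2)[OF k0(2)] by (simp_all add: integrable_abs)
 have small: "\<forall>\<^sub>F n in sequentially. q n * m \<le> 1 / 2" for m
 proof -
  have "(\<lambda>n. q n * m) \<longlonglongrightarrow> 0 * m" by (intro tendsto_mult q(2) tendsto_const)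
  from order_tendstoD(2)[OF this, of "1/2"] show ?thesis by (auto elim: eventually_mono)
 qed
 have cs: "\<forall>\<^sub>F n in sequentially. 2 * q n \<le> c"
 proof -
  have "(\<lambda>n. 2 * q n) \<longlonglongrightarrow> 2 * 0" by (intro tendsto_mult q(2) tendsto_const)
  from order_tendstoD(2)[OF this, of c] Yexp(1) show ?thesis by (auto elim: eventually_mono)
 qed
 have good: "\<forall>\<^sub>F n in sequentially. ?L n \<le> ennreal (1 + \<epsilon> n) ^ n * ?R n \<and> ?R n \<le> ennreal (1 + \<epsilon> n) ^ n * ?L n
   \<and> 0 \<le> \<epsilon> n \<and> real n * \<epsilon> n \<le> 2 * taylor_const k * (real n * rZ n + real n * q n ^ k * mY)"
  using q(1) cs small[of "LINT v|M. \<bar>Z v\<bar>"] small[of "LINT v|N. \<bar>Y v\<bar>"] remZ(1)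
 proof eventually_elim
  case (elim n)
  have t0: "q n \<ge> 0" using elim(1) by simp
  note iY = taylor_rem_comparator[OF N Y Yexp(2) t0 elim(2)]
  have rr: "rZ n \<ge> 0" "rY n \<ge> 0" unfolding rZ_def rY_def
   using taylor_rem_nonneg[OF t0] by (auto intro: integral_nonneg_AE)
  have tc: "taylor_const k \<ge> 1" by (rule taylor_const(1)[OF k0(1)])
  have e0: "0 \<le> \<epsilon> n" unfolding \<epsilon>_def using rr tc by (intro mult_nonneg_nonneg add_nonneg_nonneg) auto
  have mZ: "(\<lambda>v. q n * trunc (B n) (Z v)) \<in> borel_measurable M" using Z B[of n] by measurable
  have mY': "(\<lambda>v. q n * Y v) \<in> borel_measurable N" using Y by measurable
  have s1: "shift_avg (distr M borel (\<lambda>v. q n * trunc (B n) (Z v))) ?g s \<le> ennreal (1 + \<epsilon> n) * shift_avg (distr N borel (\<lambda>v. q n * Y v)) ?g s" for s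
   using lindeberg_step[OF M N k0(1) t0 Z B[of n] Y, of UNIV s] int mom elim(5) iY(1) intY1 elim(4)
   by (simp add: \<epsilon>_def rZ_def rY_def)
  have s2: "shift_avg (distr N borel (\<lambda>v. q n * Y v)) ?g s \<le> ennreal (1 + \<epsilon> n) * shift_avg (distr M borel (\<lambda>v. q n * trunc (B n) (Z v))) ?g s" for s
   using lindeberg_step[OF N M k0(1) t0 Y _ Z B[of n], of UNIV s] int mom elim(5) iY(1) intZ1 elim(3)
   by (simp add: \<epsilon>_def rZ_def rY_def add.commute)
  have "?L n \<le> ennreal (1 + \<epsilon> n) ^ n * ?R n"
   by (rule shift_avg_telescope[OF borel_prob_distr[OF M mZ] borel_prob_distr[OF N mY'] gm s1])
  moreover have "?R n \<le> ennreal (1 + \<epsilon> n) ^ n * ?L n"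
   by (rule shift_avg_telescope[OF borel_prob_distr[OF N mY'] borel_prob_distr[OF M mZ] gm s2])
  moreover have "real n * \<epsilon> n \<le> 2 * taylor_const k * (real n * rZ n + real n * q n ^ k * mY)"
  proof -
   have "real n * \<epsilon> n = 2 * taylor_const k * (real n * rZ n + real n * rY n)" by (simp add: \<epsilon>_def algebra_simps)
   also have "\<dots> \<le> 2 * taylor_const k * (real n * rZ n + real n * (q n ^ k * mY))"
    using tc iY(2) unfolding rY_def mY_def by (intro mult_left_mono add_left_mono) auto
   finally show ?thesis by (simp add: mult.assoc)
  qed
  ultimately show ?case using e0 by blast
 qed
 have elim0: "(\<lambda>n. real n * \<epsilon> n) \<longlonglongrightarrow> 0"
 proof (rule tendsto_sandwich[OF _ _ tendsto_const])
  have "(\<lambda>n. 2 * taylor_const k * (real n * rZ n + real n * q n ^ k * mY)) \<longlonglongrightarrow> 2 * taylor_const k * (0 + 0 * mY)"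
   using remZ(2) unfolding rZ_def by (intro tendsto_mult tendsto_add tendsto_const q(3))
  then show "(\<lambda>n. 2 * taylor_const k * (real n * rZ n + real n * q n ^ k * mY)) \<longlonglongrightarrow> 0" by simp
  show "\<forall>\<^sub>F n in sequentially. 0 \<le> real n * \<epsilon> n" using good by eventually_elim simp
  show "\<forall>\<^sub>F n in sequentially. real n * \<epsilon> n \<le> 2 * taylor_const k * (real n * rZ n + real n * q n ^ k * mY)"
   using good by eventually_elim simp
 qed
 have conv: "\<forall>\<^sub>F n in sequentially. enn2real (?L n) \<le> exp (real n * \<epsilon> n) * enn2real (?R n) \<and> enn2real (?R n) \<le> exp (real n * \<epsilon> n) * enn2real (?L n)"
  using good
 proof eventually_elim
  case (elim n)
  have mZ: "(\<lambda>v. q n * trunc (B n) (Z v)) \<in> borel_measurable M" using Z B[of n] by measurable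
  have bM: "borel_prob (distr M borel (\<lambda>v. q n * trunc (B n) (Z v)))"
   by (rule borel_prob_distr[OF M mZ])
  have bN: "borel_prob (distr N borel (\<lambda>v. q n * Y v))" using Y by (intro borel_prob_distr N) measurable
  have fin: "?L n < top" "?R n < top"
   using shift_avg_logistic_le_1[OF bM, of n "u n"] shift_avg_logistic_le_1[OF bN, of n "u n"]
   by (auto intro: le_less_trans)
  have key: "enn2real x \<le> exp (real n * \<epsilon> n) * enn2real y" if "x \<le> ennreal (1 + \<epsilon> n) ^ n * y" "x < top" "y < top" for x y
  proof -
   obtain x' where x': "x = ennreal x'" "x' \<ge> 0" using \<open>x < top\<close> by (cases x) auto
   obtain y' where y': "y = ennreal y'" "y' \<ge> 0" using \<open>y < top\<close> by (cases y) auto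
   have p: "ennreal (1 + \<epsilon> n) ^ n = ennreal ((1 + \<epsilon> n) ^ n)" by (rule ennreal_power) (use elim in simp)
   have "ennreal x' \<le> ennreal ((1 + \<epsilon> n) ^ n) * ennreal y'" using that(1) unfolding x'(1) y'(1) p .
   also have "\<dots> = ennreal ((1 + \<epsilon> n) ^ n * y')" by (rule ennreal_mult[symmetric]) (use elim y'(2) in simp_all)
   finally have "x' \<le> (1 + \<epsilon> n) ^ n * y'" using elim y'(2) by (subst (asm) ennreal_le_iff) auto
   also have "\<dots> \<le> exp (real n * \<epsilon> n) * y'" using elim y'(2) by (intro mult_right_mono power_one_plus_le_exp) auto
   finally show ?thesis unfolding x' y' using x'(2) y'(2) by simp
  qed
  show ?case using key[of "?L n" "?R n"] key[of "?R n" "?L n"] elim fin by blast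
 qed
 show ?thesis
 proof (rule tendsto_sandwich[where f="\<lambda>n. exp (- (real n * \<epsilon> n)) * (P n * enn2real (?R n))" and h="\<lambda>n. exp (real n * \<epsilon> n) * (P n * enn2real (?R n))"])
  have "(\<lambda>n. exp (real n * \<epsilon> n) * (P n * enn2real (?R n))) \<longlonglongrightarrow> exp 0 * l"
   by (intro tendsto_mult tendsto_exp elim0 lim)
  then show "(\<lambda>n. exp (real n * \<epsilon> n) * (P n * enn2real (?R n))) \<longlonglongrightarrow> l" by simp
  have "(\<lambda>n. exp (- (real n * \<epsilon> n)) * (P n * enn2real (?R n))) \<longlonglongrightarrow> exp (- 0) * l"
   by (intro tendsto_mult tendsto_exp tendsto_minus elim0 lim)
  then show "(\<lambda>n. exp (- (real n * \<epsilon> n)) * (P n * enn2real (?R n))) \<longlonglongrightarrow> l" by simp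
  show "\<forall>\<^sub>F n in sequentially. P n * enn2real (?L n) \<le> exp (real n * \<epsilon> n) * (P n * enn2real (?R n))"
   using conv
  proof eventually_elim
   case (elim n)
   then have "P n * enn2real (?L n) \<le> P n * (exp (real n * \<epsilon> n) * enn2real (?R n))" using P by (intro mult_left_mono) auto
   then show ?case by (simp only: mult_ac)
  qed
  show "\<forall>\<^sub>F n in sequentially. exp (- (real n * \<epsilon> n)) * (P n * enn2real (?R n)) \<le> P n * enn2real (?L n)"
   using conv
  proof eventually_elim
   case (elim n)
   then have "exp (- (real n * \<epsilon> n)) * (P n * enn2real (?R n)) \<le> exp (- (real n * \<epsilon> n)) * (P n * (exp (real n * \<epsilon> n) * enn2real (?L n)))"
    using P by (intro mult_left_mono) auto
   also have "\<dots> = (exp (- (real n * \<epsilon> n)) * exp (real n * \<epsilon> n)) * (P n * enn2real (?L n))" by (simp only: mult_ac)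
   also have "exp (- (real n * \<epsilon> n)) * exp (real n * \<epsilon> n) = 1" by (simp add: exp_add[symmetric])
   finally show ?case by simp
  qed
 qed
qed

section \<open>Comparison variables\<close>

lemma shift_avg_std_normal_pow:
 assumes "\<theta> > 0" "n > 0"
 shows "(shift_avg (distr std_normal borel (\<lambda>y. \<theta> * y)) ^^ n) elogistic
  = shift_avg (normal_shift (\<theta> * sqrt n)) elogistic"
proof -
 have "distr std_normal borel (\<lambda>y. \<theta> * y) = normal_shift (\<theta> *\<^sub>R (1::real))"
  unfolding normal_shift_def by (simp add: mult.commute)
 moreover have "(shift_avg (normal_shift (\<theta> *\<^sub>R (1::real))) ^^ n) elogistic
   = shift_avg (normal_shift ((\<theta> * sqrt n) *\<^sub>R 1)) elogistic"
  using assms by (intro shift_avg_normal_pow) measurable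
 ultimately show ?thesis by simp
qed

text \<open>The standardized gamma variable with skewness twice \<open>\<epsilon> / sqrt k\<close>; every nonzero third moment has this form for some sign \<open>\<epsilon>\<close> and shape \<open>k\<close>.\<close>
definition centered_gamma :: "real \<Rightarrow> real \<Rightarrow> real \<Rightarrow> real"
 where "centered_gamma k \<epsilon> y = \<epsilon> * (y - k) / sqrt k"

lemma shift_avg_centered_gamma_pow:
 assumes k: "k > 0" and n: "n > 0"
 shows "(shift_avg (distr (density lborel (gamma_density k)) borel (\<lambda>y. \<theta> * centered_gamma k \<epsilon> y)) ^^ n) elogistic
  = shift_avg (gamma_shift (\<epsilon> * \<theta> / sqrt k) (n * k)) elogistic"
proof -
 have "distr (density lborel (gamma_density k)) borel (\<lambda>y. \<theta> * centered_gamma k \<epsilon> y) = gamma_shift (\<epsilon> * \<theta> / sqrt k) k"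
  unfolding gamma_shift_def centered_gamma_def by (simp add: mult_ac)
 then show ?thesis using shift_avg_gamma_pow[OF k n, of "\<lambda>u. ennreal (logistic u)" "\<epsilon> * \<theta> / sqrt k"] by simp
qed

lemma gamma_moment:
 assumes k: "k > 0"
 shows "integrable (density lborel (gamma_density k)) (\<lambda>y. y ^ j)"
  and "(LINT y|density lborel (gamma_density k). y ^ j) = Gamma (k + real j) / Gamma k"
proof -
 have G: "Gamma k > 0" "Gamma (k + real j) > 0" using k by (auto intro: Gamma_real_pos)
 have eq: "gamma_density k y * y ^ j = Gamma (k + real j) / Gamma k * gamma_density (k + real j) y" for y
 proof (cases "y > 0")
  case True
  then have "y powr (k + real j - 1) = y powr (k - 1) * y ^ j"
   by (simp add: powr_realpow[symmetric] powr_add[symmetric] algebra_simps)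
  then show ?thesis using True G by (simp add: gamma_density_def)
 qed (simp add: gamma_density_def)
 have kj: "k + real j > 0" using k by simp
 have i: "integrable lborel (gamma_density (k + real j))"
  using integral_gamma_density[OF kj] not_integrable_integral_eq by fastforce
 have "integrable lborel (\<lambda>y. gamma_density k y *\<^sub>R y ^ j)"
  unfolding real_scaleR_def eq by (intro integrable_mult_right i)
 then show "integrable (density lborel (gamma_density k)) (\<lambda>y. y ^ j)"
  using k by (subst integrable_density) (auto simp: gamma_density_nonneg)
 have "(LINT y|density lborel (gamma_density k). y ^ j) = (LINT y|lborel. gamma_density k y *\<^sub>R y ^ j)"
  using k by (intro integral_density) (auto simp: gamma_density_nonneg)
 also have "\<dots> = Gamma (k + real j) / Gamma k"
  unfolding real_scaleR_def eq using integral_gamma_density[OF kj] by simp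
 finally show "(LINT y|density lborel (gamma_density k). y ^ j) = Gamma (k + real j) / Gamma k" .
qed

lemma centered_gamma_moments:
 assumes k: "k > 0" and \<epsilon>: "\<epsilon> \<in> {1, -1}"
 defines "G \<equiv> density lborel (gamma_density k)"
 shows "integrable G (\<lambda>y. centered_gamma k \<epsilon> y ^ 1)" "(LINT y|G. centered_gamma k \<epsilon> y ^ 1) = 0"
  "integrable G (\<lambda>y. centered_gamma k \<epsilon> y ^ 2)" "(LINT y|G. centered_gamma k \<epsilon> y ^ 2) = 1"
  "integrable G (\<lambda>y. centered_gamma k \<epsilon> y ^ 3)" "(LINT y|G. centered_gamma k \<epsilon> y ^ 3) = 2 * \<epsilon> / sqrt k"
proof -
 interpret prob_space G unfolding G_def by (rule prob_space_gamma[OF k])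
 define r where "r = sqrt k"
 have r: "r > 0" "k = r * r" using k by (auto simp: r_def)
 have Gp: "Gamma k \<noteq> 0" using Gamma_real_pos[OF k] by simp
 have g1: "Gamma (k + 1) = k * Gamma k" using k by (intro Gamma_plus1) auto
 have np: "x \<notin> \<int>\<^sub>\<le>\<^sub>0" if "x > 0" for x :: real using that by (auto elim!: nonpos_Ints_cases)
 have g2: "Gamma (k + 2) = (k + 1) * k * Gamma k" using Gamma_plus1[OF np, of "k + 1"] k g1 by (simp add: add.assoc)
 have g3: "Gamma (k + 3) = (k + 2) * (k + 1) * k * Gamma k" using Gamma_plus1[OF np, of "k + 2"] k g2 by (simp add: add.assoc)
 have m1: "integrable G (\<lambda>y. y)" "(LINT y|G. y) = k"
  using gamma_moment[OF k, of 1] g1 Gp unfolding G_def by simp_all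
 have m2: "integrable G (\<lambda>y. y\<^sup>2)" "(LINT y|G. y\<^sup>2) = k * (k + 1)"
  using gamma_moment[OF k, of 2] g2 Gp unfolding G_def by simp_all
 have m3: "integrable G (\<lambda>y. y ^ 3)" "(LINT y|G. y ^ 3) = k * (k + 1) * (k + 2)"
  using gamma_moment[OF k, of 3] g3 Gp unfolding G_def by simp_all
 have c1: "centered_gamma k \<epsilon> y ^ 1 = \<epsilon> / r * y - \<epsilon> / r * k" for y
  by (simp add: centered_gamma_def r_def[symmetric] diff_divide_distrib right_diff_distrib)
 have e2: "\<epsilon>\<^sup>2 = 1" "\<epsilon> ^ 3 = \<epsilon>" using \<epsilon> by auto
 have c2: "centered_gamma k \<epsilon> y ^ 2 = 1 / k * y\<^sup>2 - 2 * y + k" for y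
 proof -
  have "centered_gamma k \<epsilon> y ^ 2 = (y - k)\<^sup>2 / k"
   using k by (simp add: centered_gamma_def power_divide power_mult_distrib e2)
  also have "\<dots> = 1 / k * y\<^sup>2 - 2 * y + k" using k by (simp add: power2_eq_square field_simps)
  finally show ?thesis .
 qed
 have r3: "r ^ 3 = k * r" unfolding r(2) by (simp add: power3_eq_cube)
 have c3: "centered_gamma k \<epsilon> y ^ 3 = \<epsilon> / (k * r) * y ^ 3 - 3 * \<epsilon> / r * y\<^sup>2 + 3 * \<epsilon> * k / r * y - \<epsilon> * k\<^sup>2 / r" for y
 proof -
  have "centered_gamma k \<epsilon> y ^ 3 = \<epsilon> * (y - k) ^ 3 / (k * r)"
   by (simp add: centered_gamma_def r_def[symmetric] power_divide power_mult_distrib e2 r3)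
  also have "\<dots> = \<epsilon> / (k * r) * y ^ 3 - 3 * \<epsilon> / r * y\<^sup>2 + 3 * \<epsilon> * k / r * y - \<epsilon> * k\<^sup>2 / r"
   using k r(1) by (simp add: power3_eq_cube power2_eq_square field_simps)
  finally show ?thesis .
 qed
 show "integrable G (\<lambda>y. centered_gamma k \<epsilon> y ^ 1)" "integrable G (\<lambda>y. centered_gamma k \<epsilon> y ^ 2)"
  "integrable G (\<lambda>y. centered_gamma k \<epsilon> y ^ 3)"
  unfolding c1 c2 c3 by (intro Bochner_Integration.integrable_diff Bochner_Integration.integrable_add integrable_mult_right m1 m2 m3 integrable_const)+
 have ib: "(LINT y|G. a * y ^ 3 - b * y\<^sup>2 + c * y - e) = a * (LINT y|G. y ^ 3) - b * (LINT y|G. y\<^sup>2) + c * (LINT y|G. y) - e" for a b c e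
  using m1 m2 m3 by (simp add: prob_space)
 show "(LINT y|G. centered_gamma k \<epsilon> y ^ 1) = 0"
  unfolding c1 using ib[of 0 0 "\<epsilon> / r" "\<epsilon> / r * k"] m1(2) by simp
 have "(LINT y|G. centered_gamma k \<epsilon> y ^ 2) = 1 / k * (k * (k + 1)) - 2 * k + k"
  unfolding c2 using ib[of 0 "- 1 / k" "- 2" "- k"] m1(2) m2(2) by simp
 also have "\<dots> = 1" using k by simp
 finally show "(LINT y|G. centered_gamma k \<epsilon> y ^ 2) = 1" .
 have "(LINT y|G. centered_gamma k \<epsilon> y ^ 3) = \<epsilon> / (k * r) * (k * (k + 1) * (k + 2)) - 3 * \<epsilon> / r * (k * (k + 1)) + 3 * \<epsilon> * k / r * k - \<epsilon> * k\<^sup>2 / r"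
  unfolding c3 ib m1(2) m2(2) m3(2) ..
 also have "\<dots> = 2 * \<epsilon> / r" using k r(1) by (simp add: field_simps power2_eq_square)
 finally show "(LINT y|G. centered_gamma k \<epsilon> y ^ 3) = 2 * \<epsilon> / sqrt k" by (simp add: r_def)
qed

lemma centered_gamma_exp_moment:
 assumes k: "k > 0" and \<epsilon>: "\<epsilon> \<in> {1, -1}"
 shows "integrable (density lborel (gamma_density k)) (\<lambda>y. \<bar>centered_gamma k \<epsilon> y\<bar> ^ j * exp (sqrt k / 4 * \<bar>centered_gamma k \<epsilon> y\<bar>))"
proof -
 define r where "r = sqrt k"
 have r: "r > 0" "k = r * r" using k by (auto simp: r_def)
 define c where "c = r / 4"
 have c: "c > 0" using r by (simp add: c_def)
 define K where "K = fact j * (1 / c) ^ j * exp (k / 2)"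
 have G: "Gamma k > 0" by (rule Gamma_real_pos[OF k])
 have bd: "\<bar>centered_gamma k \<epsilon> y\<bar> ^ j * exp (c * \<bar>centered_gamma k \<epsilon> y\<bar>) \<le> K * exp (y / 2)" if "y > 0" for y
 proof -
  let ?a = "\<bar>centered_gamma k \<epsilon> y\<bar>"
  have a: "?a = \<bar>y - k\<bar> / r" using \<epsilon> r(1) by (auto simp: centered_gamma_def r_def[symmetric] abs_mult)
  have "?a ^ j = (1 / c) ^ j * (c * ?a) ^ j" using c by (simp add: power_mult_distrib[symmetric])
  also have "\<dots> \<le> (1 / c) ^ j * (fact j * exp (c * ?a))" using c by (intro mult_left_mono power_le_fact_exp) auto
  finally have "?a ^ j * exp (c * ?a) \<le> ((1 / c) ^ j * (fact j * exp (c * ?a))) * exp (c * ?a)"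
   by (intro mult_right_mono) auto
  also have "\<dots> = (fact j * (1 / c) ^ j) * exp (2 * (c * ?a))" by (simp add: exp_double power2_eq_square)
  also have "\<dots> \<le> (fact j * (1 / c) ^ j) * exp (k / 2 + y / 2)"
  proof (intro mult_left_mono)
   have "2 * (c * ?a) = \<bar>y - k\<bar> / 2" unfolding a c_def using r(1) by simp
   also have "\<dots> \<le> k / 2 + y / 2" using that k by auto
   finally show "exp (2 * (c * ?a)) \<le> exp (k / 2 + y / 2)" by simp
  qed (use c in auto)
  finally show ?thesis unfolding K_def by (simp add: exp_add mult.assoc)
 qed
 have i: "integrable lborel (\<lambda>y. indicator {0<..} y * y powr (k - 1) * exp (- (1 / 2) * y))"
  by (rule integrableI_nonneg) (use nn_integral_gamma_moment[OF k, of "1/2"] in auto)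
 have "integrable lborel (\<lambda>y. gamma_density k y *\<^sub>R (\<bar>centered_gamma k \<epsilon> y\<bar> ^ j * exp (c * \<bar>centered_gamma k \<epsilon> y\<bar>)))"
 proof (rule Bochner_Integration.integrable_bound)
  show "integrable lborel (\<lambda>y. K / Gamma k * (indicator {0<..} y * y powr (k - 1) * exp (- (1 / 2) * y)))"
   by (intro integrable_mult_right i)
  show "AE y in lborel. norm (gamma_density k y *\<^sub>R (\<bar>centered_gamma k \<epsilon> y\<bar> ^ j * exp (c * \<bar>centered_gamma k \<epsilon> y\<bar>)))
   \<le> norm (K / Gamma k * (indicator {0<..} y * y powr (k - 1) * exp (- (1 / 2) * y)))"
  proof (rule AE_I2)
   fix y
   show "norm (gamma_density k y *\<^sub>R (\<bar>centered_gamma k \<epsilon> y\<bar> ^ j * exp (c * \<bar>centered_gamma k \<epsilon> y\<bar>)))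
   \<le> norm (K / Gamma k * (indicator {0<..} y * y powr (k - 1) * exp (- (1 / 2) * y)))"
   proof (cases "y > 0")
    case True
    let ?D = "y powr (k - 1) * exp (- y) / Gamma k"
    have D: "?D \<ge> 0" using G by simp
    have "norm (gamma_density k y *\<^sub>R (\<bar>centered_gamma k \<epsilon> y\<bar> ^ j * exp (c * \<bar>centered_gamma k \<epsilon> y\<bar>)))
     = ?D * (\<bar>centered_gamma k \<epsilon> y\<bar> ^ j * exp (c * \<bar>centered_gamma k \<epsilon> y\<bar>))"
     using True G by (simp add: gamma_density_def abs_mult)
    also have "\<dots> \<le> ?D * (K * exp (y / 2))" by (intro mult_left_mono bd True D)
    also have "\<dots> = K / Gamma k * (y powr (k - 1) * (exp (- y) * exp (y / 2)))" by simp
    also have "exp (- y) * exp (y / 2) = exp (- (1 / 2) * y)" by (simp add: exp_add[symmetric])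
    also have "K / Gamma k * (y powr (k - 1) * exp (- (1 / 2) * y)) = K / Gamma k * (indicator {0<..} y * y powr (k - 1) * exp (- (1 / 2) * y))"
     using True by simp
    also have "\<dots> \<le> norm \<dots>" unfolding real_norm_def by (rule abs_ge_self)
    finally show ?thesis .
   qed (simp add: gamma_density_def)
  qed
 qed (unfold centered_gamma_def, measurable)
 then show ?thesis unfolding c_def r_def
  using k by (subst integrable_density) (auto simp: gamma_density_nonneg centered_gamma_def)
qed

section \<open>Truncated kernels and the marginal tail\<close>

locale standardized_kernel = iid_array M X for M :: "'a measure" and X +
 fixes h :: "real \<Rightarrow> real \<Rightarrow> real" and p :: "nat \<Rightarrow> nat" and \<rho> :: real and Z :: "'a \<Rightarrow> real"
 assumes h_meas: "(\<lambda>(x, y). h x y) \<in> borel_measurable (borel \<Otimes>\<^sub>M borel)"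
  and h_sym: "\<And>x y. h x y = h y x"
  and Z_def: "Z = (\<lambda>w. h (X 1 1 w) (X 2 1 w))"
  and Z_int2: "integrable M (\<lambda>w. (Z w)\<^sup>2)" and Z_mean: "expectation Z = 0" and Z_var: "expectation (\<lambda>w. (Z w)\<^sup>2) = 1"
  and rho_def: "\<rho> = expectation (\<lambda>w. h (X 1 1 w) (X 2 1 w) * h (X 1 1 w) (X 3 1 w))"
  and p_lim: "filterlim p at_top sequentially"
begin

lemma h_pair_measurable [measurable (raw)]:
 "U \<in> borel_measurable N \<Longrightarrow> V \<in> borel_measurable N \<Longrightarrow> (\<lambda>x. h (U x) (V x)) \<in> borel_measurable N"
 using measurable_compose[OF measurable_Pair h_meas, of U N V] by simp

lemma Z_measurable: "Z \<in> borel_measurable M"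
 unfolding Z_def by (intro h_pair_measurable X_meas) auto

definition Z3 :: "'a \<Rightarrow> real" where "Z3 w = h (X 1 1 w) (X 3 1 w)"

lemma Z3_measurable: "Z3 \<in> borel_measurable M"
 unfolding Z3_def[abs_def] by (intro h_pair_measurable X_meas) auto

lemma Z3_same_law:
 assumes [measurable]: "f \<in> borel_measurable borel"
 shows "expectation (\<lambda>w. f (Z3 w)) = expectation (\<lambda>w. f (Z w))"
  and "integrable M (\<lambda>w. (f (Z3 w) :: real)) \<longleftrightarrow> integrable M (\<lambda>w. f (Z w))"
proof -
 have m: "(\<lambda>(x, y, z). f (h x y)) \<in> borel_measurable triple_borel" by measurable
 show "expectation (\<lambda>w. f (Z3 w)) = expectation (\<lambda>w. f (Z w))"
  using expectation_triple(1)[of 1 3 2 1, OF _ _ _ _ _ _ _ m] by (simp add: Z3_def Z_def)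
 show "integrable M (\<lambda>w. f (Z3 w)) \<longleftrightarrow> integrable M (\<lambda>w. f (Z w))"
  using expectation_triple(2)[of 1 3 2 1, OF _ _ _ _ _ _ _ m] by (simp add: Z3_def Z_def)
qed

lemma Z_integrable: "integrable M Z"
 using square_integrable_imp_integrable[OF Z_measurable Z_int2] .

lemma Z_product_integrable: "integrable M (\<lambda>w. Z w * Z3 w)"
proof (rule Bochner_Integration.integrable_bound)
 show "integrable M (\<lambda>w. (Z w)\<^sup>2 + (Z3 w)\<^sup>2)"
  using Z3_same_law(2)[of "\<lambda>z. z\<^sup>2"] Z_int2 by (intro Bochner_Integration.integrable_add) auto
 show "(\<lambda>w. Z w * Z3 w) \<in> borel_measurable M" using Z_measurable Z3_measurable by measurable
 show "AE w in M. norm (Z w * Z3 w) \<le> norm ((Z w)\<^sup>2 + (Z3 w)\<^sup>2)"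
 proof (rule AE_I2)
  fix w
  have "2 * (\<bar>Z w\<bar> * \<bar>Z3 w\<bar>) \<le> (Z w)\<^sup>2 + (Z3 w)\<^sup>2" using sum_squares_bound[of "\<bar>Z w\<bar>" "\<bar>Z3 w\<bar>"] by simp
  moreover have "0 \<le> \<bar>Z w\<bar> * \<bar>Z3 w\<bar>" by simp
  ultimately have "\<bar>Z w\<bar> * \<bar>Z3 w\<bar> \<le> (Z w)\<^sup>2 + (Z3 w)\<^sup>2" by linarith
  then show "norm (Z w * Z3 w) \<le> norm ((Z w)\<^sup>2 + (Z3 w)\<^sup>2)" by (simp add: abs_mult)
 qed
qed

lemma rho_eq: "expectation (\<lambda>w. Z w * Z3 w) = \<rho>"
 unfolding rho_def by (simp add: Z_def Z3_def)

text \<open>The variables \<open>h (X 1 1) (X j 1)\<close>, \<open>j \<ge> 2\<close>, are equicorrelated; infinitely many of them cannot be negatively correlated, as their sum would have negative variance.\<close>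
lemma rho_nonneg: "\<rho> \<ge> 0"
proof (rule ccontr)
 assume "\<not> \<rho> \<ge> 0"
 then have neg: "\<rho> < 0" by simp
 obtain m :: nat where m: "real m > 1 / - \<rho>" using reals_Archimedean2 by blast
 define V where "V j w = h (X 1 1 w) (X (j + 2) 1 w)" for j w
 have mm: "(\<lambda>(x, y, z). h x y * h x z) \<in> borel_measurable triple_borel" by measurable
 have m2: "(\<lambda>(x, y, z). (h x y)\<^sup>2) \<in> borel_measurable triple_borel" by measurable
 have off: "integrable M (\<lambda>w. V i w * V j w) \<and> expectation (\<lambda>w. V i w * V j w) = \<rho>" if "i \<noteq> j" for i j
  using expectation_triple[of 1 "i + 2" "j + 2" 1, OF _ _ _ _ _ _ _ mm] that Z_product_integrable rho_eq
  by (simp add: V_def Z_def Z3_def)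
 have diag: "integrable M (\<lambda>w. V i w * V i w) \<and> expectation (\<lambda>w. V i w * V i w) = 1" for i
  using expectation_triple[of 1 "i + 2" "i + 3" 1, OF _ _ _ _ _ _ _ m2] Z_int2 Z_var
  by (simp add: V_def Z_def power2_eq_square)
 have int: "integrable M (\<lambda>w. V i w * V j w)" for i j using off diag by (cases "i = j") auto
 have ex: "expectation (\<lambda>w. V i w * V j w) = (if i = j then 1 else \<rho>)" for i j using off diag by auto
 let ?I = "{..m}"
 have "0 \<le> expectation (\<lambda>w. (\<Sum>i\<in>?I. V i w)\<^sup>2)" by (intro integral_nonneg_AE AE_I2) simp
 also have "\<dots> = expectation (\<lambda>w. \<Sum>i\<in>?I. \<Sum>j\<in>?I. V i w * V j w)" by (simp only: power2_eq_square sum_product)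
 also have "\<dots> = (\<Sum>i\<in>?I. \<Sum>j\<in>?I. expectation (\<lambda>w. V i w * V j w))"
  by (subst Bochner_Integration.integral_sum; (intro Bochner_Integration.integrable_sum int)?)
   (intro sum.cong refl Bochner_Integration.integral_sum int)
 also have "\<dots> = (\<Sum>i\<in>?I. \<Sum>j\<in>?I. if i = j then 1 else \<rho>)" by (simp only: ex)
 also have "\<dots> = (\<Sum>i\<in>?I. 1 + real m * \<rho>)"
 proof (rule sum.cong[OF refl])
  fix i assume i: "i \<in> ?I"
  have "(\<Sum>j\<in>?I. if i = j then 1 else \<rho>) = 1 + (\<Sum>j\<in>?I - {i}. if i = j then 1 else \<rho>)"
   using i by (subst sum.remove[of _ i]) auto
  also have "(\<Sum>j\<in>?I - {i}. if i = j then 1 else \<rho>) = (\<Sum>j\<in>?I - {i}. \<rho>)" by (intro sum.cong) auto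
  also have "\<dots> = real m * \<rho>" using i by simp
  finally show "(\<Sum>j\<in>?I. if i = j then 1 else \<rho>) = 1 + real m * \<rho>" .
 qed
 also have "\<dots> = (real m + 1) * (1 + real m * \<rho>)" by simp
 also have "\<dots> < 0"
 proof -
  have "0 < - \<rho>" using neg by simp
  then have "1 < real m * - \<rho>" using m by (simp only: pos_divide_less_eq)
  then show ?thesis by (intro mult_pos_neg) auto
 qed
 finally show False by simp
qed

end

text \<open>The properties of the truncation sets and of the centering that the limit depends on. The order \<open>k\<close> of the expansion is 4 when the third moment contributes. The assumption \<open>joint_exponent\<close> is what makes joint exceedances negligible.\<close>
locale truncated_kernel = standardized_kernel M X h p \<rho> Z for M :: "'a measure" and X h p \<rho> Z +
 fixes d :: "nat \<Rightarrow> real" and B :: "nat \<Rightarrow> real set" and k :: nat and \<kappa> :: real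
 assumes d_lim: "filterlim d at_top sequentially"
  and B_sets: "\<And>n. B n \<in> sets borel"
  and d_small: "(\<lambda>n. d n / sqrt n) \<longlonglongrightarrow> 0"
  and union_bound: "(\<lambda>n. (real (p n))\<^sup>2 * real n * prob {w \<in> space M. Z w \<notin> B n}) \<longlonglongrightarrow> 0"
  and k_cases: "(k = 3 \<and> \<kappa> = 0) \<or> (k = 4 \<and> \<kappa> = expectation (\<lambda>w. Z w ^ 3))"
  and Z_moments: "\<And>j. j < k \<Longrightarrow> integrable M (\<lambda>w. Z w ^ j)"
  and rem_int: "\<And>a. a > 0 \<Longrightarrow> \<forall>\<^sub>F n in sequentially. integrable M (\<lambda>w. taylor_rem k (B n) (a * d n / sqrt n) (Z w))"
  and rem_lim: "\<And>a. a > 0 \<Longrightarrow> (\<lambda>n. real n * expectation (\<lambda>w. taylor_rem k (B n) (a * d n / sqrt n) (Z w))) \<longlonglongrightarrow> 0"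
  and d_pow: "(\<lambda>n. real n * (d n / sqrt n) ^ k) \<longlonglongrightarrow> 0"
  and norm: "(\<lambda>n. ptilde (p n) * std_normal_density (d n) * exp (\<kappa> * d n ^ 3 / (6 * sqrt n)) / d n) \<longlonglongrightarrow> 1"
  and rem3_int: "\<forall>\<^sub>F n in sequentially. integrable M (\<lambda>w. taylor_rem 3 (B n) (2 * d n / sqrt n) (Z w))"
  and joint_exponent: "\<And>c. c > 0 \<Longrightarrow> \<exists>C. \<forall>\<^sub>F n in sequentially. (3 / 4 - 1 / (1 + \<rho>)) * (d n)\<^sup>2
    + c * (real n * expectation (\<lambda>w. taylor_rem 3 (B n) (2 * d n / sqrt n) (Z w)) + d n ^ 3 / sqrt n) \<le> C"
  and rho_less_1: "\<rho> < 1"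
begin

definition hB :: "nat \<Rightarrow> real \<Rightarrow> real \<Rightarrow> real"
 where "hB n x y = trunc (B n) (h x y)"

definition S :: "nat \<Rightarrow> nat \<Rightarrow> nat \<Rightarrow> 'a \<Rightarrow> real"
 where "S n i j w = (\<Sum>l\<in>{1..n}. hB n (X i l w) (X j l w))"

definition W :: "nat \<Rightarrow> nat \<Rightarrow> nat \<Rightarrow> 'a \<Rightarrow> real"
 where "W n i j w = d n * (S n i j w / sqrt n - d n)"

lemma hB_pair_measurable [measurable (raw)]:
 assumes "U \<in> borel_measurable N" "V \<in> borel_measurable N"
 shows "(\<lambda>x. hB n (U x) (V x)) \<in> borel_measurable N"
 unfolding hB_def by (rule measurable_compose[OF h_pair_measurable[OF assms] trunc_measurable[OF B_sets]])

lemma hB_sym: "hB n x y = hB n y x"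
 by (simp add: hB_def h_sym[of x y])

lemma S_sym: "S n i j w = S n j i w"
 unfolding S_def by (intro sum.cong refl hB_sym)

lemma S_measurable [measurable]: "i \<ge> 1 \<Longrightarrow> j \<ge> 1 \<Longrightarrow> S n i j \<in> borel_measurable M"
 unfolding S_def[abs_def] by (intro borel_measurable_sum hB_pair_measurable X_meas) auto

lemma W_measurable [measurable]: "i \<ge> 1 \<Longrightarrow> j \<ge> 1 \<Longrightarrow> W n i j \<in> borel_measurable M"
 unfolding W_def[abs_def] by (intro borel_measurable_times borel_measurable_diff borel_measurable_divide S_measurable borel_measurable_const)

lemma W_sym: "W n i j w = W n j i w"
 by (simp add: W_def S_sym[of n i j])

lemma n_large: "\<forall>\<^sub>F n in sequentially. n > (0::nat)"
 by (rule eventually_gt_at_top)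

lemma d_pos: "\<forall>\<^sub>F n in sequentially. d n > 0"
 by (rule eventually_compose_filterlim[OF eventually_gt_at_top d_lim])

lemma scaled_args:
 fixes a :: real
 assumes "a > 0"
 defines "q \<equiv> \<lambda>n::nat. a * d n / sqrt n"
 shows "\<forall>\<^sub>F n in sequentially. q n > 0" "q \<longlonglongrightarrow> 0" "(\<lambda>n. real n * q n ^ k) \<longlonglongrightarrow> 0"
  "n > 0 \<Longrightarrow> q n * sqrt n = a * d n"
proof -
 show "\<forall>\<^sub>F n in sequentially. q n > 0" using d_pos n_large by eventually_elim (simp add: q_def assms(1))
 have "(\<lambda>n. a * (d n / sqrt n)) \<longlonglongrightarrow> a * 0" by (intro tendsto_mult tendsto_const d_small)
 then show "q \<longlonglongrightarrow> 0" by (simp add: q_def)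
 have "(\<lambda>n. a ^ k * (real n * (d n / sqrt n) ^ k)) \<longlonglongrightarrow> a ^ k * 0" by (intro tendsto_mult tendsto_const d_pow)
 moreover have "a ^ k * (real n * (d n / sqrt n) ^ k) = real n * q n ^ k" for n
  unfolding q_def by (simp add: power_mult_distrib power_divide)
 ultimately show "(\<lambda>n. real n * q n ^ k) \<longlonglongrightarrow> 0" by simp
 show "n > 0 \<Longrightarrow> q n * sqrt n = a * d n" by (simp add: q_def)
qed

lemma ptilde_nonneg: "ptilde m \<ge> 0"
 unfolding ptilde_def by (cases m) auto

lemma smoothed_marginal_limit:
 assumes A: "A \<ge> 2"
 shows "(\<lambda>n. ptilde (p n) * enn2real ((shift_avg (distr M borel (\<lambda>w. A * d n / sqrt n * trunc (B n) (Z w))) ^^ n)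
   elogistic (A * (- (d n)\<^sup>2 - t)))) \<longlonglongrightarrow> exp (- t) * smoothing_factor A"
proof -
 let ?q = "\<lambda>n. A * d n / sqrt n"
 have A0: "A > 0" using A by simp
 note sc = scaled_args[OF A0]
 have c0: "\<And>f. f = (\<lambda>n. ptilde (p n)) \<Longrightarrow> f n \<ge> 0" for n using ptilde_nonneg by simp
 show ?thesis
 proof (cases "\<kappa> = 0")
  case True
  have lim: "(\<lambda>n. ptilde (p n) * enn2real ((shift_avg (distr std_normal borel (\<lambda>y. ?q n * y)) ^^ n) elogistic (A * (- (d n)\<^sup>2 - t))))
    \<longlonglongrightarrow> exp (- t) * smoothing_factor A"
  proof (rule Lim_transform_eventually)
   show "(\<lambda>n. ptilde (p n) * enn2real (shift_avg (normal_shift (A * d n)) elogistic (A * (- (d n)\<^sup>2 - t))))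
    \<longlonglongrightarrow> exp (- t) * smoothing_factor A"
    using norm True by (intro normal_smoothed_tail d_lim A) simp
   show "\<forall>\<^sub>F n in sequentially. ptilde (p n) * enn2real (shift_avg (normal_shift (A * d n)) elogistic (A * (- (d n)\<^sup>2 - t)))
     = ptilde (p n) * enn2real ((shift_avg (distr std_normal borel (\<lambda>y. ?q n * y)) ^^ n) elogistic (A * (- (d n)\<^sup>2 - t)))"
    using sc(1) n_large
    by eventually_elim (simp only: shift_avg_std_normal_pow sc(4))
  qed
  have mom: "integrable std_normal (\<lambda>y. y ^ j) \<and> expectation (\<lambda>w. Z w ^ j) = (LINT y|std_normal. y ^ j)" if "j < k" for j
  proof -
   interpret N: prob_space std_normal by (rule prob_space_std_normal)
   have "j = 0 \<or> j = 1 \<or> j = 2 \<or> (j = 3 \<and> k = 4)" using that k_cases by auto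
   then show ?thesis
    using std_normal_moments Z_mean Z_var True k_cases N.prob_space prob_space by auto
  qed
  show ?thesis
  proof (rule lindeberg_limit[where N=std_normal and Y="\<lambda>y. y" and c=1 and k=k])
   show "prob_space M" by (rule prob_space_axioms)
   show "2 \<le> k" using k_cases by auto
   show "integrable std_normal (\<lambda>y. \<bar>y\<bar> ^ k * exp (1 * \<bar>y\<bar>))" by (rule integrable_std_normal_exp)
  qed (use mom lim sc(1-3) rem_int[OF A0] rem_lim[OF A0] Z_moments B_sets Z_measurable prob_space_std_normal ptilde_nonneg in simp_all)
 next
  case False
  then have k4: "k = 4" and kap: "\<kappa> = expectation (\<lambda>w. Z w ^ 3)" using k_cases by auto
  define e where "e = sgn \<kappa>"
  define \<beta> where "\<beta> = 4 / \<kappa>\<^sup>2"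
  have e: "e \<in> {1, -1}" using False by (auto simp: e_def sgn_if)
  have \<beta>: "\<beta> > 0" using False by (simp add: \<beta>_def)
  have sb: "sqrt \<beta> = 2 / \<bar>\<kappa>\<bar>" by (simp add: \<beta>_def real_sqrt_divide)
  have ke: "2 * e / sqrt \<beta> = \<kappa>" unfolding sb e_def using False by (simp add: sgn_mult_abs)
  let ?G = "density lborel (gamma_density \<beta>)"
  let ?Y = "centered_gamma \<beta> e"
  note gm = centered_gamma_moments[OF \<beta> e]
  have d4: "(\<lambda>n. d n ^ 4 / real n) \<longlonglongrightarrow> 0"
  proof (rule Lim_transform_eventually[OF d_pow])
   show "\<forall>\<^sub>F n in sequentially. real n * (d n / sqrt n) ^ k = d n ^ 4 / real n"
    using n_large
   proof eventually_elim
    case (elim n)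
    have "sqrt n ^ 4 = (sqrt n ^ 2) ^ 2" by (simp only: power_mult[symmetric]) simp
    also have "\<dots> = real n * real n" by (simp add: power2_eq_square)
    finally show ?case using elim by (simp add: k4 power_divide)
   qed
  qed
  have lim: "(\<lambda>n. ptilde (p n) * enn2real ((shift_avg (distr ?G borel (\<lambda>y. ?q n * ?Y y)) ^^ n) elogistic (A * (- (d n)\<^sup>2 - t))))
    \<longlonglongrightarrow> exp (- t) * smoothing_factor A"
  proof (rule Lim_transform_eventually)
   show "(\<lambda>n. ptilde (p n) * enn2real (shift_avg (gamma_shift (e * A * d n / sqrt (n * \<beta>)) (n * \<beta>)) elogistic (A * (- (d n)\<^sup>2 - t))))
    \<longlonglongrightarrow> exp (- t) * smoothing_factor A"
    using norm by (intro gamma_smoothed_tail d_lim A \<beta> e d4) (simp add: ke)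
   show "\<forall>\<^sub>F n in sequentially. ptilde (p n) * enn2real (shift_avg (gamma_shift (e * A * d n / sqrt (n * \<beta>)) (n * \<beta>)) elogistic (A * (- (d n)\<^sup>2 - t)))
     = ptilde (p n) * enn2real ((shift_avg (distr ?G borel (\<lambda>y. ?q n * ?Y y)) ^^ n) elogistic (A * (- (d n)\<^sup>2 - t)))"
    using n_large
   proof eventually_elim
    case (elim n)
    have "e * A * d n / sqrt (n * \<beta>) = e * ?q n / sqrt \<beta>" by (simp add: real_sqrt_mult)
    then show ?case by (simp only: shift_avg_centered_gamma_pow[OF \<beta> elim])
   qed
  qed
  have mom: "integrable ?G (\<lambda>y. ?Y y ^ j) \<and> expectation (\<lambda>w. Z w ^ j) = (LINT y|?G. ?Y y ^ j)" if "j < k" for j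
  proof -
   interpret G: prob_space ?G by (rule prob_space_gamma[OF \<beta>])
   have "j = 0 \<or> j = 1 \<or> j = 2 \<or> j = 3" using that k4 by auto
   then show ?thesis
    using gm Z_mean Z_var kap ke G.prob_space prob_space by auto
  qed
  have Ym: "?Y \<in> borel_measurable ?G" unfolding centered_gamma_def by measurable
  show ?thesis
  proof (rule lindeberg_limit[where N="?G" and Y="?Y" and c="sqrt \<beta> / 4" and k=k])
   show "prob_space M" by (rule prob_space_axioms)
   show "2 \<le> k" using k_cases by auto
   show "integrable ?G (\<lambda>y. \<bar>?Y y\<bar> ^ k * exp (sqrt \<beta> / 4 * \<bar>?Y y\<bar>))" by (rule centered_gamma_exp_moment[OF \<beta> e])
  qed (use mom lim sc(1-3) rem_int[OF A0] rem_lim[OF A0] Z_moments B_sets Z_measurable prob_space_gamma[OF \<beta>] ptilde_nonneg Ym \<beta> in simp_all)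
 qed
qed

end

section \<open>Two pairs with a common index\<close>

definition index_pairs :: "nat \<Rightarrow> (nat \<times> nat) set"
 where "index_pairs m = {(i, j). 1 \<le> i \<and> i < j \<and> j \<le> m}"

lemma finite_index_pairs: "finite (index_pairs m)"
 by (rule finite_subset[of _ "{1..m} \<times> {1..m}"]) (auto simp: index_pairs_def)

lemma card_index_pairs: "real (card (index_pairs m)) = ptilde m"
proof (induction m)
 case 0
 have "index_pairs 0 = {}" by (auto simp: index_pairs_def)
 then show ?case by (simp add: ptilde_def)
next
 case (Suc m)
 have e: "index_pairs (Suc m) = index_pairs m \<union> {1..m} \<times> {Suc m}"
  by (auto simp: index_pairs_def)
 have "card (index_pairs (Suc m)) = card (index_pairs m) + card ({1..m} \<times> {Suc m})"
  unfolding e by (rule card_Un_disjoint) (auto simp: finite_index_pairs, auto simp: index_pairs_def)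
 then have "real (card (index_pairs (Suc m))) = ptilde m + real m" using Suc by simp
 also have "\<dots> = ptilde (Suc m)" by (simp add: ptilde_def field_simps)
 finally show ?case .
qed

lemma ptilde_bounds:
 assumes "m \<ge> 2"
 shows "(real m)\<^sup>2 / 4 \<le> ptilde m" "ptilde m \<le> (real m)\<^sup>2 / 2"
proof -
 define x where "x = real m"
 have x: "2 \<le> x" using assms by (simp add: x_def)
 have xx: "2 * x \<le> x\<^sup>2" unfolding power2_eq_square by (rule mult_right_mono) (use x in auto)
 have pc: "ptilde m = (x\<^sup>2 - x) / 2"
  unfolding ptilde_def x_def by (simp add: right_diff_distrib power2_eq_square)
 show "(real m)\<^sup>2 / 4 \<le> ptilde m" unfolding pc x_def[symmetric] using xx by (simp add: field_simps)
 show "ptilde m \<le> (real m)\<^sup>2 / 2" unfolding pc x_def[symmetric] using x by (simp add: field_simps)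
qed

context truncated_kernel
begin

lemma prob_W_eq:
 assumes ij: "i \<ge> 1" "j \<ge> 1" "i \<noteq> j"
 shows "prob {q \<in> space M. t < W n i j q} = prob {q \<in> space M. t < W n 1 2 q}"
proof -
 let ?H = "\<lambda>(x, y, z). hB n x y"
 let ?A = "{v :: real. t < d n * (v / sqrt n - d n)}"
 have H: "?H \<in> borel_measurable triple_borel" by measurable
 have A: "?A \<in> sets borel" by measurable
 have g: "(\<lambda>v. indicator ?A v :: ennreal) \<in> borel_measurable borel" using A by measurable
 have *: "emeasure M {q \<in> space M. t < W n i j q} = (shift_avg (distr M borel (\<lambda>q. ?H (X 1 1 q, X 2 1 q, X 3 1 q))) ^^ n) (\<lambda>v. indicator ?A v) 0"
  if ij: "i \<ge> 1" "j \<ge> 1" "i \<noteq> j" for i j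
 proof -
  have [measurable]: "W n i j \<in> borel_measurable M" using ij(1,2) by (rule W_measurable)
  have "emeasure M {q \<in> space M. t < W n i j q} = (\<integral>\<^sup>+q. indicator {q \<in> space M. t < W n i j q} q \<partial>M)" by simp
  also have "\<dots> = (\<integral>\<^sup>+q. indicator ?A (0 + (\<Sum>l\<in>{1..n}. ?H (X i l q, X j l q, X (i + j + 1) l q))) \<partial>M)"
   by (rule nn_integral_cong) (simp add: indicator_def W_def S_def)
  also have "\<dots> = (shift_avg (distr M borel (\<lambda>q. ?H (X 1 1 q, X 2 1 q, X 3 1 q))) ^^ n) (\<lambda>v. indicator ?A v) 0"
   using ij by (intro nn_integral_row_sums H g) auto
  finally show ?thesis .
 qed
 show ?thesis using *[OF ij] *[of 1 2] by (simp add: measure_def)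
qed

lemma prob_W_pair_eq:
 assumes abc: "a \<ge> 1" "b \<ge> 1" "c \<ge> 1" "a \<noteq> b" "a \<noteq> c" "b \<noteq> c"
 shows "prob {q \<in> space M. t < W n a b q \<and> t < W n a c q} = prob {q \<in> space M. t < W n 1 2 q \<and> t < W n 1 3 q}"
proof -
 let ?H = "\<lambda>(x, y, z). (hB n x y, hB n x z)"
 let ?A = "{v :: real \<times> real. t < d n * (fst v / sqrt n - d n) \<and> t < d n * (snd v / sqrt n - d n)}"
 have H: "?H \<in> borel_measurable triple_borel" unfolding borel_prod[symmetric] by measurable
 have "{v \<in> space (borel \<Otimes>\<^sub>M borel). t < d n * (fst v / sqrt n - d n) \<and> t < d n * (snd v / sqrt n - d n)} \<in> sets (borel \<Otimes>\<^sub>M borel)"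
  by measurable
 then have A: "?A \<in> sets borel" by (simp only: borel_prod space_borel UNIV_I simp_thms)
 have g: "(\<lambda>v. indicator ?A v :: ennreal) \<in> borel_measurable borel" using A by measurable
 have *: "emeasure M {q \<in> space M. t < W n a b q \<and> t < W n a c q}
   = (shift_avg (distr M borel (\<lambda>q. ?H (X 1 1 q, X 2 1 q, X 3 1 q))) ^^ n) (\<lambda>v. indicator ?A v) 0"
  if abc: "a \<ge> 1" "b \<ge> 1" "c \<ge> 1" "a \<noteq> b" "a \<noteq> c" "b \<noteq> c" for a b c
 proof -
  have [measurable]: "W n a b \<in> borel_measurable M" "W n a c \<in> borel_measurable M" using abc(1-3) by (auto intro: W_measurable)
  have "emeasure M {q \<in> space M. t < W n a b q \<and> t < W n a c q} = (\<integral>\<^sup>+q. indicator {q \<in> space M. t < W n a b q \<and> t < W n a c q} q \<partial>M)" by simp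
  also have "\<dots> = (\<integral>\<^sup>+q. indicator ?A (0 + (\<Sum>l\<in>{1..n}. ?H (X a l q, X b l q, X c l q))) \<partial>M)"
   by (rule nn_integral_cong) (simp add: indicator_def W_def S_def fst_sum snd_sum)
  also have "\<dots> = (shift_avg (distr M borel (\<lambda>q. ?H (X 1 1 q, X 2 1 q, X 3 1 q))) ^^ n) (\<lambda>v. indicator ?A v) 0"
   by (rule nn_integral_row_sums[OF abc H g])
  finally show ?thesis .
 qed
 show ?thesis using *[OF abc] *[of 1 2 3] by (simp add: measure_def)
qed

lemma marginal_limit:
 "(\<lambda>n. ptilde (p n) * prob {q \<in> space M. t < W n 1 2 q}) \<longlonglongrightarrow> exp (- t)"
proof (rule tail_limit_from_smoothed)
 show "W n 1 2 \<in> borel_measurable M" for n by (rule W_measurable) auto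
 show "0 \<le> ptilde (p n)" for n by (rule ptilde_nonneg)
 fix A t :: real assume A: "A \<ge> 2"
 show "(\<lambda>n. ptilde (p n) * expectation (\<lambda>q. logistic (A * (W n 1 2 q - t)))) \<longlonglongrightarrow> exp (- t) * smoothing_factor A"
 proof (rule Lim_transform_eventually[OF smoothed_marginal_limit[OF A]])
  show "\<forall>\<^sub>F n in sequentially. ptilde (p n) * enn2real ((shift_avg (distr M borel (\<lambda>q. A * d n / sqrt n * trunc (B n) (Z q))) ^^ n)
   elogistic (A * (- (d n)\<^sup>2 - t))) = ptilde (p n) * expectation (\<lambda>q. logistic (A * (W n 1 2 q - t)))"
   using n_large
  proof eventually_elim
   case (elim n)
   let ?th = "A * d n / sqrt n"
   let ?H = "\<lambda>(x, y, z). ?th * hB n x y"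
   let ?s = "A * (- (d n)\<^sup>2 - t)"
   have [measurable]: "W n 1 2 \<in> borel_measurable M" by (rule W_measurable) auto
   have H: "?H \<in> borel_measurable triple_borel" by measurable
   have g: "elogistic \<in> borel_measurable borel" by measurable
   have eq: "?s + (\<Sum>l\<in>{1..n}. ?H (X 1 l q, X 2 l q, X 3 l q)) = A * (W n 1 2 q - t)" for q
   proof -
    have "(\<Sum>l\<in>{1..n}. ?H (X 1 l q, X 2 l q, X 3 l q)) = ?th * S n 1 2 q"
     by (simp add: S_def sum_distrib_left)
    then show ?thesis by (simp add: W_def power2_eq_square algebra_simps)
   qed
   have "ennreal (expectation (\<lambda>q. logistic (A * (W n 1 2 q - t)))) = (\<integral>\<^sup>+q. ennreal (logistic (A * (W n 1 2 q - t))) \<partial>M)"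
    by (intro nn_integral_eq_integral[symmetric] integrable_logistic) (auto intro: less_imp_le logistic_pos)
   also have "\<dots> = (\<integral>\<^sup>+q. ennreal (logistic (?s + (\<Sum>l\<in>{1..n}. ?H (X 1 l q, X 2 l q, X 3 l q)))) \<partial>M)"
    by (simp only: eq)
   also have "\<dots> = (shift_avg (distr M borel (\<lambda>q. ?H (X 1 1 q, X 2 1 q, X 3 1 q))) ^^ n) elogistic ?s"
    by (intro nn_integral_row_sums H g) auto
   also have "(\<lambda>q. ?H (X 1 1 q, X 2 1 q, X 3 1 q)) = (\<lambda>q. ?th * trunc (B n) (Z q))"
    by (simp add: hB_def Z_def)
   finally have "ennreal (expectation (\<lambda>q. logistic (A * (W n 1 2 q - t)))) = (shift_avg (distr M borel (\<lambda>q. ?th * trunc (B n) (Z q))) ^^ n) elogistic ?s" .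
   moreover have "expectation (\<lambda>q. logistic (A * (W n 1 2 q - t))) \<ge> 0"
    by (intro integral_nonneg_AE AE_I2 less_imp_le logistic_pos)
   ultimately show ?case by (metis enn2real_ennreal)
  qed
 qed
qed

lemma corr_exp_moment:
 shows "integrable normal3 (\<lambda>x. \<bar>corr1 \<rho> x\<bar> ^ 3 * exp (1 * \<bar>corr1 \<rho> x\<bar>))"
  "integrable normal3 (\<lambda>x. \<bar>corr2 \<rho> x\<bar> ^ 3 * exp (1 * \<bar>corr2 \<rho> x\<bar>))"
proof -
 have s: "sqrt \<rho> \<le> 1" "sqrt (1 - \<rho>) \<le> 1" "0 \<le> sqrt \<rho>" "0 \<le> sqrt (1 - \<rho>)" using rho_nonneg rho_less_1 by auto
 let ?f = "\<lambda>x::real. \<bar>x\<bar> ^ 3 * exp (2 * \<bar>x\<bar>)"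
 have fm: "?f \<in> borel_measurable borel" by measurable
 have fi: "integrable std_normal ?f" by (rule integrable_std_normal_exp)
 note c = normal3_coord[OF fm fi]
 have gen: "\<bar>sqrt \<rho> * x + sqrt (1 - \<rho>) * y\<bar> ^ 3 * exp (1 * \<bar>sqrt \<rho> * x + sqrt (1 - \<rho>) * y\<bar>) \<le> 8 * (?f x + ?f y)" for x y :: real
 proof -
  have "\<bar>sqrt \<rho> * x + sqrt (1 - \<rho>) * y\<bar> \<le> \<bar>sqrt \<rho> * x\<bar> + \<bar>sqrt (1 - \<rho>) * y\<bar>" by (rule abs_triangle_ineq)
  also have "\<dots> \<le> \<bar>x\<bar> + \<bar>y\<bar>" using s by (intro add_mono) (simp_all add: abs_mult mult_left_le_one_le)
  finally have "\<bar>sqrt \<rho> * x + sqrt (1 - \<rho>) * y\<bar> ^ 3 * exp (1 * \<bar>sqrt \<rho> * x + sqrt (1 - \<rho>) * y\<bar>) \<le> (\<bar>x\<bar> + \<bar>y\<bar>) ^ 3 * exp (\<bar>x\<bar> + \<bar>y\<bar>)"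
   by (intro mult_mono power_mono) auto
  also have "\<dots> \<le> 8 * (?f x + ?f y)" by (rule power3_sum_exp_le) auto
  finally show ?thesis .
 qed
 show "integrable normal3 (\<lambda>x. \<bar>corr1 \<rho> x\<bar> ^ 3 * exp (1 * \<bar>corr1 \<rho> x\<bar>))"
 proof (rule Bochner_Integration.integrable_bound)
  show "integrable normal3 (\<lambda>x. 8 * (?f (fst x) + ?f (fst (snd x))))"
   by (intro integrable_mult_right Bochner_Integration.integrable_add c)
  show "AE x in normal3. norm (\<bar>corr1 \<rho> x\<bar> ^ 3 * exp (1 * \<bar>corr1 \<rho> x\<bar>)) \<le> norm (8 * (?f (fst x) + ?f (fst (snd x))))"
   using gen by (intro AE_I2) (simp add: corr1_def abs_mult)
 qed measurable
 show "integrable normal3 (\<lambda>x. \<bar>corr2 \<rho> x\<bar> ^ 3 * exp (1 * \<bar>corr2 \<rho> x\<bar>))"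
 proof (rule Bochner_Integration.integrable_bound)
  show "integrable normal3 (\<lambda>x. 8 * (?f (fst x) + ?f (snd (snd x))))"
   by (intro integrable_mult_right Bochner_Integration.integrable_add c)
  show "AE x in normal3. norm (\<bar>corr2 \<rho> x\<bar> ^ 3 * exp (1 * \<bar>corr2 \<rho> x\<bar>)) \<le> norm (8 * (?f (fst x) + ?f (snd (snd x))))"
   using gen by (intro AE_I2) (simp add: corr2_def abs_mult)
 qed measurable
qed

definition e3 :: "nat \<Rightarrow> real"
 where "e3 n = real n * expectation (\<lambda>q. taylor_rem 3 (B n) (2 * d n / sqrt n) (Z q))"

text \<open>The comparison with the correlated normal pair is of order 3 for every \<open>k\<close>; its error need not vanish but only contributes to the exponent.\<close>
lemma joint_probability_bound:
 "\<exists>C K. C > 0 \<and> K \<ge> 0 \<and> (\<forall>\<^sub>F n in sequentially. prob {q \<in> space M. t < W n 1 2 q \<and> t < W n 1 3 q}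
   \<le> K * exp (C * (e3 n + d n ^ 3 / sqrt n)) * (exp (- (d n)\<^sup>2 / (1 + \<rho>)) / (d n)\<^sup>2))"
proof -
 let ?th = "\<lambda>n. 2 * d n / sqrt n"
 note sc = scaled_args[of 2, OF zero_less_numeral]
 define mY where "mY = (LINT x|normal3. \<bar>corr1 \<rho> x\<bar> ^ 3 * exp (1 * \<bar>corr1 \<rho> x\<bar>)) + (LINT x|normal3. \<bar>corr2 \<rho> x\<bar> ^ 3 * exp (1 * \<bar>corr2 \<rho> x\<bar>))"
 have mY0: "mY \<ge> 0" unfolding mY_def by (intro add_nonneg_nonneg integral_nonneg_AE AE_I2) auto
 define C where "C = 2 * taylor2_const * (2 + 8 * mY)"
 define K where "K = 4 * (exp_abs_mass\<^sup>2 * exp (- 2 * t / (1 + \<rho>)) / ((1 - \<rho>) * (2 * pi)))"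
 have tc: "taylor2_const \<ge> 1" by (rule taylor2_const(1))
 have C0: "C > 0" unfolding C_def using tc mY0 by (intro mult_pos_pos add_pos_nonneg) auto
 have K0: "K \<ge> 0" unfolding K_def using rho_less_1 by (intro mult_nonneg_nonneg divide_nonneg_nonneg) auto
 note cm = corr_moments[OF rho_nonneg less_imp_le[OF rho_less_1]]
 have small: "\<forall>\<^sub>F n in sequentially. ?th n * m \<le> 1 / 2" for m
 proof -
  have "(\<lambda>n. ?th n * m) \<longlonglongrightarrow> 0 * m" by (intro tendsto_mult sc(2) tendsto_const)
  from order_tendstoD(2)[OF this, of "1/2"] show ?thesis by (auto elim: eventually_mono)
 qed
 have "\<forall>\<^sub>F n in sequentially. prob {q \<in> space M. t < W n 1 2 q \<and> t < W n 1 3 q}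
   \<le> K * exp (C * (e3 n + d n ^ 3 / sqrt n)) * (exp (- (d n)\<^sup>2 / (1 + \<rho>)) / (d n)\<^sup>2)"
  using sc(1) n_large d_pos rem3_int small[of 1] small[of "(LINT x|normal3. \<bar>corr1 \<rho> x\<bar>) + (LINT x|normal3. \<bar>corr2 \<rho> x\<bar>)"]
 proof eventually_elim
  case (elim n)
  let ?t = "?th n"
  have t0: "?t > 0" "?t \<ge> 0" using elim(1) by auto
  have t1: "2 * ?t \<le> 1" using elim(5) by simp
  let ?G = "\<lambda>u :: real \<times> real. ennreal (logistic (fst u) * logistic (snd u))"
  have Gm: "?G \<in> borel_measurable borel" unfolding borel_prod[symmetric] by measurable
  let ?s = "(2 * (- (d n)\<^sup>2 - t), 2 * (- (d n)\<^sup>2 - t))"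
  let ?H = "\<lambda>(x, y, z). (?t * hB n x y, ?t * hB n x z)"
  have H: "?H \<in> borel_measurable triple_borel" unfolding borel_prod[symmetric] by measurable
  have Wm[measurable]: "W n 1 2 \<in> borel_measurable M" "W n 1 3 \<in> borel_measurable M" by (auto intro: W_measurable)
  let ?\<nu> = "distr M borel (\<lambda>q. (?t * trunc (B n) (Z q), ?t * trunc (B n) (Z3 q)))"
  let ?L = "\<lambda>q. logistic (2 * (W n 1 2 q - t)) * logistic (2 * (W n 1 3 q - t))"
  have iL: "integrable M ?L" by (rule integrable_logistic_mult) measurable
  have arg: "?s + (\<Sum>l\<in>{1..n}. ?H (X 1 l q, X 2 l q, X 3 l q)) = (2 * (W n 1 2 q - t), 2 * (W n 1 3 q - t))" for q
  proof (rule prod_eqI)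
   have 1: "(\<Sum>l\<in>{1..n}. ?t * hB n (X 1 l q) (X j l q)) = ?t * S n 1 j q" for j
    by (simp add: S_def sum_distrib_left)
   have F: "fst (\<Sum>l\<in>{1..n}. ?H (X 1 l q, X 2 l q, X 3 l q)) = ?t * S n 1 2 q"
    unfolding 1[symmetric] by (simp only: fst_sum case_prod_conv fst_conv)
   have G: "snd (\<Sum>l\<in>{1..n}. ?H (X 1 l q, X 2 l q, X 3 l q)) = ?t * S n 1 3 q"
    unfolding 1[symmetric] by (simp only: snd_sum case_prod_conv snd_conv)
   show "fst (?s + (\<Sum>l\<in>{1..n}. ?H (X 1 l q, X 2 l q, X 3 l q))) = fst (2 * (W n 1 2 q - t), 2 * (W n 1 3 q - t))"
    unfolding fst_add F fst_conv by (simp add: W_def power2_eq_square algebra_simps)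
   show "snd (?s + (\<Sum>l\<in>{1..n}. ?H (X 1 l q, X 2 l q, X 3 l q))) = snd (2 * (W n 1 2 q - t), 2 * (W n 1 3 q - t))"
    unfolding snd_add G snd_conv by (simp add: W_def power2_eq_square algebra_simps)
  qed
  have "ennreal (expectation ?L) = (\<integral>\<^sup>+q. ennreal (?L q) \<partial>M)"
   by (intro nn_integral_eq_integral[symmetric] iL AE_I2 mult_nonneg_nonneg less_imp_le logistic_pos)
  also have "\<dots> = (\<integral>\<^sup>+q. ?G (?s + (\<Sum>l\<in>{1..n}. ?H (X 1 l q, X 2 l q, X 3 l q))) \<partial>M)"
   unfolding arg fst_conv snd_conv ..
  also have "\<dots> = (shift_avg (distr M borel (\<lambda>q. ?H (X 1 1 q, X 2 1 q, X 3 1 q))) ^^ n) ?G ?s"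
   by (intro nn_integral_row_sums H Gm) auto
  also have "(\<lambda>q. ?H (X 1 1 q, X 2 1 q, X 3 1 q)) = (\<lambda>q. (?t * trunc (B n) (Z q), ?t * trunc (B n) (Z3 q)))"
   by (simp add: hB_def Z_def Z3_def)
  finally have E1: "ennreal (expectation ?L) = (shift_avg ?\<nu> ^^ n) ?G ?s" .
  define eM where "eM = expectation (\<lambda>q. taylor_rem 3 (B n) ?t (Z q))"
  have remm: "taylor_rem 3 (B n) ?t \<in> borel_measurable borel" using B_sets by measurable
  have Z3rem: "integrable M (\<lambda>q. taylor_rem 3 (B n) ?t (Z3 q))" "expectation (\<lambda>q. taylor_rem 3 (B n) ?t (Z3 q)) = eM"
   using Z3_same_law(2)[OF remm] elim(4) unfolding eM_def Z3_same_law(1)[OF remm] by simp_all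
  have sqm: "(\<lambda>z::real. z\<^sup>2) \<in> borel_measurable borel" by measurable
  have idm: "(\<lambda>z::real. z) \<in> borel_measurable borel" by measurable
  have Z3m: "integrable M Z3" "expectation Z3 = 0" "integrable M (\<lambda>q. (Z3 q)\<^sup>2)" "expectation (\<lambda>q. (Z3 q)\<^sup>2) = 1"
   using Z3_same_law(2)[OF idm] Z3_same_law(2)[OF sqm] Z_integrable Z_mean Z_int2 Z_var
   unfolding Z3_same_law(1)[OF idm] Z3_same_law(1)[OF sqm] by simp_all
  note r1 = taylor_rem_comparator[OF prob_space_normal3 corr_measurable(1) corr_exp_moment(1) t0(2) t1]
  note r2 = taylor_rem_comparator[OF prob_space_normal3 corr_measurable(2) corr_exp_moment(2) t0(2) t1]
  define eY where "eY = (LINT x|normal3. taylor_rem 3 UNIV ?t (corr1 \<rho> x)) + (LINT x|normal3. taylor_rem 3 UNIV ?t (corr2 \<rho> x))"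
  have eY: "0 \<le> eY" "eY \<le> ?t ^ 3 * mY"
  proof -
   show "0 \<le> eY" unfolding eY_def using taylor_rem_nonneg[OF t0(2)] by (intro add_nonneg_nonneg integral_nonneg_AE AE_I2)
   show "eY \<le> ?t ^ 3 * mY" unfolding eY_def mY_def distrib_left by (intro add_mono r1 r2)
  qed
  have eM0: "0 \<le> eM" unfolding eM_def using taylor_rem_nonneg[OF t0(2)] by (intro integral_nonneg_AE AE_I2)
  define E where "E = 2 * taylor2_const * ((eM + eM) + eY)"
  have E0: "E \<ge> 0" unfolding E_def using tc eM0 eY(1) by (intro mult_nonneg_nonneg add_nonneg_nonneg) auto
  have step: "shift_avg ?\<nu> ?G u \<le> ennreal (1 + E) * shift_avg (corr_shift \<rho> ?t) ?G u" for u
  proof -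
   have UN: "(UNIV :: real set) \<in> sets borel" by simp
   note lindeberg_step2[OF prob_space_axioms prob_space_normal3 t0(2) Z_measurable Z3_measurable B_sets[of n]
     corr_measurable(1) corr_measurable(2) UN Z_integrable Z3m(1) Z_int2 Z3m(3) Z_product_integrable Z_mean Z3m(2) Z_var Z3m(4) rho_eq
     cm elim(4) Z3rem(1) r1(1) r2(1) elim(6), of u]
   from this[unfolded trunc_UNIV Z3rem(2), folded eM_def eY_def E_def corr_shift_def]
   show ?thesis unfolding E_def eY_def eM_def .
  qed
  have nm: "(\<lambda>q. (?t * trunc (B n) (Z q), ?t * trunc (B n) (Z3 q))) \<in> borel_measurable M"
  proof (rule borel_measurable_Pair)
   show "(\<lambda>q. ?t * trunc (B n) (Z q)) \<in> borel_measurable M" using Z_measurable B_sets[of n] by measurable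
   show "(\<lambda>q. ?t * trunc (B n) (Z3 q)) \<in> borel_measurable M" using Z3_measurable B_sets[of n] by measurable
  qed
  have "(shift_avg ?\<nu> ^^ n) ?G ?s \<le> ennreal (1 + E) ^ n * (shift_avg (corr_shift \<rho> ?t) ^^ n) ?G ?s"
   by (rule shift_avg_telescope[OF borel_prob_distr[OF prob_space_axioms nm] borel_prob_corr_shift Gm step])
  also have "(shift_avg (corr_shift \<rho> ?t) ^^ n) ?G = shift_avg (corr_shift \<rho> (?t * sqrt n)) ?G"
   by (rule shift_avg_corr_pow[OF t0(1) elim(2) Gm])
  also have "?t * sqrt n = 2 * d n" using elim(2) by simp
  also have "ennreal (1 + E) ^ n * shift_avg (corr_shift \<rho> (2 * d n)) ?G ?s
    \<le> ennreal (1 + E) ^ n * ennreal (K / 4 * (exp (- (d n)\<^sup>2 / (1 + \<rho>)) / (d n)\<^sup>2))"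
  proof -
   have K4: "K / 4 * (exp (- (d n)\<^sup>2 / (1 + \<rho>)) / (d n)\<^sup>2)
     = exp_abs_mass\<^sup>2 * exp (- 2 * t / (1 + \<rho>)) / ((1 - \<rho>) * (2 * pi)) * (exp (- (d n)\<^sup>2 / (1 + \<rho>)) / (d n)\<^sup>2)"
    by (simp add: K_def)
   show ?thesis unfolding K4
    by (rule mult_left_mono[OF corr_shift_logistic_bound[OF elim(3) rho_nonneg rho_less_1 order_refl] zero_le])
  qed
  also have "\<dots> = ennreal ((1 + E) ^ n) * ennreal (K / 4 * (exp (- (d n)\<^sup>2 / (1 + \<rho>)) / (d n)\<^sup>2))"
   by (subst ennreal_power) (use E0 in auto)
  also have "\<dots> = ennreal ((1 + E) ^ n * (K / 4 * (exp (- (d n)\<^sup>2 / (1 + \<rho>)) / (d n)\<^sup>2)))"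
   by (rule ennreal_mult[symmetric]) (use E0 K0 in auto)
  finally have "ennreal (expectation ?L) \<le> ennreal ((1 + E) ^ n * (K / 4 * (exp (- (d n)\<^sup>2 / (1 + \<rho>)) / (d n)\<^sup>2)))"
   unfolding E1 .
  then have EL: "expectation ?L \<le> (1 + E) ^ n * (K / 4 * (exp (- (d n)\<^sup>2 / (1 + \<rho>)) / (d n)\<^sup>2))"
   by (subst (asm) ennreal_le_iff) (use E0 K0 in auto)
  have nE: "real n * E \<le> C * (e3 n + d n ^ 3 / sqrt n)"
  proof -
   have e3n: "real n * eM = e3 n" by (simp add: e3_def eM_def)
   define r where "r = sqrt (real n)"
   have r: "r > 0" and nr: "real n = r * r" using elim(2) by (auto simp: r_def)
   define D where "D = d n ^ 3 / r"
   have cube: "real n * ?t ^ 3 = 8 * D"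
   proof -
    have r3: "r ^ 3 = (r * r) * r" by (simp add: power3_eq_cube)
    have t_eq: "?t = 2 * d n / r" by (simp add: r_def)
    have "(r * r) * (2 * d n / r) ^ 3 = (r * r) * ((2 * d n) ^ 3 / ((r * r) * r))"
     unfolding power_divide r3 ..
    also have "\<dots> = (2 * d n) ^ 3 / r" using r by simp
    also have "\<dots> = 8 * D" by (simp add: D_def power_mult_distrib)
    finally have "(r * r) * (2 * d n / r) ^ 3 = 8 * D" .
    then show ?thesis unfolding t_eq by (simp only: nr)
   qed
   have e30: "0 \<le> e3 n" unfolding e3n[symmetric] using eM0 by simp
   have dd: "0 \<le> D" using elim(3) r by (simp add: D_def)
   have "real n * E = 2 * taylor2_const * (2 * (real n * eM) + real n * eY)"
    unfolding E_def by (simp add: algebra_simps)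
   also have "\<dots> \<le> 2 * taylor2_const * (2 * (real n * eM) + real n * (?t ^ 3 * mY))"
    using tc eY(2) by (intro mult_left_mono add_left_mono) auto
   also have "real n * (?t ^ 3 * mY) = 8 * D * mY" unfolding cube[symmetric] by (simp only: mult.assoc)
   also have "2 * taylor2_const * (2 * (real n * eM) + 8 * D * mY) \<le> 2 * taylor2_const * ((2 + 8 * mY) * (e3 n + D))"
   proof (intro mult_left_mono)
    have "0 \<le> mY * e3 n" "0 \<le> mY * D" using e30 dd mY0 by auto
    moreover have "(2 + 8 * mY) * (e3 n + D) = 2 * e3 n + 2 * D + 8 * (mY * e3 n) + 8 * (mY * D)"
     by (simp only: distrib_left distrib_right mult.assoc)
    moreover have "8 * D * mY = 8 * (mY * D)" by simp
    ultimately show "2 * (real n * eM) + 8 * D * mY \<le> (2 + 8 * mY) * (e3 n + D)"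
     unfolding e3n using dd by linarith
   qed (use tc in simp)
   finally show ?thesis unfolding C_def D_def r_def by (simp only: mult.assoc)
  qed
  have "prob {q \<in> space M. t < W n 1 2 q \<and> t < W n 1 3 q} = expectation (\<lambda>q. indicator {q \<in> space M. t < W n 1 2 q \<and> t < W n 1 3 q} q)" by simp
  also have "\<dots> \<le> expectation (\<lambda>q. 4 * ?L q)"
  proof (rule integral_mono)
   show "integrable M (\<lambda>q. indicator {q \<in> space M. t < W n 1 2 q \<and> t < W n 1 3 q} q :: real)"
    by (rule integrable_real_indicator) (auto simp: emeasure_eq_measure)
   show "integrable M (\<lambda>q. 4 * ?L q)" by (intro integrable_mult_right iL)
   fix q
   have half: "1 / 2 \<le> logistic (2 * w)" if "w > 0" for w :: real
   proof -
    have "1 + exp (- (2 * w)) \<le> 2" using that by simp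
    then show ?thesis unfolding logistic_def by (simp add: field_simps add_pos_pos)
   qed
   show "indicator {q \<in> space M. t < W n 1 2 q \<and> t < W n 1 3 q} q \<le> 4 * ?L q"
   proof (cases "t < W n 1 2 q \<and> t < W n 1 3 q")
    case True
    then have "1 / 2 * (1 / 2) \<le> ?L q" by (intro mult_mono half) (auto intro: less_imp_le logistic_pos)
    then show ?thesis by (simp add: indicator_def)
   next
    case False
    have "0 \<le> ?L q" by (intro mult_nonneg_nonneg less_imp_le logistic_pos)
    moreover have "indicator {q \<in> space M. t < W n 1 2 q \<and> t < W n 1 3 q} q = (0::real)"
     using False by (simp only: indicator_def mem_Collect_eq simp_thms if_False of_bool_eq)
    ultimately show ?thesis by linarith
   qed
  qed
  also have "\<dots> = 4 * expectation ?L" by simp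
  also have "\<dots> \<le> 4 * ((1 + E) ^ n * (K / 4 * (exp (- (d n)\<^sup>2 / (1 + \<rho>)) / (d n)\<^sup>2)))" by (rule mult_left_mono[OF EL]) simp
  also have "\<dots> = (1 + E) ^ n * (K * (exp (- (d n)\<^sup>2 / (1 + \<rho>)) / (d n)\<^sup>2))" by simp
  also have "\<dots> \<le> exp (C * (e3 n + d n ^ 3 / sqrt n)) * (K * (exp (- (d n)\<^sup>2 / (1 + \<rho>)) / (d n)\<^sup>2))"
   using nE K0 by (intro mult_right_mono order_trans[OF power_one_plus_le_exp[OF E0]]) auto
  finally show ?case by (simp only: mult_ac)
 qed
 then show ?thesis using C0 K0 by blast
qed

end

section \<open>The Gumbel limit under abstract conditions\<close>

context truncated_kernel
begin

lemma e3_nonneg: "d n \<ge> 0 \<Longrightarrow> 0 \<le> e3 n"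
 unfolding e3_def by (intro mult_nonneg_nonneg integral_nonneg_AE AE_I2 taylor_rem_nonneg) auto

lemma p_cubed_bound:
 assumes p2: "p n \<ge> 2" and d0: "d n > 0"
  and N: "ptilde (p n) * std_normal_density (d n) * exp (\<kappa> * d n ^ 3 / (6 * sqrt n)) / d n \<le> 2"
 shows "(real (p n) ^ 3)\<^sup>2 \<le> 512 * (sqrt (2 * pi)) ^ 3 * (d n ^ 3 * exp (3 * (d n)\<^sup>2 / 2 + \<bar>\<kappa>\<bar> * (d n ^ 3 / sqrt n) / 2))"
proof -
 define N where "N = ptilde (p n)"
 define s where "s = d n ^ 3 / sqrt n"
 define c where "c = sqrt (2 * pi)"
 have c: "c > 0" by (simp add: c_def)
 have s0: "s \<ge> 0" using d0 by (simp add: s_def)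
 have "N * (exp (- (d n)\<^sup>2 / 2) / c) * exp (\<kappa> * s / 6) / d n \<le> 2"
  using N unfolding N_def s_def c_def by (simp add: std_normal_density_def mult.commute)
 then have "N * (exp (- (d n)\<^sup>2 / 2) * exp (\<kappa> * s / 6)) \<le> 2 * c * d n" using c d0 by (simp add: field_simps)
 then have "N * (exp (- (d n)\<^sup>2 / 2) * exp (\<kappa> * s / 6)) * exp ((d n)\<^sup>2 / 2 - \<kappa> * s / 6) \<le> 2 * c * d n * exp ((d n)\<^sup>2 / 2 - \<kappa> * s / 6)"
  by (rule mult_right_mono) simp
 moreover have "exp (- (d n)\<^sup>2 / 2) * exp (\<kappa> * s / 6) * exp ((d n)\<^sup>2 / 2 - \<kappa> * s / 6) = 1"
  by (simp add: exp_add[symmetric])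
 ultimately have N2: "N \<le> 2 * c * d n * exp ((d n)\<^sup>2 / 2 - \<kappa> * s / 6)" by (simp only: mult.assoc mult_1_right)
 also have "\<dots> \<le> 2 * c * d n * exp ((d n)\<^sup>2 / 2 + \<bar>\<kappa>\<bar> * s / 6)"
 proof -
  have "- \<kappa> * s \<le> \<bar>\<kappa>\<bar> * s" by (rule mult_right_mono[OF _ s0]) simp
  then show ?thesis using c d0 by (intro mult_left_mono) auto
 qed
 finally have N3: "N \<le> 2 * c * d n * exp ((d n)\<^sup>2 / 2 + \<bar>\<kappa>\<bar> * s / 6)" .
 have "(real (p n) ^ 3)\<^sup>2 = ((real (p n))\<^sup>2) ^ 3" by (simp only: power_mult[symmetric] mult.commute)
 also have "\<dots> \<le> (4 * N) ^ 3" using ptilde_bounds(1)[OF p2] by (intro power_mono) (auto simp: N_def)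
 also have "\<dots> \<le> (4 * (2 * c * d n * exp ((d n)\<^sup>2 / 2 + \<bar>\<kappa>\<bar> * s / 6))) ^ 3"
  using N3 by (intro power_mono mult_left_mono) (auto simp: N_def ptilde_nonneg)
 also have "\<dots> = 512 * c ^ 3 * (d n ^ 3 * exp (3 * ((d n)\<^sup>2 / 2 + \<bar>\<kappa>\<bar> * s / 6)))"
  by (simp add: power_mult_distrib exp_of_nat_mult[symmetric])
 also have "3 * ((d n)\<^sup>2 / 2 + \<bar>\<kappa>\<bar> * s / 6) = 3 * (d n)\<^sup>2 / 2 + \<bar>\<kappa>\<bar> * s / 2" by simp
 finally show ?thesis by (simp only: c_def s_def)
qed

text \<open>The squares are compared, so that the power \<open>3/2\<close> of the number of pairs becomes an integer.\<close>
lemma joint_limit: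
 "(\<lambda>n. real (p n) ^ 3 * prob {w \<in> space M. t < W n 1 2 w \<and> t < W n 1 3 w}) \<longlonglongrightarrow> 0"
proof -
 obtain C K where C: "C > 0" and K: "K \<ge> 0"
  and bound: "\<forall>\<^sub>F n in sequentially. prob {w \<in> space M. t < W n 1 2 w \<and> t < W n 1 3 w}
   \<le> K * exp (C * (e3 n + d n ^ 3 / sqrt n)) * (exp (- (d n)\<^sup>2 / (1 + \<rho>)) / (d n)\<^sup>2)"
  using joint_probability_bound by blast
 have cpos: "C + \<bar>\<kappa>\<bar> / 4 > 0" using C by simp
 obtain C' where C': "\<forall>\<^sub>F n in sequentially. (3 / 4 - 1 / (1 + \<rho>)) * (d n)\<^sup>2 + (C + \<bar>\<kappa>\<bar> / 4) * (e3 n + d n ^ 3 / sqrt n) \<le> C'"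
  using joint_exponent[OF cpos] unfolding e3_def by blast
 define b where "b = 512 * (sqrt (2 * pi)) ^ 3"
 have b0: "b \<ge> 0" by (simp add: b_def)
 define J where "J n = prob {w \<in> space M. t < W n 1 2 w \<and> t < W n 1 3 w}" for n
 have N: "\<forall>\<^sub>F n in sequentially. ptilde (p n) * std_normal_density (d n) * exp (\<kappa> * d n ^ 3 / (6 * sqrt n)) / d n < 2"
  by (rule order_tendstoD(2)[OF norm]) simp
 have p2: "\<forall>\<^sub>F n in sequentially. p n \<ge> 2"
  by (rule eventually_compose_filterlim[OF eventually_ge_at_top p_lim])
 have sq: "(\<lambda>n. (real (p n) ^ 3 * J n)\<^sup>2) \<longlonglongrightarrow> 0"
 proof (rule tendsto_sandwich[OF _ _ tendsto_const])
  show "\<forall>\<^sub>F n in sequentially. 0 \<le> (real (p n) ^ 3 * J n)\<^sup>2" by simp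
  have "(\<lambda>n. inverse (d n)) \<longlonglongrightarrow> 0" by (rule tendsto_inverse_0_at_top[OF d_lim])
  from tendsto_mult[OF tendsto_const[of "b * K\<^sup>2 * exp (2 * C')"] this]
  show "(\<lambda>n. b * K\<^sup>2 * exp (2 * C') * inverse (d n)) \<longlonglongrightarrow> 0" by simp
  show "\<forall>\<^sub>F n in sequentially. (real (p n) ^ 3 * J n)\<^sup>2 \<le> b * K\<^sup>2 * exp (2 * C') * inverse (d n)"
   using bound C' N p2 d_pos
  proof eventually_elim
   case (elim n)
   define s where "s = d n ^ 3 / sqrt n"
   have s0: "s \<ge> 0" using elim(5) by (simp add: s_def)
   have "(real (p n) ^ 3)\<^sup>2 \<le> b * (d n ^ 3 * exp (3 * (d n)\<^sup>2 / 2 + \<bar>\<kappa>\<bar> * s / 2))"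
    using p_cubed_bound[OF elim(4,5) less_imp_le[OF elim(3)]] by (simp only: b_def s_def)
   moreover have "(J n)\<^sup>2 \<le> (K * exp (C * (e3 n + s)) * (exp (- (d n)\<^sup>2 / (1 + \<rho>)) / (d n)\<^sup>2))\<^sup>2"
    using elim(1) by (intro power_mono) (auto simp: J_def s_def)
   ultimately have "(real (p n) ^ 3)\<^sup>2 * (J n)\<^sup>2 \<le> (b * (d n ^ 3 * exp (3 * (d n)\<^sup>2 / 2 + \<bar>\<kappa>\<bar> * s / 2)))
     * (K * exp (C * (e3 n + s)) * (exp (- (d n)\<^sup>2 / (1 + \<rho>)) / (d n)\<^sup>2))\<^sup>2"
    using b0 elim(5) by (intro mult_mono) auto
   also have "\<dots> = b * K\<^sup>2 * (d n ^ 3 / ((d n)\<^sup>2)\<^sup>2) * (exp (3 * (d n)\<^sup>2 / 2 + \<bar>\<kappa>\<bar> * s / 2) * (exp (C * (e3 n + s)))\<^sup>2 * (exp (- (d n)\<^sup>2 / (1 + \<rho>)))\<^sup>2)"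
    by (simp only: power_mult_distrib power_divide times_divide_eq_right times_divide_eq_left mult_ac)
   also have "d n ^ 3 / ((d n)\<^sup>2)\<^sup>2 = inverse (d n)"
    using elim(5) by (simp add: field_simps power2_eq_square power3_eq_cube)
   also have "exp (3 * (d n)\<^sup>2 / 2 + \<bar>\<kappa>\<bar> * s / 2) * (exp (C * (e3 n + s)))\<^sup>2 * (exp (- (d n)\<^sup>2 / (1 + \<rho>)))\<^sup>2
     = exp (3 * (d n)\<^sup>2 / 2 + \<bar>\<kappa>\<bar> * s / 2 + 2 * (C * (e3 n + s)) + 2 * (- (d n)\<^sup>2 / (1 + \<rho>)))"
    by (simp only: exp_add exp_double)
   also have "b * K\<^sup>2 * inverse (d n) * \<dots> \<le> b * K\<^sup>2 * inverse (d n) * exp (2 * C')"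
   proof -
    have e0: "0 \<le> \<bar>\<kappa>\<bar> * e3 n" using e3_nonneg[of n] elim(5) by simp
    have "(3 / 4 - 1 / (1 + \<rho>)) * (d n)\<^sup>2 + (C + \<bar>\<kappa>\<bar> / 4) * (e3 n + s)
      = 3 / 4 * (d n)\<^sup>2 + - (d n)\<^sup>2 / (1 + \<rho>) + C * (e3 n + s) + \<bar>\<kappa>\<bar> * e3 n / 4 + \<bar>\<kappa>\<bar> * s / 4"
     by (simp add: algebra_simps)
    then have "3 * (d n)\<^sup>2 / 2 + \<bar>\<kappa>\<bar> * s / 2 + 2 * (C * (e3 n + s)) + 2 * (- (d n)\<^sup>2 / (1 + \<rho>)) \<le> 2 * C'"
     using e0 elim(2) unfolding s_def[symmetric] by linarith
    then show ?thesis using b0 elim(5) by (intro mult_left_mono) auto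
   qed
   finally show ?case by (simp only: power_mult_distrib mult_ac)
  qed
 qed
 from tendsto_real_sqrt[OF sq] show ?thesis unfolding J_def by simp
qed


definition adjacent :: "nat \<Rightarrow> nat \<times> nat \<Rightarrow> (nat \<times> nat) set"
 where "adjacent m a = {be \<in> index_pairs m - {a}. {fst be, snd be} \<inter> {fst a, snd a} \<noteq> {}}"

lemma card_adjacent: "real (card (adjacent m a)) \<le> 4 * real m"
proof -
 have "card (adjacent m a) \<le> card ({fst a, snd a} \<times> {1..m} \<union> {1..m} \<times> {fst a, snd a})"
  by (intro card_mono) (auto simp: adjacent_def index_pairs_def)
 also have "\<dots> \<le> card ({fst a, snd a} \<times> {1..m}) + card ({1..m} \<times> {fst a, snd a})" by (rule card_Un_le)
 also have "\<dots> \<le> 2 * m + m * 2"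
  unfolding card_cartesian_product by (intro add_mono mult_mono) (auto intro: card_insert_le_m1)
 finally show ?thesis by (simp add: of_nat_le_iff[symmetric, where 'a = real])
qed

lemma prob_adjacent:
 assumes "a \<in> index_pairs m" "be \<in> adjacent m a"
 shows "prob {w \<in> space M. t < W n (fst a) (snd a) w \<and> t < W n (fst be) (snd be) w}
  = prob {w \<in> space M. t < W n 1 2 w \<and> t < W n 1 3 w}"
proof -
 obtain i j where a: "a = (i, j)" by (cases a)
 obtain k l where be: "be = (k, l)" by (cases be)
 have ij: "1 \<le> i" "i < j" and kl: "1 \<le> k" "k < l" and ne: "(k, l) \<noteq> (i, j)" and sh: "i = k \<or> i = l \<or> j = k \<or> j = l"
  using assms by (auto simp: a be adjacent_def index_pairs_def)
 from sh consider "i = k" "j \<noteq> l" | "i = l" "j \<noteq> k" | "j = k" "i \<noteq> l" | "j = l" "i \<noteq> k"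
  using ij kl ne by fastforce
 then show ?thesis
 proof cases
  case 1
  then show ?thesis using prob_W_pair_eq[of i j l t n] ij kl by (simp add: a be)
 next
  case 2
  then show ?thesis using prob_W_pair_eq[of i j k t n] ij kl by (simp add: a be W_sym[of n k l])
 next
  case 3
  then show ?thesis using prob_W_pair_eq[of j i l t n] ij kl by (simp add: a be W_sym[of n k i])
 next
  case 4
  then show ?thesis using prob_W_pair_eq[of j i k t n] ij kl by (simp add: a be W_sym[of n l i] W_sym[of n l k])
 qed
qed

lemma exceedance_eq:
 assumes "d n > 0" "n > 0"
 shows "t < W n i j w \<longleftrightarrow> sqrt n * (d n + t / d n) < (\<Sum>l\<in>{1..n}. hB n (X i l w) (X j l w))"
proof -
 define r where "r = sqrt (real n)"
 have r: "r > 0" using assms(2) by (simp add: r_def)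
 have "t < W n i j w \<longleftrightarrow> t / d n < S n i j w / r - d n" using assms(1) by (simp add: W_def r_def[symmetric] pos_divide_less_eq mult.commute)
 also have "\<dots> \<longleftrightarrow> d n + t / d n < S n i j w / r" by linarith
 also have "\<dots> \<longleftrightarrow> r * (d n + t / d n) < S n i j w" using r by (simp add: pos_less_divide_eq mult.commute)
 finally show ?thesis by (simp add: r_def S_def)
qed

text \<open>A pair has at most \<open>4 p\<close> adjacent pairs, and it is independent of all the others.\<close>
lemma no_exceedance_bound:
 fixes t :: real
 assumes dn: "d n > 0" and n0: "n > 0" and p2: "p n \<ge> 2"
 defines "P \<equiv> prob {w \<in> space M. t < W n 1 2 w}"
  and "J \<equiv> prob {w \<in> space M. t < W n 1 2 w \<and> t < W n 1 3 w}"
 shows "\<bar>prob {w \<in> space M. \<forall>(i, j)\<in>index_pairs (p n). W n i j w \<le> t} - exp (- (ptilde (p n) * P))\<bar>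
  \<le> 20 * (ptilde (p n) * P)\<^sup>2 / real (p n) + 2 * (real (p n) ^ 3 * J)"
proof -
 let ?S = "index_pairs (p n)"
 let ?N = "ptilde (p n)"
 define E where "E a = {w \<in> space M. t < W n (fst a) (snd a) w}" for a
 let ?B = "adjacent (p n)"
 have P0: "P \<ge> 0" and J0: "J \<ge> 0" by (simp_all add: P_def J_def)
 have pE: "prob (E a) = P" if "a \<in> ?S" for a
  using that unfolding E_def P_def by (intro prob_W_eq) (auto simp: index_pairs_def)
 have Em: "E a \<in> events" if "a \<in> ?S" for a
 proof -
  have [measurable]: "W n (fst a) (snd a) \<in> borel_measurable M" using that by (intro W_measurable) (auto simp: index_pairs_def)
  show ?thesis unfolding E_def by measurable
 qed
 have BS: "?B a \<subseteq> ?S - {a}" for a by (auto simp: adjacent_def)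
 define c where "c = sqrt n * (d n + t / d n)"
 have Ec: "E a = {w \<in> space M. c < (\<Sum>l\<in>{1..n}. hB n (X (fst a) l w) (X (snd a) l w))}" for a
  unfolding E_def c_def using exceedance_eq[OF dn n0] by blast
 have hBm: "(\<lambda>(x, y). hB n x y) \<in> borel_measurable (borel \<Otimes>\<^sub>M borel)" by measurable
 have indep: "expectation (\<lambda>w. indicator (E a) w * (g (card {be \<in> ?S - insert a (?B a). w \<in> E be}) :: real))
   = prob (E a) * expectation (\<lambda>w. g (card {be \<in> ?S - insert a (?B a). w \<in> E be}))"
  if a: "a \<in> ?S" for a and g :: "nat \<Rightarrow> real"
 proof -
  obtain i j where ij: "a = (i, j)" by (cases a)
  show ?thesis unfolding ij Ec
  proof (rule indep_exceedance[OF hBm])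
   show "i \<ge> 1" "j \<ge> 1" using a by (auto simp: ij index_pairs_def)
   show "finite (?S - insert (i, j) (?B (i, j)))" by (intro finite_Diff finite_index_pairs)
   show "k \<ge> 1 \<and> m \<ge> 1 \<and> {k, m} \<inter> {i, j} = {}" if "(k, m) \<in> ?S - insert (i, j) (?B (i, j))" for k m
    using that by (auto simp: adjacent_def index_pairs_def)
  qed
 qed
 have set: "{w \<in> space M. \<forall>(i, j)\<in>?S. W n i j w \<le> t} = space M - (\<Union>a\<in>?S. E a)"
  by (auto simp: E_def not_less)
 have sum: "(\<Sum>a\<in>?S. prob (E a)) = ?N * P" by (simp add: pE card_index_pairs)
 have b1: "(\<Sum>a\<in>?S. prob (E a) * (prob (E a) + (\<Sum>be\<in>?B a. prob (E be)))) \<le> ?N * (P * (P + 4 * real (p n) * P))"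
 proof -
  have "(\<Sum>a\<in>?S. prob (E a) * (prob (E a) + (\<Sum>be\<in>?B a. prob (E be)))) \<le> (\<Sum>a\<in>?S. P * (P + 4 * real (p n) * P))"
  proof (rule sum_mono)
   fix a assume a: "a \<in> ?S"
   have "(\<Sum>be\<in>?B a. prob (E be)) = (\<Sum>be\<in>?B a. P)" using BS[of a] by (intro sum.cong pE) auto
   also have "\<dots> = real (card (?B a)) * P" by simp
   also have "\<dots> \<le> 4 * real (p n) * P" by (rule mult_right_mono[OF card_adjacent P0])
   finally show "prob (E a) * (prob (E a) + (\<Sum>be\<in>?B a. prob (E be))) \<le> P * (P + 4 * real (p n) * P)"
    unfolding pE[OF a] using P0 by (intro mult_left_mono add_left_mono)
  qed
  also have "\<dots> = ?N * (P * (P + 4 * real (p n) * P))" by (simp only: sum_constant card_index_pairs)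
  finally show ?thesis .
 qed
 also have "\<dots> = (?N * P)\<^sup>2 * ((1 + 4 * real (p n)) / ?N)"
  using ptilde_bounds(1)[OF p2] p2 by (cases "?N = 0") (auto simp: power2_eq_square field_simps)
 also have "\<dots> \<le> (?N * P)\<^sup>2 * (20 / real (p n))"
 proof (intro mult_left_mono)
  have x: "real (p n) \<ge> 2" using p2 by simp
  have N4: "(real (p n))\<^sup>2 / 4 \<le> ?N" by (rule ptilde_bounds(1)[OF p2])
  have pos: "(real (p n))\<^sup>2 / 4 > 0" using x by simp
  have "(1 + 4 * real (p n)) / ?N \<le> (5 * real (p n)) / ((real (p n))\<^sup>2 / 4)"
   using x N4 pos by (intro frac_le) auto
  also have "\<dots> = 20 / real (p n)" using x by (simp add: power2_eq_square)
  finally show "(1 + 4 * real (p n)) / ?N \<le> 20 / real (p n)" .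
 qed simp
 finally have B1: "(\<Sum>a\<in>?S. prob (E a) * (prob (E a) + (\<Sum>be\<in>?B a. prob (E be)))) \<le> (?N * P)\<^sup>2 * (20 / real (p n))" .
 have "(\<Sum>a\<in>?S. \<Sum>be\<in>?B a. prob (E a \<inter> E be)) \<le> (\<Sum>a\<in>?S. 4 * real (p n) * J)"
 proof (rule sum_mono)
  fix a assume a: "a \<in> ?S"
  have "(\<Sum>be\<in>?B a. prob (E a \<inter> E be)) = (\<Sum>be\<in>?B a. J)"
  proof (rule sum.cong[OF refl])
   fix be assume "be \<in> ?B a"
   moreover have "E a \<inter> E be = {w \<in> space M. t < W n (fst a) (snd a) w \<and> t < W n (fst be) (snd be) w}"
    by (auto simp: E_def)
   ultimately show "prob (E a \<inter> E be) = J" using prob_adjacent[OF a] by (simp only: J_def)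
  qed
  also have "\<dots> = real (card (?B a)) * J" by simp
  also have "\<dots> \<le> 4 * real (p n) * J" by (rule mult_right_mono[OF card_adjacent J0])
  finally show "(\<Sum>be\<in>?B a. prob (E a \<inter> E be)) \<le> 4 * real (p n) * J" .
 qed
 also have "\<dots> = ?N * (4 * real (p n) * J)" by (simp only: sum_constant card_index_pairs)
 also have "\<dots> \<le> (real (p n))\<^sup>2 / 2 * (4 * real (p n) * J)"
  by (rule mult_right_mono[OF ptilde_bounds(2)[OF p2]]) (use J0 in auto)
 also have "\<dots> = 2 * (real (p n) ^ 3 * J)" by (simp add: power2_eq_square power3_eq_cube)
 finally have B2: "(\<Sum>a\<in>?S. \<Sum>be\<in>?B a. prob (E a \<inter> E be)) \<le> 2 * (real (p n) ^ 3 * J)" .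
 have "\<bar>prob (space M - (\<Union>a\<in>?S. E a)) - exp (- (\<Sum>a\<in>?S. prob (E a)))\<bar>
  \<le> (\<Sum>a\<in>?S. prob (E a) * (prob (E a) + (\<Sum>be\<in>?B a. prob (E be)))) + (\<Sum>a\<in>?S. \<Sum>be\<in>?B a. prob (E a \<inter> E be))"
  by (rule chen_stein_zero_count[OF finite_index_pairs Em BS indep])
 also have "\<dots> \<le> (?N * P)\<^sup>2 * (20 / real (p n)) + 2 * (real (p n) ^ 3 * J)"
  by (rule add_mono[OF B1 B2])
 finally show ?thesis unfolding set sum by (simp only: times_divide_eq_right mult.commute[of 20])
qed

lemma truncated_limit:
 "(\<lambda>n. prob {w \<in> space M. \<forall>(i, j)\<in>index_pairs (p n). W n i j w \<le> t}) \<longlonglongrightarrow> exp (- exp (- t))"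
proof -
 let ?L = "\<lambda>n. ptilde (p n) * prob {w \<in> space M. t < W n 1 2 w}"
 let ?J = "\<lambda>n. prob {w \<in> space M. t < W n 1 2 w \<and> t < W n 1 3 w}"
 let ?A = "\<lambda>n. prob {w \<in> space M. \<forall>(i, j)\<in>index_pairs (p n). W n i j w \<le> t}"
 have p2: "\<forall>\<^sub>F n in sequentially. p n \<ge> 2"
  by (rule eventually_compose_filterlim[OF eventually_ge_at_top p_lim])
 have ip: "(\<lambda>n. inverse (real (p n))) \<longlonglongrightarrow> 0"
  by (intro tendsto_inverse_0_at_top filterlim_compose[OF filterlim_real_sequentially p_lim])
 have "(\<lambda>n. 20 * ((?L n)\<^sup>2 * inverse (real (p n))) + 2 * (real (p n) ^ 3 * ?J n)) \<longlonglongrightarrow> 20 * ((exp (- t))\<^sup>2 * 0) + 2 * 0"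
  by (intro tendsto_intros marginal_limit ip joint_limit)
 then have b: "(\<lambda>n. 20 * (?L n)\<^sup>2 / real (p n) + 2 * (real (p n) ^ 3 * ?J n)) \<longlonglongrightarrow> 0"
  by (simp add: divide_inverse mult.assoc)
 have "(\<lambda>n. ?A n - exp (- ?L n)) \<longlonglongrightarrow> 0"
 proof (rule Lim_null_comparison[OF _ b])
  show "\<forall>\<^sub>F n in sequentially. norm (?A n - exp (- ?L n)) \<le> 20 * (?L n)\<^sup>2 / real (p n) + 2 * (real (p n) ^ 3 * ?J n)"
   using d_pos n_large p2 by eventually_elim (unfold real_norm_def, rule no_exceedance_bound)
 qed
 moreover have "(\<lambda>n. exp (- ?L n)) \<longlonglongrightarrow> exp (- exp (- t))"
  by (intro tendsto_intros marginal_limit)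
 ultimately have "(\<lambda>n. (?A n - exp (- ?L n)) + exp (- ?L n)) \<longlonglongrightarrow> 0 + exp (- exp (- t))" by (rule tendsto_add)
 then show ?thesis by simp
qed

definition T :: "nat \<Rightarrow> nat \<Rightarrow> nat \<Rightarrow> 'a \<Rightarrow> real"
 where "T n i j w = (1 / sqrt (real n)) * (\<Sum>l = 1..n. h (X i l w) (X j l w))"

lemma T_measurable: "i \<ge> 1 \<Longrightarrow> j \<ge> 1 \<Longrightarrow> T n i j \<in> borel_measurable M"
 unfolding T_def[abs_def] by (intro borel_measurable_times borel_measurable_const borel_measurable_sum h_pair_measurable X_meas) auto

text \<open>The two events agree unless one of the fewer than \<open>p\<^sup>2 n\<close> summands has been truncated.\<close>
lemma truncation_error:
 "\<bar>prob {w \<in> space M. \<forall>(i, j)\<in>index_pairs (p n). d n * (T n i j w - d n) \<le> t}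
  - prob {w \<in> space M. \<forall>(i, j)\<in>index_pairs (p n). W n i j w \<le> t}\<bar>
  \<le> (real (p n))\<^sup>2 * real n * prob {w \<in> space M. Z w \<notin> B n}"
proof -
 let ?S = "index_pairs (p n)"
 let ?G = "{w \<in> space M. \<forall>(i, j)\<in>?S. d n * (T n i j w - d n) \<le> t}"
 let ?A = "{w \<in> space M. \<forall>(i, j)\<in>?S. W n i j w \<le> t}"
 define F where "F q = {w \<in> space M. h (X (fst (fst q)) (snd q) w) (X (snd (fst q)) (snd q) w) \<notin> B n}" for q :: "(nat \<times> nat) \<times> nat"
 let ?I = "?S \<times> {1..n}"
 let ?U = "\<Union>q\<in>?I. F q"
 have fin: "finite ?I" by (simp add: finite_index_pairs)
 have Zm: "Z \<in> borel_measurable M" by (rule Z_measurable)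
 have Fq: "F q \<in> events \<and> prob (F q) = prob {w \<in> space M. Z w \<notin> B n}" if "q \<in> ?I" for q
 proof -
  obtain i j l where q: "q = ((i, j), l)" by (cases q) auto
  have ij: "i \<ge> 1" "j \<ge> 1" "i \<noteq> j" "l \<ge> 1" using that by (auto simp: q index_pairs_def)
  have m: "(\<lambda>(x, y, z). indicator (- B n) (h x y) :: real) \<in> borel_measurable triple_borel"
   using B_sets[of n] by measurable
  have "(\<lambda>w. h (X i l w) (X j l w)) \<in> borel_measurable M" using ij by (intro h_pair_measurable X_meas) auto
  then have Fm: "F q \<in> events" unfolding F_def q fst_conv snd_conv using B_sets[of n] by measurable
  have Zs: "{w \<in> space M. Z w \<notin> B n} \<in> events" using Zm B_sets[of n] by measurable
  have "prob (F q) = expectation (indicator (F q))" using Fm by simp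
  also have "\<dots> = expectation (\<lambda>w. indicator (- B n) (h (X i l w) (X j l w)))"
   by (intro Bochner_Integration.integral_cong) (auto simp: F_def q indicator_def)
  also have "\<dots> = expectation (\<lambda>w. indicator (- B n) (h (X 1 1 w) (X 2 1 w)))"
   using expectation_triple(1)[of i j "i + j + 1" l, OF _ _ _ _ _ _ _ m] ij by simp
  also have "\<dots> = expectation (indicator {w \<in> space M. Z w \<notin> B n})"
   by (intro Bochner_Integration.integral_cong) (auto simp: Z_def indicator_def)
  also have "\<dots> = prob {w \<in> space M. Z w \<notin> B n}" using Zs by simp
  finally show ?thesis using Fm by blast
 qed
 have Um: "?U \<in> events" using fin Fq by (intro sets.finite_UN) auto
 have Gm: "?G \<in> events"
 proof -
  have "(\<lambda>w. d n * (T n i j w - d n)) \<in> borel_measurable M" if "(i, j) \<in> ?S" for i j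
   using that by (intro borel_measurable_times borel_measurable_const borel_measurable_diff T_measurable) (auto simp: index_pairs_def)
  then have "{w \<in> space M. d n * (T n (fst q) (snd q) w - d n) \<le> t} \<in> events" if "q \<in> ?S" for q
   using that by (intro borel_measurable_le) (cases q, auto)+
  then have "{w \<in> space M. \<forall>q\<in>?S. d n * (T n (fst q) (snd q) w - d n) \<le> t} \<in> events"
   by (intro sets.sets_Collect_finite_All finite_index_pairs)
  then show ?thesis by (simp add: case_prod_beta)
 qed
 have Am: "?A \<in> events"
 proof -
  have "W n i j \<in> borel_measurable M" if "(i, j) \<in> ?S" for i j
   using that by (intro W_measurable) (auto simp: index_pairs_def)
  then have "{w \<in> space M. W n (fst q) (snd q) w \<le> t} \<in> events" if "q \<in> ?S" for q
   using that by (intro borel_measurable_le) (cases q, auto)+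
  then have "{w \<in> space M. \<forall>q\<in>?S. W n (fst q) (snd q) w \<le> t} \<in> events"
   by (intro sets.sets_Collect_finite_All finite_index_pairs)
  then show ?thesis by (simp add: case_prod_beta)
 qed
 have eq: "d n * (T n i j w - d n) = W n i j w" if "w \<in> space M" "w \<notin> ?U" "(i, j) \<in> ?S" for w i j
 proof -
  have "hB n (X i l w) (X j l w) = h (X i l w) (X j l w)" if "l \<in> {1..n}" for l
  proof -
   have "w \<notin> F ((i, j), l)" using \<open>w \<notin> ?U\<close> \<open>(i, j) \<in> ?S\<close> that by blast
   then show ?thesis using \<open>w \<in> space M\<close> by (simp add: F_def hB_def trunc_def)
  qed
  then have "S n i j w = (\<Sum>l = 1..n. h (X i l w) (X j l w))" unfolding S_def by (rule sum.cong[OF refl])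
  then show ?thesis by (simp add: T_def W_def)
 qed
 have GA: "?G \<subseteq> ?A \<union> ?U" and AG: "?A \<subseteq> ?G \<union> ?U" using eq by fastforce+
 have "prob ?G \<le> prob (?A \<union> ?U)" using GA Am Um by (intro finite_measure_mono) auto
 also have "\<dots> \<le> prob ?A + prob ?U" using Am Um by (rule measure_Un_le)
 finally have 1: "prob ?G \<le> prob ?A + prob ?U" .
 have "prob ?A \<le> prob (?G \<union> ?U)" using AG Gm Um by (intro finite_measure_mono) auto
 also have "\<dots> \<le> prob ?G + prob ?U" using Gm Um by (rule measure_Un_le)
 finally have 2: "prob ?A \<le> prob ?G + prob ?U" .
 have "prob ?U \<le> (\<Sum>q\<in>?I. prob (F q))" using fin Fq by (intro finite_measure_subadditive_finite) auto
 also have "\<dots> = (\<Sum>q\<in>?I. prob {w \<in> space M. Z w \<notin> B n})" using Fq by (intro sum.cong) auto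
 also have "\<dots> = ptilde (p n) * (real n * prob {w \<in> space M. Z w \<notin> B n})"
  by (simp add: card_cartesian_product card_index_pairs)
 also have "\<dots> \<le> (real (p n))\<^sup>2 * (real n * prob {w \<in> space M. Z w \<notin> B n})"
 proof (rule mult_right_mono)
  define x where "x = real (p n)"
  have "ptilde (p n) = (x\<^sup>2 - x) / 2" by (simp add: ptilde_def x_def right_diff_distrib power2_eq_square)
  also have "\<dots> \<le> x\<^sup>2" using zero_le_power2[of x] of_nat_0_le_iff[of "p n", where 'a = real] unfolding x_def[symmetric] by (simp add: field_simps)
  finally show "ptilde (p n) \<le> (real (p n))\<^sup>2" unfolding x_def .
 qed simp
 finally have "prob ?U \<le> (real (p n))\<^sup>2 * real n * prob {w \<in> space M. Z w \<notin> B n}" by (simp only: mult.assoc)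
 then show ?thesis using 1 2 by linarith
qed

lemma gumbel_limit:
 "(\<lambda>n. prob {w \<in> space M. \<forall>(i, j)\<in>index_pairs (p n). d n * (T n i j w - d n) \<le> t}) \<longlonglongrightarrow> exp (- exp (- t))"
proof -
 let ?G = "\<lambda>n. prob {w \<in> space M. \<forall>(i, j)\<in>index_pairs (p n). d n * (T n i j w - d n) \<le> t}"
 let ?A = "\<lambda>n. prob {w \<in> space M. \<forall>(i, j)\<in>index_pairs (p n). W n i j w \<le> t}"
 have "(\<lambda>n. ?G n - ?A n) \<longlonglongrightarrow> 0"
  by (rule Lim_null_comparison[OF always_eventually union_bound]) (simp only: real_norm_def truncation_error simp_thms)
 from tendsto_add[OF this truncated_limit[of t]] show ?thesis by simp
qed

end

section \<open>Centering sequences\<close>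

lemma centering_correction: "((\<lambda>x::real. (ln x + ln (4 * pi)) / (2 * sqrt (2 * x))) \<longlongrightarrow> 0) at_top"
 by real_asymp

text \<open>With \<open>a = sqrt (2 L)\<close> and \<open>D = a - \<epsilon> + \<delta>\<close>, the factor \<open>exp (a \<epsilon>)\<close> cancels \<open>a sqrt (2 \<pi>)\<close>, and \<open>\<delta> D\<^sup>3 / a\<^sup>2\<close> cancels \<open>\<delta> D\<close> up to \<open>o(1)\<close>.\<close>
lemma centering_asymptotics:
 fixes L \<delta> :: "'b \<Rightarrow> real"
 assumes L: "filterlim L at_top F" and \<delta>: "(\<delta> \<longlongrightarrow> 0) F"
 defines "D \<equiv> \<lambda>n. sqrt (2 * L n) - (ln (L n) + ln (4 * pi)) / (2 * sqrt (2 * L n)) + \<delta> n"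
 shows "filterlim D at_top F"
  and "\<forall>\<^sub>F n in F. L n \<le> (D n)\<^sup>2 \<and> (D n)\<^sup>2 \<le> 8 * L n"
  and "((\<lambda>n. exp (L n) * std_normal_density (D n) * exp (\<delta> n * D n ^ 3 / (2 * L n)) / D n) \<longlongrightarrow> 1) F"
proof -
 define a where "a n = sqrt (2 * L n)" for n
 define \<epsilon> where "\<epsilon> n = (ln (L n) + ln (4 * pi)) / (2 * sqrt (2 * L n))" for n
 have D: "D n = a n - \<epsilon> n + \<delta> n" for n by (simp add: D_def a_def \<epsilon>_def)
 have \<epsilon>: "(\<epsilon> \<longlongrightarrow> 0) F" unfolding \<epsilon>_def[abs_def] by (rule filterlim_compose[OF centering_correction L])
 have a: "filterlim a at_top F" unfolding a_def[abs_def]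
  by (intro filterlim_compose[OF sqrt_at_top] filterlim_tendsto_pos_mult_at_top[OF tendsto_const _ L]) simp
 have \<epsilon>\<delta>: "((\<lambda>n. \<delta> n - \<epsilon> n) \<longlongrightarrow> 0) F" using tendsto_diff[OF \<delta> \<epsilon>] by simp
 have Da: "D = (\<lambda>n. (\<delta> n - \<epsilon> n) + a n)" by (simp add: D fun_eq_iff)
 show Dlim: "filterlim D at_top F" unfolding Da by (rule filterlim_tendsto_add_at_top[OF \<epsilon>\<delta> a])
 define \<eta> where "\<eta> n = (\<delta> n - \<epsilon> n) / a n" for n
 have \<eta>: "(\<eta> \<longlongrightarrow> 0) F" unfolding \<eta>_def[abs_def] by (rule tendsto_divide_0[OF \<epsilon>\<delta> filterlim_at_top_imp_at_infinity[OF a]])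
 have Lpos: "\<forall>\<^sub>F n in F. L n > 1" by (rule eventually_compose_filterlim[OF eventually_gt_at_top L])
 have Dpos: "\<forall>\<^sub>F n in F. D n > 0" by (rule eventually_compose_filterlim[OF eventually_gt_at_top Dlim])
 have D\<eta>: "D n = a n * (1 + \<eta> n)" if "L n > 1" for n
 proof -
  have "a n > 0" using that by (simp add: a_def)
  then show ?thesis unfolding \<eta>_def D by (simp add: field_simps)
 qed
 have \<eta>1: "\<forall>\<^sub>F n in F. \<bar>\<eta> n\<bar> < 1 / 4" using tendsto_rabs_zero[OF \<eta>] by (rule order_tendstoD(2)) simp
 show "\<forall>\<^sub>F n in F. L n \<le> (D n)\<^sup>2 \<and> (D n)\<^sup>2 \<le> 8 * L n"
  using Lpos \<eta>1
 proof eventually_elim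
  case (elim n)
  have "(3 / 4)\<^sup>2 \<le> (1 + \<eta> n)\<^sup>2" "(1 + \<eta> n)\<^sup>2 \<le> (5 / 4)\<^sup>2" using elim(2) by (intro power_mono; linarith)+
  moreover have "(D n)\<^sup>2 = 2 * L n * (1 + \<eta> n)\<^sup>2"
   unfolding D\<eta>[OF elim(1)] power_mult_distrib a_def using elim(1) by simp
  ultimately have "2 * L n * (3 / 4)\<^sup>2 \<le> (D n)\<^sup>2" "(D n)\<^sup>2 \<le> 2 * L n * (5 / 4)\<^sup>2"
   using elim(1) by (auto intro!: mult_left_mono)
  then show ?case using elim(1) by (simp add: power2_eq_square)
 qed
 have main: "((\<lambda>n. inverse (1 + \<eta> n) * exp (- (\<epsilon> n)\<^sup>2 / 2 - (\<delta> n)\<^sup>2 / 2 + \<delta> n * ((\<delta> n - \<epsilon> n) * (3 + 3 * \<eta> n + (\<eta> n)\<^sup>2) + \<epsilon> n))) \<longlongrightarrow>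
   inverse (1 + 0) * exp (- 0\<^sup>2 / 2 - 0\<^sup>2 / 2 + 0 * (0 * (3 + 3 * 0 + 0\<^sup>2) + 0))) F"
  by (intro tendsto_intros \<eta> \<epsilon> \<delta> \<epsilon>\<delta>) auto
 show "((\<lambda>n. exp (L n) * std_normal_density (D n) * exp (\<delta> n * D n ^ 3 / (2 * L n)) / D n) \<longlongrightarrow> 1) F"
 proof (rule Lim_transform_eventually[of _ 1])
  show "((\<lambda>n. inverse (1 + \<eta> n) * exp (- (\<epsilon> n)\<^sup>2 / 2 - (\<delta> n)\<^sup>2 / 2 + \<delta> n * ((\<delta> n - \<epsilon> n) * (3 + 3 * \<eta> n + (\<eta> n)\<^sup>2) + \<epsilon> n))) \<longlongrightarrow> 1) F"
   using main by simp
  show "\<forall>\<^sub>F n in F. inverse (1 + \<eta> n) * exp (- (\<epsilon> n)\<^sup>2 / 2 - (\<delta> n)\<^sup>2 / 2 + \<delta> n * ((\<delta> n - \<epsilon> n) * (3 + 3 * \<eta> n + (\<eta> n)\<^sup>2) + \<epsilon> n))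
    = exp (L n) * std_normal_density (D n) * exp (\<delta> n * D n ^ 3 / (2 * L n)) / D n"
   using Lpos Dpos \<eta>1
  proof eventually_elim
   case (elim n)
   have a0: "a n > 0" and aa: "2 * L n = (a n)\<^sup>2" using elim(1) by (simp_all add: a_def)
   have L0: "L n > 0" using elim(1) by simp
   have "a n * \<epsilon> n = (ln (L n) + ln (4 * pi)) / 2" unfolding \<epsilon>_def a_def[symmetric] using a0 by simp
   also have "\<dots> = ln (sqrt (4 * pi * L n))" using L0 by (simp add: ln_sqrt ln_mult)
   finally have "exp (a n * \<epsilon> n) = sqrt (4 * pi * L n)" using L0 by simp
   also have "4 * pi * L n = (2 * pi) * (2 * L n)" by simp
   also have "sqrt \<dots> = sqrt (2 * pi) * a n" by (simp only: real_sqrt_mult a_def)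
   finally have ea: "exp (a n * \<epsilon> n) = sqrt (2 * pi) * a n" .
   have cube: "D n ^ 3 / (2 * L n) = a n * (1 + \<eta> n) ^ 3"
    unfolding D\<eta>[OF elim(1)] aa using a0 by (simp add: power_mult_distrib power2_eq_square power3_eq_cube)
   have e\<eta>: "\<delta> n - \<epsilon> n = a n * \<eta> n" using a0 by (simp add: \<eta>_def)
   have "L n - (D n)\<^sup>2 / 2 + \<delta> n * (a n * (1 + \<eta> n) ^ 3) - a n * \<epsilon> n
     = - (\<epsilon> n)\<^sup>2 / 2 - (\<delta> n)\<^sup>2 / 2 + \<delta> n * ((a n * \<eta> n) * (3 + 3 * \<eta> n + (\<eta> n)\<^sup>2) + \<epsilon> n)"
    unfolding D using aa by (simp add: power2_eq_square power3_eq_cube field_simps)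
   then have ex: "- (\<epsilon> n)\<^sup>2 / 2 - (\<delta> n)\<^sup>2 / 2 + \<delta> n * ((\<delta> n - \<epsilon> n) * (3 + 3 * \<eta> n + (\<eta> n)\<^sup>2) + \<epsilon> n)
     = L n + - (D n)\<^sup>2 / 2 + \<delta> n * D n ^ 3 / (2 * L n) - a n * \<epsilon> n"
    unfolding e\<eta> times_divide_eq_right[symmetric] cube by linarith
   have inv: "inverse (1 + \<eta> n) = a n / D n" unfolding D\<eta>[OF elim(1)] using a0 by (simp add: inverse_eq_divide)
   have alg: "a n / D n * (x * y * z / (c * a n)) = x * (1 / c * y) * z / D n" for x y z c :: real using a0 by (simp add: mult_ac)
   show ?case unfolding ex exp_diff exp_add ea inv std_normal_density_def alg ..
  qed
 qed
qed

section \<open>Stretched exponential moments\<close>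

lemma power_le_exp:
 fixes c x :: real
 assumes "c > 0" "x \<ge> 0" "m > 0"
 shows "x ^ m \<le> (real m / c) ^ m * exp (c * x)"
proof -
 have "(c * x / real m) ^ m \<le> (1 + c * x / real m) ^ m" using assms by (intro power_mono) auto
 also have "\<dots> \<le> exp (c * x)"
  by (rule exp_ge_one_plus_x_over_n_power_n) (use assms in \<open>auto intro: order_trans[of _ 0]\<close>)
 finally have "(real m / c) ^ m * (c * x / real m) ^ m \<le> (real m / c) ^ m * exp (c * x)"
  using assms by (intro mult_left_mono) auto
 moreover have "(real m / c) ^ m * (c * x / real m) ^ m = x ^ m" using assms by (simp add: power_mult_distrib[symmetric])
 ultimately show ?thesis by simp
qed

lemma power_le_stretched_exp:
 fixes c r :: real
 assumes "c > 0" "r > 0"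
 obtains C where "C \<ge> 0" "\<And>z::real. \<bar>z\<bar> ^ k \<le> C * exp (c * \<bar>z\<bar> powr r)"
proof -
 obtain m :: nat where m: "real m > real k / r" using reals_Archimedean2 by blast
 then have mk: "real k \<le> real m * r" using assms(2) by (simp add: pos_divide_less_eq)
 have "real k / r \<ge> 0" using assms by simp
 then have m0: "m > 0" using m by linarith
 define C where "C = 1 + (real m / c) ^ m"
 have C0: "(real m / c) ^ m \<ge> 0" using assms by simp
 show thesis
 proof (rule that)
  show "C \<ge> 0" unfolding C_def using C0 by simp
  fix z :: real
  define x where "x = \<bar>z\<bar> powr r"
  have x0: "x \<ge> 0" by (simp add: x_def)
  have e1: "1 \<le> exp (c * x)" using assms(1) x0 by simp
  show "\<bar>z\<bar> ^ k \<le> C * exp (c * \<bar>z\<bar> powr r)"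
  proof (cases "\<bar>z\<bar> \<le> 1")
   case True
   have "\<bar>z\<bar> ^ k \<le> 1 * 1" using True by (simp add: power_le_one)
   also have "\<dots> \<le> C * exp (c * x)" using C0 e1 by (intro mult_mono) (auto simp: C_def)
   finally show ?thesis by (simp add: x_def)
  next
   case False
   have "\<bar>z\<bar> ^ k = \<bar>z\<bar> powr real k" using False by (simp add: powr_realpow)
   also have "\<dots> \<le> \<bar>z\<bar> powr (real m * r)" using False mk by (intro powr_mono) auto
   also have "\<dots> = x ^ m" using False by (simp add: x_def powr_powr[symmetric] powr_realpow mult.commute)
   also have "\<dots> \<le> (real m / c) ^ m * exp (c * x)" by (rule power_le_exp[OF assms(1) x0 m0])
   also have "\<dots> \<le> C * exp (c * x)" by (intro mult_right_mono) (auto simp: C_def)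
   finally show ?thesis by (simp add: x_def)
  qed
 qed
qed

lemma stretched_exp_decay:
 assumes "c > 0" "r > 0"
 shows "(\<lambda>n. real n * exp (- (c * real n powr r))) \<longlonglongrightarrow> 0"
 using assms by real_asymp

text \<open>The assumption \<open>scale\<close> says that \<open>D\<^sup>2\<close> is of smaller order than the exponent \<open>(D sqrt n)\<^sup>r\<close> with which the tail of \<open>Z\<close> decays at the truncation level.\<close>
locale stretched_exp_moment = prob_space M for M :: "'a measure" +
 fixes Z :: "'a \<Rightarrow> real" and \<eta> r :: real and D :: "nat \<Rightarrow> real"
 assumes Z_meas [measurable]: "Z \<in> borel_measurable M" and \<eta>: "\<eta> > 0" and r: "0 < r" "r < 1"
  and mgf: "integrable M (\<lambda>w. exp (\<eta> * \<bar>Z w\<bar> powr r))"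
  and D_lim: "filterlim D at_top sequentially"
  and D_small: "(\<lambda>n. D n / sqrt n) \<longlonglongrightarrow> 0"
  and scale: "(\<lambda>n. D n powr (2 - r) * real n powr (- (r / 2))) \<longlonglongrightarrow> 0"
begin

definition level :: "nat \<Rightarrow> real set" where "level n = {z. \<bar>z\<bar> \<le> D n * sqrt n}"

definition tail_error :: "nat \<Rightarrow> real"
 where "tail_error n = real n * exp (- (\<eta> / 2 * (D n * sqrt n) powr r))"

lemma level_sets: "level n \<in> sets borel"
 unfolding level_def by measurable

lemma D_gt_1: "\<forall>\<^sub>F n in sequentially. D n > 1"
 by (rule eventually_compose_filterlim[OF eventually_gt_at_top D_lim])

lemma tail_error_lim: "tail_error \<longlonglongrightarrow> 0"
proof (rule Lim_null_comparison)
 show "(\<lambda>n. real n * exp (- (\<eta> / 2 * real n powr (r / 2)))) \<longlonglongrightarrow> 0"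
  using \<eta> r by (intro stretched_exp_decay) auto
 show "\<forall>\<^sub>F n in sequentially. norm (tail_error n) \<le> real n * exp (- (\<eta> / 2 * real n powr (r / 2)))"
  using D_gt_1 eventually_gt_at_top[of 0]
 proof eventually_elim
  case (elim n)
  have "real n powr (r / 2) = sqrt n powr r" using elim(2) by (simp add: powr_half_sqrt[symmetric] powr_powr)
  also have "\<dots> \<le> (D n * sqrt n) powr r" using elim r by (intro powr_mono2) auto
  finally show ?case unfolding tail_error_def using \<eta> by (simp add: mult_left_mono)
 qed
qed

lemma scale_identity:
 assumes x: "x > 0" and n: "n > (0::nat)"
 shows "x\<^sup>2 = x powr (2 - r) * real n powr (- (r / 2)) * (x * sqrt n) powr r"
  and "x / sqrt n * (x * sqrt n) powr (1 - r) = x powr (2 - r) * real n powr (- (r / 2))"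
proof -
 define m where "m = sqrt (real n)"
 have m: "m > 0" using n by (simp add: m_def)
 have nm: "real n powr (- (r / 2)) = m powr - r"
  by (simp add: m_def powr_half_sqrt[symmetric] powr_powr)
 have s: "(x * m) powr q = x powr q * m powr q" for q
  using x m by (simp add: powr_mult)
 have "x powr (2 - r) * m powr - r * (x * m) powr r = (x powr (2 - r) * x powr r) * (m powr - r * m powr r)"
  unfolding s by (simp only: mult_ac)
 also have "\<dots> = x powr ((2 - r) + r) * m powr (- r + r)" by (simp only: powr_add)
 also have "\<dots> = x powr 2" using m by simp
 also have "\<dots> = x\<^sup>2" using x by simp
 finally show "x\<^sup>2 = x powr (2 - r) * real n powr (- (r / 2)) * (x * sqrt n) powr r"
  unfolding nm m_def by (rule sym)
 have "x / m = x powr 1 * m powr - 1" using x m by (simp add: powr_minus divide_inverse)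
 then have "x / m * (x * m) powr (1 - r) = (x powr 1 * x powr (1 - r)) * (m powr - 1 * m powr (1 - r))"
  unfolding s by (simp only: mult_ac)
 also have "\<dots> = x powr (1 + (1 - r)) * m powr (- 1 + (1 - r))" by (simp only: powr_add)
 also have "1 + (1 - r) = 2 - r" by simp
 also have "- 1 + (1 - r) = - r" by simp
 finally show "x / sqrt n * (x * sqrt n) powr (1 - r) = x powr (2 - r) * real n powr (- (r / 2))"
  unfolding nm m_def .
qed

lemma taylor_rem_bound:
 assumes a: "a > 0"
 obtains C where "C \<ge> 0" "\<forall>\<^sub>F n in sequentially. \<forall>z. taylor_rem k (level n) (a * D n / sqrt n) z
   \<le> C * ((a * D n / sqrt n) ^ k + exp (- (\<eta> / 2 * (D n * sqrt n) powr r))) * exp (\<eta> * \<bar>z\<bar> powr r)"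
proof -
 have \<eta>2: "\<eta> / 2 > 0" using \<eta> by simp
 obtain C1 where C1: "C1 \<ge> 0" "\<And>z::real. \<bar>z\<bar> ^ k \<le> C1 * exp (\<eta> / 2 * \<bar>z\<bar> powr r)"
  using power_le_stretched_exp[OF \<eta>2 r(1), of k] by blast
 obtain C2 where C2: "C2 \<ge> 0" "\<And>z::real. \<bar>z\<bar> ^ (k - 1) \<le> C2 * exp (\<eta> / 2 * \<bar>z\<bar> powr r)"
  using power_le_stretched_exp[OF \<eta>2 r(1), of "k - 1"] by blast
 have "(\<lambda>n. 2 * a * (D n powr (2 - r) * real n powr (- (r / 2)))) \<longlonglongrightarrow> 2 * a * 0"
  by (intro tendsto_mult tendsto_const scale)
 then have ev1: "\<forall>\<^sub>F n in sequentially. 2 * a * (D n powr (2 - r) * real n powr (- (r / 2))) < \<eta> / 2"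
  using \<eta>2 by (intro order_tendstoD(2)) auto
 have "(\<lambda>n. a * (D n / sqrt n)) \<longlonglongrightarrow> a * 0" by (intro tendsto_mult tendsto_const D_small)
 then have ev2: "\<forall>\<^sub>F n in sequentially. a * (D n / sqrt n) < 1" by (intro order_tendstoD(2)) auto
 show thesis
 proof (rule that[of "C1 + (1 + C2)"])
  show "C1 + (1 + C2) \<ge> 0" using C1 C2 by simp
  show "\<forall>\<^sub>F n in sequentially. \<forall>z. taylor_rem k (level n) (a * D n / sqrt n) z
   \<le> (C1 + (1 + C2)) * ((a * D n / sqrt n) ^ k + exp (- (\<eta> / 2 * (D n * sqrt n) powr r))) * exp (\<eta> * \<bar>z\<bar> powr r)"
   using ev1 ev2 D_gt_1 eventually_gt_at_top[of 0]
  proof (eventually_elim, intro allI)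
   fix n :: nat and z :: real
   assume e1: "2 * a * (D n powr (2 - r) * real n powr (- (r / 2))) < \<eta> / 2" and e2: "a * (D n / sqrt n) < 1" and D1: "1 < D n" and n0: "0 < n"
   define \<theta> where "\<theta> = a * D n / sqrt n"
   define \<tau> where "\<tau> = D n * sqrt n"
   define x where "x = \<bar>z\<bar> powr r"
   define E where "E = exp (- (\<eta> / 2 * \<tau> powr r))"
   have \<theta>: "0 \<le> \<theta>" "\<theta> \<le> 1" using e2 a D1 by (auto simp: \<theta>_def)
   have D0: "D n > 0" using D1 by simp
   have \<tau>0: "\<tau> \<ge> 0" using D1 by (simp add: \<tau>_def)
   have x0: "x \<ge> 0" by (simp add: x_def)
   have E0: "E \<ge> 0" by (simp add: E_def)
   have dbl: "exp (\<eta> / 2 * x) * exp (\<eta> / 2 * x) = exp (\<eta> * x)" by (simp add: exp_add[symmetric])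
   have "taylor_rem k (level n) \<theta> z \<le> (C1 + (1 + C2)) * (\<theta> ^ k + E) * exp (\<eta> * x)"
   proof (cases "\<bar>z\<bar> \<le> \<tau>")
    case True
    have "2 * \<theta> * \<bar>z\<bar> \<le> \<eta> / 2 * x"
    proof (cases "z = 0")
     case True
     then show ?thesis using \<eta> x0 by simp
    next
     case False
     have "2 * \<theta> * \<bar>z\<bar> = 2 * \<theta> * (\<bar>z\<bar> powr (1 - r) * x)" unfolding x_def powr_add[symmetric] using False by simp
     also have "\<dots> \<le> 2 * \<theta> * (\<tau> powr (1 - r) * x)"
      using True r \<theta> x0 by (intro mult_left_mono mult_right_mono powr_mono2) auto
     also have "\<dots> = 2 * a * (D n / sqrt n * \<tau> powr (1 - r)) * x" by (simp add: \<theta>_def)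
     also have "\<dots> \<le> \<eta> / 2 * x" unfolding \<tau>_def scale_identity(2)[OF D0 n0] by (rule mult_right_mono[OF less_imp_le[OF e1] x0])
     finally show ?thesis .
    qed
    then have "taylor_rem k (level n) \<theta> z \<le> (\<theta> * \<bar>z\<bar>) ^ k * exp (\<eta> / 2 * x)"
     using True \<theta> by (simp add: taylor_rem_def level_def \<tau>_def mult_left_mono mult.assoc)
    also have "\<dots> \<le> \<theta> ^ k * (C1 * exp (\<eta> / 2 * x)) * exp (\<eta> / 2 * x)"
     unfolding power_mult_distrib x_def using \<theta> by (intro mult_right_mono mult_left_mono C1) auto
    also have "\<dots> = C1 * \<theta> ^ k * exp (\<eta> * x)" unfolding dbl[symmetric] by (simp only: mult_ac)
    also have "\<dots> \<le> (C1 + (1 + C2)) * (\<theta> ^ k + E) * exp (\<eta> * x)"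
     using C1(1) C2(1) \<theta> E0 by (intro mult_right_mono mult_mono) auto
    finally show ?thesis .
   next
    case False
    have px: "\<tau> powr r \<le> x" unfolding x_def using False r \<tau>0 by (intro powr_mono2) auto
    have e1: "1 \<le> exp (\<eta> / 2 * x)" using \<eta> x0 by simp
    have ex: "exp (\<eta> / 2 * x) \<le> E * exp (\<eta> * x)"
     unfolding E_def exp_add[symmetric] using mult_left_mono[OF px, of "\<eta> / 2"] \<eta> by simp
    have "\<theta> * \<bar>z\<bar> \<le> 1 * \<bar>z\<bar>" using \<theta> by (intro mult_right_mono) auto
    then have "(\<theta> * \<bar>z\<bar>) ^ (k - 1) \<le> \<bar>z\<bar> ^ (k - 1)" using \<theta> by (intro power_mono) auto
    then have "taylor_rem k (level n) \<theta> z \<le> 1 + \<bar>z\<bar> ^ (k - 1)"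
     using False by (simp add: taylor_rem_def level_def \<tau>_def)
    also have "\<dots> \<le> exp (\<eta> / 2 * x) + C2 * exp (\<eta> / 2 * x)" by (rule add_mono[OF e1 C2(2)[of z, folded x_def]])
    also have "\<dots> = (1 + C2) * exp (\<eta> / 2 * x)" by (simp only: distrib_right mult_1_left)
    also have "\<dots> \<le> (1 + C2) * (E * exp (\<eta> * x))" using C2(1) ex by (intro mult_left_mono) auto
    also have "\<dots> = (1 + C2) * E * exp (\<eta> * x)" by simp
    also have "\<dots> \<le> (C1 + (1 + C2)) * (\<theta> ^ k + E) * exp (\<eta> * x)"
     using C1(1) C2(1) \<theta> E0 by (intro mult_right_mono mult_mono) auto
    finally show ?thesis .
   qed
   then show "taylor_rem k (level n) (a * D n / sqrt n) z
    \<le> (C1 + (1 + C2)) * ((a * D n / sqrt n) ^ k + exp (- (\<eta> / 2 * (D n * sqrt n) powr r))) * exp (\<eta> * \<bar>z\<bar> powr r)"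
    by (simp only: \<theta>_def \<tau>_def x_def E_def)
  qed
 qed
qed

lemma taylor_rem_expectation:
 assumes a: "a > 0"
 shows "\<exists>C\<ge>0. \<forall>\<^sub>F n in sequentially. integrable M (\<lambda>w. taylor_rem k (level n) (a * D n / sqrt n) (Z w))
  \<and> real n * expectation (\<lambda>w. taylor_rem k (level n) (a * D n / sqrt n) (Z w)) \<le> C * (real n * (D n / sqrt n) ^ k + tail_error n)"
proof -
 obtain C where C: "C \<ge> 0" and ev: "\<forall>\<^sub>F n in sequentially. \<forall>z. taylor_rem k (level n) (a * D n / sqrt n) z
   \<le> C * ((a * D n / sqrt n) ^ k + exp (- (\<eta> / 2 * (D n * sqrt n) powr r))) * exp (\<eta> * \<bar>z\<bar> powr r)"
  using taylor_rem_bound[OF a] by blast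
 define m where "m = expectation (\<lambda>w. exp (\<eta> * \<bar>Z w\<bar> powr r))"
 have m0: "m \<ge> 0" unfolding m_def by (intro integral_nonneg_AE AE_I2) simp
 have "\<forall>\<^sub>F n in sequentially. integrable M (\<lambda>w. taylor_rem k (level n) (a * D n / sqrt n) (Z w))
  \<and> real n * expectation (\<lambda>w. taylor_rem k (level n) (a * D n / sqrt n) (Z w)) \<le> (C * (a ^ k + 1) * m) * (real n * (D n / sqrt n) ^ k + tail_error n)"
  using ev D_gt_1
 proof eventually_elim
  case (elim n)
  let ?R = "\<lambda>w. taylor_rem k (level n) (a * D n / sqrt n) (Z w)"
  define E where "E = exp (- (\<eta> / 2 * (D n * sqrt n) powr r))"
  define y where "y = (D n / sqrt n) ^ k"
  have y0: "y \<ge> 0" and E0: "E \<ge> 0" using elim(2) by (auto simp: y_def E_def)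
  have \<theta>k: "(a * D n / sqrt n) ^ k = a ^ k * y" unfolding y_def power_mult_distrib[symmetric] by simp
  have \<theta>0: "a * D n / sqrt n \<ge> 0" using a elim(2) by simp
  have le: "?R w \<le> C * (a ^ k * y + E) * exp (\<eta> * \<bar>Z w\<bar> powr r)" for w
   using elim(1) unfolding \<theta>k E_def by blast
  have int: "integrable M ?R"
  proof (rule Bochner_Integration.integrable_bound)
   show "integrable M (\<lambda>w. C * (a ^ k * y + E) * exp (\<eta> * \<bar>Z w\<bar> powr r))" by (intro integrable_mult_right mgf)
   show "?R \<in> borel_measurable M" by (rule measurable_compose[OF Z_meas taylor_rem_measurable[OF level_sets]])
   show "AE w in M. norm (?R w) \<le> norm (C * (a ^ k * y + E) * exp (\<eta> * \<bar>Z w\<bar> powr r))"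
    using le taylor_rem_nonneg[OF \<theta>0] by (intro AE_I2) (metis abs_ge_self abs_of_nonneg order_trans real_norm_def)
  qed
  have "expectation ?R \<le> expectation (\<lambda>w. C * (a ^ k * y + E) * exp (\<eta> * \<bar>Z w\<bar> powr r))"
   by (intro integral_mono int integrable_mult_right mgf le)
  also have "\<dots> = C * (a ^ k * y + E) * m" by (simp add: m_def)
  finally have "real n * expectation ?R \<le> real n * (C * (a ^ k * y + E) * m)" by (rule mult_left_mono) simp
  also have "\<dots> \<le> real n * (C * ((a ^ k + 1) * (y + E)) * m)"
  proof (intro mult_left_mono mult_right_mono m0 C)
   have "0 \<le> a ^ k * E" "0 \<le> y" using y0 E0 a by auto
   then show "a ^ k * y + E \<le> (a ^ k + 1) * (y + E)" by (simp add: distrib_left distrib_right)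
  qed auto
  also have "\<dots> = (C * (a ^ k + 1) * m) * (real n * y + tail_error n)"
   unfolding tail_error_def E_def[symmetric] by (simp add: algebra_simps)
  finally show ?case using int by (simp add: y_def)
 qed
 moreover have "C * (a ^ k + 1) * m \<ge> 0" using C a m0 by (intro mult_nonneg_nonneg add_nonneg_nonneg) auto
 ultimately show ?thesis by blast
qed

lemma union_bound_limit:
 assumes p: "\<forall>\<^sub>F n in sequentially. (p n)\<^sup>2 \<le> 4 * exp ((D n)\<^sup>2)"
 shows "(\<lambda>n. (p n)\<^sup>2 * real n * prob {w \<in> space M. Z w \<notin> level n}) \<longlonglongrightarrow> 0"
proof (rule Lim_null_comparison)
 define m where "m = expectation (\<lambda>w. exp (\<eta> * \<bar>Z w\<bar> powr r))"
 show "(\<lambda>n. (4 * m) * tail_error n) \<longlonglongrightarrow> 0" using tendsto_mult[OF tendsto_const tail_error_lim, of "4 * m"] by simp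
 have ev: "\<forall>\<^sub>F n in sequentially. D n powr (2 - r) * real n powr (- (r / 2)) < \<eta> / 2"
  using scale \<eta> by (intro order_tendstoD(2)) auto
 show "\<forall>\<^sub>F n in sequentially. norm ((p n)\<^sup>2 * real n * prob {w \<in> space M. Z w \<notin> level n}) \<le> (4 * m) * tail_error n"
  using p D_gt_1 eventually_gt_at_top[of 0] ev
 proof eventually_elim
  case (elim n)
  define x where "x = (D n * sqrt n) powr r"
  have x0: "x \<ge> 0" by (simp add: x_def)
  let ?b = "exp (- (\<eta> * x))"
  have "prob {w \<in> space M. Z w \<notin> level n} = expectation (indicator {w \<in> space M. Z w \<notin> level n})"
   using level_sets[of n] by simp
  also have "\<dots> \<le> expectation (\<lambda>w. ?b * exp (\<eta> * \<bar>Z w\<bar> powr r))"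
  proof (rule integral_mono)
   have "{w \<in> space M. Z w \<notin> level n} \<in> events" using level_sets[of n] by measurable
   then show "integrable M (indicator {w \<in> space M. Z w \<notin> level n} :: 'a \<Rightarrow> real)" by (simp add: emeasure_eq_measure)
   show "integrable M (\<lambda>w. ?b * exp (\<eta> * \<bar>Z w\<bar> powr r))" by (intro integrable_mult_right mgf)
   fix w
   show "indicator {w \<in> space M. Z w \<notin> level n} w \<le> ?b * exp (\<eta> * \<bar>Z w\<bar> powr r)"
   proof (cases "Z w \<in> level n")
    case True
    then show ?thesis by (simp add: indicator_def)
   next
    case False
    have "x \<le> \<bar>Z w\<bar> powr r" unfolding x_def using False elim(2) r by (intro powr_mono2) (auto simp: level_def)
    then have "1 \<le> ?b * exp (\<eta> * \<bar>Z w\<bar> powr r)" unfolding exp_add[symmetric] using \<eta> by simp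
    then show ?thesis using indicator_le_1[of "{w \<in> space M. Z w \<notin> level n}" w] by (rule order_trans[rotated])
   qed
  qed
  also have "\<dots> = ?b * m" by (simp add: m_def)
  finally have P: "prob {w \<in> space M. Z w \<notin> level n} \<le> ?b * m" .
  have m0: "m \<ge> 0" unfolding m_def by (intro integral_nonneg_AE AE_I2) simp
  have "(D n)\<^sup>2 \<le> \<eta> / 2 * x"
   unfolding x_def using elim(2-4) by (subst scale_identity(1)[of "D n" n]) (auto intro!: mult_right_mono)
  then have "exp ((D n)\<^sup>2) * ?b \<le> exp (- (\<eta> / 2 * x))" unfolding exp_add[symmetric] by simp
  then have b: "real n * (exp ((D n)\<^sup>2) * ?b) \<le> tail_error n" unfolding tail_error_def x_def[symmetric] by (rule mult_left_mono) simp
  have "(p n)\<^sup>2 * real n * prob {w \<in> space M. Z w \<notin> level n} \<le> (4 * exp ((D n)\<^sup>2)) * real n * (?b * m)"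
   using elim(1) P by (intro mult_mono) auto
  also have "\<dots> = 4 * m * (real n * (exp ((D n)\<^sup>2) * ?b))" by (simp only: mult_ac)
  also have "\<dots> \<le> 4 * m * tail_error n" using b m0 by (intro mult_left_mono) auto
  finally show ?case by simp
 qed
qed

end

section \<open>Polynomial-logarithmic moments\<close>

lemma log_level_lim: "filterlim (\<lambda>n. sqrt (real n / ln (real n))) at_top sequentially"
 by real_asymp

lemma ln_log_level: "\<forall>\<^sub>F n in sequentially. ln (real n) / 4 \<le> ln (sqrt (real n / ln (real n)))"
proof -
 have "\<forall>\<^sub>F n in sequentially. ln (real n) / 4 \<le> ln (real n / ln (real n)) / 2" by real_asymp
 then show ?thesis using eventually_gt_at_top[of 1]
 proof eventually_elim
  case (elim n)
  have "real n / ln (real n) > 0" using elim(2) by simp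
  then show ?case using elim(1) by (simp add: ln_sqrt)
 qed
qed

lemma log_level_powr_decay:
 assumes "m > (2::real)"
 shows "(\<lambda>n. real n * (1 / sqrt (real n / ln (real n))) powr m) \<longlonglongrightarrow> 0"
 using assms by real_asymp

locale log_moment = prob_space M for M :: "'a measure" +
 fixes Z :: "'a \<Rightarrow> real" and s :: real
 assumes Z_meas [measurable]: "Z \<in> borel_measurable M" and s: "s > 2"
  and moment: "integrable M (\<lambda>v. \<bar>Z v\<bar> powr s * ln_plus \<bar>Z v\<bar> powr (s / 2))"
begin

definition height :: "nat \<Rightarrow> real" where "height n = sqrt (real n / ln (real n))"

definition level :: "nat \<Rightarrow> real set" where "level n = {z. \<bar>z\<bar> \<le> height n}"

lemma level_sets: "level n \<in> sets borel"
 unfolding level_def by measurable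

lemma height_lim: "filterlim height at_top sequentially"
 unfolding height_def[abs_def] by (rule log_level_lim)

lemma ln_plus_nonneg: "0 \<le> ln_plus x"
 by (simp add: ln_plus_def)

lemma moment_large_values:
 "\<forall>\<^sub>F n in sequentially. \<forall>z. z \<notin> level n \<longrightarrow> real n powr (s / 2) \<le> 4 powr (s / 2) * (\<bar>z\<bar> powr s * ln_plus \<bar>z\<bar> powr (s / 2))"
 using ln_log_level eventually_gt_at_top[of 1] eventually_compose_filterlim[OF eventually_gt_at_top[of 1] height_lim]
proof (eventually_elim, intro allI impI)
 fix n :: nat and z :: real
 assume l: "ln (real n) / 4 \<le> ln (sqrt (real n / ln (real n)))" and n1: "1 < n" and h1: "1 < height n" and z: "z \<notin> level n"
 define y where "y = \<bar>z\<bar>"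
 have yh: "y > height n" using z by (simp add: level_def y_def)
 have lnn: "ln (real n) > 0" using n1 by simp
 have y2: "y\<^sup>2 \<ge> real n / ln (real n)"
 proof -
  have "(height n)\<^sup>2 \<le> y\<^sup>2" using yh h1 by (intro power_mono) auto
  then show ?thesis using lnn by (simp add: height_def)
 qed
 have "ln (real n) / 4 \<le> ln (height n)" using l by (simp add: height_def)
 also have "\<dots> \<le> ln y" using yh h1 by simp
 finally have ly: "ln (real n) / 4 \<le> ln_plus y" unfolding ln_plus_def by simp
 have "real n = 4 * ((real n / ln (real n)) * (ln (real n) / 4))" using lnn by simp
 also have "\<dots> \<le> 4 * (y\<^sup>2 * ln_plus y)" using y2 ly lnn by (intro mult_left_mono mult_mono) auto
 finally have "real n powr (s / 2) \<le> (4 * (y\<^sup>2 * ln_plus y)) powr (s / 2)" using s by (intro powr_mono2) auto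
 also have "\<dots> = 4 powr (s / 2) * ((y\<^sup>2) powr (s / 2) * ln_plus y powr (s / 2))" by (simp add: powr_mult ln_plus_nonneg)
 also have "(y\<^sup>2) powr (s / 2) = y powr s"
 proof -
  have "y\<^sup>2 = y powr 2" using yh h1 by simp
  then show ?thesis by (simp add: powr_powr)
 qed
 finally show "real n powr (s / 2) \<le> 4 powr (s / 2) * (\<bar>z\<bar> powr s * ln_plus \<bar>z\<bar> powr (s / 2))" by (simp add: y_def)
qed

text \<open>At the truncation level the moment function is of the order of \<open>n\<close> to the power \<open>s / 2\<close>, so this is a Markov bound with the integrable function restricted to a vanishing set.\<close>
lemma tail_prob_limit: "(\<lambda>n. real n powr (s / 2) * prob {v \<in> space M. Z v \<notin> level n}) \<longlonglongrightarrow> 0"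
proof (rule Lim_null_comparison)
 let ?\<Phi> = "\<lambda>v. \<bar>Z v\<bar> powr s * ln_plus \<bar>Z v\<bar> powr (s / 2)"
 have L[measurable]: "level n \<in> sets borel" for n by (rule level_sets)
 have \<Phi>m[measurable]: "?\<Phi> \<in> borel_measurable M" using moment by (rule borel_measurable_integrable)
 have \<Phi>0: "0 \<le> ?\<Phi> v" for v by (simp add: ln_plus_nonneg)
 have "(\<lambda>n. expectation (\<lambda>v. indicator (- level n) (Z v) * ?\<Phi> v)) \<longlonglongrightarrow> expectation (\<lambda>v. 0)"
 proof (rule integral_dominated_convergence[where w = ?\<Phi>])
  show "(\<lambda>v. indicator (- level n) (Z v) * ?\<Phi> v) \<in> borel_measurable M" for n by measurable
  show "AE v in M. (\<lambda>n. indicator (- level n) (Z v) * ?\<Phi> v) \<longlonglongrightarrow> 0"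
  proof (rule AE_I2, rule tendsto_eventually)
   fix v
   show "\<forall>\<^sub>F n in sequentially. indicator (- level n) (Z v) * ?\<Phi> v = 0"
    using eventually_compose_filterlim[OF eventually_ge_at_top[of "\<bar>Z v\<bar>"] height_lim]
    by eventually_elim (simp add: level_def indicator_def)
  qed
  show "AE v in M. norm (indicator (- level n) (Z v) * ?\<Phi> v) \<le> ?\<Phi> v" for n
   by (rule AE_I2) (auto simp: indicator_def ln_plus_nonneg)
 qed (use moment in auto)
 from tendsto_mult[OF tendsto_const this, of "4 powr (s / 2)"]
 show "(\<lambda>n. 4 powr (s / 2) * expectation (\<lambda>v. indicator (- level n) (Z v) * ?\<Phi> v)) \<longlonglongrightarrow> 0" by simp
 show "\<forall>\<^sub>F n in sequentially. norm (real n powr (s / 2) * prob {v \<in> space M. Z v \<notin> level n})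
   \<le> 4 powr (s / 2) * expectation (\<lambda>v. indicator (- level n) (Z v) * ?\<Phi> v)"
  using moment_large_values
 proof eventually_elim
  case (elim n)
  have A: "{v \<in> space M. Z v \<notin> level n} \<in> events" by measurable
  have "real n powr (s / 2) * prob {v \<in> space M. Z v \<notin> level n} = expectation (\<lambda>v. real n powr (s / 2) * indicator {v \<in> space M. Z v \<notin> level n} v)"
   using A by simp
  also have "\<dots> \<le> expectation (\<lambda>v. 4 powr (s / 2) * (indicator (- level n) (Z v) * ?\<Phi> v))"
  proof (rule integral_mono)
   show "integrable M (\<lambda>v. real n powr (s / 2) * indicator {v \<in> space M. Z v \<notin> level n} v)"
    using A by (intro integrable_mult_right) (simp add: emeasure_eq_measure)
   have "integrable M (\<lambda>v. indicator (- level n) (Z v) * ?\<Phi> v)"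
    by (rule Bochner_Integration.integrable_bound[OF moment]) (auto simp: indicator_def ln_plus_nonneg intro!: AE_I2)
   then show "integrable M (\<lambda>v. 4 powr (s / 2) * (indicator (- level n) (Z v) * ?\<Phi> v))" by (rule integrable_mult_right)
   fix v assume "v \<in> space M"
   then show "real n powr (s / 2) * indicator {v \<in> space M. Z v \<notin> level n} v \<le> 4 powr (s / 2) * (indicator (- level n) (Z v) * ?\<Phi> v)"
    using elim by (cases "Z v \<in> level n") auto
  qed
  also have "\<dots> = 4 powr (s / 2) * expectation (\<lambda>v. indicator (- level n) (Z v) * ?\<Phi> v)" by simp
  finally show ?case by simp
 qed
qed

text \<open>A third moment may be missing; the Taylor error of order 3 is bounded by this moment.\<close>
definition order :: real where "order = min s 3"

lemma order_bounds: "order > 2" "order \<le> 3"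
 using s by (auto simp: order_def)

lemma order_moment: "integrable M (\<lambda>v. \<bar>Z v\<bar> powr order)"
proof (rule Bochner_Integration.integrable_bound)
 show "integrable M (\<lambda>v. (1 + exp s) + \<bar>Z v\<bar> powr s * ln_plus \<bar>Z v\<bar> powr (s / 2))"
  using moment by (intro Bochner_Integration.integrable_add) auto
 show "AE v in M. norm (\<bar>Z v\<bar> powr order) \<le> norm ((1 + exp s) + \<bar>Z v\<bar> powr s * ln_plus \<bar>Z v\<bar> powr (s / 2))"
 proof (rule AE_I2)
  fix v
  define y where "y = \<bar>Z v\<bar>"
  have y0: "y \<ge> 0" by (simp add: y_def)
  have m: "0 \<le> y powr s * ln_plus y powr (s / 2)" by (simp add: ln_plus_nonneg)
  have 1: "y powr order \<le> 1 + y powr s"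
  proof (cases "y \<le> 1")
   case True
   then have "y powr order \<le> 1" using powr_mono2[of order y 1] y0 order_bounds by simp
   then show ?thesis using powr_ge_zero[of y s] by linarith
  next
   case False
   then have "y powr order \<le> y powr s" by (intro powr_mono) (auto simp: order_def)
   then show ?thesis by linarith
  qed
  have 2: "y powr s \<le> exp s + y powr s * ln_plus y powr (s / 2)"
  proof (cases "y \<le> exp 1")
   case True
   then have "y powr s \<le> exp 1 powr s" using y0 s by (intro powr_mono2) auto
   then have "y powr s \<le> exp s" by (simp add: exp_powr_real)
   then show ?thesis using m by linarith
  next
   case False
   then have "exp 1 \<le> y" by simp
   then have "ln (exp 1) \<le> ln y" by (subst ln_le_cancel_iff) (auto intro: less_le_trans[OF exp_gt_zero])
   then have "1 \<le> ln_plus y" by (simp add: ln_plus_def)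
   then have "1 \<le> ln_plus y powr (s / 2)" using s by (intro ge_one_powr_ge_zero) auto
   then have "y powr s * 1 \<le> y powr s * ln_plus y powr (s / 2)" by (intro mult_left_mono) auto
   then show ?thesis using exp_gt_zero[of s] by linarith
  qed
  have "y powr order \<le> (1 + exp s) + y powr s * ln_plus y powr (s / 2)" using 1 2 by linarith
  then show "norm (\<bar>Z v\<bar> powr order) \<le> norm ((1 + exp s) + \<bar>Z v\<bar> powr s * ln_plus \<bar>Z v\<bar> powr (s / 2))"
   using m unfolding y_def by (simp add: abs_of_nonneg add_nonneg_nonneg)
 qed
qed measurable

lemma taylor_rem_bound:
 assumes \<theta>: "0 \<le> \<theta>" "\<theta> * height n \<le> b" and h: "height n > 0"
 shows "taylor_rem 3 (level n) \<theta> z \<le> (b ^ 3 * exp (2 * b) + (1 + b\<^sup>2)) * (1 / height n) powr order * \<bar>z\<bar> powr order"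
proof -
 define u where "u = \<bar>z\<bar> / height n"
 have u0: "u \<ge> 0" using h by (simp add: u_def)
 have b0: "b \<ge> 0" using \<theta> h by (intro order_trans[OF _ \<theta>(2)]) simp
 have zu: "\<bar>z\<bar> = height n * u" using h by (simp add: u_def)
 have \<theta>z: "\<theta> * \<bar>z\<bar> \<le> b * u" unfolding zu mult.assoc[symmetric] using \<theta>(2) u0 by (rule mult_right_mono)
 have \<theta>z0: "0 \<le> \<theta> * \<bar>z\<bar>" using \<theta> by simp
 have "taylor_rem 3 (level n) \<theta> z \<le> (b ^ 3 * exp (2 * b) + (1 + b\<^sup>2)) * u powr order"
 proof (cases "\<bar>z\<bar> \<le> height n")
  case True
  then have u1: "u \<le> 1" using h by (simp add: u_def)
  have "taylor_rem 3 (level n) \<theta> z = (\<theta> * \<bar>z\<bar>) ^ 3 * exp (2 * (\<theta> * \<bar>z\<bar>))" using True by (simp add: taylor_rem_def level_def mult.assoc)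
  also have "\<dots> \<le> (b * u) ^ 3 * exp (2 * b)"
  proof (rule mult_mono[OF power_mono[OF \<theta>z \<theta>z0]])
   have "b * u \<le> b * 1" by (rule mult_left_mono[OF u1 b0])
   then show "exp (2 * (\<theta> * \<bar>z\<bar>)) \<le> exp (2 * b)" using \<theta>z by simp
  qed (use b0 u0 in auto)
  also have "\<dots> = b ^ 3 * exp (2 * b) * u ^ 3" by (simp add: power_mult_distrib)
  also have "\<dots> \<le> b ^ 3 * exp (2 * b) * u powr order"
  proof (rule mult_left_mono)
   show "u ^ 3 \<le> u powr order"
   proof (cases "u = 0")
    case False
    then have "u ^ 3 = u powr 3" using u0 by simp
    also have "\<dots> \<le> u powr order" using u0 u1 order_bounds by (intro powr_mono') auto
    finally show ?thesis .
   qed simp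
  qed (use b0 in auto)
  also have "\<dots> \<le> (b ^ 3 * exp (2 * b) + (1 + b\<^sup>2)) * u powr order" by (intro mult_right_mono) auto
  finally show ?thesis .
 next
  case False
  then have u1: "u > 1" using h by (simp add: u_def)
  have "taylor_rem 3 (level n) \<theta> z = 1 + (\<theta> * \<bar>z\<bar>)\<^sup>2" using False by (simp add: taylor_rem_def level_def)
  also have "\<dots> \<le> u\<^sup>2 + (b * u)\<^sup>2" using \<theta>z \<theta>z0 u1 by (intro add_mono power_mono) (auto simp: one_le_power)
  also have "\<dots> = (1 + b\<^sup>2) * u\<^sup>2" by (simp add: power_mult_distrib algebra_simps)
  also have "\<dots> \<le> (1 + b\<^sup>2) * u powr order"
  proof (rule mult_left_mono)
   have "u\<^sup>2 = u powr 2" using u1 by simp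
   also have "\<dots> \<le> u powr order" using u1 order_bounds by (intro powr_mono) auto
   finally show "u\<^sup>2 \<le> u powr order" .
  qed simp
  also have "\<dots> \<le> (b ^ 3 * exp (2 * b) + (1 + b\<^sup>2)) * u powr order" using b0 by (intro mult_right_mono) auto
  finally show ?thesis .
 qed
 also have "u powr order = (1 / height n) powr order * \<bar>z\<bar> powr order" unfolding u_def using h by (simp add: powr_divide)
 finally show ?thesis by (simp only: mult.assoc)
qed

lemma taylor_rem_expectation:
 assumes a: "a > 0" and D: "\<forall>\<^sub>F n in sequentially. 0 \<le> D n \<and> D n \<le> c * sqrt (ln (real n))"
 shows "\<forall>\<^sub>F n in sequentially. integrable M (\<lambda>v. taylor_rem 3 (level n) (a * D n / sqrt n) (Z v))"
  and "(\<lambda>n. real n * expectation (\<lambda>v. taylor_rem 3 (level n) (a * D n / sqrt n) (Z v))) \<longlonglongrightarrow> 0"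
proof -
 define b where "b = a * c"
 define K where "K = b ^ 3 * exp (2 * b) + (1 + b\<^sup>2)"
 define m where "m = expectation (\<lambda>v. \<bar>Z v\<bar> powr order)"
 have ev: "\<forall>\<^sub>F n in sequentially. integrable M (\<lambda>v. taylor_rem 3 (level n) (a * D n / sqrt n) (Z v))
   \<and> norm (real n * expectation (\<lambda>v. taylor_rem 3 (level n) (a * D n / sqrt n) (Z v))) \<le> K * m * (real n * (1 / height n) powr order)"
  using D eventually_gt_at_top[of 1] eventually_compose_filterlim[OF eventually_gt_at_top[of 0] height_lim]
 proof eventually_elim
  case (elim n)
  let ?R = "\<lambda>v. taylor_rem 3 (level n) (a * D n / sqrt n) (Z v)"
  have \<theta>0: "0 \<le> a * D n / sqrt n" using a elim(1) by simp
  have l0: "ln (real n) > 0" using elim(2) by simp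
  have "a * D n / sqrt n * height n = a * (D n / sqrt (ln (real n)))"
   unfolding height_def real_sqrt_divide using elim(2) by simp
  also have "\<dots> \<le> b" unfolding b_def using a elim(1) l0 by (intro mult_left_mono) (auto simp: pos_divide_le_eq)
  finally have \<theta>h: "a * D n / sqrt n * height n \<le> b" .
  have le: "?R v \<le> K * (1 / height n) powr order * \<bar>Z v\<bar> powr order" for v
   unfolding K_def by (rule taylor_rem_bound[OF \<theta>0 \<theta>h elim(3)])
  have R0: "0 \<le> ?R v" for v by (rule taylor_rem_nonneg[OF \<theta>0])
  have int: "integrable M ?R"
  proof (rule Bochner_Integration.integrable_bound)
   show "integrable M (\<lambda>v. K * (1 / height n) powr order * \<bar>Z v\<bar> powr order)" by (intro integrable_mult_right order_moment)
   show "?R \<in> borel_measurable M" by (rule measurable_compose[OF Z_meas taylor_rem_measurable[OF level_sets]])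
   show "AE v in M. norm (?R v) \<le> norm (K * (1 / height n) powr order * \<bar>Z v\<bar> powr order)"
    using le R0 by (intro AE_I2) (metis abs_ge_self abs_of_nonneg order_trans real_norm_def)
  qed
  have "expectation ?R \<le> expectation (\<lambda>v. K * (1 / height n) powr order * \<bar>Z v\<bar> powr order)"
   by (intro integral_mono int integrable_mult_right order_moment le)
  also have "\<dots> = K * (1 / height n) powr order * m" by (simp add: m_def)
  finally have "real n * expectation ?R \<le> real n * (K * (1 / height n) powr order * m)" by (rule mult_left_mono) simp
  moreover have "0 \<le> real n * expectation ?R" by (intro mult_nonneg_nonneg integral_nonneg_AE AE_I2 R0) simp
  ultimately show ?case using int by (simp add: mult_ac)
 qed
 show "\<forall>\<^sub>F n in sequentially. integrable M (\<lambda>v. taylor_rem 3 (level n) (a * D n / sqrt n) (Z v))"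
  using ev by eventually_elim blast
 show "(\<lambda>n. real n * expectation (\<lambda>v. taylor_rem 3 (level n) (a * D n / sqrt n) (Z v))) \<longlonglongrightarrow> 0"
 proof (rule Lim_null_comparison)
  show "\<forall>\<^sub>F n in sequentially. norm (real n * expectation (\<lambda>v. taylor_rem 3 (level n) (a * D n / sqrt n) (Z v))) \<le> K * m * (real n * (1 / height n) powr order)"
   using ev by eventually_elim blast
  from tendsto_mult[OF tendsto_const log_level_powr_decay[OF order_bounds(1)], of "K * m"]
  show "(\<lambda>n. K * m * (real n * (1 / height n) powr order)) \<longlonglongrightarrow> 0" by (simp add: height_def)
 qed
qed

end

section \<open>Verification of the conditions\<close>

lemma cube_scaling:
 fixes x :: real
 assumes "n > 0"
 shows "x ^ 3 / sqrt n = real n * (x / sqrt n) ^ 3"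
proof -
 define m where "m = sqrt (real n)"
 have m: "m > 0" using assms by (auto simp: m_def)
 have nm: "real n = m\<^sup>2" by (simp add: m_def)
 have "x ^ 3 / m = m\<^sup>2 * (x / m) ^ 3" using m by (simp add: power_divide power2_eq_square power3_eq_cube)
 then show ?thesis unfolding m_def[symmetric] by (simp only: nm)
qed

context standardized_kernel
begin

definition L :: "nat \<Rightarrow> real" where "L n = ln (ptilde (p n))"

definition D :: "real \<Rightarrow> nat \<Rightarrow> real"
 where "D \<kappa> n = sqrt (2 * L n) - (ln (L n) + ln (4 * pi)) / (2 * sqrt (2 * L n)) + \<kappa> * L n / (3 * sqrt (real n))"

lemma p_ge_2: "\<forall>\<^sub>F n in sequentially. p n \<ge> 2"
 by (rule eventually_compose_filterlim[OF eventually_ge_at_top p_lim])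

lemma ptilde_pos: "m \<ge> 2 \<Longrightarrow> ptilde m > 0"
 by (simp add: ptilde_def)

lemma L_lim: "filterlim L at_top sequentially"
proof -
 have "filterlim (\<lambda>x::real. ln (x * (x - 1) / 2)) at_top at_top" by real_asymp
 from filterlim_compose[OF this filterlim_compose[OF filterlim_real_sequentially p_lim]]
 show ?thesis by (simp add: L_def[abs_def] ptilde_def)
qed

lemma L_pos: "\<forall>\<^sub>F n in sequentially. L n > 0"
 by (rule eventually_compose_filterlim[OF eventually_gt_at_top L_lim])

lemma L_le_ln_p: "\<forall>\<^sub>F n in sequentially. L n \<le> 2 * ln (real (p n))"
 using p_ge_2
proof eventually_elim
 case (elim n)
 define x where "x = real (p n)"
 have x: "x \<ge> 2" using elim by (simp add: x_def)
 have "ptilde (p n) \<le> x\<^sup>2 / 2" using ptilde_bounds(2)[OF elim] by (simp only: x_def)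
 also have "\<dots> \<le> x\<^sup>2" by simp
 finally have "ln (ptilde (p n)) \<le> ln (x\<^sup>2)" using ptilde_pos[OF elim] by (rule ln_mono)
 also have "\<dots> = 2 * ln x" using x by (simp add: ln_realpow)
 finally have "L n \<le> 2 * ln (real (p n))" unfolding L_def x_def .
 then show ?case .
qed

context
 fixes \<kappa> :: real
 assumes correction: "(\<lambda>n. \<kappa> * L n / (3 * sqrt (real n))) \<longlonglongrightarrow> 0"
begin

lemma D_lim: "filterlim (D \<kappa>) at_top sequentially"
 unfolding D_def[abs_def] by (rule centering_asymptotics(1)[OF L_lim correction])

lemma D_square: "\<forall>\<^sub>F n in sequentially. L n \<le> (D \<kappa> n)\<^sup>2 \<and> (D \<kappa> n)\<^sup>2 \<le> 8 * L n"
 unfolding D_def[abs_def] by (rule centering_asymptotics(2)[OF L_lim correction])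

lemma D_pos: "\<forall>\<^sub>F n in sequentially. D \<kappa> n > 0"
 by (rule eventually_compose_filterlim[OF eventually_gt_at_top D_lim])

lemma D_norm:
 "(\<lambda>n. ptilde (p n) * std_normal_density (D \<kappa> n) * exp (\<kappa> * D \<kappa> n ^ 3 / (6 * sqrt n)) / D \<kappa> n) \<longlonglongrightarrow> 1"
proof (rule Lim_transform_eventually)
 show "(\<lambda>n. exp (L n) * std_normal_density (D \<kappa> n) * exp (\<kappa> * L n / (3 * sqrt (real n)) * D \<kappa> n ^ 3 / (2 * L n)) / D \<kappa> n) \<longlonglongrightarrow> 1"
  unfolding D_def[abs_def] by (rule centering_asymptotics(3)[OF L_lim correction])
 show "\<forall>\<^sub>F n in sequentially. exp (L n) * std_normal_density (D \<kappa> n) * exp (\<kappa> * L n / (3 * sqrt (real n)) * D \<kappa> n ^ 3 / (2 * L n)) / D \<kappa> n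
   = ptilde (p n) * std_normal_density (D \<kappa> n) * exp (\<kappa> * D \<kappa> n ^ 3 / (6 * sqrt n)) / D \<kappa> n"
  using L_pos p_ge_2
 proof eventually_elim
  case (elim n)
  have 1: "exp (L n) = ptilde (p n)" using ptilde_pos[OF elim(2)] by (simp add: L_def)
  have 2: "\<kappa> * L n / (3 * sqrt (real n)) * D \<kappa> n ^ 3 / (2 * L n) = \<kappa> * D \<kappa> n ^ 3 / (6 * sqrt n)"
   using elim(1) by simp
  show ?case unfolding 1 2 ..
 qed
qed

lemma p_square_le: "\<forall>\<^sub>F n in sequentially. (real (p n))\<^sup>2 \<le> 4 * exp ((D \<kappa> n)\<^sup>2)"
 using D_square p_ge_2
proof eventually_elim
 case (elim n)
 have "ptilde (p n) = exp (L n)" using ptilde_pos[OF elim(2)] by (simp add: L_def)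
 also have "\<dots> \<le> exp ((D \<kappa> n)\<^sup>2)" using elim(1) by simp
 finally show ?case using ptilde_bounds(1)[OF elim(2)] by simp
qed

lemma D_square_ratio:
 assumes "(\<lambda>n. ln (real (p n)) / g n) \<longlonglongrightarrow> 0" and g: "\<forall>\<^sub>F n in sequentially. g n > 0"
 shows "(\<lambda>n. (D \<kappa> n)\<^sup>2 / g n) \<longlonglongrightarrow> 0"
proof (rule Lim_null_comparison)
 show "(\<lambda>n. 16 * (ln (real (p n)) / g n)) \<longlonglongrightarrow> 0" using tendsto_mult[OF tendsto_const assms(1), of 16] by simp
 show "\<forall>\<^sub>F n in sequentially. norm ((D \<kappa> n)\<^sup>2 / g n) \<le> 16 * (ln (real (p n)) / g n)"
  using D_square L_le_ln_p g
 proof eventually_elim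
  case (elim n)
  have "(D \<kappa> n)\<^sup>2 \<le> 16 * ln (real (p n))" using elim(1,2) by linarith
  then have "(D \<kappa> n)\<^sup>2 / g n \<le> 16 * ln (real (p n)) / g n" using elim(3) by (intro divide_right_mono) auto
  then show ?case using elim(3) by simp
 qed
qed

end

lemma rho_coefficient:
 assumes "0 \<le> \<rho>"
 shows "\<rho> \<le> 1 / 3 \<Longrightarrow> 3 / 4 - 1 / (1 + \<rho>) \<le> 0" "\<rho> < 1 / 3 \<Longrightarrow> 3 / 4 - 1 / (1 + \<rho>) < 0"
 using assms by (simp_all add: field_simps)

text \<open>The exponent \<open>r / (2 - r)\<close> is at most \<open>1/3\<close> if \<open>r \<le> 1/2\<close>, and then \<open>d\<^sup>3 = o(sqrt n)\<close>; it is at most \<open>1/2\<close> if \<open>r \<le> 2/3\<close>, and then \<open>d\<^sup>4 = o(n)\<close>. These are the requirements of expansions of order 3 and 4.\<close>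
theorem gumbel_limit_stretched_exp:
 assumes \<eta>: "\<eta> > 0" and r: "0 < r" "r \<le> 2 / 3"
  and mgf: "integrable M (\<lambda>w. exp (\<eta> * \<bar>Z w\<bar> powr r))"
  and growth: "(\<lambda>n. ln (real (p n))) \<in> o(\<lambda>n. real n powr (r / (2 - r)))"
  and cases: "(r \<le> 1 / 2 \<and> 0 \<le> \<rho> \<and> \<rho> \<le> 1 / 3 \<and> \<kappa> = 0) \<or> (0 \<le> \<rho> \<and> \<rho> < 1 / 3 \<and> \<kappa> = expectation (\<lambda>w. Z w ^ 3))"
 shows "(\<lambda>n. prob {w \<in> space M. \<forall>(i, j)\<in>index_pairs (p n).
   D \<kappa> n * (1 / sqrt (real n) * (\<Sum>l = 1..n. h (X i l w) (X j l w)) - D \<kappa> n) \<le> t}) \<longlonglongrightarrow> exp (- exp (- t))"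
proof -
 define \<gamma> where "\<gamma> = r / (2 - r)"
 have \<gamma>: "0 < \<gamma>" "\<gamma> \<le> 1 / 2" "r \<le> 1 / 2 \<Longrightarrow> \<gamma> \<le> 1 / 3" using r by (simp_all add: \<gamma>_def field_simps)
 have gpos: "\<forall>\<^sub>F n in sequentially. real n powr q > 0" for q
  using eventually_gt_at_top[of 0] by eventually_elim simp
 have lnp: "(\<lambda>n. ln (real (p n)) / real n powr \<gamma>) \<longlonglongrightarrow> 0"
  using smalloD_tendsto[OF growth] by (simp add: \<gamma>_def)
 have lnp': "(\<lambda>n. ln (real (p n)) / real n powr q) \<longlonglongrightarrow> 0" if q: "q \<ge> \<gamma>" for q
 proof (rule Lim_null_comparison[OF _ lnp])
  show "\<forall>\<^sub>F n in sequentially. norm (ln (real (p n)) / real n powr q) \<le> ln (real (p n)) / real n powr \<gamma>"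
   using p_ge_2 eventually_gt_at_top[of 0]
  proof eventually_elim
   case (elim n)
   have "real n powr \<gamma> \<le> real n powr q" using elim(2) q by (intro powr_mono) auto
   moreover have "0 \<le> ln (real (p n))" using elim(1) by simp
   ultimately show ?case using elim(2) by (simp add: frac_le)
  qed
 qed
 have correction: "(\<lambda>n. \<kappa> * L n / (3 * sqrt (real n))) \<longlonglongrightarrow> 0"
 proof (rule Lim_null_comparison)
  show "(\<lambda>n. \<bar>\<kappa>\<bar> * (ln (real (p n)) / real n powr (1 / 2))) \<longlonglongrightarrow> 0"
   using tendsto_mult[OF tendsto_const lnp'[OF \<gamma>(2)], of "\<bar>\<kappa>\<bar>"] by simp
  show "\<forall>\<^sub>F n in sequentially. norm (\<kappa> * L n / (3 * sqrt (real n))) \<le> \<bar>\<kappa>\<bar> * (ln (real (p n)) / real n powr (1 / 2))"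
   using L_pos L_le_ln_p eventually_gt_at_top[of 0]
  proof eventually_elim
   case (elim n)
   have "L n / 3 \<le> ln (real (p n))" using elim(1,2) by linarith
   then have "\<bar>\<kappa>\<bar> * (L n / 3 / sqrt n) \<le> \<bar>\<kappa>\<bar> * (ln (real (p n)) / sqrt n)" by (intro mult_left_mono divide_right_mono) auto
   then show ?case using elim(1) by (simp add: powr_half_sqrt abs_mult)
  qed
 qed
 note Dl = D_lim[OF correction] and Dsq = D_square[OF correction] and Dp = D_pos[OF correction]
 have ratio: "(\<lambda>n. (D \<kappa> n)\<^sup>2 / real n powr q) \<longlonglongrightarrow> 0" if "q \<ge> \<gamma>" for q
  by (rule D_square_ratio[OF correction lnp'[OF that] gpos])
 have D_small: "(\<lambda>n. D \<kappa> n / sqrt n) \<longlonglongrightarrow> 0"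
 proof (rule Lim_transform_eventually)
  show "(\<lambda>n. sqrt ((D \<kappa> n)\<^sup>2 / real n powr 1)) \<longlonglongrightarrow> 0" using tendsto_real_sqrt[OF ratio[of 1]] \<gamma> by simp
  show "\<forall>\<^sub>F n in sequentially. sqrt ((D \<kappa> n)\<^sup>2 / real n powr 1) = D \<kappa> n / sqrt n"
   using Dp by eventually_elim (simp add: real_sqrt_divide)
 qed
 have scale: "(\<lambda>n. D \<kappa> n powr (2 - r) * real n powr (- (r / 2))) \<longlonglongrightarrow> 0"
 proof (rule Lim_transform_eventually)
  show "(\<lambda>n. ((D \<kappa> n)\<^sup>2 / real n powr \<gamma>) powr ((2 - r) / 2)) \<longlonglongrightarrow> 0"
   by (rule tendsto_zero_powrI[OF ratio[OF order_refl] tendsto_const]) (use r in auto)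
  show "\<forall>\<^sub>F n in sequentially. ((D \<kappa> n)\<^sup>2 / real n powr \<gamma>) powr ((2 - r) / 2) = D \<kappa> n powr (2 - r) * real n powr (- (r / 2))"
   using Dp eventually_gt_at_top[of 0]
  proof eventually_elim
   case (elim n)
   have e: "\<gamma> * ((2 - r) / 2) = r / 2" using r by (simp add: \<gamma>_def)
   have e2: "2 * ((2 - r) / 2) = 2 - r" by simp
   have num: "((D \<kappa> n)\<^sup>2) powr ((2 - r) / 2) = D \<kappa> n powr (2 - r)"
    using powr_powr[of "D \<kappa> n" 2 "(2 - r) / 2"] elim(1) unfolding e2 by simp
   have den: "(real n powr \<gamma>) powr ((2 - r) / 2) = real n powr (r / 2)" unfolding powr_powr e ..
   have "((D \<kappa> n)\<^sup>2 / real n powr \<gamma>) powr ((2 - r) / 2) = D \<kappa> n powr (2 - r) / real n powr (r / 2)"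
    unfolding num[symmetric] den[symmetric] by (rule powr_divide)
   also have "\<dots> = D \<kappa> n powr (2 - r) * real n powr (- (r / 2))"
    unfolding powr_minus by (rule divide_inverse)
   finally show ?case .
  qed
 qed
 interpret st: stretched_exp_moment M Z \<eta> r "D \<kappa>"
  using Z_measurable \<eta> r mgf Dl D_small scale by unfold_locales auto
 let ?R = "\<lambda>q a n v. taylor_rem q (st.level n) (a * D \<kappa> n / sqrt n) (Z v)"
 let ?E = "\<lambda>q a n. expectation (?R q a n)" and ?I = "\<lambda>q a n. integrable M (?R q a n)"
 have union: "(\<lambda>n. (real (p n))\<^sup>2 * real n * prob {w \<in> space M. Z w \<notin> st.level n}) \<longlonglongrightarrow> 0"
  by (rule st.union_bound_limit[OF p_square_le[OF correction]])
 obtain k :: nat where k: "(k = 3 \<and> \<kappa> = 0 \<and> r \<le> 1 / 2 \<and> \<rho> \<le> 1 / 3) \<or> (k = 4 \<and> \<kappa> = expectation (\<lambda>w. Z w ^ 3) \<and> \<rho> < 1 / 3)"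
  using cases by blast
 have moments: "integrable M (\<lambda>w. Z w ^ j)" if "j < k" for j
 proof -
  obtain C where C: "C \<ge> 0" "\<And>z::real. \<bar>z\<bar> ^ j \<le> C * exp (\<eta> * \<bar>z\<bar> powr r)" using power_le_stretched_exp[OF \<eta> r(1), of j] by blast
  show ?thesis
  proof (rule Bochner_Integration.integrable_bound)
   show "integrable M (\<lambda>w. C * exp (\<eta> * \<bar>Z w\<bar> powr r))" by (intro integrable_mult_right mgf)
   show "(\<lambda>w. Z w ^ j) \<in> borel_measurable M" using Z_measurable by measurable
   show "AE w in M. norm (Z w ^ j) \<le> norm (C * exp (\<eta> * \<bar>Z w\<bar> powr r))"
    using C by (intro AE_I2) (simp add: power_abs abs_mult)
  qed
 qed
 have rho: "0 \<le> \<rho>" "\<rho> \<le> 1 / 3" using cases by auto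
 have D_pow: "(\<lambda>n. real n * (D \<kappa> n / sqrt n) ^ k) \<longlonglongrightarrow> 0"
 proof (cases "k = 3")
  case True
  then have r': "1 / 3 \<ge> \<gamma>" using k \<gamma> by auto
  show ?thesis
  proof (rule Lim_transform_eventually)
   show "(\<lambda>n. sqrt (((D \<kappa> n)\<^sup>2 / real n powr (1 / 3)) ^ 3)) \<longlonglongrightarrow> 0"
    using tendsto_real_sqrt[OF tendsto_power[OF ratio[OF r'], of 3]] by simp
   show "\<forall>\<^sub>F n in sequentially. sqrt (((D \<kappa> n)\<^sup>2 / real n powr (1 / 3)) ^ 3) = real n * (D \<kappa> n / sqrt n) ^ k"
    using Dp eventually_gt_at_top[of 0]
   proof eventually_elim
    case (elim n)
    define y where "y = D \<kappa> n"
    define m where "m = sqrt (real n)"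
    have m: "m > 0" and y: "y > 0" using elim by (auto simp: m_def y_def)
    have nm: "m\<^sup>2 = real n" by (simp add: m_def)
    have "(real n powr (1 / 3)) ^ 3 = (real n powr (1 / 3)) powr 3" using elim(2) by simp
    also have "\<dots> = real n powr 1" unfolding powr_powr by simp
    also have "\<dots> = m\<^sup>2" by (simp add: m_def)
    finally have "((y\<^sup>2) / real n powr (1 / 3)) ^ 3 = (y\<^sup>2) ^ 3 / m\<^sup>2" by (simp only: power_divide)
    also have "\<dots> = (y ^ 3 / m)\<^sup>2" by (simp only: power_divide power_mult[symmetric] mult.commute[of 2])
    finally have "sqrt ((y\<^sup>2 / real n powr (1 / 3)) ^ 3) = y ^ 3 / m" using m y by simp
    also have "\<dots> = m\<^sup>2 * (y / m) ^ 3" using m by (simp add: power_divide power2_eq_square power3_eq_cube)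
    finally have "sqrt ((y\<^sup>2 / real n powr (1 / 3)) ^ 3) = real n * (y / m) ^ 3" unfolding nm .
    then show ?case by (simp only: True y_def m_def)
   qed
  qed
 next
  case False
  then have k4: "k = 4" using k by auto
  show ?thesis
  proof (rule Lim_transform_eventually)
   show "(\<lambda>n. ((D \<kappa> n)\<^sup>2 / real n powr (1 / 2))\<^sup>2) \<longlonglongrightarrow> 0"
    using tendsto_power[OF ratio[OF \<gamma>(2)], of 2] by simp
   show "\<forall>\<^sub>F n in sequentially. ((D \<kappa> n)\<^sup>2 / real n powr (1 / 2))\<^sup>2 = real n * (D \<kappa> n / sqrt n) ^ k"
    using eventually_gt_at_top[of 0]
   proof eventually_elim
    case (elim n)
    define y where "y = D \<kappa> n"
    define m where "m = sqrt (real n)"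
    have m: "m > 0" using elim by (auto simp: m_def)
    have nm: "m\<^sup>2 = real n" by (simp add: m_def)
    have "real n powr (1 / 2) = m" using elim by (simp add: m_def powr_half_sqrt)
    moreover have "(y\<^sup>2 / m)\<^sup>2 = m\<^sup>2 * (y / m) ^ 4" using m by (simp add: power_divide power2_eq_square power4_eq_xxxx)
    ultimately have "(y\<^sup>2 / real n powr (1 / 2))\<^sup>2 = real n * (y / m) ^ 4" by (simp only: nm)
    then show ?case by (simp only: k4 y_def m_def)
   qed
  qed
 qed
 have rem_lim: "(\<lambda>n. real n * ?E k a n) \<longlonglongrightarrow> 0" if a: "a > 0" for a
 proof -
  obtain C where ev: "\<forall>\<^sub>F n in sequentially. ?I k a n
   \<and> real n * ?E k a n \<le> C * (real n * (D \<kappa> n / sqrt n) ^ k + st.tail_error n)"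
   using st.taylor_rem_expectation[OF a, of k] by blast
  show ?thesis
  proof (rule Lim_null_comparison)
   have "(\<lambda>n. C * (real n * (D \<kappa> n / sqrt n) ^ k + st.tail_error n)) \<longlonglongrightarrow> C * (0 + 0)"
    by (intro tendsto_intros D_pow st.tail_error_lim)
   then show "(\<lambda>n. C * (real n * (D \<kappa> n / sqrt n) ^ k + st.tail_error n)) \<longlonglongrightarrow> 0" by simp
   show "\<forall>\<^sub>F n in sequentially. norm (real n * ?E k a n)
     \<le> C * (real n * (D \<kappa> n / sqrt n) ^ k + st.tail_error n)"
    using ev Dp
   proof eventually_elim
    case (elim n)
    have "0 \<le> real n * ?E k a n"
     using a elim(2) by (intro mult_nonneg_nonneg integral_nonneg_AE AE_I2 taylor_rem_nonneg) auto
    then show ?case using elim(1) by (simp only: real_norm_def abs_of_nonneg)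
   qed
  qed
 qed
 have rem_int: "\<forall>\<^sub>F n in sequentially. ?I q a n" if a: "a > 0" for a q
 proof -
  obtain C where "\<forall>\<^sub>F n in sequentially. ?I q a n
   \<and> real n * ?E q a n \<le> C * (real n * (D \<kappa> n / sqrt n) ^ q + st.tail_error n)"
   using st.taylor_rem_expectation[OF a, of q] by blast
  then show ?thesis by eventually_elim blast
 qed
 have joint: "\<exists>C. \<forall>\<^sub>F n in sequentially. (3 / 4 - 1 / (1 + \<rho>)) * (D \<kappa> n)\<^sup>2
    + c * (real n * ?E 3 2 n + D \<kappa> n ^ 3 / sqrt n) \<le> C" if c: "c > 0" for c
 proof -
  obtain C where C: "C \<ge> 0" and ev: "\<forall>\<^sub>F n in sequentially. ?I 3 2 n
   \<and> real n * ?E 3 2 n \<le> C * (real n * (D \<kappa> n / sqrt n) ^ 3 + st.tail_error n)"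
   using st.taylor_rem_expectation[of 2 3] by auto
  have te: "\<forall>\<^sub>F n in sequentially. st.tail_error n < 1" using st.tail_error_lim by (rule order_tendstoD(2)) simp
  define \<beta> where "\<beta> = 3 / 4 - 1 / (1 + \<rho>)"
  have main: "\<forall>\<^sub>F n in sequentially. \<beta> * (D \<kappa> n)\<^sup>2 + c * ((C + 1) * (D \<kappa> n ^ 3 / sqrt n)) \<le> 1"
  proof (cases "k = 3")
   case True
   have "(\<lambda>n. c * ((C + 1) * (real n * (D \<kappa> n / sqrt n) ^ 3))) \<longlonglongrightarrow> c * ((C + 1) * 0)"
    using D_pow unfolding True by (intro tendsto_mult tendsto_const)
   then have "\<forall>\<^sub>F n in sequentially. c * ((C + 1) * (real n * (D \<kappa> n / sqrt n) ^ 3)) < 1" by (rule order_tendstoD(2)) simp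
   then show ?thesis using eventually_gt_at_top[of 0]
   proof eventually_elim
    case (elim n)
    have "\<beta> * (D \<kappa> n)\<^sup>2 \<le> 0" using rho_coefficient(1)[OF rho] by (simp add: \<beta>_def mult_nonpos_nonneg)
    then show ?case using elim(1) unfolding cube_scaling[OF elim(2)] by linarith
   qed
  next
   case False
   then have \<beta>0: "\<beta> < 0" using k rho_coefficient(2)[OF rho(1)] by (auto simp: \<beta>_def)
   have "(\<lambda>n. c * ((C + 1) * (D \<kappa> n / sqrt n))) \<longlonglongrightarrow> c * ((C + 1) * 0)" by (intro tendsto_mult tendsto_const D_small)
   then have "\<forall>\<^sub>F n in sequentially. c * ((C + 1) * (D \<kappa> n / sqrt n)) < - \<beta>" using \<beta>0 by (intro order_tendstoD(2)) auto
   then show ?thesis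
   proof eventually_elim
    case (elim n)
    have "(\<beta> + c * ((C + 1) * (D \<kappa> n / sqrt n))) * (D \<kappa> n)\<^sup>2 \<le> 0" using elim by (intro mult_nonpos_nonneg) auto
    moreover have "(\<beta> + c * ((C + 1) * (D \<kappa> n / sqrt n))) * (D \<kappa> n)\<^sup>2 = \<beta> * (D \<kappa> n)\<^sup>2 + c * ((C + 1) * (D \<kappa> n ^ 3 / sqrt n))"
    proof -
     have cb: "D \<kappa> n ^ 3 / sqrt n = D \<kappa> n / sqrt n * (D \<kappa> n)\<^sup>2" by (simp add: power2_eq_square power3_eq_cube)
     show ?thesis unfolding cb by (simp only: distrib_right mult.assoc)
    qed
    ultimately show ?case by linarith
   qed
  qed
  have "\<forall>\<^sub>F n in sequentially. \<beta> * (D \<kappa> n)\<^sup>2 + c * (real n * ?E 3 2 n + D \<kappa> n ^ 3 / sqrt n) \<le> 1 + c * C"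
   using main ev te eventually_gt_at_top[of 0]
  proof eventually_elim
   case (elim n)
   define E where "E = real n * ?E 3 2 n"
   define x where "x = D \<kappa> n ^ 3 / sqrt n"
   have "E \<le> C * (x + st.tail_error n)" using elim(2) by (simp only: E_def x_def cube_scaling[OF elim(4)])
   also have "\<dots> \<le> C * (x + 1)" using C elim(3) by (intro mult_left_mono) auto
   finally have "c * (E + x) \<le> c * (C * (x + 1) + x)" using c by (intro mult_left_mono) auto
   also have "\<dots> = c * ((C + 1) * x) + c * C" by (simp add: algebra_simps)
   finally have "\<beta> * (D \<kappa> n)\<^sup>2 + c * (E + x) \<le> (\<beta> * (D \<kappa> n)\<^sup>2 + c * ((C + 1) * x)) + c * C" by linarith
   also have "\<dots> \<le> 1 + c * C" using elim(1) unfolding x_def by (rule add_right_mono)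
   finally show ?case by (simp only: E_def x_def)
  qed
  then show ?thesis unfolding \<beta>_def by blast
 qed
 have kc: "(k = 3 \<and> \<kappa> = 0) \<or> (k = 4 \<and> \<kappa> = expectation (\<lambda>w. Z w ^ 3))" using k by blast
 have rem3: "\<forall>\<^sub>F n in sequentially. ?I 3 2 n"
  by (rule rem_int) simp
 have rho1: "\<rho> < 1" using rho by simp
 interpret tk: truncated_kernel M X h p \<rho> Z "D \<kappa>" st.level k \<kappa>
  by unfold_locales (fact Dl st.level_sets
   D_small union kc moments rem_int rem_lim D_pow
   D_norm[OF correction] rem3 joint rho1)+
 show ?thesis using tk.gumbel_limit[of t] unfolding tk.T_def .
qed

lemma log_ratio_limits: "(\<lambda>n. sqrt (ln (real n)) / sqrt (real n)) \<longlonglongrightarrow> 0"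
  "(\<lambda>n. real n * (sqrt (ln (real n)) / sqrt (real n)) ^ 3) \<longlonglongrightarrow> 0"
 by real_asymp+

text \<open>Here \<open>p\<close> is polynomial in \<open>n\<close> and \<open>d\<close> of order \<open>sqrt (ln n)\<close>, so that the product of the scale \<open>d / sqrt n\<close> and the level \<open>sqrt (n / ln n)\<close> stays bounded.\<close>
theorem gumbel_limit_log_moment:
 assumes s: "s > 2" and moment: "integrable M (\<lambda>w. \<bar>Z w\<bar> powr s * ln_plus \<bar>Z w\<bar> powr (s / 2))"
  and rho: "0 \<le> \<rho>" "\<rho> \<le> 1 / 3"
  and growth: "(\<lambda>n. real (p n)) \<in> O(\<lambda>n. real n powr ((s - 2) / 4))"
 shows "(\<lambda>n. prob {w \<in> space M. \<forall>(i, j)\<in>index_pairs (p n).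
   D 0 n * (1 / sqrt (real n) * (\<Sum>l = 1..n. h (X i l w) (X j l w)) - D 0 n) \<le> t}) \<longlonglongrightarrow> exp (- exp (- t))"
proof -
 interpret lm: log_moment M Z s using Z_measurable s moment by unfold_locales auto
 define q where "q = (s - 2) / 4"
 have q0: "q > 0" using s by (simp add: q_def)
 obtain C where C: "C > 0" and pC: "\<forall>\<^sub>F n in sequentially. norm (real (p n)) \<le> C * norm (real n powr q)"
  using landau_o.bigE[OF growth] unfolding q_def by blast
 have correction: "(\<lambda>n. 0 * L n / (3 * sqrt (real n))) \<longlonglongrightarrow> 0" by simp
 note Dl = D_lim[OF correction] and Dsq = D_square[OF correction] and Dp = D_pos[OF correction]
 define c0 where "c0 = \<bar>ln C\<bar> + q"
 define c where "c = sqrt (16 * c0)"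
 have c0: "c0 \<ge> 0" using q0 by (simp add: c0_def)
 have ln1: "\<forall>\<^sub>F n in sequentially. ln (real n) \<ge> 1"
  by (rule eventually_compose_filterlim[OF eventually_ge_at_top filterlim_compose[OF ln_at_top filterlim_real_sequentially]])
 have Dc: "\<forall>\<^sub>F n in sequentially. 0 \<le> D 0 n \<and> D 0 n \<le> c * sqrt (ln (real n))"
  using Dp Dsq L_le_ln_p pC p_ge_2 ln1 eventually_gt_at_top[of 0]
 proof eventually_elim
  case (elim n)
  have "real (p n) \<le> C * real n powr q" using elim(4) by simp
  then have "ln (real (p n)) \<le> ln (C * real n powr q)" using elim(5) by (intro ln_mono) auto
  also have "\<dots> = ln C + q * ln (real n)" using C elim(7) by (simp add: ln_mult ln_powr)
  also have "\<dots> \<le> \<bar>ln C\<bar> * ln (real n) + q * ln (real n)"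
  proof -
   have "\<bar>ln C\<bar> * 1 \<le> \<bar>ln C\<bar> * ln (real n)" using elim(6) by (intro mult_left_mono) auto
   then show ?thesis by linarith
  qed
  also have "\<dots> = c0 * ln (real n)" by (simp add: c0_def distrib_right)
  finally have "(D 0 n)\<^sup>2 \<le> 16 * c0 * ln (real n)" using elim(2,3) by linarith
  then have "sqrt ((D 0 n)\<^sup>2) \<le> sqrt (16 * c0 * ln (real n))" by (rule real_sqrt_le_mono)
  then show ?case using elim(1) by (simp add: c_def real_sqrt_mult)
 qed
 have quot: "\<forall>\<^sub>F n in sequentially. 0 \<le> D 0 n / sqrt n \<and> D 0 n / sqrt n \<le> c * (sqrt (ln (real n)) / sqrt n)"
  using Dc
 proof eventually_elim
  case (elim n)
  then show ?case using divide_right_mono[of "D 0 n" "c * sqrt (ln (real n))" "sqrt n"] by simp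
 qed
 have D_small: "(\<lambda>n. D 0 n / sqrt n) \<longlonglongrightarrow> 0"
 proof (rule tendsto_sandwich[OF _ _ tendsto_const])
  show "(\<lambda>n. c * (sqrt (ln (real n)) / sqrt n)) \<longlonglongrightarrow> 0" using tendsto_mult[OF tendsto_const log_ratio_limits(1), of c] by simp
 qed (use quot in \<open>eventually_elim, simp\<close>)+
 have D_pow: "(\<lambda>n. real n * (D 0 n / sqrt n) ^ 3) \<longlonglongrightarrow> 0"
 proof (rule tendsto_sandwich[OF _ _ tendsto_const])
  show "(\<lambda>n. c ^ 3 * (real n * (sqrt (ln (real n)) / sqrt n) ^ 3)) \<longlonglongrightarrow> 0" using tendsto_mult[OF tendsto_const log_ratio_limits(2), of "c ^ 3"] by simp
  show "\<forall>\<^sub>F n in sequentially. 0 \<le> real n * (D 0 n / sqrt n) ^ 3" using quot by eventually_elim simp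
  show "\<forall>\<^sub>F n in sequentially. real n * (D 0 n / sqrt n) ^ 3 \<le> c ^ 3 * (real n * (sqrt (ln (real n)) / sqrt n) ^ 3)"
   using quot
  proof eventually_elim
   case (elim n)
   then have "(D 0 n / sqrt n) ^ 3 \<le> (c * (sqrt (ln (real n)) / sqrt n)) ^ 3" by (intro power_mono) auto
   then have "real n * (D 0 n / sqrt n) ^ 3 \<le> real n * (c * (sqrt (ln (real n)) / sqrt n)) ^ 3" by (rule mult_left_mono) simp
   also have "\<dots> = c ^ 3 * (real n * (sqrt (ln (real n)) / sqrt n) ^ 3)" unfolding power_mult_distrib by (rule mult.left_commute)
   finally show ?case .
  qed
 qed
 have union: "(\<lambda>n. (real (p n))\<^sup>2 * real n * prob {w \<in> space M. Z w \<notin> lm.level n}) \<longlonglongrightarrow> 0"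
 proof (rule Lim_null_comparison)
  show "(\<lambda>n. C\<^sup>2 * (real n powr (s / 2) * prob {w \<in> space M. Z w \<notin> lm.level n})) \<longlonglongrightarrow> 0"
   using tendsto_mult[OF tendsto_const lm.tail_prob_limit, of "C\<^sup>2"] by simp
  show "\<forall>\<^sub>F n in sequentially. norm ((real (p n))\<^sup>2 * real n * prob {w \<in> space M. Z w \<notin> lm.level n})
    \<le> C\<^sup>2 * (real n powr (s / 2) * prob {w \<in> space M. Z w \<notin> lm.level n})"
   using pC eventually_gt_at_top[of 0]
  proof eventually_elim
   case (elim n)
   have e: "q + q + 1 = s / 2" by (simp add: q_def field_simps)
   have "real n powr q * real n powr q * real n = real n powr q * real n powr q * real n powr 1" using elim(2) by simp
   also have "\<dots> = real n powr (s / 2)" by (simp only: powr_add[symmetric] e)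
   finally have n: "(real n powr q)\<^sup>2 * real n = real n powr (s / 2)" by (simp only: power2_eq_square)
   have "(real (p n))\<^sup>2 \<le> (C * real n powr q)\<^sup>2" using elim(1) by (intro power_mono) auto
   then have "(real (p n))\<^sup>2 * real n * prob {w \<in> space M. Z w \<notin> lm.level n} \<le> (C * real n powr q)\<^sup>2 * real n * prob {w \<in> space M. Z w \<notin> lm.level n}"
    by (intro mult_right_mono) auto
   also have "\<dots> = C\<^sup>2 * (((real n powr q)\<^sup>2 * real n) * prob {w \<in> space M. Z w \<notin> lm.level n})"
    by (simp only: power_mult_distrib mult.assoc)
   finally show ?case unfolding n by simp
  qed
 qed
 note rem_int = lm.taylor_rem_expectation(1)[OF _ Dc] and rem_lim = lm.taylor_rem_expectation(2)[OF _ Dc]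
 have two: "(0::real) < 2" by simp
 have joint: "\<exists>K. \<forall>\<^sub>F n in sequentially. (3 / 4 - 1 / (1 + \<rho>)) * (D 0 n)\<^sup>2
    + c * (real n * expectation (\<lambda>w. taylor_rem 3 (lm.level n) (2 * D 0 n / sqrt n) (Z w)) + D 0 n ^ 3 / sqrt n) \<le> K" if c: "c > 0" for c
 proof -
  have "(\<lambda>n. c * (real n * expectation (\<lambda>w. taylor_rem 3 (lm.level n) (2 * D 0 n / sqrt n) (Z w)) + real n * (D 0 n / sqrt n) ^ 3)) \<longlonglongrightarrow> c * (0 + 0)"
   by (intro tendsto_intros rem_lim[OF two] D_pow)
  then have "\<forall>\<^sub>F n in sequentially. c * (real n * expectation (\<lambda>w. taylor_rem 3 (lm.level n) (2 * D 0 n / sqrt n) (Z w)) + real n * (D 0 n / sqrt n) ^ 3) < 1"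
   by (rule order_tendstoD(2)) simp
  then have "\<forall>\<^sub>F n in sequentially. (3 / 4 - 1 / (1 + \<rho>)) * (D 0 n)\<^sup>2
    + c * (real n * expectation (\<lambda>w. taylor_rem 3 (lm.level n) (2 * D 0 n / sqrt n) (Z w)) + D 0 n ^ 3 / sqrt n) \<le> 1"
   using eventually_gt_at_top[of 0]
  proof eventually_elim
   case (elim n)
   have "(3 / 4 - 1 / (1 + \<rho>)) * (D 0 n)\<^sup>2 \<le> 0" using rho_coefficient(1)[OF rho] by (intro mult_nonpos_nonneg) auto
   then show ?case using elim(1) unfolding cube_scaling[OF elim(2)] by linarith
  qed
  then show ?thesis by blast
 qed
 have moments: "integrable M (\<lambda>w. Z w ^ j)" if "j < 3" for j
 proof -
  have "j = 0 \<or> j = 1 \<or> j = 2" using that by auto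
  then show ?thesis using Z_int2 square_integrable_imp_integrable[OF Z_measurable Z_int2] by auto
 qed
 have kc: "((3::nat) = 3 \<and> (0::real) = 0) \<or> ((3::nat) = 4 \<and> (0::real) = expectation (\<lambda>w. Z w ^ 3))" by simp
 have rho1: "\<rho> < 1" using rho by simp
 interpret tk: truncated_kernel M X h p \<rho> Z "D 0" lm.level 3 0
  by unfold_locales (fact Dl lm.level_sets
   D_small union kc moments rem_int rem_lim D_pow
   D_norm[OF correction] rem_int[OF two] joint rho1)+
 show ?thesis using tk.gumbel_limit[of t] unfolding tk.T_def .
qed

end

section \<open>The limit theorem\<close>

lemma weak_conv_m_gumbel_of_cdf:
  assumes "\<And>t. (\<lambda>n. cdf (F n) t) \<longlonglongrightarrow> exp (- exp (- t))"
  shows "weak_conv_m F gumbel"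
  unfolding weak_conv_m_def weak_conv_def cdf_gumbel using assms by blast

lemma (in prob_space) cdf_Max:
  assumes "finite S" "S \<noteq> {}" "\<And>q. q \<in> S \<Longrightarrow> V q \<in> borel_measurable M"
  shows "cdf (distr M borel (\<lambda>w. MAX q\<in>S. V q w)) t = prob {w \<in> space M. \<forall>q\<in>S. V q w \<le> t}"
proof -
  have le: "(MAX q\<in>S. V q w) \<le> u \<longleftrightarrow> (\<forall>q\<in>S. V q w \<le> u)" for w u
    using assms(1,2) by (subst Max_le_iff) auto
  have "(\<lambda>w. MAX q\<in>S. V q w) \<in> borel_measurable M"
  proof (rule borel_measurableI_le)
    fix u
    have "{w \<in> space M. V q w \<le> u} \<in> events" if "q \<in> S" for q using assms(3)[OF that] by measurable
    then have "{w \<in> space M. \<forall>q\<in>S. V q w \<le> u} \<in> events" by (intro sets.sets_Collect_finite_All assms(1))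
    then show "{w \<in> space M. (MAX q\<in>S. V q w) \<le> u} \<in> events" unfolding le .
  qed
  then have "cdf (distr M borel (\<lambda>w. MAX q\<in>S. V q w)) t = prob ((\<lambda>w. MAX q\<in>S. V q w) -` {..t} \<inter> space M)"
    unfolding cdf_def by (subst measure_distr) auto
  also have "(\<lambda>w. MAX q\<in>S. V q w) -` {..t} \<inter> space M = {w \<in> space M. \<forall>q\<in>S. V q w \<le> t}"
    using le by blast
  finally show ?thesis .
qed

lemma (in prob_space) bounded_imp_exp_moment:
  fixes Z :: "'a \<Rightarrow> real"
  assumes [measurable]: "Z \<in> borel_measurable M" and K: "prob {w \<in> space M. \<bar>Z w\<bar> \<le> K} = 1"
  shows "integrable M (\<lambda>w. exp (1 * \<bar>Z w\<bar> powr (1 / 2)))"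
proof (rule integrable_const_bound)
  have "AE w in M. \<bar>Z w\<bar> \<le> K" using K by (subst (asm) prob_Collect_eq_1) measurable
  then show "AE w in M. norm (exp (1 * \<bar>Z w\<bar> powr (1 / 2))) \<le> exp (K powr (1 / 2))"
  proof eventually_elim
    case (elim w)
    then have "\<bar>Z w\<bar> powr (1 / 2) \<le> K powr (1 / 2)" by (intro powr_mono2) auto
    then show ?case by simp
  qed
qed measurable

lemma (in prob_space) exp_moment_mono:
  fixes Z :: "'a \<Rightarrow> real"
  assumes [measurable]: "Z \<in> borel_measurable M" and \<eta>: "\<eta> > 0" and qr: "0 < q" "q \<le> r"
    and int: "integrable M (\<lambda>w. exp (\<eta> * \<bar>Z w\<bar> powr r))"
  shows "integrable M (\<lambda>w. exp (\<eta> * \<bar>Z w\<bar> powr q))"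
proof (rule Bochner_Integration.integrable_bound)
  show "integrable M (\<lambda>w. exp \<eta> * exp (\<eta> * \<bar>Z w\<bar> powr r))" by (intro integrable_mult_right int)
  show "AE w in M. norm (exp (\<eta> * \<bar>Z w\<bar> powr q)) \<le> norm (exp \<eta> * exp (\<eta> * \<bar>Z w\<bar> powr r))"
  proof (rule AE_I2)
    fix w
    define y where "y = \<bar>Z w\<bar>"
    have "y powr q \<le> 1 + y powr r"
    proof (cases "y \<le> 1")
      case True
      then have "y powr q \<le> 1 powr q" using qr by (intro powr_mono2) (auto simp: y_def)
      then have "y powr q \<le> 1" by simp
      then show ?thesis using powr_ge_zero[of y r] by linarith
    next
      case False
      then have "y powr q \<le> y powr r" using qr by (intro powr_mono) auto
      then show ?thesis by linarith
    qed
    then have "\<eta> * y powr q \<le> \<eta> * (1 + y powr r)" using \<eta> by (intro mult_left_mono) auto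
    then have "exp (\<eta> * y powr q) \<le> exp \<eta> * exp (\<eta> * y powr r)" unfolding exp_add[symmetric] by (simp add: distrib_left)
    then show "norm (exp (\<eta> * \<bar>Z w\<bar> powr q)) \<le> norm (exp \<eta> * exp (\<eta> * \<bar>Z w\<bar> powr r))" by (simp add: y_def)
  qed
qed measurable

lemma powr_smallo_mono:
  assumes "f \<in> o(\<lambda>n. real n powr a)" "a \<le> b"
  shows "f \<in> o(\<lambda>n. real n powr b)"
proof (rule landau_o.small_big_trans[OF assms(1)])
  show "(\<lambda>n. real n powr a) \<in> O(\<lambda>n. real n powr b)"
  proof (rule landau_o.bigI[of 1])
    show "\<forall>\<^sub>F n in sequentially. norm (real n powr a) \<le> 1 * norm (real n powr b)"
      using eventually_gt_at_top[of 0] by eventually_elim (use assms(2) in \<open>auto intro: powr_mono\<close>)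
  qed simp
qed

theorem theorem2p4:
  fixes M :: "'a measure"
    and X :: "nat \<Rightarrow> nat \<Rightarrow> 'a \<Rightarrow> real"
    and f :: "real \<Rightarrow> real \<Rightarrow> real"
    and Z :: "'a \<Rightarrow> real"
    and \<rho> :: real
    and p :: "nat \<Rightarrow> nat"
    and d :: "nat \<Rightarrow> real"
  assumes "prob_space M"
    and X_indep: "prob_space.indep_vars M (\<lambda>_. borel) (\<lambda>(i, t). X i t) ({1..} \<times> {1..})"
    and X_ident: "\<And>i t. i \<ge> 1 \<Longrightarrow> t \<ge> 1 \<Longrightarrow> distr M borel (X i t) = distr M borel (X 1 1)"
    and f_meas: "(\<lambda>(x, y). f x y) \<in> borel_measurable (borel \<Otimes>\<^sub>M borel)"
    and f_sym: "\<And>x y. f x y = f y x"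
    and f_mean: "integrable M (\<lambda>\<omega>. f (X 1 1 \<omega>) (X 2 1 \<omega>))"
    and f_var_finite: "integrable M (\<lambda>\<omega>. (f (X 1 1 \<omega>) (X 2 1 \<omega>)
          - prob_space.expectation M (\<lambda>\<omega>. f (X 1 1 \<omega>) (X 2 1 \<omega>)))\<^sup>2)"
    and f_var_pos: "0 < prob_space.variance M (\<lambda>\<omega>. f (X 1 1 \<omega>) (X 2 1 \<omega>))"
    and Z_meas: "Z \<in> borel_measurable M"
    and Z_distr: "distr M borel Z = distr M borel (Zn M X f 1 2 1)"
    and rho: "\<rho> = prob_space.expectation M (\<lambda>\<omega>. Zn M X f 1 2 1 \<omega> * Zn M X f 1 3 1 \<omega>)"
    and p_lim: "filterlim p at_top sequentially"
    and cond: "(\<exists>s. cond_C1 M Z \<rho> p s) \<or> (\<exists>\<eta> r. cond_C2 M Z \<rho> p \<eta> r) \<or>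
               (\<exists>\<eta> r. cond_C3 M Z \<rho> p \<eta> r) \<or> (\<exists>K. cond_C4 M Z \<rho> p K)"
    and d: "\<And>n. d n = (if \<exists>\<eta> r. r > 1/2 \<and> cond_C2 M Z \<rho> p \<eta> r
                      then dy (p n) n (prob_space.expectation M (\<lambda>\<omega>. Z \<omega> ^ 3))
                      else d1 (p n))"
  shows "weak_conv_m
    (\<lambda>n. distr M borel
       (\<lambda>\<omega>. MAX (i, j) \<in> {(i, j). 1 \<le> i \<and> i < j \<and> j \<le> p n}. d n * (Tn M X f n i j \<omega> - d n)))
    gumbel"
proof -
  interpret iid_array M X by (intro iid_array.intro iid_array_axioms.intro assms(1) X_indep X_ident)
  define \<mu> where "\<mu> = expectation (\<lambda>w. f (X 1 1 w) (X 2 1 w))"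
  define \<sigma> where "\<sigma> = sqrt (variance (\<lambda>w. f (X 1 1 w) (X 2 1 w)))"
  define h where "h x y = (f x y - \<mu>) / \<sigma>" for x y
  have \<sigma>: "\<sigma> > 0" "\<sigma>\<^sup>2 = expectation (\<lambda>w. (f (X 1 1 w) (X 2 1 w) - \<mu>)\<^sup>2)"
    using f_var_pos by (simp_all add: \<sigma>_def \<mu>_def)
  have Zn: "Zn M X f i j l w = h (X i l w) (X j l w)" for i j l w
    by (simp add: Zn_def h_def \<mu>_def \<sigma>_def)
  have h_meas: "(\<lambda>(x, y). h x y) \<in> borel_measurable (borel \<Otimes>\<^sub>M borel)"
  proof -
    have "(\<lambda>z. ((\<lambda>(x, y). f x y) z - \<mu>) / \<sigma>) \<in> borel_measurable (borel \<Otimes>\<^sub>M borel)"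
      by (intro borel_measurable_divide borel_measurable_diff f_meas borel_measurable_const)
    then show ?thesis by (simp add: h_def case_prod_beta')
  qed
  let ?z = "\<lambda>w. h (X 1 1 w) (X 2 1 w)"
  have z_meas: "?z \<in> borel_measurable M"
    using measurable_compose[OF measurable_Pair[OF X_meas X_meas] h_meas, of 1 1 2 1] by simp
  have z_distr: "distr M borel Z = distr M borel ?z" using Z_distr by (simp only: Zn[abs_def])
  have sq: "(?z w)\<^sup>2 = (f (X 1 1 w) (X 2 1 w) - \<mu>)\<^sup>2 / \<sigma>\<^sup>2" for w by (simp add: h_def power_divide)
  interpret standardized_kernel M X h p \<rho> ?z
  proof (unfold_locales, fact h_meas)
    show "h x y = h y x" for x y by (simp only: h_def f_sym[of x y])
    show "integrable M (\<lambda>w. (?z w)\<^sup>2)" unfolding sq using f_var_finite by (simp add: \<mu>_def)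
    show "expectation ?z = 0" unfolding h_def using f_mean by (simp add: \<mu>_def prob_space)
    show "expectation (\<lambda>w. (?z w)\<^sup>2) = 1" 
    proof -
      have "expectation (\<lambda>w. (?z w)\<^sup>2) = \<sigma>\<^sup>2 / \<sigma>\<^sup>2" unfolding sq \<sigma>(2) by simp
      then show ?thesis using \<sigma>(1) by simp
    qed
    show "\<rho> = expectation (\<lambda>w. h (X 1 1 w) (X 2 1 w) * h (X 1 1 w) (X 3 1 w))" using rho by (simp only: Zn)
  qed (fact p_lim refl)+
  have transfer: "integrable M (\<lambda>w. g (Z w)) \<longleftrightarrow> integrable M (\<lambda>w. g (?z w))"
      "expectation (\<lambda>w. g (Z w)) = expectation (\<lambda>w. g (?z w))"
    if g: "g \<in> borel_measurable borel" for g :: "real \<Rightarrow> real"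
    using integrable_distr_eq[OF Z_meas g] integrable_distr_eq[OF z_meas g] integral_distr[OF Z_meas g] integral_distr[OF z_meas g] z_distr
    by simp_all
  have exp_transfer: "integrable M (\<lambda>w. exp (\<eta> * \<bar>?z w\<bar> powr r))" if "integrable M (\<lambda>w. exp (\<eta> * \<bar>Z w\<bar> powr r))" for \<eta> r
    using that by (subst (asm) transfer(1)) measurable
  have D_eq: "D \<kappa> n = dy (p n) n \<kappa>" for \<kappa> n
    by (simp add: D_def dy_def d1_def L_def ptilde_def)
  define F where "F \<delta> n t = prob {w \<in> space M. \<forall>(i, j)\<in>index_pairs (p n).
      \<delta> * (1 / sqrt (real n) * (\<Sum>l = 1..n. h (X i l w) (X j l w)) - \<delta>) \<le> t}" for \<delta> n t
  have main: "(\<lambda>n. F (d n) n t) \<longlonglongrightarrow> exp (- exp (- t))" for t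
  proof (cases "\<exists>\<eta> r. r > 1/2 \<and> cond_C2 M Z \<rho> p \<eta> r")
    case True
    then obtain \<eta> r where c: "r > 1 / 2" "cond_C2 M Z \<rho> p \<eta> r" by blast
    have \<kappa>: "expectation (\<lambda>w. Z w ^ 3) = expectation (\<lambda>w. ?z w ^ 3)" by (rule transfer(2)) measurable
    have dD: "d = D (expectation (\<lambda>w. ?z w ^ 3))" by (rule ext) (simp only: d True if_True D_eq \<kappa>)
    show ?thesis unfolding dD F_def using c unfolding cond_C2_def
      by (intro gumbel_limit_stretched_exp[of \<eta> r] exp_transfer) (auto simp: rho_nonneg)
  next
    case False
    then have d_eq: "d = D 0" by (intro ext) (simp only: d D_eq dy_def if_False mult_zero_left div_0 add_0_right)
    have light: "(\<lambda>n. F (D 0 n) n t) \<longlonglongrightarrow> exp (- exp (- t))"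
      if "\<eta> > 0" "0 < r" "r \<le> 1 / 2" "integrable M (\<lambda>w. exp (\<eta> * \<bar>Z w\<bar> powr r))" "\<rho> \<le> 1 / 3"
        "(\<lambda>n. ln (real (p n))) \<in> o(\<lambda>n. real n powr (r / (2 - r)))" for \<eta> r
      unfolding F_def using that by (intro gumbel_limit_stretched_exp[of \<eta> r] exp_transfer) (auto simp: rho_nonneg)
    have half: "(1 / 2) / (2 - 1 / 2) = (1 / 3 :: real)" by simp
    show ?thesis unfolding d_eq using cond
    proof (elim disjE exE)
      fix s assume c: "cond_C1 M Z \<rho> p s"
      have "(\<lambda>x. \<bar>x\<bar> powr s * ln_plus \<bar>x\<bar> powr (s / 2)) \<in> borel_measurable borel" unfolding ln_plus_def by measurable
      from transfer(1)[OF this] show "(\<lambda>n. F (D 0 n) n t) \<longlonglongrightarrow> exp (- exp (- t))"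
        unfolding F_def using c unfolding cond_C1_def by (intro gumbel_limit_log_moment[of s]) (auto simp: rho_nonneg)
    next
      fix \<eta> r assume c: "cond_C2 M Z \<rho> p \<eta> r"
      then have "\<not> r > 1 / 2" using False by blast
      then show "(\<lambda>n. F (D 0 n) n t) \<longlonglongrightarrow> exp (- exp (- t))" using c unfolding cond_C2_def by (intro light[of \<eta> r]) auto
    next
      fix \<eta> r assume c: "cond_C3 M Z \<rho> p \<eta> r"
      then have r: "r \<ge> 1 / 2" "\<eta> > 0" by (auto simp: cond_C3_def)
      have "1 / (3 + 2 / r) \<le> 1 / 3" using r by (intro frac_le) auto
      then have "(\<lambda>n. ln (real (p n))) \<in> o(\<lambda>n. real n powr (1 / 3))" using c powr_smallo_mono unfolding cond_C3_def by blast
      moreover have "integrable M (\<lambda>w. exp (\<eta> * \<bar>Z w\<bar> powr (1 / 2)))"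
        using c r by (intro exp_moment_mono[OF Z_meas r(2) _ r(1)]) (auto simp: cond_C3_def)
      ultimately show "(\<lambda>n. F (D 0 n) n t) \<longlonglongrightarrow> exp (- exp (- t))"
        using c r by (intro light[of \<eta> "1 / 2"]) (auto simp: cond_C3_def)
    next
      fix K assume c: "cond_C4 M Z \<rho> p K"
      then have "integrable M (\<lambda>w. exp (1 * \<bar>Z w\<bar> powr (1 / 2)))" by (intro bounded_imp_exp_moment[OF Z_meas]) (auto simp: cond_C4_def)
      then show "(\<lambda>n. F (D 0 n) n t) \<longlonglongrightarrow> exp (- exp (- t))"
        using c by (intro light[of 1 "1 / 2"]) (auto simp: cond_C4_def)
    qed
  qed
  let ?V = "\<lambda>n w. MAX (i, j) \<in> {(i, j). 1 \<le> i \<and> i < j \<and> j \<le> p n}. d n * (Tn M X f n i j w - d n)"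
  have cdf: "cdf (distr M borel (?V n)) t = F (d n) n t" if "p n \<ge> 2" for n t
  proof -
    let ?v = "\<lambda>q w. case q of (i, j) \<Rightarrow> d n * (Tn M X f n i j w - d n)"
    have "(1, 2) \<in> index_pairs (p n)" using that by (simp add: index_pairs_def)
    then have ne: "index_pairs (p n) \<noteq> {}" by blast
    have m: "?v q \<in> borel_measurable M" if q: "q \<in> index_pairs (p n)" for q
    proof -
      obtain i j where ij: "q = (i, j)" "i \<ge> 1" "j \<ge> 1" using q by (cases q) (auto simp: index_pairs_def)
      have "(\<lambda>w. h (X i l w) (X j l w)) \<in> borel_measurable M" if "l \<ge> 1" for l
        using measurable_compose[OF measurable_Pair[OF X_meas X_meas] h_meas, of i l j l] ij that by simp
      then have "(\<lambda>w. Tn M X f n i j w) \<in> borel_measurable M"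
        unfolding Tn_def Zn by (intro borel_measurable_times borel_measurable_const borel_measurable_sum) auto
      then show ?thesis unfolding ij(1) prod.case by (intro borel_measurable_times borel_measurable_const borel_measurable_diff)
    qed
    have "cdf (distr M borel (?V n)) t = prob {w \<in> space M. \<forall>q\<in>index_pairs (p n). ?v q w \<le> t}"
      unfolding index_pairs_def[symmetric] by (rule cdf_Max[OF finite_index_pairs ne m])
    also have "\<dots> = F (d n) n t" unfolding F_def Tn_def Zn by (simp add: case_prod_beta')
    finally show ?thesis .
  qed
  show ?thesis
  proof (rule weak_conv_m_gumbel_of_cdf, rule Lim_transform_eventually[OF main])
    show "\<forall>\<^sub>F n in sequentially. F (d n) n t = cdf (distr M borel (?V n)) t" for t
      using p_ge_2 by eventually_elim (simp only: cdf)
  qed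
qed

end
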